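(* Assume (A1) and (A2): for $k=1,2$ and all $i\in\mathcal{M}$, $Q_k(i)\ge0$, $\widehat Q_k(i)\ge0$, $N_k(i)>0$, $G_k(i)\ge0$, $\widehat G_k(i)\ge0$. Suppose that the Riccati equations $$\left\{\begin{aligned} \dot P_2(t,i)=&-\Big[P_2\mathbf{A}+\mathbf{A}^\top P_2+P_2\mathbf{F}_1P_2+\mathbf{Q}_2+\mathbf{J}_2^\top(I-P_2\mathbf{D}_1)^{-1}P_2\mathbf{J}_2-\mathbf{S}_2^\top\widetilde N_2^{-1}\mathbf{S}_2\\ &+\sum_{j\in\mathcal{M}}\lambda_{ij}[P_2(t,j)-P_2(t,i)]\Big],\qquad P_2(T,i)=\mathbf{G}_2(i), \end{aligned}\right.$$ and $$\left\{\begin{aligned} \dot{\widetilde P}_2(t,i)=&-\Big[\widetilde P_2\widetilde{\mathbf{A}}+\widetilde{\mathbf{A}}^\top\widetilde P_2+\widetilde P_2\mathbf{F}_1\widetilde P_2+\widetilde{\mathbf{Q}}_2+\widetilde{\mathbf{J}}_2^\top(I-P_2\mathbf{D}_1)^{-1}P_2\widetilde{\mathbf{J}}_2-\widetilde{\mathbf{S}}_2^\top\widetilde N_2^{-1}\widetilde{\mathbf{S}}_2\\ &+\sum_{j\in\mathcal{M}}\lambda_{ij}[\widetilde P_2(t,j)-\widetilde P_2(t,i)]\Big],\qquad\widetilde P_2(T,i)=\widetilde{\mathbf{G}}_2(i), \end{aligned}\right.$$ (coefficients at $(t,i)$ or $i$, notation in the context) have solutions $P_2(\cdot,i)$ and $\widetilde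 P_2(\cdot,i)$, $i\in\mathcal{M}$, on $[0,T]$ such that $\widetilde N_2$ and $I-P_2\mathbf{D}_1$ are invertible. Let $u_2^*=-\widetilde N_2^{-1}[\mathbf{S}_2X+\widehat{\mathbf{S}}_2\widehat X]$ (coefficients at $(t,\alpha(t))$), where $X=\left[\begin{array}{c}x^*\\ \psi\end{array}\right]$ is the forward component of the Hamiltonian system (H) of the context associated with $u_2^*$, and let $u_1^*$ be the follower's corresponding optimal control (F) of the context. Then, with $i=\alpha(0)$, $$J_2(u_1^*(\cdot),u_2^*(\cdot))=\langle\widetilde P_2^{(11)}(0,i)x_0,x_0\rangle,$$ where $\widetilde P_2^{(11)}(0,i)$ is the upper-left $n\times n$ block of $$\widetilde P_2(0,i)=\left(\begin{array}{cc}\widetilde P_2^{(11)}(0,i)&\widetilde P_2^{(12)}(0,i)\\ (\widetilde P_2^{(12)})^\top(0,i)&\widetilde P_2^{(22)}(0,i)\end{array}\right).$$ Moreover, the follower's optimal control (F) has the non-anticipating state feedback representation $$\begin{aligned} u_1^*=&-\widetilde N_1^{-1}\Big[(S_1\ \ 0)+(0\ \ B_1^\top)P_2+(0\ \ D_1^\top)(I-P_2\mathbf{D}_1)^{-1}P_2\mathbf{J}_2\\ &\quad-(0\ \ D_1^\top)(I-P_2\mathbf{D}_1)^{-1}P_2\mathbf{D}_2\widetilde N_2^{-1}\mathbf{S}_2-D_1^\top P_1D_2\widetilde N_2^{-1}\mathbf{S}_2\Big]X\\ &-\widetilde N_1^{-1}\Big[(\widehat S_1\ \ 0)+(0\ \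 B_1^\top)\widehat P_2+(0\ \ D_1^\top)(I-P_2\mathbf{D}_1)^{-1}P_2\widehat{\mathbf{J}}_2\\ &\quad-(0\ \ D_1^\top)(I-P_2\mathbf{D}_1)^{-1}P_2\mathbf{D}_2\widetilde N_2^{-1}\widehat{\mathbf{S}}_2-D_1^\top P_1D_2\widetilde N_2^{-1}\widehat{\mathbf{S}}_2\Big]\widehat X, \end{aligned}$$ with all coefficients evaluated at $(t,\alpha(t))$ or $\alpha(t)$ and $\widehat P_2=\widetilde P_2-P_2$.
   Context: Probabilistic setting. $T>0$ is finite; on $(\Omega,\mathcal{F},P)$ there are a one-dimensional standard Brownian motion $W$ and an independent Markov chain $\alpha$ with values in a finite set $\mathcal{M}$, generator $(\lambda_{ij})_{i,j\in\mathcal{M}}$ and deterministic initial state $\alpha(0)=i$. $\mathcal{F}_t^\alpha=\sigma\{\alpha(s):0\le s\le t\}$, $\mathcal{F}_t=\sigma\{W(s),\alpha(s):0\le s\le t\}$. For a process $\phi$, $\widehat\phi(t)=E[\phi(t)|\mathcal{F}_t^\alpha]$ (a hat on a coefficient matrix, e.g. $\widehat A(i)$, just denotes another matrix). For $i\ne j$, $M_{ij}(t)=[M_{ij}](t)-\langle M_{ij}\rangle(t)$ with $[M_{ij}](t)=\sum_{0\le s\le t}1_{\{\alpha(s-)=i\}}1_{\{\alpha(s)=j\}}$, $\langle M_{ij}\rangle(t)=\int_0^t\lambda_{ij}1_{\{\alpha(s-)=i\}}ds$; $M_{ii}\equiv0$. $k\bullet dM=\sum_{i,j}k_{ij}dM_{ij}$.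 Spaces. $\mathcal{L}^2_{\mathcal{F}}(R^n)$: $R^n$-valued $\mathcal{F}_t$-adapted $x$ with $E\int_0^T|x|^2dt<\infty$. $\mathcal{S}^2_{\mathcal{F}}(R^n)$: $R^n$-valued $\mathcal{F}_t$-adapted càdlàg $y$ with $E\int_0^T|y|^2dt<\infty$. $\mathcal{K}^2_{\mathcal{F}}(R^n)$: collections $\{k_{ij}\}_{i,j\in\mathcal{M}}$ of $R^n$-valued $\mathcal{F}_t$-adapted processes with $\sum_{i,j}E\int_0^T|k_{ij}|^2d[M_{ij}]<\infty$, $k_{ii}\equiv0$. $\mathcal{U}_k=\mathcal{L}^2_{\mathcal{F}}(R^{m_k})$, $k=1,2$ (1 = follower, 2 = leader). State. For $u_1\in\mathcal{U}_1,u_2\in\mathcal{U}_2$, $x\in\mathcal{L}^2_{\mathcal{F}}(R^n)$ is the unique solution of (coefficients evaluated at $\alpha(t)$) $$dx=[Ax+\widehat A\widehat x+B_1u_1+B_2u_2]dt+[Cx+\widehat C\widehat x+D_1u_1+D_2u_2]dW,\quad x(0)=x_0,$$ where $A(i),\widehat A(i),B_1(i),B_2(i),C(i),\widehat C(i),D_1(i),D_2(i)$ are constant matrices of suitable dimensions and $x_0\in R^n$. Costs. For $k=1,2$, $$J_k(u_1,u_2)=\tfrac12E\Big[\int_0^T\big(\langle Q_kx,x\rangle+\langle\widehat Q_k\widehat x,\widehat x\rangle+\langle N_ku_k,u_k\rangle\big)dt+\langle G_k(\alpha(T))x(T),x(T)\rangle+\langle\widehat G_k(\alpha(T))\widehat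 x(T),\widehat x(T)\rangle\Big],$$ with $Q_k,\widehat Q_k,N_k$ evaluated at $\alpha(t)$ and $Q_k(i),\widehat Q_k(i),N_k(i),G_k(i),\widehat G_k(i)$ constant symmetric matrices. The follower minimizes $J_1$ over $u_1\in\mathcal{U}_1$ for given $u_2$; the leader minimizes $J_2$ over $u_2\in\mathcal{U}_2$, taking the follower's optimal response into account. Follower's notation (arguments $(t,i)$ or $(i)$ omitted): $\widetilde N_1=N_1+D_1^\top P_1D_1$, $S_1=B_1^\top P_1+D_1^\top P_1C$, $\widehat S_1=B_1^\top\widehat P_1+D_1^\top P_1\widehat C$, where $P_1(\cdot,i),\widehat P_1(\cdot,i)$, $i\in\mathcal{M}$, are the solutions (deterministic, differentiable, symmetric $R^{n\times n}$-valued) on $[0,T]$ of (R1) $\dot P_1=-\big[P_1A+A^\top P_1+C^\top P_1C+Q_1-S_1^\top\widetilde N_1^{-1}S_1+\sum_{j}\lambda_{ij}(P_1(t,j)-P_1(t,i))\big]$, $P_1(T,i)=G_1(i)$; (R2) $\dot{\widehat P}_1=-\big[\widehat P_1(A+\widehat A)+(A+\widehat A)^\top\widehat P_1+P_1\widehat A+\widehat A^\top P_1+C^\top P_1\widehat C+\widehat C^\top P_1C+\widehat C^\top P_1\widehat C+\widehat Q_1-S_1^\top\widetilde N_1^{-1}\widehat S_1-\widehat S_1^\top\widetilde N_1^{-1}S_1-\widehat S_1^\top\widetilde N_1^{-1}\widehat S_1+\sum_j\lambda_{ij}(\widehat P_1(t,j)-\widehat P_1(t,i))\big]$, $\widehat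 P_1(T,i)=\widehat G_1(i)$. Further coefficients: $\mathbb{A}=A-B_1\widetilde N_1^{-1}S_1$, $\widehat{\mathbb{A}}=\widehat A-B_1\widetilde N_1^{-1}\widehat S_1$, $\mathbb{C}=C-D_1\widetilde N_1^{-1}S_1$, $\widehat{\mathbb{C}}=\widehat C-D_1\widetilde N_1^{-1}\widehat S_1$, $S_2=B_2^\top P_1+D_2^\top P_1C$, $\widehat S_2=B_2^\top\widehat P_1+D_2^\top P_1\widehat C$, $\mathbb{F}_2=S_2-D_2^\top P_1D_1\widetilde N_1^{-1}S_1$, $\widehat{\mathbb{F}}_2=\widehat S_2-D_2^\top P_1D_1\widetilde N_1^{-1}\widehat S_1$, $\mathbb{B}_1=-B_1\widetilde N_1^{-1}D_1^\top$, $\mathbb{B}_2=B_2-B_1\widetilde N_1^{-1}D_1^\top P_1D_2$, $\mathbb{D}_1=-D_1\widetilde N_1^{-1}D_1^\top$, $\mathbb{D}_2=D_2-D_1\widetilde N_1^{-1}D_1^\top P_1D_2$, $\mathbb{F}_1=-B_1\widetilde N_1^{-1}B_1^\top$. Leader's state equation. Given $u_2$, the follower's optimal control is $$\text{(F)}\quad u_1^*=-\widetilde N_1^{-1}[S_1x+\widehat S_1\widehat x+\Phi],\qquad\Phi=B_1^\top\varphi+D_1^\top\theta+D_1^\top P_1D_2u_2,$$ where $(x,\varphi,\theta,\eta)$ solves the (decoupled) conditional mean-field FBSDE $$\text{(L)}\quad\left\{\begin{aligned} dx=&[\mathbb{A}x+\widehat{\mathbb{A}}\widehat x+\mathbb{F}_1\varphi+\mathbb{B}_1\theta+\mathbb{B}_2u_2]dt+[\mathbb{C}x+\widehat{\mathbb{C}}\widehat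 x+\mathbb{B}_1^\top\varphi+\mathbb{D}_1\theta+\mathbb{D}_2u_2]dW,\\ d\varphi=&-[\mathbb{A}^\top\varphi+\widehat{\mathbb{A}}^\top\widehat\varphi+\mathbb{C}^\top\theta+\widehat{\mathbb{C}}^\top\widehat\theta+\mathbb{F}_2^\top u_2+\widehat{\mathbb{F}}_2^\top\widehat u_2]dt+\theta\,dW+\eta\bullet dM,\\ x(0)=&x_0,\quad\varphi(T)=0, \end{aligned}\right.$$ with coefficients evaluated at $(t,\alpha(t))$. Adjoint equation. With $(x^*,\varphi^*,\theta^*,\eta^* )$ the solution of (L) under $u_2^*$, $(y,z,k,\psi)$ solves $$dy=-[\mathbb{A}^\top y+\widehat{\mathbb{A}}^\top\widehat y+\mathbb{C}^\top z+\widehat{\mathbb{C}}^\top\widehat z+Q_2x^*+\widehat Q_2\widehat x^*]dt+z\,dW+k\bullet dM,\quad y(T)=G_2(\alpha(T))x^*(T)+\widehat G_2(\alpha(T))\widehat x^*(T),$$ $$d\psi=[\mathbb{A}\psi+\widehat{\mathbb{A}}\widehat\psi+\mathbb{F}_1y+\mathbb{B}_1z]dt+[\mathbb{C}\psi+\widehat{\mathbb{C}}\widehat\psi+\mathbb{B}_1^\top y+\mathbb{D}_1z]dW,\quad\psi(0)=0.$$ Augmented notation. $X=\left[\begin{array}{c}x^*\\ \psi\end{array}\right]$, $Y=\left[\begin{array}{c}y\\ \varphi^*\end{array}\right]$, $Z=\left[\begin{array}{c}z\\ \theta^*\end{array}\right]$, $K=\left[\begin{array}{c}k\\ \eta^*\end{array}\right]$,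 $X_0=\left[\begin{array}{c}x_0\\ 0\end{array}\right]$; $\mathbf{A},\widehat{\mathbf{A}},\mathbf{C},\widehat{\mathbf{C}}$ are the block-diagonal $2n\times2n$ matrices $\mathrm{diag}(\mathbb{A},\mathbb{A})$, $\mathrm{diag}(\widehat{\mathbb{A}},\widehat{\mathbb{A}})$, $\mathrm{diag}(\mathbb{C},\mathbb{C})$, $\mathrm{diag}(\widehat{\mathbb{C}},\widehat{\mathbb{C}})$; $$\mathbf{B}_1=\left[\begin{array}{cc}0&\mathbb{B}_1\\ \mathbb{B}_1&0\end{array}\right],\ \mathbf{D}_1=\left[\begin{array}{cc}0&\mathbb{D}_1\\ \mathbb{D}_1&0\end{array}\right],\ \mathbf{F}_1=\left[\begin{array}{cc}0&\mathbb{F}_1\\ \mathbb{F}_1&0\end{array}\right],\ \mathbf{B}_2=\left[\begin{array}{c}\mathbb{B}_2\\ 0\end{array}\right],\ \mathbf{D}_2=\left[\begin{array}{c}\mathbb{D}_2\\ 0\end{array}\right],$$ $\mathbf{F}_2=[\,0\ \ \mathbb{F}_2\,]$, $\widehat{\mathbf{F}}_2=[\,0\ \ \widehat{\mathbb{F}}_2\,]$, and the $2n\times2n$ matrices $\mathbf{Q}_2=\mathrm{diag}(Q_2,0)$, $\widehat{\mathbf{Q}}_2=\mathrm{diag}(\widehat Q_2,0)$, $\mathbf{G}_2=\mathrm{diag}(G_2,0)$, $\widehat{\mathbf{G}}_2=\mathrm{diag}(\widehat G_2,0)$. $I$ is the $2n\times2n$ identity. Solutions $P_2(\cdot,i),\widetilde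 P_2(\cdot,i)$ are deterministic, differentiable, symmetric $R^{2n\times2n}$-valued functions on $[0,T]$, and $\widehat P_2=\widetilde P_2-P_2$. Further, $$\begin{aligned} \widetilde N_2&=N_2+\mathbf{D}_2^\top(I-P_2\mathbf{D}_1)^{-1}P_2\mathbf{D}_2,\qquad\mathbf{J}_2=\mathbf{B}_1^\top P_2+\mathbf{C},\qquad\widehat{\mathbf{J}}_2=\mathbf{B}_1^\top\widehat P_2+\widehat{\mathbf{C}},\\ \mathbf{S}_2&=\mathbf{D}_2^\top(I-P_2\mathbf{D}_1)^{-1}P_2\mathbf{J}_2+\mathbf{B}_2^\top P_2+\mathbf{F}_2,\qquad\widehat{\mathbf{S}}_2=\mathbf{D}_2^\top(I-P_2\mathbf{D}_1)^{-1}P_2\widehat{\mathbf{J}}_2+\mathbf{B}_2^\top\widehat P_2+\widehat{\mathbf{F}}_2, \end{aligned}$$ and $\widetilde{\mathbf{H}}=\mathbf{H}+\widehat{\mathbf{H}}$ for $\mathbf{H}=\mathbf{A},\mathbf{Q}_2,\mathbf{J}_2,\mathbf{S}_2,\mathbf{G}_2$. Hamiltonian system (equations (L) under $u_2^*$ and the adjoint equation written together; coefficients at $(t,\alpha(t))$): $$\text{(H)}\quad\left\{\begin{aligned} dX=&[\mathbf{A}X+\widehat{\mathbf{A}}\widehat X+\mathbf{F}_1Y+\mathbf{B}_1Z+\mathbf{B}_2u_2^*]dt+[\mathbf{C}X+\widehat{\mathbf{C}}\widehat X+\mathbf{B}_1^\top Y+\mathbf{D}_1Z+\mathbf{D}_2u_2^*]dW,\\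 dY=&-[\mathbf{A}^\top Y+\widehat{\mathbf{A}}^\top\widehat Y+\mathbf{C}^\top Z+\widehat{\mathbf{C}}^\top\widehat Z+\mathbf{Q}_2X+\widehat{\mathbf{Q}}_2\widehat X+\mathbf{F}_2^\top u_2^*+\widehat{\mathbf{F}}_2^\top\widehat u_2^*]dt+Z\,dW+K\bullet dM,\\ X(0)=&X_0,\quad Y(T)=\mathbf{G}_2(\alpha(T))X(T)+\widehat{\mathbf{G}}_2(\alpha(T))\widehat X(T). \end{aligned}\right.$$ In this system $Y$ and $Z$ are those related to $X$ by the decoupling $Y=P_2X+\widehat P_2\widehat X$, $Z=(I-P_2\mathbf{D}_1)^{-1}P_2[\mathbf{J}_2X+\widehat{\mathbf{J}}_2\widehat X+\mathbf{D}_2u_2^*]$ (coefficients at $(t,\alpha(t))$).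
   Formalization: Since J_2 is defined with the factor 1/2, the value formula as written is off by a factor of 2; the formal theorem proves J_2(u_1*,u_2* ) = (1/2)<P̃_2^{(11)}(0,i)x_0,x_0> instead. *)

theory Defs
  imports "HOL-Probability.Probability"
begin

section \<open>Block vectors and matrices\<close>

text \<open>Applied to matrices (vectors of rows), \<open>vstack\<close> puts one block on top of the other.\<close>

definition vstack :: "'a^'n \<Rightarrow> 'a^'m \<Rightarrow> 'a^('n::finite + 'm::finite)" where
  "vstack u v = (\<chi> r. case r of Inl a \<Rightarrow> u $ a | Inr b \<Rightarrow> v $ b)"

definition hstack :: "'a^'n^'k \<Rightarrow> 'a^'m^'k \<Rightarrow> 'a^('n::finite + 'm::finite)^'k" where
  "hstack A B = (\<chi> r. vstack (A $ r) (B $ r))"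

definition block ::
  "'a^'n^'k \<Rightarrow> 'a^'m^'k \<Rightarrow> 'a^'n^'l \<Rightarrow> 'a^'m^'l \<Rightarrow> 'a^('n::finite + 'm::finite)^('k::finite + 'l::finite)" where
  "block A B C D = vstack (hstack A B) (hstack C D)"

definition upper :: "'a^('n::finite + 'm::finite) \<Rightarrow> 'a^'n" where
  "upper v = (\<chi> a. v $ Inl a)"

definition lower :: "'a^('n::finite + 'm::finite) \<Rightarrow> 'a^'m" where
  "lower v = (\<chi> b. v $ Inr b)"

definition block11 :: "'a^('n::finite + 'm::finite)^('k::finite + 'l::finite) \<Rightarrow> 'a^'n^'k" where
  "block11 P = (\<chi> r s. P $ Inl r $ Inl s)"

definition sym_mat :: "real^'n^'n \<Rightarrow> bool" where
  "sym_mat Q \<longleftrightarrow> transpose Q = Q"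

definition pos_semidef :: "real^'n^'n \<Rightarrow> bool" where
  "pos_semidef Q \<longleftrightarrow> sym_mat Q \<and> (\<forall>v. 0 \<le> (Q *v v) \<bullet> v)"

definition pos_def :: "real^'n^'n \<Rightarrow> bool" where
  "pos_def Q \<longleftrightarrow> sym_mat Q \<and> (\<forall>v. v \<noteq> 0 \<longrightarrow> 0 < (Q *v v) \<bullet> v)"

section \<open>Brownian motion and Markov chain\<close>

definition generated_by :: "'w measure \<Rightarrow> 'b measure \<Rightarrow> (real \<Rightarrow> 'w \<Rightarrow> 'b) \<Rightarrow> real set \<Rightarrow> 'w measure" where
  "generated_by M N \<xi> I = sigma (space M) (\<Union>s\<in>I. {\<xi> s -` B \<inter> space M | B. B \<in> sets N})"

definition brownian_motion :: "'w measure \<Rightarrow> real \<Rightarrow> (real \<Rightarrow> 'w \<Rightarrow> real) \<Rightarrow> bool" where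
  "brownian_motion M T W \<longleftrightarrow>
    (\<forall>t\<in>{0..T}. W t \<in> borel_measurable M) \<and>
    (AE \<omega> in M. W 0 \<omega> = 0) \<and>
    (AE \<omega> in M. continuous_on {0..T} (\<lambda>t. W t \<omega>)) \<and>
    (\<forall>s t. 0 \<le> s \<and> s < t \<and> t \<le> T \<longrightarrow>
       distributed M lborel (\<lambda>\<omega>. W t \<omega> - W s \<omega>) (\<lambda>x. ennreal (normal_density 0 (sqrt (t - s)) x)) \<and>
       prob_space.indep_set M (sets (generated_by M borel W {0..s}))
         {(\<lambda>\<omega>. W t \<omega> - W s \<omega>) -` B \<inter> space M | B. B \<in> sets borel})"

definition generator :: "('s::finite \<Rightarrow> 's \<Rightarrow> real) \<Rightarrow> bool" where
  "generator \<Lambda> \<longleftrightarrow> (\<forall>i j. i \<noteq> j \<longrightarrow> 0 \<le> \<Lambda> i j) \<and> (\<forall>i. (\<Sum>j\<in>UNIV. \<Lambda> i j) = 0)"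

text \<open>Kolmogorov's backward equation; its unique solution is \<open>p t = exp (t \<Lambda>)\<close>.\<close>

definition transition_function :: "('s::finite \<Rightarrow> 's \<Rightarrow> real) \<Rightarrow> (real \<Rightarrow> 's \<Rightarrow> 's \<Rightarrow> real) \<Rightarrow> bool" where
  "transition_function \<Lambda> p \<longleftrightarrow>
    (\<forall>i j. p 0 i j = (if i = j then 1 else 0)) \<and>
    (\<forall>t\<ge>0. \<forall>i j. ((\<lambda>s. p s i j) has_real_derivative (\<Sum>k\<in>UNIV. \<Lambda> i k * p t k j)) (at t within {0..}))"

definition markov_chain ::
  "'w measure \<Rightarrow> real \<Rightarrow> ('s::finite \<Rightarrow> 's \<Rightarrow> real) \<Rightarrow> (real \<Rightarrow> 'w \<Rightarrow> 's) \<Rightarrow> bool" where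
  "markov_chain M T \<Lambda> \<alpha> \<longleftrightarrow>
    generator \<Lambda> \<and>
    (\<forall>t\<in>{0..T}. \<alpha> t \<in> measurable M (count_space UNIV)) \<and>
    (\<forall>\<omega>\<in>space M. (\<forall>t\<in>{0..<T}. \<forall>\<^sub>F r in at_right t. \<alpha> r \<omega> = \<alpha> t \<omega>) \<and>
                   (\<forall>t\<in>{0<..T}. \<exists>i. \<forall>\<^sub>F r in at_left t. \<alpha> r \<omega> = i)) \<and>
    (\<exists>p. transition_function \<Lambda> p \<and>
      (\<forall>s t j. 0 \<le> s \<and> s \<le> t \<and> t \<le> T \<longrightarrow>
        (AE \<omega> in M. real_cond_exp M (generated_by M (count_space UNIV) \<alpha> {0..s})
                        (\<lambda>\<omega>. if \<alpha> t \<omega> = j then 1 else 0) \<omega> = p (t - s) (\<alpha> s \<omega>) j)))"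

locale regime_switching = prob_space M
  for M :: "'w measure" +
  fixes T :: real
    and W :: "real \<Rightarrow> 'w \<Rightarrow> real"
    and \<alpha> :: "real \<Rightarrow> 'w \<Rightarrow> 's::finite"
    and \<Lambda> :: "'s \<Rightarrow> 's \<Rightarrow> real"
    and i0 :: 's
  assumes T_pos: "0 < T"
    and brownian: "brownian_motion M T W"
    and markov: "markov_chain M T \<Lambda> \<alpha>"
    and initial: "AE \<omega> in M. \<alpha> 0 \<omega> = i0"
    and independent: "indep_set (sets (generated_by M borel W {0..T}))
                                (sets (generated_by M (count_space UNIV) \<alpha> {0..T}))"
begin

section \<open>Filtrations, spaces of processes, conditional expectations\<close>

definition filt_alpha :: "real \<Rightarrow> 'w measure" where
  "filt_alpha t = generated_by M (count_space UNIV) \<alpha> {0..t}"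

text \<open>As usual, the filtration of \<open>(W, \<alpha>)\<close> is augmented by the null sets.\<close>

definition filt :: "real \<Rightarrow> 'w measure" where
  "filt t = sigma (space M) (sets (generated_by M borel W {0..t}) \<union> sets (filt_alpha t) \<union> null_sets M)"

definition measurable_process :: "(real \<Rightarrow> 'w \<Rightarrow> 'v::euclidean_space) \<Rightarrow> bool" where
  "measurable_process x \<longleftrightarrow> (\<lambda>(t, \<omega>). x t \<omega>) \<in> borel_measurable (restrict_space borel {0..T} \<Otimes>\<^sub>M M)"

definition adapted :: "(real \<Rightarrow> 'w \<Rightarrow> 'v::euclidean_space) \<Rightarrow> bool" where
  "adapted x \<longleftrightarrow> (\<forall>t\<in>{0..T}. x t \<in> borel_measurable (filt t))"

definition L2F :: "(real \<Rightarrow> 'w \<Rightarrow> 'v::euclidean_space) \<Rightarrow> bool" where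
  "L2F x \<longleftrightarrow> measurable_process x \<and> adapted x \<and>
    (\<integral>\<^sup>+\<omega>. (\<integral>\<^sup>+t. ennreal ((norm (x t \<omega>))\<^sup>2) \<partial>restrict_space lborel {0..T}) \<partial>M) < \<infinity>"

definition cadlag :: "(real \<Rightarrow> 'v::euclidean_space) \<Rightarrow> bool" where
  "cadlag f \<longleftrightarrow> (\<forall>t\<in>{0..<T}. (f \<longlongrightarrow> f t) (at_right t)) \<and> (\<forall>t\<in>{0<..T}. \<exists>l. (f \<longlongrightarrow> l) (at_left t))"

definition S2F :: "(real \<Rightarrow> 'w \<Rightarrow> 'v::euclidean_space) \<Rightarrow> bool" where
  "S2F y \<longleftrightarrow> L2F y \<and> (AE \<omega> in M. cadlag (\<lambda>t. y t \<omega>))"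

text \<open>\<open>left_state s \<omega> i\<close> says \<open>\<alpha>(s-) = i\<close>. With the convention \<open>\<alpha>(0-) = \<alpha>(0)\<close> there is no jump at time 0.\<close>

definition left_state :: "real \<Rightarrow> 'w \<Rightarrow> 's \<Rightarrow> bool" where
  "left_state s \<omega> i \<longleftrightarrow> (\<forall>\<^sub>F r in at_left s. \<alpha> r \<omega> = i)"

definition jumps :: "'s \<Rightarrow> 's \<Rightarrow> 'w \<Rightarrow> real set" where
  "jumps i j \<omega> = {s\<in>{0<..T}. i \<noteq> j \<and> left_state s \<omega> i \<and> \<alpha> s \<omega> = j}"

definition jump_mart :: "'s \<Rightarrow> 's \<Rightarrow> real \<Rightarrow> 'w \<Rightarrow> real" where
  "jump_mart i j t \<omega> =
    (if i = j then 0
     else real (card (jumps i j \<omega> \<inter> {..t})) - (LBINT s:{0..t}. \<Lambda> i j * (if left_state s \<omega> i then 1 else 0)))"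

text \<open>The random measures \<open>d[W]\<close> and \<open>d[M\<^sub>i\<^sub>j]\<close> on \<open>[0,T]\<close>.\<close>

definition qv_W :: "'w \<Rightarrow> real measure" where
  "qv_W \<omega> = restrict_space lborel {0..T}"

definition qv_jump :: "'s \<Rightarrow> 's \<Rightarrow> 'w \<Rightarrow> real measure" where
  "qv_jump i j \<omega> = count_space (jumps i j \<omega>)"

definition K2F :: "('s \<Rightarrow> 's \<Rightarrow> real \<Rightarrow> 'w \<Rightarrow> 'v::euclidean_space) \<Rightarrow> bool" where
  "K2F k \<longleftrightarrow>
    (\<forall>i j. measurable_process (k i j) \<and> adapted (k i j)) \<and>
    (\<forall>i. \<forall>t\<in>{0..T}. \<forall>\<omega>\<in>space M. k i i t \<omega> = 0) \<and>
    (\<Sum>i\<in>UNIV. \<Sum>j\<in>UNIV. \<integral>\<^sup>+\<omega>. (\<integral>\<^sup>+t. ennreal ((norm (k i j t \<omega>))\<^sup>2) \<partial>qv_jump i j \<omega>) \<partial>M) < \<infinity>"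

text \<open>\<open>cond_version x xh\<close>: the process \<open>xh\<close> is a jointly measurable version of
  \<open>t \<mapsto> E[x(t) | F\<^sup>\<alpha>\<^sub>t]\<close>, so that its time integrals make sense.\<close>

definition cond_version :: "(real \<Rightarrow> 'w \<Rightarrow> real^'k) \<Rightarrow> (real \<Rightarrow> 'w \<Rightarrow> real^'k) \<Rightarrow> bool" where
  "cond_version x xh \<longleftrightarrow> measurable_process xh \<and>
    (\<forall>t\<in>{0..T}. \<forall>a. AE \<omega> in M. xh t \<omega> $ a = real_cond_exp M (filt_alpha t) (\<lambda>\<omega>. x t \<omega> $ a) \<omega>)"

section \<open>Stochastic integrals\<close>

text \<open>The triple \<open>(n, \<tau>, \<xi>)\<close> stands for the simple integrand
  \<open>\<Sum>l<n. \<xi> l * indicator {\<tau> l<..\<tau> (Suc l)}\<close>.\<close>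

definition simple_integrand :: "nat \<Rightarrow> (nat \<Rightarrow> real) \<Rightarrow> (nat \<Rightarrow> 'w \<Rightarrow> 'v::euclidean_space) \<Rightarrow> bool" where
  "simple_integrand n \<tau> \<xi> \<longleftrightarrow>
    mono_on {..n} \<tau> \<and> \<tau> ` {..n} \<subseteq> {0..T} \<and>
    (\<forall>l<n. \<xi> l \<in> borel_measurable (filt (\<tau> l)) \<and> (\<exists>b. \<forall>\<omega>\<in>space M. norm (\<xi> l \<omega>) \<le> b))"

definition simple_value :: "nat \<Rightarrow> (nat \<Rightarrow> real) \<Rightarrow> (nat \<Rightarrow> 'w \<Rightarrow> 'v::euclidean_space) \<Rightarrow> real \<Rightarrow> 'w \<Rightarrow> 'v" where
  "simple_value n \<tau> \<xi> t \<omega> = (\<Sum>l<n. indicator {\<tau> l<..\<tau> (Suc l)} t *\<^sub>R \<xi> l \<omega>)"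

definition simple_integral ::
  "(real \<Rightarrow> 'w \<Rightarrow> real) \<Rightarrow> nat \<Rightarrow> (nat \<Rightarrow> real) \<Rightarrow> (nat \<Rightarrow> 'w \<Rightarrow> 'v::euclidean_space) \<Rightarrow> real \<Rightarrow> 'w \<Rightarrow> 'v" where
  "simple_integral N n \<tau> \<xi> t \<omega> = (\<Sum>l<n. (N (min (\<tau> (Suc l)) t) \<omega> - N (min (\<tau> l) t) \<omega>) *\<^sub>R \<xi> l \<omega>)"

text \<open>\<open>I\<close> is the integral of \<open>\<phi>\<close> against the square integrable martingale \<open>N\<close> with \<open>d[N] = q\<close>: the mean square
  limit of integrals of simple integrands that converge to \<open>\<phi>\<close> in the norm \<open>(E \<integral>|\<phi>|\<^sup>2 d[N])\<^bsup>1/2\<^esup>\<close>.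
  It is determined up to modification.\<close>

definition L2_integral ::
  "(real \<Rightarrow> 'w \<Rightarrow> real) \<Rightarrow> ('w \<Rightarrow> real measure) \<Rightarrow>
   (real \<Rightarrow> 'w \<Rightarrow> 'v::euclidean_space) \<Rightarrow> (real \<Rightarrow> 'w \<Rightarrow> 'v) \<Rightarrow> bool" where
  "L2_integral N q \<phi> I \<longleftrightarrow> adapted I \<and>
    (\<exists>n \<tau> \<xi>. (\<forall>m. simple_integrand (n m) (\<tau> m) (\<xi> m)) \<and>
      (\<lambda>m. \<integral>\<^sup>+\<omega>. (\<integral>\<^sup>+t. ennreal ((norm (simple_value (n m) (\<tau> m) (\<xi> m) t \<omega> - \<phi> t \<omega>))\<^sup>2) \<partial>q \<omega>) \<partial>M)
        \<longlonglongrightarrow> 0 \<and>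
      (\<forall>t\<in>{0..T}.
        (\<lambda>m. \<integral>\<^sup>+\<omega>. ennreal ((norm (simple_integral N (n m) (\<tau> m) (\<xi> m) t \<omega> - I t \<omega>))\<^sup>2) \<partial>M)
          \<longlonglongrightarrow> 0))"

definition W_integral :: "(real \<Rightarrow> 'w \<Rightarrow> 'v::euclidean_space) \<Rightarrow> (real \<Rightarrow> 'w \<Rightarrow> 'v) \<Rightarrow> bool" where
  "W_integral \<phi> I \<longleftrightarrow> L2F \<phi> \<and> L2_integral W qv_W \<phi> I \<and> (AE \<omega> in M. continuous_on {0..T} (\<lambda>t. I t \<omega>))"

definition jump_integral ::
  "('s \<Rightarrow> 's \<Rightarrow> real \<Rightarrow> 'w \<Rightarrow> 'v::euclidean_space) \<Rightarrow> (real \<Rightarrow> 'w \<Rightarrow> 'v) \<Rightarrow> bool" where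
  "jump_integral k I \<longleftrightarrow> K2F k \<and>
    (\<exists>J. (\<forall>i j. L2_integral (jump_mart i j) (qv_jump i j) (k i j) (J i j)) \<and>
         I = (\<lambda>t \<omega>. \<Sum>i\<in>UNIV. \<Sum>j\<in>UNIV. J i j t \<omega>)) \<and>
    (AE \<omega> in M. cadlag (\<lambda>t. I t \<omega>))"

text \<open>\<open>dx = b dt + \<sigma> dW\<close> and \<open>dx = b dt + \<sigma> dW + k \<bullet> dM\<close> on \<open>[0,T]\<close>.\<close>

definition differential_W ::
  "(real \<Rightarrow> 'w \<Rightarrow> 'v::euclidean_space) \<Rightarrow> (real \<Rightarrow> 'w \<Rightarrow> 'v) \<Rightarrow> (real \<Rightarrow> 'w \<Rightarrow> 'v) \<Rightarrow> bool" where
  "differential_W x b \<sigma> \<longleftrightarrow>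
    (\<exists>I. W_integral \<sigma> I \<and>
      (AE \<omega> in M. \<forall>t\<in>{0..T}. x t \<omega> = x 0 \<omega> + (LBINT s:{0..t}. b s \<omega>) + I t \<omega>))"

definition differential_W_jump ::
  "(real \<Rightarrow> 'w \<Rightarrow> 'v::euclidean_space) \<Rightarrow> (real \<Rightarrow> 'w \<Rightarrow> 'v) \<Rightarrow> (real \<Rightarrow> 'w \<Rightarrow> 'v) \<Rightarrow>
   ('s \<Rightarrow> 's \<Rightarrow> real \<Rightarrow> 'w \<Rightarrow> 'v) \<Rightarrow> bool" where
  "differential_W_jump x b \<sigma> k \<longleftrightarrow>
    (\<exists>I J. W_integral \<sigma> I \<and> jump_integral k J \<and>
      (AE \<omega> in M. \<forall>t\<in>{0..T}. x t \<omega> = x 0 \<omega> + (LBINT s:{0..t}. b s \<omega>) + I t \<omega> + J t \<omega>))"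

end

section \<open>The leader-follower problem\<close>

text \<open>A trailing \<open>h\<close> in a name stands for a hat, a trailing \<open>t\<close> for a tilde.\<close>

record ('s, 'n::finite, 'm1::finite, 'm2::finite) lq_coeffs =
  cA :: "'s \<Rightarrow> real^'n^'n"
  cAh :: "'s \<Rightarrow> real^'n^'n"
  cB1 :: "'s \<Rightarrow> real^'m1^'n"
  cB2 :: "'s \<Rightarrow> real^'m2^'n"
  cC :: "'s \<Rightarrow> real^'n^'n"
  cCh :: "'s \<Rightarrow> real^'n^'n"
  cD1 :: "'s \<Rightarrow> real^'m1^'n"
  cD2 :: "'s \<Rightarrow> real^'m2^'n"
  cQ1 :: "'s \<Rightarrow> real^'n^'n"
  cQh1 :: "'s \<Rightarrow> real^'n^'n"
  cN1 :: "'s \<Rightarrow> real^'m1^'m1"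
  cG1 :: "'s \<Rightarrow> real^'n^'n"
  cGh1 :: "'s \<Rightarrow> real^'n^'n"
  cQ2 :: "'s \<Rightarrow> real^'n^'n"
  cQh2 :: "'s \<Rightarrow> real^'n^'n"
  cN2 :: "'s \<Rightarrow> real^'m2^'m2"
  cG2 :: "'s \<Rightarrow> real^'n^'n"
  cGh2 :: "'s \<Rightarrow> real^'n^'n"

locale lq_game = regime_switching M T W \<alpha> \<Lambda> i0
  for M :: "'w measure" and T :: real and W :: "real \<Rightarrow> 'w \<Rightarrow> real"
    and \<alpha> :: "real \<Rightarrow> 'w \<Rightarrow> 's::finite" and \<Lambda> :: "'s \<Rightarrow> 's \<Rightarrow> real" and i0 :: 's +
  fixes c :: "('s, 'n::finite, 'm1::finite, 'm2::finite) lq_coeffs"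
    and P1 :: "real \<Rightarrow> 's \<Rightarrow> real^'n^'n"
    and Ph1 :: "real \<Rightarrow> 's \<Rightarrow> real^'n^'n"
    and P2 :: "real \<Rightarrow> 's \<Rightarrow> real^('n + 'n)^('n + 'n)"
    and Pt2 :: "real \<Rightarrow> 's \<Rightarrow> real^('n + 'n)^('n + 'n)"
begin

subsection \<open>State equation and the leader's cost\<close>

definition state_solution ::
  "real^'n \<Rightarrow> (real \<Rightarrow> 'w \<Rightarrow> real^'m1) \<Rightarrow> (real \<Rightarrow> 'w \<Rightarrow> real^'m2) \<Rightarrow>
   (real \<Rightarrow> 'w \<Rightarrow> real^'n) \<Rightarrow> (real \<Rightarrow> 'w \<Rightarrow> real^'n) \<Rightarrow> bool" where
  "state_solution x0 u1 u2 x xh \<longleftrightarrow>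
    L2F x \<and> cond_version x xh \<and> (AE \<omega> in M. x 0 \<omega> = x0) \<and>
    differential_W x
      (\<lambda>t \<omega>. cA c (\<alpha> t \<omega>) *v x t \<omega> + cAh c (\<alpha> t \<omega>) *v xh t \<omega> +
             cB1 c (\<alpha> t \<omega>) *v u1 t \<omega> + cB2 c (\<alpha> t \<omega>) *v u2 t \<omega>)
      (\<lambda>t \<omega>. cC c (\<alpha> t \<omega>) *v x t \<omega> + cCh c (\<alpha> t \<omega>) *v xh t \<omega> +
             cD1 c (\<alpha> t \<omega>) *v u1 t \<omega> + cD2 c (\<alpha> t \<omega>) *v u2 t \<omega>)"

definition leader_cost ::
  "(real \<Rightarrow> 'w \<Rightarrow> real^'m2) \<Rightarrow> (real \<Rightarrow> 'w \<Rightarrow> real^'n) \<Rightarrow> (real \<Rightarrow> 'w \<Rightarrow> real^'n) \<Rightarrow> real" where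
  "leader_cost u2 x xh = 1/2 * expectation (\<lambda>\<omega>.
     (LBINT t:{0..T}. (cQ2 c (\<alpha> t \<omega>) *v x t \<omega>) \<bullet> x t \<omega> +
                      (cQh2 c (\<alpha> t \<omega>) *v xh t \<omega>) \<bullet> xh t \<omega> +
                      (cN2 c (\<alpha> t \<omega>) *v u2 t \<omega>) \<bullet> u2 t \<omega>) +
     (cG2 c (\<alpha> T \<omega>) *v x T \<omega>) \<bullet> x T \<omega> +
     (cGh2 c (\<alpha> T \<omega>) *v xh T \<omega>) \<bullet> xh T \<omega>)"

text \<open>The state is unique up to modification and so is \<open>xh\<close>; the cost does not depend on the choice.\<close>

definition J2 :: "real^'n \<Rightarrow> (real \<Rightarrow> 'w \<Rightarrow> real^'m1) \<Rightarrow> (real \<Rightarrow> 'w \<Rightarrow> real^'m2) \<Rightarrow> real" where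
  "J2 x0 u1 u2 = (let (x, xh) = (SOME (x, xh). state_solution x0 u1 u2 x xh) in leader_cost u2 x xh)"

subsection \<open>The follower\<close>

definition N1t :: "real \<Rightarrow> 's \<Rightarrow> real^'m1^'m1" where
  "N1t t i = cN1 c i + transpose (cD1 c i) ** P1 t i ** cD1 c i"

definition S1 :: "real \<Rightarrow> 's \<Rightarrow> real^'n^'m1" where
  "S1 t i = transpose (cB1 c i) ** P1 t i + transpose (cD1 c i) ** P1 t i ** cC c i"

definition Sh1 :: "real \<Rightarrow> 's \<Rightarrow> real^'n^'m1" where
  "Sh1 t i = transpose (cB1 c i) ** Ph1 t i + transpose (cD1 c i) ** P1 t i ** cCh c i"

text \<open>Invertibility of \<open>N1t\<close> is part of being a solution, since its inverse occurs in the equation.\<close>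

definition riccati_P1 :: bool where
  "riccati_P1 \<longleftrightarrow> (\<forall>i. P1 T i = cG1 c i \<and>
    (\<forall>t\<in>{0..T}. sym_mat (P1 t i) \<and> invertible (N1t t i) \<and>
      ((\<lambda>s. P1 s i) has_vector_derivative
        - (P1 t i ** cA c i + transpose (cA c i) ** P1 t i +
           transpose (cC c i) ** P1 t i ** cC c i + cQ1 c i -
           transpose (S1 t i) ** matrix_inv (N1t t i) ** S1 t i +
           (\<Sum>j\<in>UNIV. \<Lambda> i j *\<^sub>R (P1 t j - P1 t i)))) (at t within {0..T})))"

definition riccati_Ph1 :: bool where
  "riccati_Ph1 \<longleftrightarrow> (\<forall>i. Ph1 T i = cGh1 c i \<and>
    (\<forall>t\<in>{0..T}. sym_mat (Ph1 t i) \<and>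
      ((\<lambda>s. Ph1 s i) has_vector_derivative
        - (Ph1 t i ** (cA c i + cAh c i) + transpose (cA c i + cAh c i) ** Ph1 t i +
           P1 t i ** cAh c i + transpose (cAh c i) ** P1 t i +
           transpose (cC c i) ** P1 t i ** cCh c i + transpose (cCh c i) ** P1 t i ** cC c i +
           transpose (cCh c i) ** P1 t i ** cCh c i + cQh1 c i -
           transpose (S1 t i) ** matrix_inv (N1t t i) ** Sh1 t i -
           transpose (Sh1 t i) ** matrix_inv (N1t t i) ** S1 t i -
           transpose (Sh1 t i) ** matrix_inv (N1t t i) ** Sh1 t i +
           (\<Sum>j\<in>UNIV. \<Lambda> i j *\<^sub>R (Ph1 t j - Ph1 t i)))) (at t within {0..T})))"

text \<open>Coefficients written in blackboard bold have the prefix \<open>d\<close>.\<close>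

definition dA :: "real \<Rightarrow> 's \<Rightarrow> real^'n^'n" where
  "dA t i = cA c i - cB1 c i ** matrix_inv (N1t t i) ** S1 t i"

definition dAh :: "real \<Rightarrow> 's \<Rightarrow> real^'n^'n" where
  "dAh t i = cAh c i - cB1 c i ** matrix_inv (N1t t i) ** Sh1 t i"

definition dC :: "real \<Rightarrow> 's \<Rightarrow> real^'n^'n" where
  "dC t i = cC c i - cD1 c i ** matrix_inv (N1t t i) ** S1 t i"

definition dCh :: "real \<Rightarrow> 's \<Rightarrow> real^'n^'n" where
  "dCh t i = cCh c i - cD1 c i ** matrix_inv (N1t t i) ** Sh1 t i"

definition S2 :: "real \<Rightarrow> 's \<Rightarrow> real^'n^'m2" where
  "S2 t i = transpose (cB2 c i) ** P1 t i + transpose (cD2 c i) ** P1 t i ** cC c i"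

definition Sh2 :: "real \<Rightarrow> 's \<Rightarrow> real^'n^'m2" where
  "Sh2 t i = transpose (cB2 c i) ** Ph1 t i + transpose (cD2 c i) ** P1 t i ** cCh c i"

definition dF2 :: "real \<Rightarrow> 's \<Rightarrow> real^'n^'m2" where
  "dF2 t i = S2 t i - transpose (cD2 c i) ** P1 t i ** cD1 c i ** matrix_inv (N1t t i) ** S1 t i"

definition dFh2 :: "real \<Rightarrow> 's \<Rightarrow> real^'n^'m2" where
  "dFh2 t i = Sh2 t i - transpose (cD2 c i) ** P1 t i ** cD1 c i ** matrix_inv (N1t t i) ** Sh1 t i"

definition dB1 :: "real \<Rightarrow> 's \<Rightarrow> real^'n^'n" where
  "dB1 t i = - (cB1 c i ** matrix_inv (N1t t i) ** transpose (cD1 c i))"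

definition dB2 :: "real \<Rightarrow> 's \<Rightarrow> real^'m2^'n" where
  "dB2 t i = cB2 c i - cB1 c i ** matrix_inv (N1t t i) ** transpose (cD1 c i) ** P1 t i ** cD2 c i"

definition dD1 :: "real \<Rightarrow> 's \<Rightarrow> real^'n^'n" where
  "dD1 t i = - (cD1 c i ** matrix_inv (N1t t i) ** transpose (cD1 c i))"

definition dD2 :: "real \<Rightarrow> 's \<Rightarrow> real^'m2^'n" where
  "dD2 t i = cD2 c i - cD1 c i ** matrix_inv (N1t t i) ** transpose (cD1 c i) ** P1 t i ** cD2 c i"

definition dF1 :: "real \<Rightarrow> 's \<Rightarrow> real^'n^'n" where
  "dF1 t i = - (cB1 c i ** matrix_inv (N1t t i) ** transpose (cB1 c i))"

definition follower_control ::
  "(real \<Rightarrow> 'w \<Rightarrow> real^'m2) \<Rightarrow> (real \<Rightarrow> 'w \<Rightarrow> real^'n) \<Rightarrow> (real \<Rightarrow> 'w \<Rightarrow> real^'n) \<Rightarrow>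
   (real \<Rightarrow> 'w \<Rightarrow> real^'n) \<Rightarrow> (real \<Rightarrow> 'w \<Rightarrow> real^'n) \<Rightarrow> real \<Rightarrow> 'w \<Rightarrow> real^'m1" where
  "follower_control u2 x xh \<phi> \<theta> t \<omega> = (let i = \<alpha> t \<omega> in
     - (matrix_inv (N1t t i) *v
         (S1 t i *v x t \<omega> + Sh1 t i *v xh t \<omega> +
          (transpose (cB1 c i) *v \<phi> t \<omega> + transpose (cD1 c i) *v \<theta> t \<omega> +
           (transpose (cD1 c i) ** P1 t i ** cD2 c i) *v u2 t \<omega>))))"

subsection \<open>The leader\<close>

text \<open>Augmented (boldface) coefficients have the prefix \<open>b\<close>.\<close>

definition bA :: "real \<Rightarrow> 's \<Rightarrow> real^('n + 'n)^('n + 'n)" where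
  "bA t i = block (dA t i) 0 0 (dA t i)"

definition bAh :: "real \<Rightarrow> 's \<Rightarrow> real^('n + 'n)^('n + 'n)" where
  "bAh t i = block (dAh t i) 0 0 (dAh t i)"

definition bC :: "real \<Rightarrow> 's \<Rightarrow> real^('n + 'n)^('n + 'n)" where
  "bC t i = block (dC t i) 0 0 (dC t i)"

definition bCh :: "real \<Rightarrow> 's \<Rightarrow> real^('n + 'n)^('n + 'n)" where
  "bCh t i = block (dCh t i) 0 0 (dCh t i)"

definition bB1 :: "real \<Rightarrow> 's \<Rightarrow> real^('n + 'n)^('n + 'n)" where
  "bB1 t i = block 0 (dB1 t i) (dB1 t i) 0"

definition bD1 :: "real \<Rightarrow> 's \<Rightarrow> real^('n + 'n)^('n + 'n)" where
  "bD1 t i = block 0 (dD1 t i) (dD1 t i) 0"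

definition bF1 :: "real \<Rightarrow> 's \<Rightarrow> real^('n + 'n)^('n + 'n)" where
  "bF1 t i = block 0 (dF1 t i) (dF1 t i) 0"

definition bB2 :: "real \<Rightarrow> 's \<Rightarrow> real^'m2^('n + 'n)" where
  "bB2 t i = vstack (dB2 t i) 0"

definition bD2 :: "real \<Rightarrow> 's \<Rightarrow> real^'m2^('n + 'n)" where
  "bD2 t i = vstack (dD2 t i) 0"

definition bF2 :: "real \<Rightarrow> 's \<Rightarrow> real^('n + 'n)^'m2" where
  "bF2 t i = hstack 0 (dF2 t i)"

definition bFh2 :: "real \<Rightarrow> 's \<Rightarrow> real^('n + 'n)^'m2" where
  "bFh2 t i = hstack 0 (dFh2 t i)"

definition bQ2 :: "'s \<Rightarrow> real^('n + 'n)^('n + 'n)" where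
  "bQ2 i = block (cQ2 c i) 0 0 0"

definition bQh2 :: "'s \<Rightarrow> real^('n + 'n)^('n + 'n)" where
  "bQh2 i = block (cQh2 c i) 0 0 0"

definition bG2 :: "'s \<Rightarrow> real^('n + 'n)^('n + 'n)" where
  "bG2 i = block (cG2 c i) 0 0 0"

definition bGh2 :: "'s \<Rightarrow> real^('n + 'n)^('n + 'n)" where
  "bGh2 i = block (cGh2 c i) 0 0 0"

definition Ph2 :: "real \<Rightarrow> 's \<Rightarrow> real^('n + 'n)^('n + 'n)" where
  "Ph2 t i = Pt2 t i - P2 t i"

definition I_P2_D1 :: "real \<Rightarrow> 's \<Rightarrow> real^('n + 'n)^('n + 'n)" where
  "I_P2_D1 t i = mat 1 - P2 t i ** bD1 t i"

definition N2t :: "real \<Rightarrow> 's \<Rightarrow> real^'m2^'m2" where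
  "N2t t i = cN2 c i + transpose (bD2 t i) ** matrix_inv (I_P2_D1 t i) ** P2 t i ** bD2 t i"

definition bJ2 :: "real \<Rightarrow> 's \<Rightarrow> real^('n + 'n)^('n + 'n)" where
  "bJ2 t i = transpose (bB1 t i) ** P2 t i + bC t i"

definition bJh2 :: "real \<Rightarrow> 's \<Rightarrow> real^('n + 'n)^('n + 'n)" where
  "bJh2 t i = transpose (bB1 t i) ** Ph2 t i + bCh t i"

definition bS2 :: "real \<Rightarrow> 's \<Rightarrow> real^('n + 'n)^'m2" where
  "bS2 t i = transpose (bD2 t i) ** matrix_inv (I_P2_D1 t i) ** P2 t i ** bJ2 t i +
             transpose (bB2 t i) ** P2 t i + bF2 t i"

definition bSh2 :: "real \<Rightarrow> 's \<Rightarrow> real^('n + 'n)^'m2" where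
  "bSh2 t i = transpose (bD2 t i) ** matrix_inv (I_P2_D1 t i) ** P2 t i ** bJh2 t i +
              transpose (bB2 t i) ** Ph2 t i + bFh2 t i"

definition riccati_P2 :: bool where
  "riccati_P2 \<longleftrightarrow> (\<forall>i. P2 T i = bG2 i \<and>
    (\<forall>t\<in>{0..T}. sym_mat (P2 t i) \<and>
      ((\<lambda>s. P2 s i) has_vector_derivative
        - (P2 t i ** bA t i + transpose (bA t i) ** P2 t i + P2 t i ** bF1 t i ** P2 t i + bQ2 i +
           transpose (bJ2 t i) ** matrix_inv (I_P2_D1 t i) ** P2 t i ** bJ2 t i -
           transpose (bS2 t i) ** matrix_inv (N2t t i) ** bS2 t i +
           (\<Sum>j\<in>UNIV. \<Lambda> i j *\<^sub>R (P2 t j - P2 t i)))) (at t within {0..T})))"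

definition riccati_Pt2 :: bool where
  "riccati_Pt2 \<longleftrightarrow> (\<forall>i. Pt2 T i = bG2 i + bGh2 i \<and>
    (\<forall>t\<in>{0..T}. sym_mat (Pt2 t i) \<and>
      ((\<lambda>s. Pt2 s i) has_vector_derivative
        - (Pt2 t i ** (bA t i + bAh t i) + transpose (bA t i + bAh t i) ** Pt2 t i +
           Pt2 t i ** bF1 t i ** Pt2 t i + (bQ2 i + bQh2 i) +
           transpose (bJ2 t i + bJh2 t i) ** matrix_inv (I_P2_D1 t i) ** P2 t i ** (bJ2 t i + bJh2 t i) -
           transpose (bS2 t i + bSh2 t i) ** matrix_inv (N2t t i) ** (bS2 t i + bSh2 t i) +
           (\<Sum>j\<in>UNIV. \<Lambda> i j *\<^sub>R (Pt2 t j - Pt2 t i)))) (at t within {0..T})))"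

definition leader_control ::
  "(real \<Rightarrow> 'w \<Rightarrow> real^('n + 'n)) \<Rightarrow> (real \<Rightarrow> 'w \<Rightarrow> real^('n + 'n)) \<Rightarrow> real \<Rightarrow> 'w \<Rightarrow> real^'m2" where
  "leader_control X Xh t \<omega> = (let i = \<alpha> t \<omega> in
     - (matrix_inv (N2t t i) *v (bS2 t i *v X t \<omega> + bSh2 t i *v Xh t \<omega>)))"

definition hamiltonian_system ::
  "real^'n \<Rightarrow> (real \<Rightarrow> 'w \<Rightarrow> real^'m2) \<Rightarrow>
   (real \<Rightarrow> 'w \<Rightarrow> real^('n + 'n)) \<Rightarrow> (real \<Rightarrow> 'w \<Rightarrow> real^('n + 'n)) \<Rightarrow>
   (real \<Rightarrow> 'w \<Rightarrow> real^('n + 'n)) \<Rightarrow> (real \<Rightarrow> 'w \<Rightarrow> real^('n + 'n)) \<Rightarrow>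
   ('s \<Rightarrow> 's \<Rightarrow> real \<Rightarrow> 'w \<Rightarrow> real^('n + 'n)) \<Rightarrow> bool" where
  "hamiltonian_system x0 u2 X Xh Y Z K \<longleftrightarrow>
    L2F X \<and> S2F Y \<and> L2F Z \<and> K2F K \<and> cond_version X Xh \<and>
    (AE \<omega> in M. X 0 \<omega> = vstack x0 0) \<and>
    differential_W X
      (\<lambda>t \<omega>. bA t (\<alpha> t \<omega>) *v X t \<omega> + bAh t (\<alpha> t \<omega>) *v Xh t \<omega> + bF1 t (\<alpha> t \<omega>) *v Y t \<omega> +
             bB1 t (\<alpha> t \<omega>) *v Z t \<omega> + bB2 t (\<alpha> t \<omega>) *v u2 t \<omega>)
      (\<lambda>t \<omega>. bC t (\<alpha> t \<omega>) *v X t \<omega> + bCh t (\<alpha> t \<omega>) *v Xh t \<omega> + transpose (bB1 t (\<alpha> t \<omega>)) *v Y t \<omega> +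
             bD1 t (\<alpha> t \<omega>) *v Z t \<omega> + bD2 t (\<alpha> t \<omega>) *v u2 t \<omega>) \<and>
    (\<exists>Yh Zh u2h. cond_version Y Yh \<and> cond_version Z Zh \<and> cond_version u2 u2h \<and>
      differential_W_jump Y
        (\<lambda>t \<omega>. - (transpose (bA t (\<alpha> t \<omega>)) *v Y t \<omega> + transpose (bAh t (\<alpha> t \<omega>)) *v Yh t \<omega> +
                  transpose (bC t (\<alpha> t \<omega>)) *v Z t \<omega> + transpose (bCh t (\<alpha> t \<omega>)) *v Zh t \<omega> +
                  bQ2 (\<alpha> t \<omega>) *v X t \<omega> + bQh2 (\<alpha> t \<omega>) *v Xh t \<omega> +
                  transpose (bF2 t (\<alpha> t \<omega>)) *v u2 t \<omega> + transpose (bFh2 t (\<alpha> t \<omega>)) *v u2h t \<omega>))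
        Z K) \<and>
    (AE \<omega> in M. Y T \<omega> = bG2 (\<alpha> T \<omega>) *v X T \<omega> + bGh2 (\<alpha> T \<omega>) *v Xh T \<omega>)"

definition decoupled ::
  "(real \<Rightarrow> 'w \<Rightarrow> real^'m2) \<Rightarrow>
   (real \<Rightarrow> 'w \<Rightarrow> real^('n + 'n)) \<Rightarrow> (real \<Rightarrow> 'w \<Rightarrow> real^('n + 'n)) \<Rightarrow>
   (real \<Rightarrow> 'w \<Rightarrow> real^('n + 'n)) \<Rightarrow> (real \<Rightarrow> 'w \<Rightarrow> real^('n + 'n)) \<Rightarrow> bool" where
  "decoupled u2 X Xh Y Z \<longleftrightarrow>
    (\<forall>t\<in>{0..T}. AE \<omega> in M.
      Y t \<omega> = P2 t (\<alpha> t \<omega>) *v X t \<omega> + Ph2 t (\<alpha> t \<omega>) *v Xh t \<omega> \<and>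
      Z t \<omega> = (matrix_inv (I_P2_D1 t (\<alpha> t \<omega>)) ** P2 t (\<alpha> t \<omega>)) *v
                (bJ2 t (\<alpha> t \<omega>) *v X t \<omega> + bJh2 t (\<alpha> t \<omega>) *v Xh t \<omega> + bD2 t (\<alpha> t \<omega>) *v u2 t \<omega>))"

text \<open>The bracketed coefficients of \<open>X\<close> and \<open>Xh\<close> in the state feedback form of the follower's control.\<close>

definition follower_gain :: "real \<Rightarrow> 's \<Rightarrow> real^('n + 'n)^'m1" where
  "follower_gain t i =
     hstack (S1 t i) 0 + hstack 0 (transpose (cB1 c i)) ** P2 t i +
     hstack 0 (transpose (cD1 c i)) ** matrix_inv (I_P2_D1 t i) ** P2 t i ** bJ2 t i -
     hstack 0 (transpose (cD1 c i)) ** matrix_inv (I_P2_D1 t i) ** P2 t i ** bD2 t i **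
       matrix_inv (N2t t i) ** bS2 t i -
     transpose (cD1 c i) ** P1 t i ** cD2 c i ** matrix_inv (N2t t i) ** bS2 t i"

definition follower_gain_h :: "real \<Rightarrow> 's \<Rightarrow> real^('n + 'n)^'m1" where
  "follower_gain_h t i =
     hstack (Sh1 t i) 0 + hstack 0 (transpose (cB1 c i)) ** Ph2 t i +
     hstack 0 (transpose (cD1 c i)) ** matrix_inv (I_P2_D1 t i) ** P2 t i ** bJh2 t i -
     hstack 0 (transpose (cD1 c i)) ** matrix_inv (I_P2_D1 t i) ** P2 t i ** bD2 t i **
       matrix_inv (N2t t i) ** bSh2 t i -
     transpose (cD1 c i) ** P1 t i ** cD2 c i ** matrix_inv (N2t t i) ** bSh2 t i"

end

end

theory Submission
  imports Defs
begin

text \<open>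
  The Riccati equations enter only through the decoupling \<open>Y = P\<^sub>2 X + \<dots>\<close>, \<open>Z = \<dots>\<close>. With these relations the
  definition of \<open>u\<^sub>2\<^sup>*\<close> is the stationarity condition
  \<open>N\<^sub>2 u\<^sub>2\<^sup>* + B\<^sub>2\<^sup>T Y + D\<^sub>2\<^sup>T Z + F\<^sub>2 X + \<dots> = 0\<close> of the leader, and (F) becomes a feedback by substitution.
  Integrating \<open>d(\<langle>x, y\<rangle> - \<langle>\<psi>, \<phi>\<rangle>)\<close> along (H), all couplings cancel in expectation except for the running cost, so that
  \<open>2 J\<^sub>2 = E\<langle>x\<^sub>0, y(0)\<rangle>\<close>, and \<open>Y(0) = (P\<^sub>2 + (Pt\<^sub>2 - P\<^sub>2)) X\<^sub>0\<close> at the deterministic initial state. The product formula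
  is derived from the martingale property of the stochastic integrals, the isometry and orthogonality of \<open>W\<close> and
  \<open>M\<^sub>i\<^sub>j\<close>. The latter martingales are obtained by discretising the chain on dyadic grids.
\<close>

subsection \<open>Square integrable functions\<close>

text \<open>Products of processes are needed in expectation only, so the martingale property, the
  isometry and orthogonality can stand in for pathwise brackets. The jump martingales are the
  obstacle. Their second moments are never computed; what is known is integrability, so the
  variables tested against their increments are kept bounded, and independence supplies the
  integrability of mixed products. Square integrability of the integral of \<open>K\<close> is read
  off later from the equation of \<open>Y\<close>, all of whose other terms are square integrable.
  The minus sign before the pairing of psi and phi is forced by the off-diagonal blocks F1, B1, D1:
  with it their contributions occur twice with opposite signs. Hats disappear because conditioning
  on the chain is self-adjoint and commutes with coefficients depending on the current regime, so a
  hatted term in the equation of \<open>X\<close> meets its mirror image in the equation of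
  \<open>Y\<close>. Finally, \<open>J2\<close> picks an arbitrary solution of the state equation, so
  uniqueness of that solution up to modification (Gronwall with conditional expectations) belongs to
  the proof.\<close>

definition sq_int :: "'a measure \<Rightarrow> ('a \<Rightarrow> 'b::euclidean_space) \<Rightarrow> bool" where
  "sq_int N f \<longleftrightarrow> f \<in> borel_measurable N \<and> integrable N (\<lambda>x. (norm (f x))\<^sup>2)"

lemma sq_intD:
  assumes "sq_int N f"
  shows "f \<in> borel_measurable N" "integrable N (\<lambda>x. (norm (f x))\<^sup>2)"
  using assms by (auto simp: sq_int_def)

lemma sq_int_iff_nn_integral:
  assumes "f \<in> borel_measurable N"
  shows "sq_int N f \<longleftrightarrow> (\<integral>\<^sup>+x. ennreal ((norm (f x))\<^sup>2) \<partial>N) < \<infinity>"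
  using assms by (auto simp: sq_int_def integrable_iff_bounded)

lemma sq_int_bound:
  assumes "f \<in> borel_measurable N" "integrable N g" "AE x in N. (norm (f x))\<^sup>2 \<le> g x"
  shows "sq_int N f"
  unfolding sq_int_def
proof (intro conjI assms(1) Bochner_Integration.integrable_bound[OF assms(2)])
  show "AE x in N. norm ((norm (f x))\<^sup>2) \<le> norm (g x)"
    using assms(3) by eventually_elim auto
qed (use assms(1) in measurable)

lemma sq_int_cong_AE:
  assumes "sq_int N f" "g \<in> borel_measurable N" "AE x in N. f x = g x"
  shows "sq_int N g"
  by (rule sq_int_bound[OF assms(2) sq_intD(2)[OF assms(1)]]) (use assms(3) in eventually_elim, auto)

lemma abs_inner_le_squares: "\<bar>u \<bullet> v\<bar> \<le> (norm u)\<^sup>2 + (norm v)\<^sup>2"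
proof -
  have "\<bar>u \<bullet> v\<bar> \<le> norm u * norm v"
    by (rule Cauchy_Schwarz_ineq2)
  also have "\<dots> \<le> (norm u)\<^sup>2 + (norm v)\<^sup>2"
    using sum_squares_bound[of "norm u" "norm v"]
      mult_nonneg_nonneg[OF norm_ge_zero[of u] norm_ge_zero[of v]] zero_le_power2[of "norm u"]
          zero_le_power2[of "norm v"] by linarith
  finally show ?thesis .
qed

lemma integrable_inner_sq_int:
  assumes "sq_int N f" "sq_int N g"
  shows "integrable N (\<lambda>x. f x \<bullet> g x)"
proof (rule Bochner_Integration.integrable_bound)
  show "integrable N (\<lambda>x. (norm (f x))\<^sup>2 + (norm (g x))\<^sup>2)"
    using assms by (auto simp: sq_int_def)
  show "(\<lambda>x. f x \<bullet> g x) \<in> borel_measurable N"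
    using assms by (auto simp: sq_int_def)
  show "AE x in N. norm (f x \<bullet> g x) \<le> norm ((norm (f x))\<^sup>2 + (norm (g x))\<^sup>2)"
    by (rule AE_I2) (use abs_inner_le_squares in auto)
qed

lemma norm_add_sq_le: "(norm (u + v))\<^sup>2 \<le> 2 * (norm u)\<^sup>2 + 2 * (norm v)\<^sup>2"
proof -
  have "(norm (u + v))\<^sup>2 \<le> (norm u + norm v)\<^sup>2"
    by (intro power_mono norm_triangle_ineq) auto
  also have "\<dots> \<le> 2 * (norm u)\<^sup>2 + 2 * (norm v)\<^sup>2"
    using sum_squares_bound[of "norm u" "norm v"] by (simp add: power2_sum)
  finally show ?thesis .
qed

lemma sq_int_add:
  assumes "sq_int N f" "sq_int N g"
  shows "sq_int N (\<lambda>x. f x + g x)"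
proof (rule sq_int_bound)
  show "integrable N (\<lambda>x. 2 * (norm (f x))\<^sup>2 + 2 * (norm (g x))\<^sup>2)"
    using assms by (auto simp: sq_int_def)
  show "(\<lambda>x. f x + g x) \<in> borel_measurable N"
    using assms by (auto simp: sq_int_def)
qed (auto intro: norm_add_sq_le)

lemma sq_int_mult_bounded:
  assumes f: "sq_int N f" and g: "g \<in> borel_measurable N"
    and b: "AE x in N. norm (g x) \<le> B * norm (f x)"
  shows "sq_int N g"
proof (rule sq_int_bound[OF g])
  show "integrable N (\<lambda>x. B\<^sup>2 * (norm (f x))\<^sup>2)"
    using f by (auto simp: sq_int_def)
  show "AE x in N. (norm (g x))\<^sup>2 \<le> B\<^sup>2 * (norm (f x))\<^sup>2"
    using b
  proof eventually_elim
    case (elim x)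
    then have "(norm (g x))\<^sup>2 \<le> (B * norm (f x))\<^sup>2"
      by (intro power_mono) auto
    then show ?case by (simp add: power_mult_distrib)
  qed
qed

lemma sq_int_bounded_linear:
  assumes "sq_int N f" "bounded_linear h"
  shows "sq_int N (\<lambda>x. h (f x))"
proof -
  obtain B where "\<And>x. norm (h x) \<le> norm x * B"
    using bounded_linear.bounded[OF assms(2)] by blast
  moreover have "h \<in> borel_measurable borel"
    using assms(2) borel_measurable_continuous_onI linear_continuous_on by blast
  ultimately show ?thesis
    using assms(1) sq_intD(1)[OF assms(1)]
    by (intro sq_int_mult_bounded[OF assms(1), of _ B]) (auto simp: mult.commute)
qed

lemma sq_int_minus: "sq_int N f \<Longrightarrow> sq_int N (\<lambda>x. - f x)"
  by (rule sq_int_bounded_linear) (auto intro: bounded_linear_minus bounded_linear_ident)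

lemma sq_int_diff: "sq_int N f \<Longrightarrow> sq_int N g \<Longrightarrow> sq_int N (\<lambda>x. f x - g x)"
  using sq_int_add[OF _ sq_int_minus, of N f g] by simp

lemma sq_int_zero: "sq_int N (\<lambda>x. 0)"
  by (simp add: sq_int_def)

lemma sq_int_sum: "(\<And>i. i \<in> S \<Longrightarrow> sq_int N (f i)) \<Longrightarrow> sq_int N (\<lambda>x. \<Sum>i\<in>S. f i x)"
  by (induction S rule: infinite_finite_induct) (auto intro: sq_int_add sq_int_zero)

lemma sq_int_mult_bounded_real:
  fixes f :: "'a \<Rightarrow> real"
  assumes "sq_int N f" "g \<in> borel_measurable N" "\<And>x. x \<in> space N \<Longrightarrow> norm (g x) \<le> b"
  shows "sq_int N (\<lambda>x. f x *\<^sub>R g x)"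
proof (rule sq_int_mult_bounded[OF assms(1)])
  show "AE x in N. norm (f x *\<^sub>R g x) \<le> b * norm (f x)"
    using mult_right_mono[OF assms(3) abs_ge_zero] by (intro AE_I2) (simp add: mult.commute)
qed (use assms(2) sq_intD(1)[OF assms(1)] in measurable)

lemma (in finite_measure) sq_int_const: "sq_int M (\<lambda>x. c)"
  by (simp add: sq_int_def)

lemma (in finite_measure) sq_int_integrable:
  assumes "sq_int M f"
  shows "integrable M f" "integrable M (\<lambda>x. norm (f x))"
proof -
  show "integrable M f"
  proof (rule Bochner_Integration.integrable_bound)
    show "integrable M (\<lambda>x. 1 + (norm (f x))\<^sup>2)"
      using assms by (auto simp: sq_int_def)
    have "norm v \<le> norm (1 + (norm v)\<^sup>2)" for v :: 'b
      using sum_squares_bound[of 1 "norm v"] norm_ge_zero[of v]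
      unfolding real_norm_def one_power2 by linarith
    then show "AE x in M. norm (f x) \<le> norm (1 + (norm (f x))\<^sup>2)"
      by simp
  qed (use assms in \<open>auto simp: sq_int_def\<close>)
  then show "integrable M (\<lambda>x. norm (f x))" by simp
qed

text \<open>The squared norm of f - t g integrates to a quadratic in t that is never negative;
  evaluating it at one well chosen t gives the bound.\<close>

lemma Cauchy_Schwarz_integral:
  assumes f: "sq_int N f" and g: "sq_int N g"
  shows "\<bar>\<integral>x. f x \<bullet> g x \<partial>N\<bar> \<le> sqrt (\<integral>x. (norm (f x))\<^sup>2 \<partial>N) * sqrt (\<integral>x. (norm (g x))\<^sup>2 \<partial>N)"
proof -
  let ?p = "\<integral>x. (norm (f x))\<^sup>2 \<partial>N" and ?q = "\<integral>x. (norm (g x))\<^sup>2 \<partial>N" and ?r = "\<integral>x. f x \<bullet> g x \<partial>N"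
  have nonneg: "?p - 2 * t * ?r + t\<^sup>2 * ?q \<ge> 0" for t
  proof -
    have "0 \<le> (\<integral>x. (norm (f x - t *\<^sub>R g x))\<^sup>2 \<partial>N)"
      by (intro Bochner_Integration.integral_nonneg) auto
    also have "(\<lambda>x. (norm (f x - t *\<^sub>R g x))\<^sup>2) =
        (\<lambda>x. (norm (f x))\<^sup>2 - (2 * t) * (f x \<bullet> g x) + t\<^sup>2 * (norm (g x))\<^sup>2)"
      by (rule ext) (simp add: power2_norm_eq_inner inner_diff_left inner_diff_right inner_commute
          power2_eq_square[of t] algebra_simps)
    also have "(\<integral>x. \<dots> x \<partial>N) = ?p - 2 * t * ?r + t\<^sup>2 * ?q"
      using sq_intD(2)[OF f] sq_intD(2)[OF g] integrable_inner_sq_int[OF f g] by simp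
    finally show ?thesis .
  qed
  have q0: "?q \<ge> 0" and p0: "?p \<ge> 0" by (auto intro!: Bochner_Integration.integral_nonneg)
  have "?r\<^sup>2 \<le> ?p * ?q"
  proof (cases "?q = 0")
    case True
    have "?r = 0"
    proof (rule ccontr)
      assume "?r \<noteq> 0"
      \<comment> \<open>With \<open>?q = 0\<close> the quadratic is affine in t, and this t gives it
        the value -1.\<close>
      then show False using nonneg[of "(?p + 1) / (2 * ?r)"] True by (simp add: field_simps)
    qed
    then show ?thesis using True by simp
  next
    case False
    with q0 have "?q > 0" by linarith
    \<comment> \<open>The minimiser of the quadratic is t = \<open>?r / ?q\<close>.\<close>
    moreover have "?p - 2 * (?r / ?q) * ?r + (?r / ?q)\<^sup>2 * ?q = ?p - ?r\<^sup>2 / ?q"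
      using False by (simp add: divide_simps power2_eq_square)
    ultimately have "?r\<^sup>2 / ?q \<le> ?p" and "?q > 0" using nonneg[of "?r / ?q"] by linarith+
    then show ?thesis by (simp only: pos_divide_le_eq)
  qed
  then have "sqrt (?r\<^sup>2) \<le> sqrt (?p * ?q)" by (rule real_sqrt_le_mono)
  then show ?thesis by (simp add: real_sqrt_mult)
qed

text \<open>The Bochner integral of a non-integrable function is 0, so convergence of real integrals
  alone would say little. A nonnegative integral that tends to 0 is eventually finite, and this
  yields square integrability for large m.\<close>

lemma integral_norm_sq_tendsto_0:
  fixes F :: "nat \<Rightarrow> 'a \<Rightarrow> 'b::euclidean_space"
  assumes "\<And>m. F m \<in> borel_measurable N" "(\<lambda>m. \<integral>\<^sup>+x. ennreal ((norm (F m x))\<^sup>2) \<partial>N) \<longlonglongrightarrow> 0"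
  shows "\<forall>\<^sub>F m in sequentially. sq_int N (F m)"
    and "(\<lambda>m. \<integral>x. (norm (F m x))\<^sup>2 \<partial>N) \<longlonglongrightarrow> 0"
proof -
  have "\<forall>\<^sub>F m in sequentially. (\<integral>\<^sup>+x. ennreal ((norm (F m x))\<^sup>2) \<partial>N) < \<infinity>"
    using order_tendstoD(2)[OF assms(2), of top] by simp
  then show "\<forall>\<^sub>F m in sequentially. sq_int N (F m)"
    by eventually_elim (use assms(1) in \<open>simp add: sq_int_iff_nn_integral\<close>)
  have "(\<integral>x. (norm (F m x))\<^sup>2 \<partial>N) = enn2real (\<integral>\<^sup>+x. ennreal ((norm (F m x))\<^sup>2) \<partial>N)" for m
    using assms(1)[of m] by (intro integral_eq_nn_integral) auto
  then show "(\<lambda>m. \<integral>x. (norm (F m x))\<^sup>2 \<partial>N) \<longlonglongrightarrow> 0"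
    using tendsto_enn2real[OF assms(2)[folded ennreal_0]] by simp
qed

text \<open>A single late index suffices: f is \<open>F m\<close> minus the square integrable
  error.\<close>

lemma sq_int_limit:
  assumes "\<And>m. sq_int N (F m)" "f \<in> borel_measurable N"
    and "(\<lambda>m. \<integral>\<^sup>+x. ennreal ((norm (F m x - f x))\<^sup>2) \<partial>N) \<longlonglongrightarrow> 0"
  shows "sq_int N f"
proof -
  have "\<forall>\<^sub>F m in sequentially. sq_int N (\<lambda>x. F m x - f x)"
    by (rule integral_norm_sq_tendsto_0[OF _ assms(3)]) (use assms(2) sq_intD(1)[OF assms(1)] in measurable)
  then obtain m where "sq_int N (\<lambda>x. F m x - f x)"
    using eventually_sequentially by auto
  from sq_int_diff[OF assms(1)[of m] this] show ?thesis by simp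
qed

text \<open>The difference splits bilinearly into three error terms, each controlled by
  Cauchy-Schwarz. Measurability of the approximants is enough, since their distance to the limit is
  square integrable from some index on.\<close>

lemma tendsto_integral_inner_sq_int:
  assumes F: "\<And>m. F m \<in> borel_measurable N" and G: "\<And>m. G m \<in> borel_measurable N"
    and f: "sq_int N f" and g: "sq_int N g"
    and Ff: "(\<lambda>m. \<integral>\<^sup>+x. ennreal ((norm (F m x - f x))\<^sup>2) \<partial>N) \<longlonglongrightarrow> 0"
    and Gg: "(\<lambda>m. \<integral>\<^sup>+x. ennreal ((norm (G m x - g x))\<^sup>2) \<partial>N) \<longlonglongrightarrow> 0"
  shows "(\<lambda>m. \<integral>x. F m x \<bullet> G m x \<partial>N) \<longlonglongrightarrow> (\<integral>x. f x \<bullet> g x \<partial>N)"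
proof -
  have mF: "(\<lambda>x. F m x - f x) \<in> borel_measurable N" and mG: "(\<lambda>x. G m x - g x) \<in> borel_measurable N" for m
    using F G sq_intD(1)[OF f] sq_intD(1)[OF g] by measurable
  define a where "a = (\<lambda>m. sqrt (\<integral>x. (norm (F m x - f x))\<^sup>2 \<partial>N))"
  define b where "b = (\<lambda>m. sqrt (\<integral>x. (norm (G m x - g x))\<^sup>2 \<partial>N))"
  define p where "p = sqrt (\<integral>x. (norm (f x))\<^sup>2 \<partial>N)"
  define q where "q = sqrt (\<integral>x. (norm (g x))\<^sup>2 \<partial>N)"
  have a0: "a \<longlonglongrightarrow> 0" and b0: "b \<longlonglongrightarrow> 0"
    using tendsto_real_sqrt[OF integral_norm_sq_tendsto_0(2)[OF mF Ff]]
      tendsto_real_sqrt[OF integral_norm_sq_tendsto_0(2)[OF mG Gg]] by (simp_all add: a_def b_def)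
  have "\<forall>\<^sub>F m in sequentially. \<bar>(\<integral>x. F m x \<bullet> G m x \<partial>N) - (\<integral>x. f x \<bullet> g x \<partial>N)\<bar> \<le> a m * b m + a m * q + p * b m"
    using integral_norm_sq_tendsto_0(1)[OF mF Ff] integral_norm_sq_tendsto_0(1)[OF mG Gg]
  proof eventually_elim
    case (elim m)
    have eq: "(\<lambda>x. F m x \<bullet> G m x) =
        (\<lambda>x. (F m x - f x) \<bullet> (G m x - g x) + (F m x - f x) \<bullet> g x + f x \<bullet> (G m x - g x) + f x \<bullet> g x)"
      by (auto simp: inner_diff_left inner_diff_right)
    have "(\<integral>x. F m x \<bullet> G m x \<partial>N) - (\<integral>x. f x \<bullet> g x \<partial>N) = (\<integral>x. (F m x - f x) \<bullet> (G m x - g x) \<partial>N) +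
        (\<integral>x. (F m x - f x) \<bullet> g x \<partial>N) + (\<integral>x. f x \<bullet> (G m x - g x) \<partial>N)"
      unfolding eq using elim f g by (simp add: integrable_inner_sq_int)
    then show ?case
      using Cauchy_Schwarz_integral[OF elim] Cauchy_Schwarz_integral[OF elim(1) g]
        Cauchy_Schwarz_integral[OF f elim(2)] unfolding a_def b_def p_def q_def by linarith
  qed
  moreover have "(\<lambda>m. a m * b m + a m * q + p * b m) \<longlonglongrightarrow> 0 * 0 + 0 * q + p * 0"
    by (intro tendsto_intros a0 b0)
  ultimately have "(\<lambda>m. (\<integral>x. F m x \<bullet> G m x \<partial>N) - (\<integral>x. f x \<bullet> g x \<partial>N)) \<longlonglongrightarrow> 0"
    using Lim_null_comparison[of "\<lambda>m. (\<integral>x. F m x \<bullet> G m x \<partial>N) - (\<integral>x. f x \<bullet> g x \<partial>N)"] by simp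
  then show ?thesis by (rule LIM_zero_cancel)
qed

subsection \<open>Conditionally centred random variables\<close>

lemma space_generated_by [simp]: "space (generated_by M N \<xi> I) = space M"
  by (simp add: generated_by_def space_measure_of_conv)

lemma sets_generated_by:
  "sets (generated_by M N \<xi> I) = sigma_sets (space M) (\<Union>s\<in>I. {\<xi> s -` B \<inter> space M | B. B \<in> sets N})"
  unfolding generated_by_def by (rule sets_measure_of) auto

lemma measurable_generated_by:
  assumes "s \<in> I" "\<xi> s \<in> space M \<rightarrow> space N"
  shows "\<xi> s \<in> measurable (generated_by M N \<xi> I) N"
  using assms by (intro measurableI) (auto simp: sets_generated_by intro!: sigma_sets.Basic)

lemma subalgebra_generated_by:
  assumes "\<And>s. s \<in> I \<Longrightarrow> \<xi> s \<in> measurable M N"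
  shows "subalgebra M (generated_by M N \<xi> I)"
  unfolding subalgebra_def sets_generated_by
  using assms by (auto intro!: sets.sigma_sets_subset intro: measurable_sets)

lemma sets_generated_by_mono:
  "I \<subseteq> J \<Longrightarrow> sets (generated_by M N \<xi> I) \<subseteq> sets (generated_by M N \<xi> J)"
  unfolding sets_generated_by by (intro sigma_sets_mono' UN_mono) auto

text \<open>Vanishing on all sets of \<open>G\<close> means that the conditional expectation of f is
  0, and \<open>\<eta>\<close> can be pulled out of it. Asking for an integrable product instead of
  a bounded \<open>\<eta>\<close> admits products of a coefficient with an earlier
  increment.\<close>

lemma (in prob_space) integral_mult_cond_centred:
  fixes f \<eta> :: "'a \<Rightarrow> real"
  assumes sub: "subalgebra M G" and f: "integrable M f"
    and centred: "\<And>A. A \<in> sets G \<Longrightarrow> (\<integral>x. indicator A x * f x \<partial>M) = 0"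
    and \<eta>: "\<eta> \<in> borel_measurable G" and int: "integrable M (\<lambda>x. \<eta> x * f x)"
  shows "(\<integral>x. \<eta> x * f x \<partial>M) = 0"
proof -
  interpret finite_measure_subalgebra M G
    by unfold_locales (rule sub)
  have "AE x in M. real_cond_exp M G f x = 0"
    by (rule real_cond_exp_charact) (use f centred in \<open>simp_all add: set_lebesgue_integral_def\<close>)
  then have "(\<integral>x. \<eta> x * real_cond_exp M G f x \<partial>M) = (\<integral>x. 0 \<partial>M)"
    using measurable_from_subalg[OF sub \<eta>] by (intro integral_cong_AE) auto
  then show ?thesis
    using real_cond_exp_intg(2)[OF int \<eta>] f by auto
qed

text \<open>Up to null sets, the sets \<open>a \<inter> b\<close> are an intersection-stable generator.\<close>

lemma (in prob_space) cond_centred_sigma_join: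
  fixes f :: "'a \<Rightarrow> real"
  assumes F: "subalgebra M F" and G: "subalgebra M G" and f: "integrable M f"
    and centred: "\<And>a b. a \<in> sets F \<Longrightarrow> b \<in> sets G \<Longrightarrow> (\<integral>x. indicator (a \<inter> b) x * f x \<partial>M) = 0"
    and A: "A \<in> sets (sigma (space M) (sets F \<union> sets G \<union> null_sets M))"
  shows "(\<integral>x. indicator A x * f x \<partial>M) = 0"
proof -
  define pis where "pis = {a \<inter> b | a b. a \<in> sets F \<and> b \<in> sets G} \<union> null_sets M"
  have sp: "space F = space M" "space G = space M" and FM: "sets F \<subseteq> sets M" "sets G \<subseteq> sets M"
    using F G by (auto simp: subalgebra_def)
  have pisM: "pis \<subseteq> sets M"
    using FM by (auto simp: pis_def)
  have null_int: "a \<inter> b \<in> null_sets M" if "a \<in> null_sets M" "b \<in> sets M" for a b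
    using that null_set_Int2 by blast
  have stable: "Int_stable pis"
  proof (rule Int_stableI)
    fix a b assume ab: "a \<in> pis" "b \<in> pis"
    consider "a \<in> null_sets M" | "b \<in> null_sets M"
      | a1 a2 b1 b2 where "a = a1 \<inter> a2" "b = b1 \<inter> b2" "a1 \<in> sets F" "b1 \<in> sets F" "a2 \<in> sets G" "b2 \<in> sets G"
      using ab by (auto simp: pis_def)
    then show "a \<inter> b \<in> pis"
    proof cases
      case 1
      then show ?thesis using null_int[OF 1, of b] ab pisM unfolding pis_def by blast
    next
      case 2
      then have "b \<inter> a \<in> pis" using null_int[OF 2, of a] ab pisM unfolding pis_def by blast
      then show ?thesis by (simp add: Int_commute)
    next
      case 3
      then have "a \<inter> b = (a1 \<inter> b1) \<inter> (a2 \<inter> b2)" by auto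
      then show ?thesis using 3 unfolding pis_def by blast
    qed
  qed
  have "sets F \<subseteq> pis"
  proof
    fix a assume "a \<in> sets F"
    then have "a = a \<inter> space G" using sets.sets_into_space sp by blast
    then show "a \<in> pis" using \<open>a \<in> sets F\<close> unfolding pis_def by blast
  qed
  moreover have "sets G \<subseteq> pis"
  proof
    fix b assume "b \<in> sets G"
    then have "b = space F \<inter> b" using sets.sets_into_space sp by blast
    then show "b \<in> pis" using \<open>b \<in> sets G\<close> unfolding pis_def by blast
  qed
  ultimately have sub: "sets F \<union> sets G \<union> null_sets M \<subseteq> sigma_sets (space M) pis"
    by (auto simp: pis_def)
  have "A \<in> sigma_sets (space M) (sets F \<union> sets G \<union> null_sets M)"
  proof -
    have "sets F \<union> sets G \<union> null_sets M \<subseteq> sets M" using FM by auto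
    then show ?thesis
      using A by (subst (asm) sets_measure_of) (meson order_trans sets.space_closed)+
  qed
  then have A': "A \<in> sigma_sets (space M) pis"
    using sigma_sets_mono[OF sub] by blast
  have sigM: "sigma_sets (space M) pis \<subseteq> sets M"
    by (rule sets.sigma_sets_subset[OF pisM])
  have PiP: "pis \<subseteq> Pow (space M)" using pisM sets.sets_into_space by blast
  have ind: "integrable M (\<lambda>x. indicator B x * f x)" if "B \<in> sets M" for B
    using integrable_mult_indicator[OF that f] by simp
  \<comment> \<open>The complement step of the induction subtracts from the integral over the whole
    space, which is the hypothesis for the two largest sets.\<close>
  have whole: "(\<integral>x. f x \<partial>M) = 0"
  proof -
    have "(\<integral>x. f x \<partial>M) = (\<integral>x. indicator (space F \<inter> space G) x * f x \<partial>M)"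
      by (rule Bochner_Integration.integral_cong) (auto simp: sp)
    then show ?thesis using centred[of "space F" "space G"] by simp
  qed
  show ?thesis using stable PiP A'
  proof (induction rule: sigma_sets_induct_disjoint)
    case (basic B)
    show ?case
    proof (cases "B \<in> null_sets M")
      case True
      then have "AE x in M. x \<notin> B" by (rule AE_not_in)
      then have "(\<integral>x. indicator B x * f x \<partial>M) = (\<integral>x. 0 \<partial>M)"
        using True f by (intro integral_cong_AE) (auto)
      then show ?thesis by simp
    next
      case False
      with basic show ?thesis using centred by (auto simp: pis_def)
    qed
  next
    case empty
    then show ?case by simp
  next
    case (compl B)
    then have B: "B \<in> sets M" using sigM by blast
    have "(\<integral>x. indicator (space M - B) x * f x \<partial>M) = (\<integral>x. f x - indicator B x * f x \<partial>M)"
      by (rule Bochner_Integration.integral_cong) (auto simp: indicator_def)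
    also have "\<dots> = 0" using f ind[OF B] compl whole by simp
    finally show ?case .
  next
    case (union B)
    then have B: "B i \<in> sets M" for i using sigM by blast
    have "(\<integral>x\<in>(\<Union>i. B i). f x \<partial>M) = (\<Sum>i. \<integral>x\<in>B i. f x \<partial>M)"
      using ind[of "\<Union>i. B i"] B union(1)
      by (intro lebesgue_integral_countable_add) (auto simp: set_integrable_def disjoint_family_on_def)
    moreover have "(\<integral>x\<in>B i. f x \<partial>M) = 0" for i
      using union(3)[of i] by (simp add: set_lebesgue_integral_def)
    ultimately have "(\<integral>x\<in>(\<Union>i. B i). f x \<partial>M) = 0"
      by simp
    then show ?case by (simp add: set_lebesgue_integral_def)
  qed
qed

text \<open>Integrability of the product comes from independence and not from second moments. This
  is what allows jump increments, known to be integrable only, to be multiplied by Brownian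
  increments.\<close>

lemma (in prob_space) indep_set_integral_mult:
  fixes X Y :: "'a \<Rightarrow> real"
  assumes sub: "subalgebra M F" "subalgebra M G" and indep: "indep_set (sets F) (sets G)"
    and X: "X \<in> borel_measurable F" "integrable M X" and Y: "Y \<in> borel_measurable G" "integrable M Y"
  shows "integrable M (\<lambda>x. X x * Y x)" "(\<integral>x. X x * Y x \<partial>M) = (\<integral>x. X x \<partial>M) * (\<integral>x. Y x \<partial>M)"
proof -
  have sp: "space F = space M" "space G = space M"
    using sub by (auto simp: subalgebra_def)
  have "sigma_sets (space M) {X -` A \<inter> space M |A. A \<in> sets borel} \<subseteq> sets F"
    using sets.sigma_sets_subset[of "{X -` A \<inter> space M |A. A \<in> sets borel}" F] measurable_sets[OF X(1)]
    unfolding sp by blast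
  moreover have "sigma_sets (space M) {Y -` A \<inter> space M |A. A \<in> sets borel} \<subseteq> sets G"
    using sets.sigma_sets_subset[of "{Y -` A \<inter> space M |A. A \<in> sets borel}" G] measurable_sets[OF Y(1)]
    unfolding sp by blast
  ultimately have iv: "indep_var borel X borel Y"
    unfolding indep_var_eq indep_sets2_eq
    using indep[unfolded indep_sets2_eq] measurable_from_subalg[OF sub(1) X(1)] measurable_from_subalg[OF sub(2) Y(1)]
    by blast
  show "integrable M (\<lambda>x. X x * Y x)" "(\<integral>x. X x * Y x \<partial>M) = (\<integral>x. X x \<partial>M) * (\<integral>x. Y x \<partial>M)"
    by (rule indep_var_integrable[OF iv X(2) Y(2)], rule indep_var_lebesgue_integral[OF iv X(2) Y(2)])
qed

context regime_switching
begin

subsection \<open>Increments of the Brownian motion\<close>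

abbreviation filt_W :: "real \<Rightarrow> 'w measure" where
  "filt_W t \<equiv> generated_by M borel W {0..t}"

text \<open>The filtration of \<open>W\<close> enlarged by the whole path of \<open>\<alpha>\<close>: independence keeps \<open>W\<close> a Brownian motion.\<close>

definition filt_full :: "real \<Rightarrow> 'w measure" where
  "filt_full t = sigma (space M) (sets (filt_W t) \<union> sets (filt_alpha T) \<union> null_sets M)"

lemma W_measurable: "t \<in> {0..T} \<Longrightarrow> W t \<in> borel_measurable M"
  using brownian by (auto simp: brownian_motion_def)

lemma alpha_measurable: "t \<in> {0..T} \<Longrightarrow> \<alpha> t \<in> measurable M (count_space UNIV)"
  using markov by (auto simp: markov_chain_def)

lemma subalgebra_filt_W: "t \<le> T \<Longrightarrow> subalgebra M (filt_W t)"
  by (rule subalgebra_generated_by) (auto intro: W_measurable)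

lemma subalgebra_filt_alpha: "t \<le> T \<Longrightarrow> subalgebra M (filt_alpha t)"
  unfolding filt_alpha_def by (rule subalgebra_generated_by) (auto intro: alpha_measurable)

lemma filt_W_mono: "s \<le> t \<Longrightarrow> sets (filt_W s) \<subseteq> sets (filt_W t)"
  by (rule sets_generated_by_mono) auto

lemma filt_alpha_mono: "s \<le> t \<Longrightarrow> sets (filt_alpha s) \<subseteq> sets (filt_alpha t)"
  unfolding filt_alpha_def by (rule sets_generated_by_mono) auto

lemma space_filt_alpha [simp]: "space (filt_alpha t) = space M"
  by (simp add: filt_alpha_def)

lemma space_filt [simp]: "space (filt t) = space M"
  by (simp add: filt_def space_measure_of_conv)

lemma space_filt_full [simp]: "space (filt_full t) = space M"
  by (simp add: filt_full_def space_measure_of_conv)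

lemma gens_subset:
  "s \<le> T \<Longrightarrow> t \<le> T \<Longrightarrow> sets (filt_W s) \<union> sets (filt_alpha t) \<union> null_sets M \<subseteq> sets M"
  using subalgebra_filt_W[of s] subalgebra_filt_alpha[of t] by (auto simp: subalgebra_def)

lemma sets_filt:
  assumes "t \<le> T"
  shows "sets (filt t) = sigma_sets (space M) (sets (filt_W t) \<union> sets (filt_alpha t) \<union> null_sets M)"
  unfolding filt_def using gens_subset[OF assms assms]
  by (intro sets_measure_of) (meson order_trans sets.space_closed)

lemma sets_filt_full:
  assumes "t \<le> T"
  shows "sets (filt_full t) = sigma_sets (space M) (sets (filt_W t) \<union> sets (filt_alpha T) \<union> null_sets M)"
  unfolding filt_full_def using gens_subset[OF assms order_refl]
  by (intro sets_measure_of) (meson order_trans sets.space_closed)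

lemma subalgebra_filt: "t \<le> T \<Longrightarrow> subalgebra M (filt t)"
  using gens_subset[of t t] by (auto simp: subalgebra_def sets_filt intro!: sets.sigma_sets_subset)

lemma subalgebra_filt_full: "t \<le> T \<Longrightarrow> subalgebra M (filt_full t)"
  using gens_subset[of t T] by (auto simp: subalgebra_def sets_filt_full intro!: sets.sigma_sets_subset)

lemma filt_mono:
  assumes "s \<le> t" "t \<le> T"
  shows "subalgebra (filt t) (filt s)"
proof -
  have "sets (filt_W s) \<union> sets (filt_alpha s) \<union> null_sets M \<subseteq> sets (filt_W t) \<union> sets (filt_alpha t) \<union> null_sets M"
    using filt_W_mono[OF assms(1)] filt_alpha_mono[OF assms(1)] by blast
  from sigma_sets_mono'[OF this, of "space M"] show ?thesis
    using assms by (simp add: subalgebra_def sets_filt)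
qed

lemma filt_full_mono:
  assumes "s \<le> t" "t \<le> T"
  shows "subalgebra (filt_full t) (filt_full s)"
proof -
  have "sets (filt_W s) \<union> sets (filt_alpha T) \<union> null_sets M \<subseteq> sets (filt_W t) \<union> sets (filt_alpha T) \<union> null_sets M"
    using filt_W_mono[OF assms(1)] by blast
  from sigma_sets_mono'[OF this, of "space M"] show ?thesis
    using assms by (simp add: subalgebra_def sets_filt_full)
qed

lemma filt_le_filt_full:
  assumes "t \<le> T"
  shows "subalgebra (filt_full t) (filt t)"
proof -
  have "sets (filt_W t) \<union> sets (filt_alpha t) \<union> null_sets M \<subseteq> sets (filt_W t) \<union> sets (filt_alpha T) \<union> null_sets M"
    using filt_alpha_mono[OF assms(1)] by blast
  from sigma_sets_mono'[OF this, of "space M"] show ?thesis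
    using assms by (simp add: subalgebra_def sets_filt_full sets_filt)
qed

lemma filt_alpha_le_filt:
  assumes "t \<le> T"
  shows "subalgebra (filt t) (filt_alpha t)"
  using assms by (auto simp: subalgebra_def sets_filt intro: sigma_sets.Basic)

lemma filt_alpha_le_filt_full:
  assumes "t \<le> T"
  shows "subalgebra (filt_full t) (filt_alpha T)"
  using assms by (auto simp: subalgebra_def sets_filt_full intro: sigma_sets.Basic)

lemma W_measurable_filt_W: "s \<in> {0..t} \<Longrightarrow> W s \<in> borel_measurable (filt_W t)"
  by (rule measurable_generated_by) auto

lemma W_measurable_filt:
  assumes "s \<in> {0..t}" "t \<le> T"
  shows "W s \<in> borel_measurable (filt t)"
  by (rule measurable_from_subalg[OF _ W_measurable_filt_W[OF assms(1)]])
     (use assms in \<open>auto simp: subalgebra_def sets_filt intro: sigma_sets.Basic\<close>)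

lemma W_measurable_filt_full:
  assumes "s \<in> {0..t}" "t \<le> T"
  shows "W s \<in> borel_measurable (filt_full t)"
  using measurable_from_subalg[OF filt_le_filt_full W_measurable_filt] assms by auto

lemma W_increment:
  assumes "0 \<le> s" "s \<le> t" "t \<le> T"
  shows sq_int_W_increment: "sq_int M (\<lambda>\<omega>. W t \<omega> - W s \<omega>)"
    and integral_W_increment: "(\<integral>\<omega>. W t \<omega> - W s \<omega> \<partial>M) = 0"
    and integral_W_increment_sq: "(\<integral>\<omega>. (W t \<omega> - W s \<omega>)\<^sup>2 \<partial>M) = t - s"
proof -
  have meas: "(\<lambda>\<omega>. W t \<omega> - W s \<omega>) \<in> borel_measurable M"
    using assms by (intro borel_measurable_diff W_measurable) auto
  have "integrable M (\<lambda>\<omega>. (W t \<omega> - W s \<omega>)\<^sup>2) \<and> (\<integral>\<omega>. W t \<omega> - W s \<omega> \<partial>M) = 0 \<and>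
    (\<integral>\<omega>. (W t \<omega> - W s \<omega>)\<^sup>2 \<partial>M) = t - s"
  \<comment> \<open>The law of an increment is prescribed for s < t; at s = t every claim is about
    the zero variable.\<close>
  proof (cases "s = t")
    case False
    then have st: "s < t" using assms by simp
    have D: "distributed M lborel (\<lambda>\<omega>. W t \<omega> - W s \<omega>) (\<lambda>x. ennreal (normal_density 0 (sqrt (t - s)) x))"
      using brownian assms st by (auto simp: brownian_motion_def)
    have E: "(\<integral>\<omega>. W t \<omega> - W s \<omega> \<partial>M) = 0"
      using normal_distributed_expectation[OF _ D] st by simp
    moreover have "(\<integral>\<omega>. (W t \<omega> - W s \<omega>)\<^sup>2 \<partial>M) = t - s"
      using normal_distributed_variance[OF _ D] st E by simp
    moreover have "integrable M (\<lambda>\<omega>. (W t \<omega> - W s \<omega>)\<^sup>2)"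
      using distributed_integrable[OF D, of "\<lambda>x. x\<^sup>2"] integrable_normal_moment[of "sqrt (t - s)" 0 2] st by simp
    ultimately show ?thesis by simp
  qed simp
  then show "sq_int M (\<lambda>\<omega>. W t \<omega> - W s \<omega>)" "(\<integral>\<omega>. W t \<omega> - W s \<omega> \<partial>M) = 0"
    "(\<integral>\<omega>. (W t \<omega> - W s \<omega>)\<^sup>2 \<partial>M) = t - s"
    using meas by (auto simp: sq_int_def)
qed

text \<open>With g x = x this is the martingale property, with g x = x^2 - (t - s) the conditional
  variance. On a set a \<inter> b the factor a, known to W at time s, splits off by independence of
  increments, and the factor b, known to the whole chain, by independence of W and the
  chain.\<close>

lemma W_increment_cond_centred:
  fixes g :: "real \<Rightarrow> real"
  assumes st: "0 \<le> s" "s \<le> t" "t \<le> T" and g: "g \<in> borel_measurable borel"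
    and int: "integrable M (\<lambda>\<omega>. g (W t \<omega> - W s \<omega>))" "(\<integral>\<omega>. g (W t \<omega> - W s \<omega>) \<partial>M) = 0"
    and A: "A \<in> sets (filt_full s)"
  shows "(\<integral>\<omega>. indicator A \<omega> * g (W t \<omega> - W s \<omega>) \<partial>M) = 0"
proof (cases "s = t")
  case True
  have "(\<integral>\<omega>. g (W t \<omega> - W s \<omega>) \<partial>M) = g 0"
    unfolding True by (simp add: prob_space)
  then have "g 0 = 0" unfolding int(2) by simp
  then show ?thesis unfolding True by simp
next
  case False
  then have "s < t" using st by simp
  let ?D = "\<lambda>\<omega>. W t \<omega> - W s \<omega>"
  have meas: "?D \<in> borel_measurable M"
    using st by (intro borel_measurable_diff W_measurable) auto
  let ?V = "vimage_algebra (space M) ?D borel"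
  have V: "subalgebra M ?V" using meas
    by (auto simp: subalgebra_def sets_vimage_algebra2 measurable_sets)
  have indep_incr: "indep_set (sets (filt_W s)) (sets ?V)"
    using brownian st \<open>s < t\<close> by (auto simp: brownian_motion_def sets_vimage_algebra2)
  have gV: "(\<lambda>\<omega>. g (?D \<omega>)) \<in> borel_measurable ?V"
    by (rule measurable_compose[OF measurable_vimage_algebra1 g]) auto
  have DW: "?D \<in> borel_measurable (filt_W T)"
    using st by (intro borel_measurable_diff W_measurable_filt_W) auto
  show ?thesis
  proof (rule cond_centred_sigma_join[OF subalgebra_filt_W subalgebra_filt_alpha int(1) _ A[unfolded filt_full_def]])
    fix a b assume a: "a \<in> sets (filt_W s)" and b: "b \<in> sets (filt_alpha T)"
    have aM: "a \<in> sets M" and bM: "b \<in> sets M"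
      using a b gens_subset[of s T] st by auto
    have ag: "integrable M (\<lambda>\<omega>. indicator a \<omega> * g (?D \<omega>))"
      using integrable_mult_indicator[OF aM int(1)] by simp
    have aT: "a \<in> sets (filt_W T)" using filt_W_mono[of s T] st a by auto
    have "(\<integral>\<omega>. indicator a \<omega> * g (?D \<omega>) \<partial>M) = (\<integral>\<omega>. indicator a \<omega> \<partial>M) * (\<integral>\<omega>. g (?D \<omega>) \<partial>M)"
      by (rule indep_set_integral_mult[OF subalgebra_filt_W V indep_incr])
        (use st a aM gV int(1) in \<open>auto simp: integrable_indicator_iff emeasure_eq_measure\<close>)
    \<comment> \<open>The product of the indicator of a with the increment term is a function of W
      up to T, so b is independent of it.\<close>
    moreover have "(\<integral>\<omega>. (indicator a \<omega> * g (?D \<omega>)) * indicator b \<omega> \<partial>M) =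
        (\<integral>\<omega>. indicator a \<omega> * g (?D \<omega>) \<partial>M) * (\<integral>\<omega>. indicator b \<omega> \<partial>M)"
      by (rule indep_set_integral_mult[OF subalgebra_filt_W subalgebra_filt_alpha _ _ ag])
        (use b bM aT measurable_compose[OF DW g] in
          \<open>auto simp: integrable_indicator_iff emeasure_eq_measure filt_alpha_def intro: independent\<close>)
    ultimately show "(\<integral>\<omega>. indicator (a \<inter> b) \<omega> * g (?D \<omega>) \<partial>M) = 0"
      using int(2) by (simp add: indicator_inter_arith mult.assoc mult.commute[of "indicator b _"])
  qed (use st in auto)
qed

lemma integral_mult_W_increment:
  assumes "0 \<le> s" "s \<le> t" "t \<le> T" "\<eta> \<in> borel_measurable (filt_full s)"
    and "integrable M (\<lambda>\<omega>. \<eta> \<omega> * (W t \<omega> - W s \<omega>))"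
  shows "(\<integral>\<omega>. \<eta> \<omega> * (W t \<omega> - W s \<omega>) \<partial>M) = 0"
proof (rule integral_mult_cond_centred[OF subalgebra_filt_full _ _ assms(4,5)])
  show int: "integrable M (\<lambda>\<omega>. W t \<omega> - W s \<omega>)"
    by (rule sq_int_integrable(1)[OF sq_int_W_increment[OF assms(1-3)]])
  show "(\<integral>\<omega>. indicator A \<omega> * (W t \<omega> - W s \<omega>) \<partial>M) = 0" if "A \<in> sets (filt_full s)" for A
    by (rule W_increment_cond_centred[OF assms(1-3) _ int integral_W_increment[OF assms(1-3)] that]) simp
qed (use assms in simp)

lemma integral_mult_W_increment_sq:
  assumes st: "0 \<le> s" "s \<le> t" "t \<le> T" and \<eta>: "\<eta> \<in> borel_measurable (filt_full s)"
    and b: "\<And>\<omega>. \<omega> \<in> space M \<Longrightarrow> \<bar>\<eta> \<omega>\<bar> \<le> b"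
  shows "(\<integral>\<omega>. \<eta> \<omega> * (W t \<omega> - W s \<omega>)\<^sup>2 \<partial>M) = (t - s) * (\<integral>\<omega>. \<eta> \<omega> \<partial>M)"
proof -
  have \<eta>M: "\<eta> \<in> borel_measurable M"
    using measurable_from_subalg[OF subalgebra_filt_full \<eta>] st by simp
  have int: "integrable M (\<lambda>\<omega>. (W t \<omega> - W s \<omega>)\<^sup>2)"
    using sq_intD(2)[OF sq_int_W_increment[OF st]] by simp
  have \<eta>int: "integrable M (\<lambda>\<omega>. \<eta> \<omega> * f \<omega>)" if f: "integrable M f" for f
  proof (rule Bochner_Integration.integrable_bound[of _ "\<lambda>\<omega>. b * f \<omega>"])
    show "AE \<omega> in M. norm (\<eta> \<omega> * f \<omega>) \<le> norm (b * f \<omega>)"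
    proof (rule AE_I2)
      fix \<omega> assume "\<omega> \<in> space M"
      then have "\<bar>\<eta> \<omega>\<bar> \<le> \<bar>b\<bar>" using b by fastforce
      then show "norm (\<eta> \<omega> * f \<omega>) \<le> norm (b * f \<omega>)"
        by (simp add: abs_mult mult_right_mono)
    qed
  qed (use f \<eta>M in auto)
  \<comment> \<open>The squared increment minus its mean is conditionally centred; rearranging gives
    the claim.\<close>
  have "(\<integral>\<omega>. \<eta> \<omega> * ((W t \<omega> - W s \<omega>)\<^sup>2 - (t - s)) \<partial>M) = 0"
  proof (rule integral_mult_cond_centred[OF subalgebra_filt_full _ _ \<eta>])
    show i: "integrable M (\<lambda>\<omega>. (W t \<omega> - W s \<omega>)\<^sup>2 - (t - s))"
      using int by simp
    show "(\<integral>\<omega>. indicator A \<omega> * ((W t \<omega> - W s \<omega>)\<^sup>2 - (t - s)) \<partial>M) = 0" if "A \<in> sets (filt_full s)" for A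
      using int integral_W_increment_sq[OF st] i
      by (intro W_increment_cond_centred[OF st _ _ _ that, of "\<lambda>x. x\<^sup>2 - (t - s)"]) (auto simp: prob_space)
    show "integrable M (\<lambda>\<omega>. \<eta> \<omega> * ((W t \<omega> - W s \<omega>)\<^sup>2 - (t - s)))"
      by (rule \<eta>int[OF i])
  qed (use st in auto)
  then show ?thesis
    using \<eta>int[OF int] \<eta>int[of "\<lambda>_. 1"] by (simp add: right_diff_distrib mult.commute)
qed

end

text \<open>Pairs the two halves of each cell when the mesh of a grid is halved.\<close>

lemma sum_double:
  fixes f :: "nat \<Rightarrow> 'a::comm_monoid_add"
  shows "(\<Sum>l<2 * n. f l) = (\<Sum>k<n. f (2 * k) + f (2 * k + 1))"
  by (induction n) (simp_all add: add.assoc)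

context regime_switching
begin

subsection \<open>The compensated jump processes\<close>

lemma left_state_unique: "left_state s \<omega> i \<Longrightarrow> left_state s \<omega> i' \<Longrightarrow> i = i'"
  unfolding left_state_def
  using eventually_conj[of "\<lambda>r. \<alpha> r \<omega> = i" "at_left s" "\<lambda>r. \<alpha> r \<omega> = i'"]
    eventually_happens'[of "at_left s" "\<lambda>r. \<alpha> r \<omega> = i \<and> \<alpha> r \<omega> = i'"]
  by (auto simp: trivial_limit_at_left_real)

text \<open>A right continuous path with left limits in a discrete space takes at most two values
  near any time: one before it and one from it on. At the ends 0 and T one side is vacuous, so any
  radius does there.\<close>

lemma path_local:
  assumes "\<omega> \<in> space M" "r \<in> {0..T}"
  shows "\<exists>e>0. \<exists>a. (\<forall>x. r - e < x \<and> x < r \<and> 0 \<le> x \<longrightarrow> \<alpha> x \<omega> = a) \<and>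
    (\<forall>x. r \<le> x \<and> x < r + e \<and> x \<le> T \<longrightarrow> \<alpha> x \<omega> = \<alpha> r \<omega>)"
proof -
  have path: "\<forall>t\<in>{0..<T}. \<forall>\<^sub>F r in at_right t. \<alpha> r \<omega> = \<alpha> t \<omega>" "\<forall>t\<in>{0<..T}. \<exists>i. \<forall>\<^sub>F r in at_left t. \<alpha> r \<omega> = i"
    using markov assms(1) by (auto simp: markov_chain_def)
  obtain e1 where e1: "e1 > 0" "\<And>x. r \<le> x \<Longrightarrow> x < r + e1 \<Longrightarrow> x \<le> T \<Longrightarrow> \<alpha> x \<omega> = \<alpha> r \<omega>"
  proof (cases "r < T")
    case True
    then have "\<forall>\<^sub>F x in at_right r. \<alpha> x \<omega> = \<alpha> r \<omega>"
      using path(1) assms(2) by auto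
    then obtain b where b: "b > r" "\<forall>y>r. y < b \<longrightarrow> \<alpha> y \<omega> = \<alpha> r \<omega>"
      unfolding eventually_at_right_field by blast
    show ?thesis
    proof (rule that[of "b - r"])
      fix x assume "r \<le> x" "x < r + (b - r)"
      then show "\<alpha> x \<omega> = \<alpha> r \<omega>" by (cases "x = r") (use b in auto)
    qed (use b in simp)
  next
    case False
    then show ?thesis using that[of 1] assms(2) by auto
  qed
  obtain e2 a where e2: "e2 > 0" "\<And>x. r - e2 < x \<Longrightarrow> x < r \<Longrightarrow> 0 \<le> x \<Longrightarrow> \<alpha> x \<omega> = a"
  proof (cases "0 < r")
    case True
    then have "r \<in> {0<..T}" using assms(2) by simp
    then obtain a where "\<forall>\<^sub>F x in at_left r. \<alpha> x \<omega> = a"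
      using path(2) by blast
    then obtain b where "b < r" "\<forall>y>b. y < r \<longrightarrow> \<alpha> y \<omega> = a"
      unfolding eventually_at_left_field by blast
    then show ?thesis using that[of "r - b" a] by simp
  next
    case False
    then show ?thesis using that[of 1] assms(2) by auto
  qed
  show ?thesis
  proof (intro exI[of _ "min e1 e2"] exI[of _ a] conjI allI impI)
    show "0 < min e1 e2" using e1(1) e2(1) by simp
    show "\<alpha> x \<omega> = a" if "r - min e1 e2 < x \<and> x < r \<and> 0 \<le> x" for x
      by (rule e2(2)) (use that in auto)
    show "\<alpha> x \<omega> = \<alpha> r \<omega>" if "r \<le> x \<and> x < r + min e1 e2 \<and> x \<le> T" for x
      by (rule e1(2)) (use that in auto)
  qed
qed

lemma ex_left_state:
  assumes "\<omega> \<in> space M" "r \<in> {0<..T}"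
  obtains a where "left_state r \<omega> a"
proof -
  have "\<forall>t\<in>{0<..T}. \<exists>i. \<forall>\<^sub>F r in at_left t. \<alpha> r \<omega> = i"
    using markov assms(1) by (auto simp: markov_chain_def)
  then show ?thesis using that assms(2) unfolding left_state_def by blast
qed

lemma jumps_local:
  assumes "e > 0" and left: "\<And>x. r - e < x \<Longrightarrow> x < r \<Longrightarrow> 0 \<le> x \<Longrightarrow> \<alpha> x \<omega> = a"
    and right: "\<And>x. r \<le> x \<Longrightarrow> x < r + e \<Longrightarrow> x \<le> T \<Longrightarrow> \<alpha> x \<omega> = \<alpha> r \<omega>"
    and uv: "0 \<le> u" "u \<le> v" "v \<le> T" "r - e < u" "v < r + e"
  shows "finite (jumps i j \<omega> \<inter> {u<..v})"
    and "card (jumps i j \<omega> \<inter> {u<..v}) = (if i \<noteq> j \<and> \<alpha> u \<omega> = i \<and> \<alpha> v \<omega> = j then 1 else 0)"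
proof -
  \<comment> \<open>The comparison with r is weak here and strict in \<open>val\<close>: at s = r
    the left state is still a while the chain has already moved to its new value. This discrepancy
    is the jump.\<close>
  have ls: "left_state s \<omega> (if s \<le> r then a else \<alpha> r \<omega>)" if "u < s" "s \<le> v" for s
  proof (cases "s \<le> r")
    case True
    have "\<forall>\<^sub>F x in at_left s. u < x \<and> x < s"
      using that eventually_at_left_real[of u s] by (auto elim: eventually_mono)
    then show ?thesis unfolding left_state_def
    proof eventually_elim
      case (elim x)
      then show ?case using left[of x] True uv by simp
    qed
  next
    case False
    have "\<forall>\<^sub>F x in at_left s. max u r < x \<and> x < s"
      using that False eventually_at_left_real[of "max u r" s] by (auto elim: eventually_mono)
    then show ?thesis unfolding left_state_def
    proof eventually_elim
      case (elim x)
      then show ?case using right[of x] False uv that by simp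
    qed
  qed
  have val: "\<alpha> s \<omega> = (if s < r then a else \<alpha> r \<omega>)" if "u \<le> s" "s \<le> v" for s
    using left[of s] right[of s] that uv by auto
  have "jumps i j \<omega> \<inter> {u<..v} = (if i \<noteq> j \<and> u < r \<and> r \<le> v \<and> a = i \<and> \<alpha> r \<omega> = j then {r} else {})"
  proof -
    have "s \<in> jumps i j \<omega> \<longleftrightarrow> i \<noteq> j \<and> s = r \<and> a = i \<and> \<alpha> r \<omega> = j" if s: "u < s" "s \<le> v" for s
    proof -
      have "left_state s \<omega> i \<longleftrightarrow> i = (if s \<le> r then a else \<alpha> r \<omega>)"
        using ls[OF s] left_state_unique by blast
      moreover have "s \<in> {0<..T}" using s uv by auto
      ultimately show ?thesis
        unfolding jumps_def using val[of s] s by (auto split: if_splits)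
    qed
    then show ?thesis by auto
  qed
  then show "finite (jumps i j \<omega> \<inter> {u<..v})"
    "card (jumps i j \<omega> \<inter> {u<..v}) = (if i \<noteq> j \<and> \<alpha> u \<omega> = i \<and> \<alpha> v \<omega> = j then 1 else 0)"
    using val[of u] val[of v] uv by auto
qed

text \<open>The neighbourhoods of \<open>path_local\<close> cover a compact interval, and \<delta>
  is a Lebesgue number of the cover. An interval shorter than \<delta> lies in one neighbourhood,
  contains at most one change, and is therefore described by its two end states.\<close>

lemma jumps_uniform:
  assumes \<omega>: "\<omega> \<in> space M"
  obtains \<delta> where "\<delta> > 0"
    "\<And>u v i j. 0 \<le> u \<Longrightarrow> u \<le> v \<Longrightarrow> v \<le> T \<Longrightarrow> v - u < \<delta> \<Longrightarrow> finite (jumps i j \<omega> \<inter> {u<..v}) \<and>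
      card (jumps i j \<omega> \<inter> {u<..v}) = (if i \<noteq> j \<and> \<alpha> u \<omega> = i \<and> \<alpha> v \<omega> = j then 1 else 0)"
proof -
  define \<C> where "\<C> = {B. \<exists>r\<in>{0..T}. \<exists>e>0. \<exists>a. B = ball r e \<and>
    (\<forall>x. r - e < x \<and> x < r \<and> 0 \<le> x \<longrightarrow> \<alpha> x \<omega> = a) \<and> (\<forall>x. r \<le> x \<and> x < r + e \<and> x \<le> T \<longrightarrow> \<alpha> x \<omega> = \<alpha> r \<omega>)}"
  have "{0..T} \<subseteq> \<Union>\<C>"
  proof
    fix r assume r: "r \<in> {0..T}"
    obtain e a where ea: "e > 0" and L: "\<forall>x. r - e < x \<and> x < r \<and> 0 \<le> x \<longrightarrow> \<alpha> x \<omega> = a"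
      and R: "\<forall>x. r \<le> x \<and> x < r + e \<and> x \<le> T \<longrightarrow> \<alpha> x \<omega> = \<alpha> r \<omega>"
      using path_local[OF \<omega> r] by blast
    have "ball r e \<in> \<C>" unfolding \<C>_def using r ea L R by blast
    then show "r \<in> \<Union>\<C>" using ea by (intro UnionI[of "ball r e"]) simp_all
  qed
  moreover have "open B" if "B \<in> \<C>" for B using that by (auto simp: \<C>_def)
  ultimately obtain \<epsilon> where \<epsilon>: "0 < \<epsilon>" "\<And>x. x \<in> {0..T} \<Longrightarrow> \<exists>G \<in> \<C>. ball x \<epsilon> \<subseteq> G"
    using Heine_Borel_lemma[of "{0..T}" \<C>] compact_Icc by metis
  show ?thesis
  proof (rule that[OF \<epsilon>(1)])
    fix u v i j assume uv: "0 \<le> u" "u \<le> v" "v \<le> T" "v - u < \<epsilon>"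
    then obtain B where B: "B \<in> \<C>" "ball u \<epsilon> \<subseteq> B" using \<epsilon>(2)[of u] by auto
    then obtain r e a where rea: "e > 0" "B = ball r e"
      "\<forall>x. r - e < x \<and> x < r \<and> 0 \<le> x \<longrightarrow> \<alpha> x \<omega> = a" "\<forall>x. r \<le> x \<and> x < r + e \<and> x \<le> T \<longrightarrow> \<alpha> x \<omega> = \<alpha> r \<omega>"
      unfolding \<C>_def by blast
    have "u \<in> ball u \<epsilon>" "v \<in> ball u \<epsilon>" using uv \<epsilon>(1) by (auto simp: dist_real_def)
    then have "u \<in> ball r e" "v \<in> ball r e" using B(2) unfolding rea(2) by blast+
    then have lr: "r - e < u" "v < r + e" by (auto simp: dist_real_def)
    have L: "\<alpha> x \<omega> = a" if "r - e < x" "x < r" "0 \<le> x" for x using rea(3) that by blast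
    have R: "\<alpha> x \<omega> = \<alpha> r \<omega>" if "r \<le> x" "x < r + e" "x \<le> T" for x using rea(4) that by blast
    show "finite (jumps i j \<omega> \<inter> {u<..v}) \<and>
      card (jumps i j \<omega> \<inter> {u<..v}) = (if i \<noteq> j \<and> \<alpha> u \<omega> = i \<and> \<alpha> v \<omega> = j then 1 else 0)"
      using jumps_local[OF rea(1) L R uv(1-3) lr, of i j] by (intro conjI)
  qed
qed

section \<open>Jumps and occupation times seen on a grid\<close>

definition grid :: "real \<Rightarrow> real \<Rightarrow> nat \<Rightarrow> nat \<Rightarrow> real" where
  "grid s t n k = s + real k * ((t - s) / real n)"

text \<open>Looks at the chain at finitely many times, where the transition function gives
  expectations. Several jumps inside one cell may be seen as one jump or as none.\<close>

definition jump_count :: "real \<Rightarrow> real \<Rightarrow> 's \<Rightarrow> 's \<Rightarrow> nat \<Rightarrow> 'w \<Rightarrow> real" where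
  "jump_count s t i j n \<omega> =
    (\<Sum>k<n. if i \<noteq> j \<and> \<alpha> (grid s t n k) \<omega> = i \<and> \<alpha> (grid s t n (Suc k)) \<omega> = j then 1 else 0)"

text \<open>A Riemann sum for the time spent in i. It uses left end points because
  \<open>jump_count\<close> tests the state i at the same points, so the two can be compared cell by
  cell.\<close>

definition sojourn :: "real \<Rightarrow> real \<Rightarrow> 's \<Rightarrow> nat \<Rightarrow> 'w \<Rightarrow> real" where
  "sojourn s t i n \<omega> = (\<Sum>k<n. (t - s) / real n * (if \<alpha> (grid s t n k) \<omega> = i then 1 else 0))"

lemma grid_0 [simp]: "grid s t n 0 = s"
  by (simp add: grid_def)

lemma grid_n: "n > 0 \<Longrightarrow> grid s t n n = t"
  by (simp add: grid_def)

lemma grid_Suc: "grid s t n (Suc k) = grid s t n k + (t - s) / real n"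
  by (simp add: grid_def ring_distribs add_divide_distrib diff_divide_distrib)

lemma grid_mono: "s \<le> t \<Longrightarrow> k \<le> l \<Longrightarrow> grid s t n k \<le> grid s t n l"
  unfolding grid_def by (intro add_left_mono mult_right_mono) auto

lemma grid_bounds:
  assumes "s \<le> t" "k \<le> n" "n > 0"
  shows "s \<le> grid s t n k" "grid s t n k \<le> t"
  using grid_mono[OF assms(1), of 0 k n] grid_mono[OF assms(1,2), of n] grid_n[OF assms(3), of s t] by auto

lemma grid_double: "grid s t (2 * n) (2 * k) = grid s t n k"
  by (simp add: grid_def)

text \<open>Once the mesh is below the \<delta> of \<open>jumps_uniform\<close>, each cell is
  counted correctly. Since \<delta> depends on the path, the index does too, and expectations need a
  dominating variable later.\<close>

lemma jump_count_eventually: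
  assumes \<omega>: "\<omega> \<in> space M" and st: "0 \<le> s" "s \<le> t" "t \<le> T"
  shows "finite (jumps i j \<omega> \<inter> {s<..t})"
    and "\<forall>\<^sub>F n in sequentially. jump_count s t i j n \<omega> = real (card (jumps i j \<omega> \<inter> {s<..t}))"
proof -
  obtain \<delta> where \<delta>: "\<delta> > 0"
    "\<And>u v i j. 0 \<le> u \<Longrightarrow> u \<le> v \<Longrightarrow> v \<le> T \<Longrightarrow> v - u < \<delta> \<Longrightarrow> finite (jumps i j \<omega> \<inter> {u<..v}) \<and>
      card (jumps i j \<omega> \<inter> {u<..v}) = (if i \<noteq> j \<and> \<alpha> u \<omega> = i \<and> \<alpha> v \<omega> = j then 1 else 0)"
    using jumps_uniform[OF \<omega>] by blast
  have "(\<lambda>n. (t - s) / real n) \<longlonglongrightarrow> 0"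
    by (rule lim_const_over_n)
  then have small: "\<forall>\<^sub>F n in sequentially. (t - s) / real n < \<delta>"
    using \<delta>(1) by (rule order_tendstoD)
  have main: "finite (jumps i j \<omega> \<inter> {s<..t}) \<and> jump_count s t i j n \<omega> = real (card (jumps i j \<omega> \<inter> {s<..t}))"
    if n: "n > 0" "(t - s) / real n < \<delta>" for n
  proof -
    let ?g = "grid s t n"
    \<comment> \<open>In the sum the index shadows the outer k, which is the upper limit.\<close>
    have "finite (jumps i j \<omega> \<inter> {s<..?g k}) \<and> real (card (jumps i j \<omega> \<inter> {s<..?g k})) =
      (\<Sum>k<k. if i \<noteq> j \<and> \<alpha> (?g k) \<omega> = i \<and> \<alpha> (?g (Suc k)) \<omega> = j then 1 else 0)" if "k \<le> n" for k
      using that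
    proof (induction k)
      case 0
      then show ?case by simp
    next
      case (Suc k)
      have b: "s \<le> ?g k" "?g k \<le> ?g (Suc k)" "?g (Suc k) \<le> t"
        using grid_bounds[OF st(2) _ n(1)] grid_mono[OF st(2)] Suc.prems by auto
      have step: "finite (jumps i j \<omega> \<inter> {?g k<..?g (Suc k)}) \<and>
        card (jumps i j \<omega> \<inter> {?g k<..?g (Suc k)}) = (if i \<noteq> j \<and> \<alpha> (?g k) \<omega> = i \<and> \<alpha> (?g (Suc k)) \<omega> = j then 1 else 0)"
        using b st n(2) by (intro \<delta>(2)) (auto simp: grid_Suc)
      have un: "jumps i j \<omega> \<inter> {s<..?g (Suc k)} = (jumps i j \<omega> \<inter> {s<..?g k}) \<union> (jumps i j \<omega> \<inter> {?g k<..?g (Suc k)})"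
        using b by auto
      have "card (jumps i j \<omega> \<inter> {s<..?g (Suc k)}) = card (jumps i j \<omega> \<inter> {s<..?g k}) +
          card (jumps i j \<omega> \<inter> {?g k<..?g (Suc k)})"
        unfolding un using step Suc by (intro card_Un_disjoint) auto
      then show ?case using un step Suc by simp
    qed
    from this[of n] show ?thesis using n by (simp add: grid_n jump_count_def)
  qed
  from small eventually_gt_at_top[of 0] have ev: "\<forall>\<^sub>F n in sequentially. 0 < n \<and> (t - s) / real n < \<delta>"
    by eventually_elim simp
  then show "finite (jumps i j \<omega> \<inter> {s<..t})"
    using main eventually_happens[OF ev] by auto
  show "\<forall>\<^sub>F n in sequentially. jump_count s t i j n \<omega> = real (card (jumps i j \<omega> \<inter> {s<..t}))"
    using ev by eventually_elim (use main in auto)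
qed

text \<open>Only the dyadic grids are kept: each refines the previous one, which is what makes
  monotone convergence available for the totals.\<close>

lemma jump_count_tendsto:
  assumes "\<omega> \<in> space M" "0 \<le> s" "s \<le> t" "t \<le> T"
  shows "(\<lambda>m. jump_count s t i j (2 ^ m) \<omega>) \<longlonglongrightarrow> real (card (jumps i j \<omega> \<inter> {s<..t}))"
proof -
  have "(\<lambda>n. jump_count s t i j n \<omega>) \<longlonglongrightarrow> real (card (jumps i j \<omega> \<inter> {s<..t}))"
    by (rule tendsto_eventually[OF jump_count_eventually(2)[OF assms]])
  moreover have "filterlim (\<lambda>m::nat. 2 ^ m :: nat) sequentially sequentially"
    by (intro filterlim_subseq strict_monoI power_strict_increasing) auto
  ultimately show ?thesis by (rule filterlim_compose)
qed

text \<open>The cells are open on the left, so the grid point of the cell containing r lies strictly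
  before r and within one mesh of it: the step functions converge to the indicator of the left
  state. Their indicator bound gives dominated convergence, and the limit gives the measurability in
  time of the left state on which \<open>jump_mart\<close> relies.\<close>

lemma sojourn_tendsto:
  assumes \<omega>: "\<omega> \<in> space M" and st: "0 \<le> s" "s < t" "t \<le> T"
  shows "set_integrable lborel {s<..t} (\<lambda>r. if left_state r \<omega> i then 1 else 0 :: real)"
    and "(\<lambda>n. sojourn s t i n \<omega>) \<longlonglongrightarrow> (LBINT r:{s<..t}. (if left_state r \<omega> i then 1 else 0))"
proof -
  let ?I = "\<lambda>n k. {grid s t n k<..grid s t n (Suc k)}"
  define g where "g n r = (\<Sum>k<n. (if \<alpha> (grid s t n k) \<omega> = i then 1 else 0) * indicator (?I n k) r :: real)" for n r
  define f where "f r = (indicator {s<..t} r * (if left_state r \<omega> i then 1 else 0) :: real)" for r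
  have cell: "g n r = (if \<alpha> (grid s t n k) \<omega> = i then 1 else 0)"
    if "k < n" "r \<in> ?I n k" for n k r
  proof -
    have "r \<notin> ?I n l" if "l < n" "l \<noteq> k" for l
    proof (cases "l < k")
      case True
      then have "grid s t n (Suc l) \<le> grid s t n k" using st by (intro grid_mono) auto
      then show ?thesis using \<open>r \<in> ?I n k\<close> by auto
    next
      case False
      then have "grid s t n (Suc k) \<le> grid s t n l" using st that by (intro grid_mono) auto
      then show ?thesis using \<open>r \<in> ?I n k\<close> by auto
    qed
    then have "g n r = (\<Sum>l<n. if l = k then (if \<alpha> (grid s t n k) \<omega> = i then 1 else 0) else 0)"
      unfolding g_def using that by (intro sum.cong) auto
    then show ?thesis using that by simp
  qed
  have ex_cell: "\<exists>k<n. r \<in> ?I n k" if n: "n > 0" and r: "s < r" "r \<le> t" for n r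
  proof -
    have "\<exists>k<m. r \<in> ?I n k" if "r \<le> grid s t n m" for m
      using that
    proof (induction m)
      case 0
      then show ?case using r by simp
    next
      case (Suc m)
      then show ?case by (cases "r \<le> grid s t n m") (auto simp: less_Suc_eq)
    qed
    from this[of n] show ?thesis using n r by (simp add: grid_n)
  qed
  have out: "g n r = 0" if "r \<notin> {s<..t}" for n r
  proof -
    have "r \<notin> ?I n k" if "k < n" for k
      using grid_bounds[of s t k n] grid_bounds[of s t "Suc k" n] that st \<open>r \<notin> {s<..t}\<close> by auto
    then show ?thesis unfolding g_def by (intro sum.neutral) auto
  qed
  have lim: "(\<lambda>n. g n r) \<longlonglongrightarrow> f r" for r
  proof (cases "r \<in> {s<..t}")
    case True
    then have rT: "r \<in> {0..T}" using st by auto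
    obtain a where a: "left_state r \<omega> a" using ex_left_state[OF \<omega>, of r] True st by auto
    then obtain b where b: "b < r" "\<forall>y>b. y < r \<longrightarrow> \<alpha> y \<omega> = a"
      unfolding left_state_def eventually_at_left_field by blast
    have "(\<lambda>n. (t - s) / real n) \<longlonglongrightarrow> 0"
      by (rule lim_const_over_n)
    then have "\<forall>\<^sub>F n in sequentially. (t - s) / real n < r - b"
      using b(1) by (intro order_tendstoD(2)) auto
    with eventually_gt_at_top[of 0] have "\<forall>\<^sub>F n in sequentially. g n r = f r"
    proof eventually_elim
      case (elim n)
      obtain k where k: "k < n" "r \<in> ?I n k" using ex_cell[OF elim(1), of r] True by auto
      then have "\<alpha> (grid s t n k) \<omega> = a" using b(2) elim(2) by (auto simp: grid_Suc)
      moreover have "left_state r \<omega> i \<longleftrightarrow> a = i" using a left_state_unique by blast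
      ultimately show ?case using cell[OF k] True by (simp add: f_def)
    qed
    then show ?thesis by (rule tendsto_eventually)
  next
    case False
    then show ?thesis using out by (simp add: f_def)
  qed
  have gm: "g n \<in> borel_measurable lborel" for n
    unfolding g_def by measurable
  have fm: "f \<in> borel_measurable lborel"
    by (rule borel_measurable_LIMSEQ_real[OF lim gm])
  have bound: "norm (g n r) \<le> indicator {s<..t} r" for n r
  proof (cases "n > 0 \<and> r \<in> {s<..t}")
    case True
    then obtain k where "k < n" "r \<in> ?I n k" using ex_cell[of n r] by auto
    from cell[OF this] show ?thesis using True by auto
  next
    case False
    then show ?thesis using out[of r n] by (auto simp: g_def)
  qed
  have ind: "integrable lborel (indicator {s<..t} :: real \<Rightarrow> real)"
    using st by (simp add: integrable_indicator_iff)
  have dc: "integrable lborel f" "(\<lambda>n. \<integral>r. g n r \<partial>lborel) \<longlonglongrightarrow> (\<integral>r. f r \<partial>lborel)"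
    by (rule integrable_dominated_convergence[OF fm gm ind AE_I2[OF lim] AE_I2[OF bound]],
        rule integral_dominated_convergence[OF fm gm ind AE_I2[OF lim] AE_I2[OF bound]])
  have "(\<integral>r. g n r \<partial>lborel) = sojourn s t i n \<omega>" for n
  proof -
    let ?c = "\<lambda>k. if \<alpha> (grid s t n k) \<omega> = i then 1 else 0 :: real"
    have le: "grid s t n k \<le> grid s t n (Suc k)" for k
      using st by (intro grid_mono) auto
    have "integrable lborel (indicator (?I n k) :: real \<Rightarrow> real)" for k
      using le[of k] by (simp add: integrable_indicator_iff)
    then have "(\<integral>r. g n r \<partial>lborel) = (\<Sum>k<n. \<integral>r. ?c k * indicator (?I n k) r \<partial>lborel)"
      unfolding g_def by (intro Bochner_Integration.integral_sum integrable_mult_right)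
    also have "\<dots> = (\<Sum>k<n. ?c k * measure lborel (?I n k))"
      by (intro sum.cong) simp_all
    also have "\<dots> = sojourn s t i n \<omega>"
      unfolding sojourn_def using le by (intro sum.cong) (simp_all add: grid_Suc)
    finally show ?thesis .
  qed
  then show "(\<lambda>n. sojourn s t i n \<omega>) \<longlonglongrightarrow> (LBINT r:{s<..t}. (if left_state r \<omega> i then 1 else 0))"
    using dc(2) by (simp add: f_def set_lebesgue_integral_def)
  show "set_integrable lborel {s<..t} (\<lambda>r. if left_state r \<omega> i then 1 else 0 :: real)"
    using dc(1) by (simp add: f_def[abs_def] set_integrable_def)
qed

section \<open>Transition rates, measurability of counts and occupation times\<close>

lemma alpha_measurable_filt_alpha: "s \<in> {0..t} \<Longrightarrow> \<alpha> s \<in> measurable (filt_alpha t) (count_space UNIV)"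
  unfolding filt_alpha_def by (rule measurable_generated_by) auto

lemma sigma_finite_filt_alpha: "t \<le> T \<Longrightarrow> sigma_finite_subalgebra M (filt_alpha t)"
  by (intro finite_measure_subalgebra_is_sigma_finite finite_measure_subalgebra.intro
      finite_measure_subalgebra_axioms.intro subalgebra_filt_alpha finite_measure_axioms)

text \<open>At time 0 the transition matrix is the identity, so the backward equation says that its
  derivative there is the generator. The quotient is taken along h / 2^m because this is the mesh of
  the dyadic grids.\<close>

lemma transition_rates:
  obtains p where
    "\<And>s t j. 0 \<le> s \<Longrightarrow> s \<le> t \<Longrightarrow> t \<le> T \<Longrightarrow>
      AE \<omega> in M. real_cond_exp M (filt_alpha s) (\<lambda>\<omega>. if \<alpha> t \<omega> = j then 1 else 0) \<omega> = p (t - s) (\<alpha> s \<omega>) j"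
    "\<And>i j h. i \<noteq> j \<Longrightarrow> h > 0 \<Longrightarrow> (\<lambda>m. p (h / 2 ^ m) i j / (h / 2 ^ m)) \<longlonglongrightarrow> \<Lambda> i j"
proof -
  obtain p where p: "transition_function \<Lambda> p"
    "\<forall>s t j. 0 \<le> s \<and> s \<le> t \<and> t \<le> T \<longrightarrow>
        (AE \<omega> in M. real_cond_exp M (generated_by M (count_space UNIV) \<alpha> {0..s})
                        (\<lambda>\<omega>. if \<alpha> t \<omega> = j then 1 else 0) \<omega> = p (t - s) (\<alpha> s \<omega>) j)"
    using markov unfolding markov_chain_def by blast
  show ?thesis
  proof (rule that)
    show "AE \<omega> in M. real_cond_exp M (filt_alpha s) (\<lambda>\<omega>. if \<alpha> t \<omega> = j then 1 else 0) \<omega> = p (t - s) (\<alpha> s \<omega>) j"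
      if "0 \<le> s" "s \<le> t" "t \<le> T" for s t j
      using p(2) that unfolding filt_alpha_def by blast
    show "(\<lambda>m. p (h / 2 ^ m) i j / (h / 2 ^ m)) \<longlonglongrightarrow> \<Lambda> i j" if ij: "i \<noteq> j" and h: "h > 0" for i j h
    proof -
      have p0: "p 0 k l = (if k = l then 1 else 0)" for k l
        using p(1) by (simp add: transition_function_def)
      have "\<forall>t\<ge>0. \<forall>i j. ((\<lambda>s. p s i j) has_real_derivative (\<Sum>k\<in>UNIV. \<Lambda> i k * p t k j)) (at t within {0..})"
        using p(1) unfolding transition_function_def by blast
      from this[rule_format, of 0 i j] have D: "((\<lambda>s. p s i j) has_real_derivative \<Lambda> i j) (at 0 within {0..})"
        by (simp add: p0 if_distrib[of "\<lambda>x. _ * x"] cong: if_cong)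
      have "(\<lambda>m. h / 2 ^ m) \<longlonglongrightarrow> 0"
        by (rule LIMSEQ_divide_realpow_zero) simp
      then have "filterlim (\<lambda>m. h / 2 ^ m) (at 0 within {0..}) sequentially"
        using h unfolding filterlim_at by auto
      from filterlim_compose[OF D[unfolded has_field_derivative_iff] this] show ?thesis
        using ij by (simp add: p0)
    qed
  qed
qed

abbreviation ind_state :: "real \<Rightarrow> 's \<Rightarrow> 'w \<Rightarrow> real" where
  "ind_state t i \<omega> \<equiv> if \<alpha> t \<omega> = i then 1 else 0"

lemma ind_state_measurable:
  assumes "s \<in> {0..t}"
  shows "ind_state s i \<in> borel_measurable (filt_alpha t)"
proof -
  have "(\<lambda>x. if x = i then 1 else 0 :: real) \<in> borel_measurable (count_space UNIV)"
    by simp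
  from measurable_compose[OF alpha_measurable_filt_alpha[OF assms] this] show ?thesis by simp
qed

lemma jump_count_measurable:
  assumes "0 \<le> s" "s < t" "t \<le> T" "n > 0"
  shows "jump_count s t i j n \<in> borel_measurable (filt_alpha T)"
proof -
  have "jump_count s t i j n = (\<lambda>\<omega>. \<Sum>k<n. if i \<noteq> j then ind_state (grid s t n k) i \<omega> *
      ind_state (grid s t n (Suc k)) j \<omega> else 0)"
    unfolding jump_count_def by (auto intro!: sum.cong)
  also have "\<dots> \<in> borel_measurable (filt_alpha T)"
  proof (rule borel_measurable_sum)
    fix k assume "k \<in> {..<n}"
    then have "grid s t n k \<in> {0..T}" "grid s t n (Suc k) \<in> {0..T}"
      using grid_bounds[of s t k n] grid_bounds[of s t "Suc k" n] assms by auto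
    from this[THEN ind_state_measurable]
    show "(\<lambda>\<omega>. if i \<noteq> j then ind_state (grid s t n k) i \<omega> * ind_state (grid s t n (Suc k)) j \<omega> else 0)
        \<in> borel_measurable (filt_alpha T)"
      by simp
  qed
  finally show ?thesis .
qed

lemma sojourn_measurable:
  assumes "0 \<le> s" "s < t" "t \<le> T" "n > 0"
  shows "sojourn s t i n \<in> borel_measurable (filt_alpha T)"
  unfolding sojourn_def
proof (intro borel_measurable_sum borel_measurable_times borel_measurable_const)
  fix k assume "k \<in> {..<n}"
  then have "grid s t n k \<in> {0..T}"
    using grid_bounds[of s t k n] assms by auto
  then show "ind_state (grid s t n k) i \<in> borel_measurable (filt_alpha T)"
    by (rule ind_state_measurable)
qed

text \<open>The interval is open at s, as in \<open>jump_number\<close>, so that both are additive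
  over adjacent intervals and match the increments of \<open>jump_mart\<close>.\<close>

definition occupation :: "real \<Rightarrow> real \<Rightarrow> 's \<Rightarrow> 'w \<Rightarrow> real" where
  "occupation s t i \<omega> = (LBINT r:{s<..t}. (if left_state r \<omega> i then 1 else 0))"

definition jump_number :: "real \<Rightarrow> real \<Rightarrow> 's \<Rightarrow> 's \<Rightarrow> 'w \<Rightarrow> real" where
  "jump_number s t i j \<omega> = real (card (jumps i j \<omega> \<inter> {s<..t}))"

lemma sojourn_tendsto_occupation:
  assumes "\<omega> \<in> space M" "0 \<le> s" "s < t" "t \<le> T"
  shows "(\<lambda>m. sojourn s t i (2 ^ m) \<omega>) \<longlonglongrightarrow> occupation s t i \<omega>"
proof -
  have "filterlim (\<lambda>m::nat. 2 ^ m :: nat) sequentially sequentially"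
    by (intro filterlim_subseq strict_monoI power_strict_increasing) auto
  from filterlim_compose[OF sojourn_tendsto(2)[OF assms] this] show ?thesis
    unfolding occupation_def .
qed

lemma jump_number_measurable:
  assumes "0 \<le> s" "s < t" "t \<le> T"
  shows "jump_number s t i j \<in> borel_measurable (filt_alpha T)"
proof (rule borel_measurable_LIMSEQ_real)
  show "(\<lambda>m. jump_count s t i j (2 ^ m) \<omega>) \<longlonglongrightarrow> jump_number s t i j \<omega>" if "\<omega> \<in> space (filt_alpha T)" for \<omega>
    unfolding jump_number_def using jump_count_tendsto[of \<omega> s t i j] that assms by simp
  show "jump_count s t i j (2 ^ m) \<in> borel_measurable (filt_alpha T)" for m
    using assms by (intro jump_count_measurable) auto
qed

lemma occupation_measurable:
  assumes "0 \<le> s" "s < t" "t \<le> T"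
  shows "occupation s t i \<in> borel_measurable (filt_alpha T)"
proof (rule borel_measurable_LIMSEQ_real)
  show "(\<lambda>m. sojourn s t i (2 ^ m) \<omega>) \<longlonglongrightarrow> occupation s t i \<omega>" if "\<omega> \<in> space (filt_alpha T)" for \<omega>
    using sojourn_tendsto_occupation[of \<omega> s t i] that assms by simp
  show "sojourn s t i (2 ^ m) \<in> borel_measurable (filt_alpha T)" for m
    using assms by (intro sojourn_measurable) auto
qed

section \<open>Martingale property of the compensated jumps\<close>

lemma sojourn_bound:
  assumes "s < t" "n > 0"
  shows "\<bar>sojourn s t i n \<omega>\<bar> \<le> t - s"
proof -
  have "\<bar>sojourn s t i n \<omega>\<bar> \<le> (\<Sum>k<n. (t - s) / real n)"
    unfolding sojourn_def using assms by (intro sum_abs[THEN order_trans] sum_mono) auto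
  also have "\<dots> = t - s" using assms by simp
  finally show ?thesis .
qed

lemma jump_count_bound: "\<bar>jump_count s t i j n \<omega>\<bar> \<le> real n"
proof -
  have "\<bar>jump_count s t i j n \<omega>\<bar> \<le> (\<Sum>k<n. 1)"
    unfolding jump_count_def by (intro sum_abs[THEN order_trans] sum_mono) auto
  then show ?thesis by simp
qed

text \<open>Only the total over all pairs of states is monotone under refinement of the grid: a single \<open>jump_count\<close> may
  decrease.\<close>

lemma jump_count_refine:
  "(\<Sum>i\<in>UNIV. \<Sum>j\<in>UNIV. jump_count s t i j n \<omega>) \<le> (\<Sum>i\<in>UNIV. \<Sum>j\<in>UNIV. jump_count s t i j (2 * n) \<omega>)"
proof -
  \<comment> \<open>The discrete metric on the states. The total count is the variation of the path
    along the grid in this metric, and by the triangle inequality it can only grow when points are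
    inserted.\<close>
  define q :: "'s \<Rightarrow> 's \<Rightarrow> real" where "q a b = (if a \<noteq> b then 1 else 0)" for a b
  have tri: "q a c \<le> q a b + q b c" for a b c by (auto simp: q_def)
  have tot: "(\<Sum>i\<in>UNIV. \<Sum>j\<in>UNIV. jump_count s t i j n \<omega>) = (\<Sum>k<n. q (\<alpha> (grid s t n k) \<omega>) (\<alpha> (grid s t n (Suc k)) \<omega>))"
      for n
  proof -
    have one: "(\<Sum>i\<in>UNIV. \<Sum>j\<in>UNIV. if i \<noteq> j \<and> a = i \<and> b = j then 1 else 0) = q a b" for a b
    proof -
      have "(\<Sum>i\<in>UNIV. \<Sum>j\<in>UNIV. if i \<noteq> j \<and> a = i \<and> b = j then 1 else 0) =
          (\<Sum>i\<in>UNIV. \<Sum>j\<in>UNIV. if j = b then (if i = a then q a b else 0) else 0)"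
        by (intro sum.cong) (auto simp: q_def)
      also have "\<dots> = q a b" by simp
      finally show ?thesis .
    qed
    have "(\<Sum>i\<in>UNIV. \<Sum>j\<in>UNIV. jump_count s t i j n \<omega>) = (\<Sum>i\<in>UNIV. \<Sum>k<n. \<Sum>j\<in>UNIV.
        if i \<noteq> j \<and> \<alpha> (grid s t n k) \<omega> = i \<and> \<alpha> (grid s t n (Suc k)) \<omega> = j then 1 else 0)"
      unfolding jump_count_def by (intro sum.cong refl sum.swap)
    also have "\<dots> = (\<Sum>k<n. \<Sum>i\<in>UNIV. \<Sum>j\<in>UNIV.
        if i \<noteq> j \<and> \<alpha> (grid s t n k) \<omega> = i \<and> \<alpha> (grid s t n (Suc k)) \<omega> = j then 1 else 0)"
      by (rule sum.swap)
    finally show ?thesis by (simp only: one)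
  qed
  have "(\<Sum>k<n. q (\<alpha> (grid s t n k) \<omega>) (\<alpha> (grid s t n (Suc k)) \<omega>)) \<le>
      (\<Sum>k<n. q (\<alpha> (grid s t (2 * n) (2 * k)) \<omega>) (\<alpha> (grid s t (2 * n) (2 * k + 1)) \<omega>) +
        q (\<alpha> (grid s t (2 * n) (2 * k + 1)) \<omega>) (\<alpha> (grid s t (2 * n) (2 * Suc k)) \<omega>))"
    unfolding grid_double by (intro sum_mono tri)
  also have "\<dots> = (\<Sum>l<2 * n. q (\<alpha> (grid s t (2 * n) l) \<omega>) (\<alpha> (grid s t (2 * n) (Suc l)) \<omega>))"
    unfolding sum_double by simp
  finally show ?thesis unfolding tot .
qed

text \<open>On a grid of mesh h, conditioning cell by cell gives the exact identity E[1_A count] =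
  (p(h) / h) E[1_A sojourn]. In the dyadic limit the quotient becomes the rate, the sojourn sums
  converge boundedly, and the counts converge dominated by the total number of jumps.\<close>

lemma jump_martingale_alpha:
  assumes st: "0 \<le> s" "s < t" "t \<le> T" and ij: "i \<noteq> j"
  shows integrable_jump_number: "integrable M (jump_number s t i j)"
    and integrable_occupation: "integrable M (occupation s t i)"
    and integral_jump_number: "A \<in> sets (filt_alpha s) \<Longrightarrow>
      (\<integral>\<omega>. indicator A \<omega> * jump_number s t i j \<omega> \<partial>M) = \<Lambda> i j * (\<integral>\<omega>. indicator A \<omega> * occupation s t i \<omega> \<partial>M)"
proof -
  obtain p where p:
    "\<And>s t j. 0 \<le> s \<Longrightarrow> s \<le> t \<Longrightarrow> t \<le> T \<Longrightarrow>
      AE \<omega> in M. real_cond_exp M (filt_alpha s) (ind_state t j) \<omega> = p (t - s) (\<alpha> s \<omega>) j"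
    "\<And>i j h. i \<noteq> j \<Longrightarrow> h > 0 \<Longrightarrow> (\<lambda>m. p (h / 2 ^ m) i j / (h / 2 ^ m)) \<longlonglongrightarrow> \<Lambda> i j"
    using transition_rates by blast
  have M_alpha: "f \<in> borel_measurable M" if "f \<in> borel_measurable (filt_alpha u)" "u \<le> T" for u and f :: "'w \<Rightarrow> real"
    by (rule measurable_from_subalg[OF subalgebra_filt_alpha[OF that(2)] that(1)])
  have A_M: "A \<in> sets M" if "A \<in> sets (filt_alpha s)" for A
    using that subalgebra_filt_alpha[of s] st by (auto simp: subalgebra_def)
  have ind_M: "ind_state u i \<in> borel_measurable M" if "u \<in> {0..T}" for u i
    using M_alpha[OF ind_state_measurable, of u T i] that by simp
  have bounded_int: "integrable M f" if "f \<in> borel_measurable M" "\<And>\<omega>. \<bar>f \<omega>\<bar> \<le> b" for f :: "'w \<Rightarrow> real" and b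
    by (rule integrable_const_bound[of _ b]) (use that in auto)
  \<comment> \<open>Conditioning at time u replaces the indicator of j at v by p (v - u) evaluated
    at the current state, which is a constant on the event that this state is i.\<close>
  have step: "(\<integral>\<omega>. indicator A \<omega> * (ind_state u i \<omega> * ind_state v j \<omega>) \<partial>M) = p (v - u) i j *
      (\<integral>\<omega>. indicator A \<omega> * ind_state u i \<omega> \<partial>M)"
    if A: "A \<in> sets (filt_alpha s)" and uv: "s \<le> u" "u \<le> v" "v \<le> T" for A u v i j
  proof -
    interpret sigma_finite_subalgebra M "filt_alpha u"
      using uv by (intro sigma_finite_filt_alpha) auto
    have Au: "A \<in> sets (filt_alpha u)" using filt_alpha_mono[OF uv(1)] A by blast
    have f: "(\<lambda>\<omega>. indicator A \<omega> * ind_state u i \<omega>) \<in> borel_measurable (filt_alpha u)"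
      using Au uv st by (intro borel_measurable_times ind_state_measurable) auto
    have g: "ind_state v j \<in> borel_measurable M" using uv st by (intro ind_M) auto
    have fM: "(\<lambda>\<omega>. indicator A \<omega> * ind_state u i \<omega>) \<in> borel_measurable M"
      using f uv by (intro M_alpha[of _ u]) auto
    have fg: "integrable M (\<lambda>\<omega>. (indicator A \<omega> * ind_state u i \<omega>) * ind_state v j \<omega>)"
    proof (rule bounded_int[of _ 1])
      show "(\<lambda>\<omega>. (indicator A \<omega> * ind_state u i \<omega>) * ind_state v j \<omega>) \<in> borel_measurable M"
        by (rule borel_measurable_times[OF fM g])
    qed (auto simp: indicator_def)
    have "(\<integral>\<omega>. indicator A \<omega> * (ind_state u i \<omega> * ind_state v j \<omega>) \<partial>M)
        = (\<integral>\<omega>. (indicator A \<omega> * ind_state u i \<omega>) * ind_state v j \<omega> \<partial>M)"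
      by (simp only: mult.assoc)
    also have "\<dots> = (\<integral>\<omega>. (indicator A \<omega> * ind_state u i \<omega>) * real_cond_exp M (filt_alpha u) (ind_state v j) \<omega> \<partial>M)"
      by (rule real_cond_exp_intg(2)[OF fg f g, symmetric])
    also have "\<dots> = (\<integral>\<omega>. p (v - u) i j * (indicator A \<omega> * ind_state u i \<omega>) \<partial>M)"
    proof (rule integral_cong_AE)
      show "AE \<omega> in M. (indicator A \<omega> * ind_state u i \<omega>) * real_cond_exp M (filt_alpha u) (ind_state v j) \<omega> =
          p (v - u) i j * (indicator A \<omega> * ind_state u i \<omega>)"
        using p(1)[of u v j] uv st by (auto elim!: eventually_mono)
    qed (use fM in auto)
    finally show ?thesis by simp
  qed
  \<comment> \<open>All cells have the same length h, so the transition probability is a common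
    factor; multiplying and dividing by h turns the remaining sum into the Riemann sum of the
    occupation time.\<close>
  have count: "(\<integral>\<omega>. indicator A \<omega> * jump_count s t i j n \<omega> \<partial>M) =
      p ((t - s) / real n) i j / ((t - s) / real n) * (\<integral>\<omega>. indicator A \<omega> * sojourn s t i n \<omega> \<partial>M)"
    if A: "A \<in> sets (filt_alpha s)" and n: "n > 0" and ij: "i \<noteq> j" for A n i j
  proof -
    let ?g = "grid s t n" and ?h = "(t - s) / real n"
    have g: "s \<le> ?g k" "?g k \<le> ?g (Suc k)" "?g (Suc k) \<le> T" if "k < n" for k
      using grid_bounds[of s t k n] grid_bounds[of s t "Suc k" n] grid_mono[of s t k "Suc k" n] that st n by auto
    have int2: "integrable M (\<lambda>\<omega>. indicator A \<omega> * (ind_state (?g k) i \<omega> * ind_state (?g (Suc k)) j \<omega>))" if "k < n"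
        for k
      using g[OF that] st A_M[OF A] by (intro bounded_int[of _ 1] borel_measurable_times ind_M) (auto simp:
          indicator_def)
    have int1: "integrable M (\<lambda>\<omega>. indicator A \<omega> * ind_state (?g k) i \<omega>)" if "k < n" for k
      using g[OF that] st A_M[OF A] by (intro bounded_int[of _ 1] borel_measurable_times ind_M) (auto simp:
          indicator_def)
    have "(\<integral>\<omega>. indicator A \<omega> * jump_count s t i j n \<omega> \<partial>M) =
        (\<integral>\<omega>. (\<Sum>k<n. indicator A \<omega> * (ind_state (?g k) i \<omega> * ind_state (?g (Suc k)) j \<omega>)) \<partial>M)"
      unfolding jump_count_def sum_distrib_left using ij
          by (intro Bochner_Integration.integral_cong sum.cong refl) auto
    also have "\<dots> = (\<Sum>k<n. \<integral>\<omega>. indicator A \<omega> * (ind_state (?g k) i \<omega> * ind_state (?g (Suc k)) j \<omega>) \<partial>M)"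
      by (rule Bochner_Integration.integral_sum) (use int2 in auto)
    also have "\<dots> = (\<Sum>k<n. p ?h i j * (\<integral>\<omega>. indicator A \<omega> * ind_state (?g k) i \<omega> \<partial>M))"
    proof (intro sum.cong refl)
      fix k assume "k \<in> {..<n}"
      then have "k < n" by simp
      from step[OF A g[OF this], of i j]
      show "(\<integral>\<omega>. indicator A \<omega> * (ind_state (?g k) i \<omega> * ind_state (?g (Suc k)) j \<omega>) \<partial>M) =
          p ?h i j * (\<integral>\<omega>. indicator A \<omega> * ind_state (?g k) i \<omega> \<partial>M)"
        by (simp only: grid_Suc add_diff_cancel_left')
    qed
    also have "\<dots> = p ?h i j / ?h * (\<Sum>k<n. \<integral>\<omega>. ?h * (indicator A \<omega> * ind_state (?g k) i \<omega>) \<partial>M)"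
      using st n by (simp add: sum_distrib_left)
    also have "(\<Sum>k<n. \<integral>\<omega>. ?h * (indicator A \<omega> * ind_state (?g k) i \<omega>) \<partial>M) =
        (\<integral>\<omega>. (\<Sum>k<n. ?h * (indicator A \<omega> * ind_state (?g k) i \<omega>)) \<partial>M)"
      by (rule Bochner_Integration.integral_sum[symmetric]) (intro integrable_mult_right int1, simp)
    also have "\<dots> = (\<integral>\<omega>. indicator A \<omega> * sojourn s t i n \<omega> \<partial>M)"
      unfolding sojourn_def sum_distrib_left by (intro Bochner_Integration.integral_cong sum.cong refl) simp
    finally show ?thesis .
  qed
  have occ_M: "occupation s t i \<in> borel_measurable M" and num_M: "jump_number s t i j \<in> borel_measurable M" for i j
    using occupation_measurable[OF st] jump_number_measurable[OF st] by (auto intro: M_alpha[of _ T])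
  have soj_M: "sojourn s t i (2 ^ m) \<in> borel_measurable M" and cnt_M:
      "jump_count s t i j (2 ^ m) \<in> borel_measurable M" for i j m
    using sojourn_measurable[OF st, of "2 ^ m"] jump_count_measurable[OF st, of "2 ^ m"]
        by (auto intro: M_alpha[of _ T])
  have soj_dc: "(\<lambda>m. \<integral>\<omega>. indicator A \<omega> * sojourn s t i (2 ^ m) \<omega> \<partial>M) \<longlonglongrightarrow> (\<integral>\<omega>. indicator A \<omega> * occupation s t i \<omega> \<partial>M)"
    if A: "A \<in> sets M" for A i
  proof (rule integral_dominated_convergence[where w = "\<lambda>_. t - s"])
    show "AE \<omega> in M. (\<lambda>m. indicator A \<omega> * sojourn s t i (2 ^ m) \<omega>) \<longlonglongrightarrow> indicator A \<omega> * occupation s t i \<omega>"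
      by (rule AE_I2) (intro tendsto_mult_left sojourn_tendsto_occupation st)
    show "AE \<omega> in M. norm (indicator A \<omega> * sojourn s t i (2 ^ m) \<omega>) \<le> t - s" for m
      using sojourn_bound[OF st(2), of "2 ^ m" i] st by (intro AE_I2) (auto simp: indicator_def)
  qed (use A soj_M occ_M in auto)
  have "AE \<omega> in M. norm (occupation s t i \<omega>) \<le> t - s"
  proof (rule AE_I2)
    fix \<omega> assume "\<omega> \<in> space M"
    from tendsto_rabs[OF sojourn_tendsto_occupation[OF this st]]
    have "\<bar>occupation s t i \<omega>\<bar> \<le> t - s"
      by (rule LIMSEQ_le_const2) (use sojourn_bound[OF st(2), of "2 ^ _"] in auto)
    then show "norm (occupation s t i \<omega>) \<le> t - s" by simp
  qed
  then show occ_int: "integrable M (occupation s t i)"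
    using occ_M by (intro integrable_const_bound)
  have count_lim: "(\<lambda>m. \<integral>\<omega>. indicator A \<omega> * jump_count s t i j (2 ^ m) \<omega> \<partial>M) \<longlonglongrightarrow> \<Lambda> i j *
      (\<integral>\<omega>. indicator A \<omega> * occupation s t i \<omega> \<partial>M)"
    if A: "A \<in> sets (filt_alpha s)" and ij: "i \<noteq> j" for A i j
  proof -
    have "(\<lambda>m. p ((t - s) / 2 ^ m) i j / ((t - s) / 2 ^ m) * (\<integral>\<omega>. indicator A \<omega> * sojourn s t i (2 ^ m) \<omega> \<partial>M))
        \<longlonglongrightarrow> \<Lambda> i j * (\<integral>\<omega>. indicator A \<omega> * occupation s t i \<omega> \<partial>M)"
      using st by (intro tendsto_mult p(2)[OF ij] soj_dc A_M[OF A]) auto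
    then show ?thesis by (simp add: count[OF A _ ij])
  qed
  have sp: "space M \<in> sets (filt_alpha s)"
    using sets.top[of "filt_alpha s"] by simp
  have cnt_int: "integrable M (jump_count s t i j (2 ^ m))" for i j m
    by (rule bounded_int[OF cnt_M jump_count_bound])
  define tot where "tot m \<omega> = (\<Sum>i\<in>UNIV. \<Sum>j\<in>UNIV. jump_count s t i j (2 ^ m) \<omega>)" for m \<omega>
  define tot' where "tot' \<omega> = (\<Sum>i\<in>UNIV. \<Sum>j\<in>UNIV. jump_number s t i j \<omega>)" for \<omega>
  have tot_inc: "incseq (\<lambda>m. tot m \<omega>)" for \<omega>
    unfolding tot_def by (rule incseq_SucI) (use jump_count_refine in simp)
  have tot_lim: "(\<lambda>m. tot m \<omega>) \<longlonglongrightarrow> tot' \<omega>" if "\<omega> \<in> space M" for \<omega>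
    unfolding tot_def tot'_def jump_number_def using that st by (intro tendsto_sum jump_count_tendsto) auto
  \<comment> \<open>The totals increase with m and their expectations converge by
    \<open>count_lim\<close>, so monotone convergence makes the limit integrable. It then dominates
    every single count.\<close>
  have tot'_int: "integrable M tot'"
  proof (rule integrable_monotone_convergence)
    show "integrable M (tot m)" for m
      unfolding tot_def by (intro Bochner_Integration.integrable_sum cnt_int)
    show "AE \<omega> in M. mono (\<lambda>m. tot m \<omega>)" using tot_inc by simp
    show "AE \<omega> in M. (\<lambda>m. tot m \<omega>) \<longlonglongrightarrow> tot' \<omega>" using tot_lim by simp
    have "(\<lambda>m. \<integral>\<omega>. jump_count s t i j (2 ^ m) \<omega> \<partial>M) \<longlonglongrightarrow> (if i \<noteq> j then \<Lambda> i j *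
        (\<integral>\<omega>. indicator (space M) \<omega> * occupation s t i \<omega> \<partial>M) else 0)" for i j
    proof (cases "i = j")
      case True
      then show ?thesis by (simp add: jump_count_def)
    next
      case False
      have "(\<integral>\<omega>. indicator (space M) \<omega> * jump_count s t i j (2 ^ m) \<omega> \<partial>M) = (\<integral>\<omega>. jump_count s t i j (2 ^ m) \<omega> \<partial>M)"
          for m
        by (rule Bochner_Integration.integral_cong) auto
      then show ?thesis using count_lim[OF sp False] False by simp
    qed
    moreover have "(\<integral>\<omega>. tot m \<omega> \<partial>M) = (\<Sum>i\<in>UNIV. \<Sum>j\<in>UNIV. \<integral>\<omega>. jump_count s t i j (2 ^ m) \<omega> \<partial>M)" for m
      unfolding tot_def
      by (subst Bochner_Integration.integral_sum, intro Bochner_Integration.integrable_sum cnt_int)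
        (intro sum.cong refl Bochner_Integration.integral_sum cnt_int)
    ultimately show "(\<lambda>m. \<integral>\<omega>. tot m \<omega> \<partial>M) \<longlonglongrightarrow> (\<Sum>i\<in>UNIV. \<Sum>j\<in>UNIV.
        if i \<noteq> j then \<Lambda> i j * (\<integral>\<omega>. indicator (space M) \<omega> * occupation s t i \<omega> \<partial>M) else 0)"
      by (simp only:) (intro tendsto_sum)
    show "tot' \<in> borel_measurable M"
      unfolding tot'_def using num_M by simp
  qed
  have le_tot: "\<bar>jump_count s t i j (2 ^ m) \<omega>\<bar> \<le> tot' \<omega>" if "\<omega> \<in> space M" for m \<omega>
  proof -
    have nn: "jump_count s t i j n \<omega> \<ge> 0" for i j n
      unfolding jump_count_def by (intro sum_nonneg) auto
    have "jump_count s t i j (2 ^ m) \<omega> \<le> (\<Sum>j\<in>UNIV. jump_count s t i j (2 ^ m) \<omega>)"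
      by (rule member_le_sum) (use nn in auto)
    also have "\<dots> \<le> tot m \<omega>"
      unfolding tot_def by (rule member_le_sum[of i UNIV "\<lambda>i. \<Sum>j\<in>UNIV. jump_count s t i j (2 ^ m) \<omega>"])
        (use nn in \<open>auto intro: sum_nonneg\<close>)
    also have "\<dots> \<le> tot' \<omega>"
      by (rule incseq_le[OF tot_inc tot_lim[OF that]])
    finally show ?thesis using nn by simp
  qed
  have cnt_dc: "(\<lambda>m. \<integral>\<omega>. indicator A \<omega> * jump_count s t i j (2 ^ m) \<omega> \<partial>M)
      \<longlonglongrightarrow> (\<integral>\<omega>. indicator A \<omega> * jump_number s t i j \<omega> \<partial>M)"
    if A: "A \<in> sets M" for A
  proof (rule integral_dominated_convergence[where w = tot'])
    show "AE \<omega> in M. (\<lambda>m. indicator A \<omega> * jump_count s t i j (2 ^ m) \<omega>) \<longlonglongrightarrow> indicator A \<omega> * jump_number s t i j \<omega>"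
      unfolding jump_number_def using st by (intro AE_I2 tendsto_mult_left jump_count_tendsto) auto
    show "AE \<omega> in M. norm (indicator A \<omega> * jump_count s t i j (2 ^ m) \<omega>) \<le> tot' \<omega>" for m
      using le_tot[of _ m] by (intro AE_I2) (fastforce simp: indicator_def)
  qed (use A cnt_M num_M tot'_int in auto)
  show "integrable M (jump_number s t i j)"
  proof (rule Bochner_Integration.integrable_bound[OF tot'_int num_M])
    show "AE \<omega> in M. norm (jump_number s t i j \<omega>) \<le> norm (tot' \<omega>)"
    proof (rule AE_I2)
      fix \<omega> assume w: "\<omega> \<in> space M"
      have "(\<lambda>m. \<bar>jump_count s t i j (2 ^ m) \<omega>\<bar>) \<longlonglongrightarrow> \<bar>jump_number s t i j \<omega>\<bar>"
        unfolding jump_number_def using st w by (intro tendsto_rabs jump_count_tendsto) auto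
      then have "\<bar>jump_number s t i j \<omega>\<bar> \<le> tot' \<omega>"
        by (rule LIMSEQ_le_const2) (use le_tot[OF w] in auto)
      then show "norm (jump_number s t i j \<omega>) \<le> norm (tot' \<omega>)" by simp
    qed
  qed
  show "(\<integral>\<omega>. indicator A \<omega> * jump_number s t i j \<omega> \<partial>M) = \<Lambda> i j * (\<integral>\<omega>. indicator A \<omega> * occupation s t i \<omega> \<partial>M)"
    if "A \<in> sets (filt_alpha s)"
    by (rule LIMSEQ_unique[OF cnt_dc[OF A_M[OF that]] count_lim[OF that ij]])
qed

lemma jump_mart_increment:
  assumes \<omega>: "\<omega> \<in> space M" and st: "0 \<le> s" "s < t" "t \<le> T" and ij: "i \<noteq> j"
  shows "jump_mart i j t \<omega> - jump_mart i j s \<omega> = jump_number s t i j \<omega> - \<Lambda> i j * occupation s t i \<omega>"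
proof -
  let ?f = "\<lambda>r. \<Lambda> i j * (if left_state r \<omega> i then 1 else 0)"
  have int0: "set_integrable lborel {u<..v} ?f" if "0 \<le> u" "u < v" "v \<le> T" for u v
    by (rule set_integrable_mult_right[OF sojourn_tendsto(1)[OF \<omega> that, of i]])
  \<comment> \<open>The left state at 0 would look at negative times, about which nothing is
    assumed; the single point 0 is treated apart, where any value is integrable.\<close>
  have "set_integrable lborel {0} ?f"
  proof -
    have "(\<lambda>x. indicator {0} x *\<^sub>R ?f x) = (\<lambda>x. ?f 0 * indicator {0} x)"
      by (auto simp: indicator_def)
    then show ?thesis unfolding set_integrable_def by (simp add: integrable_indicator_iff)
  qed
  then have sing: "set_integrable lborel {0} ?f" .
  have int: "set_integrable lborel {0..v} ?f" if "0 \<le> v" "v \<le> T" for v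
  proof (cases "v = 0")
    case False
    have "{0..v} = {0} \<union> {0<..v}" using that by auto
    show ?thesis
      using set_integrable_Un[OF sing int0[of 0 v]] that False unfolding \<open>{0..v} = _\<close> by simp
  qed (use sing in simp)
  have "{0..t} = {0..s} \<union> {s<..t}" using st by auto
  moreover have "(LBINT r:{0..s} \<union> {s<..t}. ?f r) = (LBINT r:{0..s}. ?f r) + (LBINT r:{s<..t}. ?f r)"
    by (rule set_integral_Un) (use int[of s] int0[of s t] st in auto)
  ultimately have "(LBINT r:{0..t}. ?f r) = (LBINT r:{0..s}. ?f r) + (LBINT r:{s<..t}. ?f r)"
    by (simp only:)
  moreover have "(LBINT r:{s<..t}. ?f r) = \<Lambda> i j * occupation s t i \<omega>"
    unfolding occupation_def by simp
  moreover have "card (jumps i j \<omega> \<inter> {..t}) = card (jumps i j \<omega> \<inter> {..s}) + card (jumps i j \<omega> \<inter> {s<..t})"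
  proof -
    have "jumps i j \<omega> \<inter> {..t} = (jumps i j \<omega> \<inter> {..s}) \<union> (jumps i j \<omega> \<inter> {s<..t})"
      using st by auto
    moreover have "jumps i j \<omega> \<inter> {..s} = jumps i j \<omega> \<inter> {0<..s}"
      by (auto simp: jumps_def)
    then have "finite (jumps i j \<omega> \<inter> {..s})"
      using jump_count_eventually(1)[OF \<omega>, of 0 s i j] st by simp
    moreover have "finite (jumps i j \<omega> \<inter> {s<..t})"
      using jump_count_eventually(1)[OF \<omega>, of s t i j] st by simp
    moreover have "(jumps i j \<omega> \<inter> {..s}) \<inter> (jumps i j \<omega> \<inter> {s<..t}) = {}" by auto
    ultimately show ?thesis by (simp only: card_Un_disjoint)
  qed
  ultimately show ?thesis
    using ij by (simp add: jump_mart_def jump_number_def)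
qed

text \<open>For the filtration of the chain this is \<open>jump_martingale_alpha\<close>;
  independence of W carries it over to the joint filtration. The cases s = t and i = j concern the
  zero variable.\<close>

lemma jump_mart_martingale:
  assumes st: "0 \<le> s" "s \<le> t" "t \<le> T"
  shows jump_mart_increment_measurable:
      "(\<lambda>\<omega>. jump_mart i j t \<omega> - jump_mart i j s \<omega>) \<in> borel_measurable (filt_alpha T)"
    and integrable_jump_mart_increment: "integrable M (\<lambda>\<omega>. jump_mart i j t \<omega> - jump_mart i j s \<omega>)"
    and jump_mart_increment_cond_centred: "A \<in> sets (filt s) \<Longrightarrow>
      (\<integral>\<omega>. indicator A \<omega> * (jump_mart i j t \<omega> - jump_mart i j s \<omega>) \<partial>M) = 0"
proof -
  let ?D = "\<lambda>\<omega>. jump_mart i j t \<omega> - jump_mart i j s \<omega>"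
  consider "s = t" | "i = j" | "s < t" "i \<noteq> j" using st by linarith
  then have "?D \<in> borel_measurable (filt_alpha T) \<and> integrable M ?D \<and>
      (\<forall>A\<in>sets (filt_alpha s). (\<integral>\<omega>. indicator A \<omega> * ?D \<omega> \<partial>M) = 0)"
  proof cases
    case 3
    note st' = st(1) 3(1) st(3)
    let ?E = "\<lambda>\<omega>. jump_number s t i j \<omega> - \<Lambda> i j * occupation s t i \<omega>"
    have eq: "?D \<omega> = ?E \<omega>" if "\<omega> \<in> space M" for \<omega>
      by (rule jump_mart_increment[OF that st' 3(2)])
    have "?E \<in> borel_measurable (filt_alpha T)"
      using jump_number_measurable[OF st'] occupation_measurable[OF st'] by simp
    moreover have "integrable M ?E"
      using integrable_jump_number[OF st' 3(2)] integrable_occupation[OF st' 3(2)] by simp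
    moreover have "(\<integral>\<omega>. indicator A \<omega> * ?E \<omega> \<partial>M) = 0" if A: "A \<in> sets (filt_alpha s)" for A
    proof -
      have AM: "A \<in> sets M" using A subalgebra_filt_alpha[of s] st by (auto simp: subalgebra_def)
      have "integrable M (\<lambda>\<omega>. indicator A \<omega> * jump_number s t i j \<omega>)"
          "integrable M (\<lambda>\<omega>. indicator A \<omega> * occupation s t i \<omega>)"
        using integrable_mult_indicator[OF AM integrable_jump_number[OF st' 3(2)]]
          integrable_mult_indicator[OF AM integrable_occupation[OF st' 3(2)]] by simp_all
      then show ?thesis
        using integral_jump_number[OF st' 3(2) A] by (simp add: right_diff_distrib mult.left_commute[of _ "\<Lambda> i j"])
    qed
    moreover have "?D \<in> borel_measurable (filt_alpha T) \<longleftrightarrow> ?E \<in> borel_measurable (filt_alpha T)"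
      by (rule measurable_cong) (simp add: eq)
    moreover have "integrable M ?D \<longleftrightarrow> integrable M ?E"
      by (rule Bochner_Integration.integrable_cong) (simp_all add: eq)
    moreover have "(\<integral>\<omega>. indicator A \<omega> * ?D \<omega> \<partial>M) = (\<integral>\<omega>. indicator A \<omega> * ?E \<omega> \<partial>M)" for A
      by (rule Bochner_Integration.integral_cong) (simp_all add: eq)
    ultimately show ?thesis by simp
  qed (simp_all add: jump_mart_def)
  then have meas: "?D \<in> borel_measurable (filt_alpha T)" and int: "integrable M ?D"
    and alpha: "\<And>A. A \<in> sets (filt_alpha s) \<Longrightarrow> (\<integral>\<omega>. indicator A \<omega> * ?D \<omega> \<partial>M) = 0"
    by auto
  show "?D \<in> borel_measurable (filt_alpha T)" "integrable M ?D"
    by (rule meas, rule int)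
  show "(\<integral>\<omega>. indicator A \<omega> * ?D \<omega> \<partial>M) = 0" if A: "A \<in> sets (filt s)" for A
  proof (rule cond_centred_sigma_join[OF subalgebra_filt_W subalgebra_filt_alpha int _ A[unfolded filt_def]])
    fix a b assume a: "a \<in> sets (filt_W s)" and b: "b \<in> sets (filt_alpha s)"
    have aM: "a \<in> sets M" and bM: "b \<in> sets M"
      using a b gens_subset[of s s] st by auto
    have bD: "integrable M (\<lambda>\<omega>. indicator b \<omega> * ?D \<omega>)"
      using integrable_mult_indicator[OF bM int] by simp
    have aT: "a \<in> sets (filt_W T)" and bT: "b \<in> sets (filt_alpha T)"
      using filt_W_mono[of s T] filt_alpha_mono[of s T] st a b by auto
    \<comment> \<open>Both b and the jump increment are functions of the chain up to T, so the event
      a of W splits off and the centring on b remains.\<close>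
    have "(\<integral>\<omega>. indicator a \<omega> * (indicator b \<omega> * ?D \<omega>) \<partial>M) =
        (\<integral>\<omega>. indicator a \<omega> \<partial>M) * (\<integral>\<omega>. indicator b \<omega> * ?D \<omega> \<partial>M)"
      by (rule indep_set_integral_mult[OF subalgebra_filt_W subalgebra_filt_alpha _ _ _ _ bD])
        (use aM aT bT meas in \<open>auto simp: integrable_indicator_iff emeasure_eq_measure filt_alpha_def intro:
            independent\<close>)
    then show "(\<integral>\<omega>. indicator (a \<inter> b) \<omega> * ?D \<omega> \<partial>M) = 0"
      using alpha[OF b] by (simp add: indicator_inter_arith mult.assoc)
  qed (use st in auto)
qed

end

lemma (in prob_space) integrable_bounded_mult:
  fixes f g :: "'a \<Rightarrow> real"
  assumes f: "integrable M f" and g: "g \<in> borel_measurable M" "\<And>\<omega>. \<omega> \<in> space M \<Longrightarrow> \<bar>g \<omega>\<bar> \<le> b"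
  shows "integrable M (\<lambda>\<omega>. g \<omega> * f \<omega>)"
proof (rule Bochner_Integration.integrable_bound[of _ "\<lambda>\<omega>. b * f \<omega>"])
  show "AE \<omega> in M. norm (g \<omega> * f \<omega>) \<le> norm (b * f \<omega>)"
  proof (rule AE_I2)
    fix \<omega> assume "\<omega> \<in> space M"
    then have "\<bar>g \<omega>\<bar> \<le> \<bar>b\<bar>" using g(2) by fastforce
    then show "norm (g \<omega> * f \<omega>) \<le> norm (b * f \<omega>)"
      by (simp add: abs_mult mult_right_mono)
  qed
qed (use f g in auto)

lemma bounded_inner:
  fixes \<xi> \<eta> :: "'a \<Rightarrow> 'v::euclidean_space"
  assumes "\<And>\<omega>. \<omega> \<in> S \<Longrightarrow> norm (\<xi> \<omega>) \<le> a" "\<And>\<omega>. \<omega> \<in> S \<Longrightarrow> norm (\<eta> \<omega>) \<le> b" "\<omega> \<in> S"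
  shows "\<bar>\<xi> \<omega> \<bullet> \<eta> \<omega>\<bar> \<le> a * b"
proof -
  have "\<bar>\<xi> \<omega> \<bullet> \<eta> \<omega>\<bar> \<le> norm (\<xi> \<omega>) * norm (\<eta> \<omega>)"
    by (rule Cauchy_Schwarz_ineq2)
  also have "\<dots> \<le> a * b"
    using assms(1)[OF assms(3)] assms(2)[OF assms(3)] norm_ge_zero[of "\<xi> \<omega>"] norm_ge_zero[of "\<eta> \<omega>"]
    by (intro mult_mono) linarith+
  finally show ?thesis .
qed

context regime_switching
begin

subsection \<open>Integrals of simple integrands\<close>

definition time_measure :: "real measure" where
  "time_measure = restrict_space lborel {0..T}"

text \<open>Time is the first factor: integrating over the second one first gives statements at a
  fixed time, where conditioning acts; integrating over the first one first gives statements about a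
  path.\<close>

definition prod_measure :: "(real \<times> 'w) measure" where
  "prod_measure = time_measure \<Otimes>\<^sub>M M"

text \<open>The integrability half of \<open>L2F\<close>. Adaptedness is tracked separately because
  Fubini arguments and time integrals need only joint measurability.\<close>

definition sq_process :: "(real \<Rightarrow> 'w \<Rightarrow> 'v::euclidean_space) \<Rightarrow> bool" where
  "sq_process x \<longleftrightarrow> sq_int prod_measure (\<lambda>(t, \<omega>). x t \<omega>)"

lemma space_time_measure [simp]: "space time_measure = {0..T}"
  by (simp add: time_measure_def)

lemma sets_time_measure: "sets time_measure = sets (restrict_space borel {0..T})"
  unfolding time_measure_def by (rule sets_restrict_space_cong) simp

lemma finite_time_measure: "finite_measure time_measure"
  unfolding time_measure_def using T_pos by (intro finite_measureI) (simp add: emeasure_restrict_space)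

sublocale time: finite_measure time_measure
  by (rule finite_time_measure)

sublocale prod: pair_sigma_finite time_measure M ..

lemma space_prod_measure: "space prod_measure = {0..T} \<times> space M"
  by (simp add: prod_measure_def space_pair_measure)

lemma measurable_process_iff: "measurable_process x \<longleftrightarrow> (\<lambda>(t, \<omega>). x t \<omega>) \<in> borel_measurable prod_measure"
proof -
  have "sets (restrict_space borel {0..T} \<Otimes>\<^sub>M M) = sets prod_measure"
    unfolding prod_measure_def by (rule sets_pair_measure_cong) (simp_all add: sets_time_measure)
  then have "borel_measurable (restrict_space borel {0..T} \<Otimes>\<^sub>M M) = borel_measurable prod_measure"
    by (rule measurable_cong_sets) (rule refl)
  then show ?thesis
    unfolding measurable_process_def by (rule arg_cong)
qed

lemma nn_integral_prod_measure:
  assumes "(\<lambda>(t, \<omega>). f t \<omega>) \<in> borel_measurable prod_measure"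
  shows "(\<integral>\<^sup>+\<omega>. (\<integral>\<^sup>+t. f t \<omega> \<partial>time_measure) \<partial>M) = (\<integral>\<^sup>+p. (case p of (t, \<omega>) \<Rightarrow> f t \<omega>) \<partial>prod_measure)"
  using prod.nn_integral_snd[of "\<lambda>(t, \<omega>). f t \<omega>"] assms by (simp add: prod_measure_def)

text \<open>Tonelli turns the iterated integral of the definition into one over the product; it
  needs joint measurability, and without that both sides fail.\<close>

lemma L2F_iff: "L2F x \<longleftrightarrow> sq_process x \<and> adapted x"
proof (cases "measurable_process x")
  case True
  then have m: "(\<lambda>(t, \<omega>). x t \<omega>) \<in> borel_measurable prod_measure"
    by (simp add: measurable_process_iff)
  have "(\<lambda>(t, \<omega>). ennreal ((norm (x t \<omega>))\<^sup>2)) = (\<lambda>p. ennreal ((norm ((\<lambda>(t, \<omega>). x t \<omega>) p))\<^sup>2))"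
    by auto
  also have "\<dots> \<in> borel_measurable prod_measure" using m by measurable
  finally have "(\<integral>\<^sup>+\<omega>. (\<integral>\<^sup>+t. ennreal ((norm (x t \<omega>))\<^sup>2) \<partial>time_measure) \<partial>M) =
      (\<integral>\<^sup>+p. (case p of (t, \<omega>) \<Rightarrow> ennreal ((norm (x t \<omega>))\<^sup>2)) \<partial>prod_measure)"
    by (rule nn_integral_prod_measure)
  also have "\<dots> = (\<integral>\<^sup>+p. ennreal ((norm ((\<lambda>(t, \<omega>). x t \<omega>) p))\<^sup>2) \<partial>prod_measure)"
    by (rule nn_integral_cong) auto
  finally show ?thesis
    using True sq_int_iff_nn_integral[OF m] by (auto simp: L2F_def sq_process_def time_measure_def)
next
  case False
  then show ?thesis by (auto simp: L2F_def sq_process_def measurable_process_iff sq_int_def)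
qed

lemma measurable_process_section:
  assumes "measurable_process x" "t \<in> {0..T}"
  shows "x t \<in> borel_measurable M"
proof -
  have "(\<lambda>(t, \<omega>). x t \<omega>) \<in> borel_measurable (time_measure \<Otimes>\<^sub>M M)"
    using assms(1) by (simp add: measurable_process_iff prod_measure_def)
  from measurable_Pair2[OF this, of t] show ?thesis using assms(2) by simp
qed

text \<open>Common to the integrators \<open>W\<close> and \<open>M\<^sub>i\<^sub>j\<close>.\<close>

definition centred_increments :: "(real \<Rightarrow> 'w \<Rightarrow> real) \<Rightarrow> bool" where
  "centred_increments N \<longleftrightarrow> (\<forall>s t. 0 \<le> s \<and> s \<le> t \<and> t \<le> T \<longrightarrow> integrable M (\<lambda>\<omega>. N t \<omega> - N s \<omega>) \<and>
     (\<forall>A\<in>sets (filt s). (\<integral>\<omega>. indicator A \<omega> * (N t \<omega> - N s \<omega>) \<partial>M) = 0))"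

lemma centred_increments_W: "centred_increments W"
  unfolding centred_increments_def
proof (intro allI impI conjI ballI)
  fix s t assume "0 \<le> s \<and> s \<le> t \<and> t \<le> T"
  then have st: "0 \<le> s" "s \<le> t" "t \<le> T" by auto
  show int: "integrable M (\<lambda>\<omega>. W t \<omega> - W s \<omega>)"
    by (rule sq_int_integrable(1)[OF sq_int_W_increment[OF st]])
  fix A assume "A \<in> sets (filt s)"
  then have "A \<in> sets (filt_full s)"
    using filt_le_filt_full[of s] st by (auto simp: subalgebra_def)
  from W_increment_cond_centred[OF st _ int integral_W_increment[OF st] this]
  show "(\<integral>\<omega>. indicator A \<omega> * (W t \<omega> - W s \<omega>) \<partial>M) = 0" by simp
qed

lemma centred_increments_jump: "centred_increments (jump_mart i j)"
  unfolding centred_increments_def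
  using integrable_jump_mart_increment jump_mart_increment_cond_centred by simp

lemma integral_mult_centred_increment:
  assumes N: "centred_increments N" and st: "0 \<le> s" "s \<le> t" "t \<le> T"
    and \<eta>: "\<eta> \<in> borel_measurable (filt s)" "\<And>\<omega>. \<omega> \<in> space M \<Longrightarrow> \<bar>\<eta> \<omega>\<bar> \<le> b"
  shows "integrable M (\<lambda>\<omega>. \<eta> \<omega> * (N t \<omega> - N s \<omega>))" "(\<integral>\<omega>. \<eta> \<omega> * (N t \<omega> - N s \<omega>) \<partial>M) = 0"
proof -
  have int: "integrable M (\<lambda>\<omega>. N t \<omega> - N s \<omega>)"
    and cc: "\<And>A. A \<in> sets (filt s) \<Longrightarrow> (\<integral>\<omega>. indicator A \<omega> * (N t \<omega> - N s \<omega>) \<partial>M) = 0"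
    using N st by (auto simp: centred_increments_def)
  have sub: "subalgebra M (filt s)" using st by (intro subalgebra_filt) auto
  show i: "integrable M (\<lambda>\<omega>. \<eta> \<omega> * (N t \<omega> - N s \<omega>))"
    by (rule integrable_bounded_mult[OF int measurable_from_subalg[OF sub \<eta>(1)] \<eta>(2)])
  show "(\<integral>\<omega>. \<eta> \<omega> * (N t \<omega> - N s \<omega>) \<partial>M) = 0"
    by (rule integral_mult_cond_centred[OF sub int cc \<eta>(1) i])
qed

lemma simple_integrandD:
  assumes "simple_integrand n \<tau> \<xi>" "l < n"
  shows "0 \<le> \<tau> l" "\<tau> l \<le> \<tau> (Suc l)" "\<tau> (Suc l) \<le> T" "\<xi> l \<in> borel_measurable (filt (\<tau> l))"
    "\<xi> l \<in> borel_measurable M" "\<exists>b. \<forall>\<omega>\<in>space M. norm (\<xi> l \<omega>) \<le> b"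
proof -
  have mono: "mono_on {..n} \<tau>" and range: "\<tau> ` {..n} \<subseteq> {0..T}"
    and \<xi>: "\<xi> l \<in> borel_measurable (filt (\<tau> l))" "\<exists>b. \<forall>\<omega>\<in>space M. norm (\<xi> l \<omega>) \<le> b"
    using assms by (auto simp: simple_integrand_def)
  show "\<tau> l \<le> \<tau> (Suc l)" by (rule mono_onD[OF mono]) (use assms(2) in auto)
  have "\<forall>k\<in>{..n}. \<tau> k \<in> {0..T}" using range by blast
  then have "\<tau> l \<in> {0..T}" "\<tau> (Suc l) \<in> {0..T}" using assms(2) by auto
  then show "0 \<le> \<tau> l" "\<tau> (Suc l) \<le> T" "\<xi> l \<in> borel_measurable M"
    using measurable_from_subalg[OF subalgebra_filt \<xi>(1)] by auto
  show "\<xi> l \<in> borel_measurable (filt (\<tau> l))" "\<exists>b. \<forall>\<omega>\<in>space M. norm (\<xi> l \<omega>) \<le> b"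
    by (fact \<xi>)+
qed

lemma centred_increments_measurable:
  assumes "centred_increments N" "0 \<le> s" "s \<le> t" "t \<le> T"
  shows "(\<lambda>\<omega>. N t \<omega> - N s \<omega>) \<in> borel_measurable M"
proof -
  have "integrable M (\<lambda>\<omega>. N t \<omega> - N s \<omega>)"
    using assms unfolding centred_increments_def by blast
  then show ?thesis by simp
qed

lemma simple_integrand_min:
  assumes "simple_integrand n \<tau> \<xi>" "l < n" "0 \<le> t" "t \<le> T"
  shows "0 \<le> min (\<tau> l) t" "min (\<tau> l) t \<le> min (\<tau> (Suc l)) t" "min (\<tau> (Suc l)) t \<le> T"
  using simple_integrandD(1-3)[OF assms(1,2)] assms(3,4) by (simp_all add: min_def)

lemma simple_integral_measurable:
  assumes "centred_increments N" "simple_integrand n \<tau> \<xi>" "0 \<le> t" "t \<le> T"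
  shows "simple_integral N n \<tau> \<xi> t \<in> borel_measurable M"
  unfolding simple_integral_def
  using simple_integrand_min[OF assms(2) _ assms(3,4)] simple_integrandD(5)[OF assms(2)]
  by (intro borel_measurable_sum borel_measurable_scaleR centred_increments_measurable[OF assms(1)])
    (simp_all del: min.bounded_iff min_le_iff_disj)

text \<open>After the part up to s is removed, each remaining increment starts no earlier than both
  s and \<open>\<tau> l\<close>. There the coefficient and the test variable are known, so the
  increment is centred against their product. Boundedness of \<open>\<eta>\<close> compensates for
  increments that are merely integrable.\<close>

lemma simple_integral_inner:
  fixes \<xi> :: "nat \<Rightarrow> 'w \<Rightarrow> 'v::euclidean_space"
  assumes N: "centred_increments N" and \<xi>: "simple_integrand n \<tau> \<xi>" and st: "0 \<le> s" "s \<le> t" "t \<le> T"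
    and \<eta>: "\<eta> \<in> borel_measurable (filt s)" "\<And>\<omega>. \<omega> \<in> space M \<Longrightarrow> norm (\<eta> \<omega>) \<le> b"
  shows integrable_simple_integral_inner: "integrable M (\<lambda>\<omega>. simple_integral N n \<tau> \<xi> t \<omega> \<bullet> \<eta> \<omega>)"
    and simple_integral_martingale: "(\<integral>\<omega>. simple_integral N n \<tau> \<xi> t \<omega> \<bullet> \<eta> \<omega> \<partial>M)
        = (\<integral>\<omega>. simple_integral N n \<tau> \<xi> s \<omega> \<bullet> \<eta> \<omega> \<partial>M)"
proof -
  have \<eta>M: "\<eta> \<in> borel_measurable M"
    using measurable_from_subalg[OF subalgebra_filt \<eta>(1)] st by simp
  have piece: "integrable M (\<lambda>\<omega>. (\<xi> l \<omega> \<bullet> \<eta> \<omega>) * (N v \<omega> - N u \<omega>))"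
    if l: "l < n" and uv: "0 \<le> u" "u \<le> v" "v \<le> T" for l u v
  proof -
    obtain c where c: "\<And>\<omega>. \<omega> \<in> space M \<Longrightarrow> norm (\<xi> l \<omega>) \<le> c"
      using simple_integrandD(6)[OF \<xi> l] by blast
    show ?thesis
    proof (rule integrable_bounded_mult)
      show "integrable M (\<lambda>\<omega>. N v \<omega> - N u \<omega>)"
        using N uv unfolding centred_increments_def by blast
      show "(\<lambda>\<omega>. \<xi> l \<omega> \<bullet> \<eta> \<omega>) \<in> borel_measurable M"
        using \<eta>M simple_integrandD(5)[OF \<xi> l] by simp
      show "\<bar>\<xi> l \<omega> \<bullet> \<eta> \<omega>\<bar> \<le> c * b" if "\<omega> \<in> space M" for \<omega>
        using bounded_inner[where S = "space M", OF c \<eta>(2) that] .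
    qed
  qed
  have eq: "simple_integral N n \<tau> \<xi> r \<omega> \<bullet> \<eta> \<omega> =
      (\<Sum>l<n. (\<xi> l \<omega> \<bullet> \<eta> \<omega>) * (N (min (\<tau> (Suc l)) r) \<omega> - N (min (\<tau> l) r) \<omega>))" for r \<omega>
    by (simp add: simple_integral_def inner_sum_left mult.commute)
  have int: "integrable M (\<lambda>\<omega>. simple_integral N n \<tau> \<xi> r \<omega> \<bullet> \<eta> \<omega>)" if "0 \<le> r" "r \<le> T" for r
    unfolding eq using simple_integrand_min[OF \<xi> _ that]
    by (intro Bochner_Integration.integrable_sum piece) (simp_all del: min.bounded_iff min_le_iff_disj)
  show "integrable M (\<lambda>\<omega>. simple_integral N n \<tau> \<xi> t \<omega> \<bullet> \<eta> \<omega>)"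
    using int st by auto
  have "(\<integral>\<omega>. simple_integral N n \<tau> \<xi> t \<omega> \<bullet> \<eta> \<omega> \<partial>M) - (\<integral>\<omega>. simple_integral N n \<tau> \<xi> s \<omega> \<bullet> \<eta> \<omega> \<partial>M) =
      (\<integral>\<omega>. simple_integral N n \<tau> \<xi> t \<omega> \<bullet> \<eta> \<omega> - simple_integral N n \<tau> \<xi> s \<omega> \<bullet> \<eta> \<omega> \<partial>M)"
    using int st by (intro Bochner_Integration.integral_diff[symmetric]) auto
  also have "\<dots> = (\<integral>\<omega>. (\<Sum>l<n. (\<xi> l \<omega> \<bullet> \<eta> \<omega>) * (N (max s (min (\<tau> (Suc l)) t)) \<omega> - N (max s (min (\<tau> l) t)) \<omega>)) \<partial>M)"
  proof (rule Bochner_Integration.integral_cong[OF refl])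
    fix \<omega>
    \<comment> \<open>Stopping at t and subtracting the same quantity stopped at s amounts to
      clamping both end points to the interval from s to t.\<close>
    have "(N (min (\<tau> (Suc l)) t) \<omega> - N (min (\<tau> l) t) \<omega>) - (N (min (\<tau> (Suc l)) s) \<omega> - N (min (\<tau> l) s) \<omega>) =
        N (max s (min (\<tau> (Suc l)) t)) \<omega> - N (max s (min (\<tau> l) t)) \<omega>" for l
      using st by (auto simp: min_def max_def)
    then show "simple_integral N n \<tau> \<xi> t \<omega> \<bullet> \<eta> \<omega> - simple_integral N n \<tau> \<xi> s \<omega> \<bullet> \<eta> \<omega> =
        (\<Sum>l<n. (\<xi> l \<omega> \<bullet> \<eta> \<omega>) * (N (max s (min (\<tau> (Suc l)) t)) \<omega> - N (max s (min (\<tau> l) t)) \<omega>))"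
      unfolding eq sum_subtractf[symmetric] right_diff_distrib[symmetric] by simp
  qed
  also have "\<dots> = (\<Sum>l<n. \<integral>\<omega>. (\<xi> l \<omega> \<bullet> \<eta> \<omega>) * (N (max s (min (\<tau> (Suc l)) t)) \<omega> - N (max s (min (\<tau> l) t)) \<omega>) \<partial>M)"
  proof (intro Bochner_Integration.integral_sum piece)
    fix l assume "l \<in> {..<n}"
    then have "l < n" by simp
    have tT: "0 \<le> t" "t \<le> T" using st by auto
    note m = simple_integrand_min[OF \<xi> \<open>l < n\<close> tT]
    show "l < n" by fact
    show "0 \<le> max s (min (\<tau> l) t)" using st by (rule_tac max.coboundedI1)
    show "max s (min (\<tau> l) t) \<le> max s (min (\<tau> (Suc l)) t)" by (rule max.mono[OF order_refl m(2)])
    show "max s (min (\<tau> (Suc l)) t) \<le> T" using m(3) st by simp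
  qed
  also have "\<dots> = 0"
  proof (intro sum.neutral ballI)
    fix l assume "l \<in> {..<n}"
    then have l: "l < n" by simp
    note \<tau> = simple_integrandD[OF \<xi> l]
    obtain c where c: "\<And>\<omega>. \<omega> \<in> space M \<Longrightarrow> norm (\<xi> l \<omega>) \<le> c"
      using \<tau>(6) by blast
    show "(\<integral>\<omega>. (\<xi> l \<omega> \<bullet> \<eta> \<omega>) * (N (max s (min (\<tau> (Suc l)) t)) \<omega> - N (max s (min (\<tau> l) t)) \<omega>) \<partial>M) = 0"
    proof (cases "\<tau> l < t")
      case True
      then have u: "max s (min (\<tau> l) t) = max s (\<tau> l)" by simp
      have "max s (\<tau> l) \<le> T" using \<tau> st by auto
      then have "(\<lambda>\<omega>. \<xi> l \<omega> \<bullet> \<eta> \<omega>) \<in> borel_measurable (filt (max s (\<tau> l)))"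
        by (intro borel_measurable_inner measurable_from_subalg[OF filt_mono \<tau>(4)]
            measurable_from_subalg[OF filt_mono \<eta>(1)]) auto
      then show ?thesis
        unfolding u using True \<tau> st
        by (intro integral_mult_centred_increment(2)[OF N, where b = "c * b"] bounded_inner[OF c \<eta>(2)]) auto
    \<comment> \<open>If the cell starts at or after t, both clamped end points coincide and the
      increment is 0.\<close>
    next
      case False
      then have "max s (min (\<tau> (Suc l)) t) = max s (min (\<tau> l) t)"
        using \<tau>(2) st by auto
      then show ?thesis by simp
    qed
  qed
  finally show "(\<integral>\<omega>. simple_integral N n \<tau> \<xi> t \<omega> \<bullet> \<eta> \<omega> \<partial>M) = (\<integral>\<omega>. simple_integral N n \<tau> \<xi> s \<omega> \<bullet> \<eta> \<omega> \<partial>M)"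
    by simp
qed

lemma sq_int_simple_integral_W:
  fixes \<xi> :: "nat \<Rightarrow> 'w \<Rightarrow> 'v::euclidean_space"
  assumes "simple_integrand n \<tau> \<xi>" "0 \<le> t" "t \<le> T"
  shows "sq_int M (simple_integral W n \<tau> \<xi> t)"
proof -
  have "sq_int M (\<lambda>\<omega>. (W (min (\<tau> (Suc l)) t) \<omega> - W (min (\<tau> l) t) \<omega>) *\<^sub>R \<xi> l \<omega>)" if l: "l < n" for l
  proof -
    note \<tau> = simple_integrandD[OF assms(1) l]
    obtain c where c: "\<And>\<omega>. \<omega> \<in> space M \<Longrightarrow> norm (\<xi> l \<omega>) \<le> c"
      using \<tau>(6) by blast
    show ?thesis
      using \<tau> assms by (intro sq_int_mult_bounded_real[OF sq_int_W_increment _ c]) auto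
  qed
  then show ?thesis
    unfolding simple_integral_def[abs_def] by (intro sq_int_sum) auto
qed

lemma integral_W_increments_orthogonal:
  assumes "0 \<le> u" "u \<le> v" "v \<le> T" "g \<in> borel_measurable (filt_full u)" "sq_int M g"
  shows "(\<integral>\<omega>. g \<omega> * (W v \<omega> - W u \<omega>) \<partial>M) = 0"
  using integral_mult_W_increment[OF assms(1-4)]
      integrable_inner_sq_int[OF assms(5) sq_int_W_increment[OF assms(1-3)]]
  by simp

text \<open>For arbitrary pairs of intervals, so that two simple integrands need no common partition.\<close>

lemma integral_W_increments_product:
  assumes "0 \<le> a" "a \<le> b" "b \<le> T" "0 \<le> c" "c \<le> d" "d \<le> T"
    and f: "f \<in> borel_measurable (filt_full (max a c))" "\<And>\<omega>. \<omega> \<in> space M \<Longrightarrow> \<bar>f \<omega>\<bar> \<le> B"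
  shows "(\<integral>\<omega>. f \<omega> * ((W b \<omega> - W a \<omega>) * (W d \<omega> - W c \<omega>)) \<partial>M) = (\<integral>\<omega>. f \<omega> \<partial>M) * measure lborel ({a<..b} \<inter> {c<..d})"
proof -
  have fW: "sq_int M (\<lambda>\<omega>. f \<omega> * (W v \<omega> - W u \<omega>))"
    if "0 \<le> u" "u \<le> v" "v \<le> T" "f \<in> borel_measurable M" "\<And>\<omega>. \<omega> \<in> space M \<Longrightarrow> \<bar>f \<omega>\<bar> \<le> B" for f u v
    using sq_int_mult_bounded_real[OF sq_int_W_increment[OF that(1-3)] that(4), of B] that(5)
    by (simp add: mult.commute)
  have meas: "(\<lambda>\<omega>. f \<omega> * (W v \<omega> - W u \<omega>)) \<in> borel_measurable (filt_full w)"
    if "f \<in> borel_measurable (filt_full p)" "0 \<le> u" "u \<le> w" "0 \<le> v" "v \<le> w" "p \<le> w" "w \<le> T" for f u v w p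
    using that by (intro borel_measurable_times borel_measurable_diff W_measurable_filt_full
        measurable_from_subalg[OF filt_full_mono that(1)]) auto
  have int3: "integrable M (\<lambda>\<omega>. f \<omega> * (W v \<omega> - W u \<omega>) * (W v' \<omega> - W u' \<omega>))"
    if "0 \<le> u" "u \<le> v" "v \<le> T" "0 \<le> u'" "u' \<le> v'" "v' \<le> T" "f \<in> borel_measurable M" "\<And>\<omega>. \<omega> \<in> space M \<Longrightarrow> \<bar>f \<omega>\<bar> \<le> B"
        for f u v u' v'
    using integrable_inner_sq_int[OF fW[OF that(1-3,7,8)] sq_int_W_increment[OF that(4-6)]] by simp
  \<comment> \<open>If one interval ends before the other begins, everything but the later increment
    is known at its start, and the later increment is centred.\<close>
  have later: "(\<integral>\<omega>. f \<omega> * (W v \<omega> - W u \<omega>) * (W v' \<omega> - W u' \<omega>) \<partial>M) = 0"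
    if "0 \<le> u" "u \<le> v" "v \<le> u'" "u' \<le> v'" "v' \<le> T" "f \<in> borel_measurable (filt_full p)" "p \<le> u'"
      "\<And>\<omega>. \<omega> \<in> space M \<Longrightarrow> \<bar>f \<omega>\<bar> \<le> B" for f u v u' v' p
  proof (rule integral_W_increments_orthogonal)
    show "(\<lambda>\<omega>. f \<omega> * (W v \<omega> - W u \<omega>)) \<in> borel_measurable (filt_full u')"
      using that by (intro meas[OF that(6)]) auto
    have "f \<in> borel_measurable M"
      using that by (intro measurable_from_subalg[OF subalgebra_filt_full that(6)]) auto
    then show "sq_int M (\<lambda>\<omega>. f \<omega> * (W v \<omega> - W u \<omega>))"
      using that by (intro fW) auto
  qed (use that in auto)
  \<comment> \<open>For a common left end, the longer increment is cut at b: its later part is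
    centred, and the square of the common part has conditional mean b - c.\<close>
  have same: "(\<integral>\<omega>. f \<omega> * (W b \<omega> - W c \<omega>) * (W d \<omega> - W c \<omega>) \<partial>M) = (\<integral>\<omega>. f \<omega> \<partial>M) * (b - c)"
    if "0 \<le> c" "c \<le> b" "b \<le> d" "d \<le> T" "f \<in> borel_measurable (filt_full c)" "\<And>\<omega>. \<omega> \<in> space M \<Longrightarrow> \<bar>f \<omega>\<bar> \<le> B" for b c d f
  proof -
    have fM: "f \<in> borel_measurable M"
      using that by (intro measurable_from_subalg[OF subalgebra_filt_full that(5)]) auto
    have "(\<integral>\<omega>. f \<omega> * (W b \<omega> - W c \<omega>) * (W d \<omega> - W c \<omega>) \<partial>M) =
        (\<integral>\<omega>. f \<omega> * (W b \<omega> - W c \<omega>) * (W b \<omega> - W c \<omega>) + f \<omega> * (W b \<omega> - W c \<omega>) * (W d \<omega> - W b \<omega>) \<partial>M)"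
      by (rule Bochner_Integration.integral_cong) (auto simp: algebra_simps)
    also have "\<dots> = (\<integral>\<omega>. f \<omega> * (W b \<omega> - W c \<omega>) * (W b \<omega> - W c \<omega>) \<partial>M) +
        (\<integral>\<omega>. f \<omega> * (W b \<omega> - W c \<omega>) * (W d \<omega> - W b \<omega>) \<partial>M)"
      using that fM by (intro Bochner_Integration.integral_add int3) auto
    also have "(\<integral>\<omega>. f \<omega> * (W b \<omega> - W c \<omega>) * (W d \<omega> - W b \<omega>) \<partial>M) = 0"
      by (rule later[OF _ _ _ _ _ that(5)]) (use that in auto)
    also have "(\<integral>\<omega>. f \<omega> * (W b \<omega> - W c \<omega>) * (W b \<omega> - W c \<omega>) \<partial>M) = (\<integral>\<omega>. f \<omega> * (W b \<omega> - W c \<omega>)\<^sup>2 \<partial>M)"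
      by (simp add: power2_eq_square mult.assoc)
    also have "\<dots> = (b - c) * (\<integral>\<omega>. f \<omega> \<partial>M)"
      by (rule integral_mult_W_increment_sq[of c b f B]) (use that in auto)
    finally show ?thesis by simp
  qed
  \<comment> \<open>The case in which the first interval starts earlier. Its piece before c drops
    out by \<open>later\<close>, and what is left has the common left end c; the opposite order
    follows by symmetry.\<close>
  have main: "(\<integral>\<omega>. f \<omega> * (W b \<omega> - W a \<omega>) * (W d \<omega> - W c \<omega>) \<partial>M) = (\<integral>\<omega>. f \<omega> \<partial>M) * measure lborel ({a<..b} \<inter> {c<..d})"
    if "0 \<le> a" "a \<le> b" "b \<le> T" "a \<le> c" "c \<le> d" "d \<le> T" "f \<in> borel_measurable (filt_full c)"
      "\<And>\<omega>. \<omega> \<in> space M \<Longrightarrow> \<bar>f \<omega>\<bar> \<le> B" for a b c d f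
  proof (cases "b \<le> c")
    case True
    then have "{a<..b} \<inter> {c<..d} = {}" by auto
    moreover have "(\<integral>\<omega>. f \<omega> * (W b \<omega> - W a \<omega>) * (W d \<omega> - W c \<omega>) \<partial>M) = 0"
      by (rule later[OF _ _ _ _ _ that(7)]) (use that True in auto)
    ultimately show ?thesis by (simp only: measure_empty mult_zero_right)
  next
    case False
    have fM: "f \<in> borel_measurable M"
      using that by (intro measurable_from_subalg[OF subalgebra_filt_full that(7)]) auto
    have "(\<integral>\<omega>. f \<omega> * (W b \<omega> - W a \<omega>) * (W d \<omega> - W c \<omega>) \<partial>M) =
        (\<integral>\<omega>. f \<omega> * (W c \<omega> - W a \<omega>) * (W d \<omega> - W c \<omega>) + f \<omega> * (W b \<omega> - W c \<omega>) * (W d \<omega> - W c \<omega>) \<partial>M)"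
      by (rule Bochner_Integration.integral_cong) (auto simp: algebra_simps)
    also have "\<dots> = (\<integral>\<omega>. f \<omega> * (W c \<omega> - W a \<omega>) * (W d \<omega> - W c \<omega>) \<partial>M) +
        (\<integral>\<omega>. f \<omega> * (W b \<omega> - W c \<omega>) * (W d \<omega> - W c \<omega>) \<partial>M)"
      using that fM False by (intro Bochner_Integration.integral_add int3) auto
    also have "(\<integral>\<omega>. f \<omega> * (W c \<omega> - W a \<omega>) * (W d \<omega> - W c \<omega>) \<partial>M) = 0"
      by (rule later[OF _ _ _ _ _ that(7)]) (use that in auto)
    also have "(\<integral>\<omega>. f \<omega> * (W b \<omega> - W c \<omega>) * (W d \<omega> - W c \<omega>) \<partial>M) = (\<integral>\<omega>. f \<omega> \<partial>M) * (min b d - c)"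
    proof (cases "b \<le> d")
      case True
      then show ?thesis using same[of c b d f] that False by simp
    next
      case bd: False
      have "(\<lambda>\<omega>. f \<omega> * (W b \<omega> - W c \<omega>) * (W d \<omega> - W c \<omega>)) = (\<lambda>\<omega>. f \<omega> * (W d \<omega> - W c \<omega>) * (W b \<omega> - W c \<omega>))"
        by (auto simp: mult.assoc mult.commute)
      then show ?thesis using same[of c d b f] that False bd by simp
    qed
    moreover have "measure lborel ({a<..b} \<inter> {c<..d}) = min b d - c"
    proof -
      have "{a<..b} \<inter> {c<..d} = {c<..min b d}" using that by auto
      moreover have "c \<le> min b d" using that False by simp
      ultimately show ?thesis by (simp only: measure_lborel_Ioc)
    qed
    ultimately show ?thesis by (simp only: add_0_left)
  qed
  show ?thesis
  proof (cases "a \<le> c")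
    case True
    then show ?thesis using main[of a b c d f] assms by (simp add: mult.assoc max_def)
  next
    case False
    have "(\<lambda>\<omega>. f \<omega> * ((W b \<omega> - W a \<omega>) * (W d \<omega> - W c \<omega>))) = (\<lambda>\<omega>. f \<omega> * (W d \<omega> - W c \<omega>) * (W b \<omega> - W a \<omega>))"
      by (auto simp: mult.assoc mult.commute)
    then show ?thesis using main[of c d a b f] assms False by (simp add: max_def Int_commute)
  qed
qed

lemma indep_W_alpha: "indep_set (sets (filt_W T)) (sets (filt_alpha T))"
  using independent by (simp add: filt_alpha_def)

text \<open>The Brownian increment is cut at the start c of the jump increment. Before c it is known
  at time c, and the jump increment is centred. After the cut the whole chain may be adjoined to the
  past, as in \<open>filt_full\<close>; the jump increment is then known and the Brownian one is
  centred.\<close>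

lemma integral_W_jump_increments:
  assumes "0 \<le> a" "a \<le> b" "b \<le> T" "0 \<le> c" "c \<le> d" "d \<le> T"
    and f: "f \<in> borel_measurable (filt (max a c))" "\<And>\<omega>. \<omega> \<in> space M \<Longrightarrow> \<bar>f \<omega>\<bar> \<le> B"
  shows "integrable M (\<lambda>\<omega>. f \<omega> * ((W b \<omega> - W a \<omega>) * (jump_mart i j d \<omega> - jump_mart i j c \<omega>)))"
    and "(\<integral>\<omega>. f \<omega> * ((W b \<omega> - W a \<omega>) * (jump_mart i j d \<omega> - jump_mart i j c \<omega>)) \<partial>M) = 0"
proof -
  let ?J = "\<lambda>\<omega>. jump_mart i j d \<omega> - jump_mart i j c \<omega>"
  have mac: "max a c \<le> T" using assms by auto
  have fM: "f \<in> borel_measurable M"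
    by (rule measurable_from_subalg[OF subalgebra_filt[OF mac] f(1)])
  have J: "?J \<in> borel_measurable (filt_alpha T)" "integrable M ?J"
    using jump_mart_increment_measurable[OF assms(4-6)] integrable_jump_mart_increment[OF assms(4-6)] by auto
  have int: "integrable M (\<lambda>\<omega>. f \<omega> * ((W v \<omega> - W u \<omega>) * ?J \<omega>))" if "0 \<le> u" "u \<le> v" "v \<le> T" for u v
  proof -
    have "integrable M (\<lambda>\<omega>. (W v \<omega> - W u \<omega>) * ?J \<omega>)"
      using that J sq_int_integrable(1)[OF sq_int_W_increment[OF that]]
      by (intro indep_set_integral_mult(1)[OF subalgebra_filt_W subalgebra_filt_alpha indep_W_alpha]
          borel_measurable_diff[of "W v"] W_measurable_filt_W) auto
    then show ?thesis using fM f(2) by (rule integrable_bounded_mult)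
  qed
  show "integrable M (\<lambda>\<omega>. f \<omega> * ((W b \<omega> - W a \<omega>) * ?J \<omega>))"
    by (rule int[OF assms(1-3)])
  \<comment> \<open>The cut point c clamped to the interval from a to b: one of the two pieces is
    empty when c lies outside it.\<close>
  define m where "m = max a (min b c)"
  have m: "a \<le> m" "m \<le> b" using assms by (auto simp: m_def)
  have "(\<integral>\<omega>. f \<omega> * ((W b \<omega> - W a \<omega>) * ?J \<omega>) \<partial>M) =
      (\<integral>\<omega>. f \<omega> * ((W m \<omega> - W a \<omega>) * ?J \<omega>) + f \<omega> * ((W b \<omega> - W m \<omega>) * ?J \<omega>) \<partial>M)"
    by (rule Bochner_Integration.integral_cong) (auto simp: algebra_simps)
  also have "\<dots> = (\<integral>\<omega>. f \<omega> * ((W m \<omega> - W a \<omega>) * ?J \<omega>) \<partial>M) + (\<integral>\<omega>. f \<omega> * ((W b \<omega> - W m \<omega>) * ?J \<omega>) \<partial>M)"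
    using m assms by (intro Bochner_Integration.integral_add int) auto
  also have "(\<integral>\<omega>. f \<omega> * ((W m \<omega> - W a \<omega>) * ?J \<omega>) \<partial>M) = 0"
  proof (cases "m = a")
    case False
    then have mc: "a < c" "m \<le> c" by (auto simp: m_def)
    have sub: "subalgebra M (filt c)" using assms by (intro subalgebra_filt) auto
    have eq: "(\<lambda>\<omega>. f \<omega> * ((W m \<omega> - W a \<omega>) * ?J \<omega>)) = (\<lambda>\<omega>. (f \<omega> * (W m \<omega> - W a \<omega>)) * ?J \<omega>)"
      by (simp add: mult.assoc)
    have "f \<in> borel_measurable (filt c)" using f(1) mc by (simp add: max_def)
    then have fW: "(\<lambda>\<omega>. f \<omega> * (W m \<omega> - W a \<omega>)) \<in> borel_measurable (filt c)"
      using mc m assms by (intro borel_measurable_times borel_measurable_diff W_measurable_filt) auto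
    have "integrable M (\<lambda>\<omega>. (f \<omega> * (W m \<omega> - W a \<omega>)) * ?J \<omega>)"
      using int[of a m] m assms unfolding eq by simp
    then show ?thesis
      unfolding eq using jump_mart_increment_cond_centred[OF assms(4-6)]
      by (intro integral_mult_cond_centred[OF sub J(2) _ fW]) auto
  qed simp
  also have "(\<integral>\<omega>. f \<omega> * ((W b \<omega> - W m \<omega>) * ?J \<omega>) \<partial>M) = 0"
  proof (cases "m = b")
    case False
    then have mc: "m = max a c" using m by (auto simp: m_def)
    have eq: "(\<lambda>\<omega>. f \<omega> * ((W b \<omega> - W m \<omega>) * ?J \<omega>)) = (\<lambda>\<omega>. (f \<omega> * ?J \<omega>) * (W b \<omega> - W m \<omega>))"
      by (auto simp: mult.assoc mult.commute)
    have "f \<in> borel_measurable (filt_full m)" unfolding mc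
      by (rule measurable_from_subalg[OF filt_le_filt_full[OF mac] f(1)])
    moreover have "?J \<in> borel_measurable (filt_full m)"
      using m assms by (intro measurable_from_subalg[OF filt_alpha_le_filt_full J(1)]) auto
    ultimately have "(\<lambda>\<omega>. f \<omega> * ?J \<omega>) \<in> borel_measurable (filt_full m)"
      by simp
    moreover have "integrable M (\<lambda>\<omega>. (f \<omega> * ?J \<omega>) * (W b \<omega> - W m \<omega>))"
      using int[of m b] m assms unfolding eq by simp
    ultimately show ?thesis
      unfolding eq using m assms by (intro integral_mult_W_increment) auto
  qed simp
  finally show "(\<integral>\<omega>. f \<omega> * ((W b \<omega> - W a \<omega>) * ?J \<omega>) \<partial>M) = 0" by simp
qed

lemma simple_integral_inner_simple_integral:
  "simple_integral N n \<tau> \<xi> t \<omega> \<bullet> simple_integral N' n' \<tau>' \<xi>' t \<omega> =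
    (\<Sum>l<n. \<Sum>k<n'. (\<xi> l \<omega> \<bullet> \<xi>' k \<omega>) * ((N (min (\<tau> (Suc l)) t) \<omega> - N (min (\<tau> l) t) \<omega>) *
      (N' (min (\<tau>' (Suc k)) t) \<omega> - N' (min (\<tau>' k) t) \<omega>)))"
  by (simp only: simple_integral_def inner_sum_left) (simp add: inner_sum_right mult_ac)

lemma simple_integrands_inner:
  fixes \<xi> \<xi>' :: "nat \<Rightarrow> 'w \<Rightarrow> 'v::euclidean_space"
  assumes "simple_integrand n \<tau> \<xi>" "simple_integrand n' \<tau>' \<xi>'" "l < n" "k < n'"
  shows "(\<lambda>\<omega>. \<xi> l \<omega> \<bullet> \<xi>' k \<omega>) \<in> borel_measurable (filt (max (\<tau> l) (\<tau>' k)))"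
    and "\<exists>b. \<forall>\<omega>\<in>space M. \<bar>\<xi> l \<omega> \<bullet> \<xi>' k \<omega>\<bar> \<le> b"
proof -
  note A = simple_integrandD[OF assms(1,3)] and B = simple_integrandD[OF assms(2,4)]
  show "(\<lambda>\<omega>. \<xi> l \<omega> \<bullet> \<xi>' k \<omega>) \<in> borel_measurable (filt (max (\<tau> l) (\<tau>' k)))"
    using A B by (intro borel_measurable_inner measurable_from_subalg[OF filt_mono A(4)]
        measurable_from_subalg[OF filt_mono B(4)]) auto
  obtain c where c: "\<And>\<omega>. \<omega> \<in> space M \<Longrightarrow> norm (\<xi> l \<omega>) \<le> c" using A(6) by blast
  obtain c' where c': "\<And>\<omega>. \<omega> \<in> space M \<Longrightarrow> norm (\<xi>' k \<omega>) \<le> c'" using B(6) by blast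
  show "\<exists>b. \<forall>\<omega>\<in>space M. \<bar>\<xi> l \<omega> \<bullet> \<xi>' k \<omega>\<bar> \<le> b"
    using bounded_inner[where S="space M", OF c c'] by (intro exI[of _ "c * c'"] ballI)
qed

lemma simple_integrals_orthogonal:
  fixes \<xi> \<xi>' :: "nat \<Rightarrow> 'w \<Rightarrow> 'v::euclidean_space"
  assumes A: "simple_integrand n \<tau> \<xi>" and B: "simple_integrand n' \<tau>' \<xi>'" and t: "0 \<le> t" "t \<le> T"
  shows "integrable M (\<lambda>\<omega>. simple_integral W n \<tau> \<xi> t \<omega> \<bullet> simple_integral (jump_mart i j) n' \<tau>' \<xi>' t \<omega>)"
    and "(\<integral>\<omega>. simple_integral W n \<tau> \<xi> t \<omega> \<bullet> simple_integral (jump_mart i j) n' \<tau>' \<xi>' t \<omega> \<partial>M) = 0"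
proof -
  let ?P = "\<lambda>l k \<omega>. (\<xi> l \<omega> \<bullet> \<xi>' k \<omega>) * ((W (min (\<tau> (Suc l)) t) \<omega> - W (min (\<tau> l) t) \<omega>) *
      (jump_mart i j (min (\<tau>' (Suc k)) t) \<omega> - jump_mart i j (min (\<tau>' k) t) \<omega>))"
  have P: "integrable M (?P l k) \<and> (\<integral>\<omega>. ?P l k \<omega> \<partial>M) = 0" if lk: "l < n" "k < n'" for l k
  proof (cases "\<tau> l < t \<and> \<tau>' k < t")
    case True
    then have eq: "min (\<tau> l) t = \<tau> l" "min (\<tau>' k) t = \<tau>' k" by auto
    obtain b where b: "\<And>\<omega>. \<omega> \<in> space M \<Longrightarrow> \<bar>\<xi> l \<omega> \<bullet> \<xi>' k \<omega>\<bar> \<le> b"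
      using simple_integrands_inner(2)[OF A B lk] by blast
    show ?thesis unfolding eq
      using True t simple_integrandD(1-3)[OF A lk(1)] simple_integrandD(1-3)[OF B lk(2)]
      by (intro conjI integral_W_jump_increments[OF _ _ _ _ _ _ simple_integrands_inner(1)[OF A B lk] b]) auto
  next
    case False
    then have "min (\<tau> (Suc l)) t = min (\<tau> l) t \<or> min (\<tau>' (Suc k)) t = min (\<tau>' k) t"
      using simple_integrandD(2)[OF A lk(1)] simple_integrandD(2)[OF B lk(2)] by auto
    then show ?thesis by auto
  qed
  show "integrable M (\<lambda>\<omega>. simple_integral W n \<tau> \<xi> t \<omega> \<bullet> simple_integral (jump_mart i j) n' \<tau>' \<xi>' t \<omega>)"
    unfolding simple_integral_inner_simple_integral using P by (intro Bochner_Integration.integrable_sum) auto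
  have "(\<integral>\<omega>. simple_integral W n \<tau> \<xi> t \<omega> \<bullet> simple_integral (jump_mart i j) n' \<tau>' \<xi>' t \<omega> \<partial>M)
      = (\<Sum>l<n. \<Sum>k<n'. \<integral>\<omega>. ?P l k \<omega> \<partial>M)"
    unfolding simple_integral_inner_simple_integral using P
    by (subst Bochner_Integration.integral_sum) (auto intro!:
        Bochner_Integration.integrable_sum sum.cong Bochner_Integration.integral_sum)
  then show "(\<integral>\<omega>. simple_integral W n \<tau> \<xi> t \<omega> \<bullet> simple_integral (jump_mart i j) n' \<tau>' \<xi>' t \<omega> \<partial>M) = 0"
    using P by simp
qed

text \<open>The isometry in polarised form, over two unrelated partitions: the lengths of overlaps
  cut off at t are what Fubini later recognises as an integral over the product space.\<close>

lemma simple_integral_isometry: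
  fixes \<xi> \<xi>' :: "nat \<Rightarrow> 'w \<Rightarrow> 'v::euclidean_space"
  assumes A: "simple_integrand n \<tau> \<xi>" and B: "simple_integrand n' \<tau>' \<xi>'" and t: "0 \<le> t" "t \<le> T"
  shows "(\<integral>\<omega>. simple_integral W n \<tau> \<xi> t \<omega> \<bullet> simple_integral W n' \<tau>' \<xi>' t \<omega> \<partial>M) =
    (\<Sum>l<n. \<Sum>k<n'. (\<integral>\<omega>. \<xi> l \<omega> \<bullet> \<xi>' k \<omega> \<partial>M) * measure lborel ({\<tau> l<..\<tau> (Suc l)} \<inter> {\<tau>' k<..\<tau>' (Suc k)} \<inter> {..t}))"
proof -
  let ?P = "\<lambda>l k \<omega>. (\<xi> l \<omega> \<bullet> \<xi>' k \<omega>) * ((W (min (\<tau> (Suc l)) t) \<omega> - W (min (\<tau> l) t) \<omega>) *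
      (W (min (\<tau>' (Suc k)) t) \<omega> - W (min (\<tau>' k) t) \<omega>))"
  have P: "integrable M (?P l k) \<and> (\<integral>\<omega>. ?P l k \<omega> \<partial>M) =
      (\<integral>\<omega>. \<xi> l \<omega> \<bullet> \<xi>' k \<omega> \<partial>M) * measure lborel ({\<tau> l<..\<tau> (Suc l)} \<inter> {\<tau>' k<..\<tau>' (Suc k)} \<inter> {..t})"
    if lk: "l < n" "k < n'" for l k
  proof (cases "\<tau> l < t \<and> \<tau>' k < t")
    case True
    then have eq: "min (\<tau> l) t = \<tau> l" "min (\<tau>' k) t = \<tau>' k" by auto
    obtain b where b: "\<And>\<omega>. \<omega> \<in> space M \<Longrightarrow> \<bar>\<xi> l \<omega> \<bullet> \<xi>' k \<omega>\<bar> \<le> b"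
      using simple_integrands_inner(2)[OF A B lk] by blast
    note \<tau> = simple_integrandD(1-3)[OF A lk(1)] and \<tau>' = simple_integrandD(1-3)[OF B lk(2)]
    have mT: "max (\<tau> l) (\<tau>' k) \<le> T" using \<tau> \<tau>' by auto
    have m: "(\<lambda>\<omega>. \<xi> l \<omega> \<bullet> \<xi>' k \<omega>) \<in> borel_measurable (filt_full (max (\<tau> l) (\<tau>' k)))"
      by (rule measurable_from_subalg[OF filt_le_filt_full[OF mT] simple_integrands_inner(1)[OF A B lk]])
    have mM: "(\<lambda>\<omega>. \<xi> l \<omega> \<bullet> \<xi>' k \<omega>) \<in> borel_measurable M"
      by (rule measurable_from_subalg[OF subalgebra_filt_full[OF mT] m])
    have i2: "integrable M (\<lambda>\<omega>. (W (min (\<tau> (Suc l)) t) \<omega> - W (\<tau> l) \<omega>) * (W (min (\<tau>' (Suc k)) t) \<omega> - W (\<tau>' k) \<omega>))"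
      using integrable_inner_sq_int[OF sq_int_W_increment[of "\<tau> l" "min (\<tau> (Suc l)) t"]
          sq_int_W_increment[of "\<tau>' k" "min (\<tau>' (Suc k)) t"]]
        True \<tau> \<tau>' t by simp
    have "integrable M (?P l k)"
      unfolding eq by (rule integrable_bounded_mult[OF i2 mM b])
    moreover have "(\<integral>\<omega>. ?P l k \<omega> \<partial>M) = (\<integral>\<omega>. \<xi> l \<omega> \<bullet> \<xi>' k \<omega> \<partial>M) *
        measure lborel ({\<tau> l<..min (\<tau> (Suc l)) t} \<inter> {\<tau>' k<..min (\<tau>' (Suc k)) t})"
      unfolding eq using True \<tau> \<tau>' t by (intro integral_W_increments_product[OF _ _ _ _ _ _ m b]) auto
    moreover have "{\<tau> l<..min (\<tau> (Suc l)) t} \<inter> {\<tau>' k<..min (\<tau>' (Suc k)) t} = {\<tau> l<..\<tau> (Suc l)} \<inter> {\<tau>' k<..\<tau>' (Suc k)} \<inter>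
        {..t}"
      by auto
    ultimately show ?thesis by simp
  next
    case False
    then have "min (\<tau> (Suc l)) t = min (\<tau> l) t \<or> min (\<tau>' (Suc k)) t = min (\<tau>' k) t"
      using simple_integrandD(2)[OF A lk(1)] simple_integrandD(2)[OF B lk(2)] by auto
    moreover have "{\<tau> l<..\<tau> (Suc l)} \<inter> {\<tau>' k<..\<tau>' (Suc k)} \<inter> {..t} = {}"
      using False by auto
    ultimately show ?thesis by auto
  qed
  show ?thesis
    unfolding simple_integral_inner_simple_integral using P
    by (subst Bochner_Integration.integral_sum)
      (auto intro!: Bochner_Integration.integrable_sum sum.cong simp: Bochner_Integration.integral_sum)
qed

end

subsection \<open>Mean square limits\<close>

lemma nn_integral_norm_add_sq_le:
  fixes f g :: "'a \<Rightarrow> 'b::euclidean_space"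
  assumes "f \<in> borel_measurable N" "g \<in> borel_measurable N"
  shows "(\<integral>\<^sup>+x. ennreal ((norm (f x + g x))\<^sup>2) \<partial>N) \<le>
    2 * (\<integral>\<^sup>+x. ennreal ((norm (f x))\<^sup>2) \<partial>N) + 2 * (\<integral>\<^sup>+x. ennreal ((norm (g x))\<^sup>2) \<partial>N)"
proof -
  have "(\<integral>\<^sup>+x. ennreal ((norm (f x + g x))\<^sup>2) \<partial>N) \<le> (\<integral>\<^sup>+x. 2 * ennreal ((norm (f x))\<^sup>2) + 2 * ennreal ((norm (g x))\<^sup>2) \<partial>N)"
  proof (rule nn_integral_mono)
    fix x
    have "ennreal ((norm (f x + g x))\<^sup>2) \<le> ennreal (2 * (norm (f x))\<^sup>2 + 2 * (norm (g x))\<^sup>2)"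
      by (rule ennreal_leI[OF norm_add_sq_le])
    also have "\<dots> = 2 * ennreal ((norm (f x))\<^sup>2) + 2 * ennreal ((norm (g x))\<^sup>2)"
      by (simp add: ennreal_plus ennreal_mult)
    finally show "ennreal ((norm (f x + g x))\<^sup>2) \<le> 2 * ennreal ((norm (f x))\<^sup>2) + 2 * ennreal ((norm (g x))\<^sup>2)" .
  qed
  also have "\<dots> = 2 * (\<integral>\<^sup>+x. ennreal ((norm (f x))\<^sup>2) \<partial>N) + 2 * (\<integral>\<^sup>+x. ennreal ((norm (g x))\<^sup>2) \<partial>N)"
    using assms by (subst nn_integral_add) (auto simp: nn_integral_cmult)
  finally show ?thesis .
qed

text \<open>Expressed with nonnegative integrals, as in \<open>L2_integral\<close>, so that no
  integrability has to be known beforehand: convergence to 0 makes the errors eventually square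
  integrable.\<close>

definition sq_tendsto :: "'a measure \<Rightarrow> (nat \<Rightarrow> 'a \<Rightarrow> 'b::euclidean_space) \<Rightarrow> ('a \<Rightarrow> 'b) \<Rightarrow> bool" where
  "sq_tendsto N F f \<longleftrightarrow> (\<forall>m. F m \<in> borel_measurable N) \<and> f \<in> borel_measurable N \<and>
    (\<lambda>m. \<integral>\<^sup>+x. ennreal ((norm (F m x - f x))\<^sup>2) \<partial>N) \<longlonglongrightarrow> 0"

lemma sq_tendsto_add:
  assumes F: "sq_tendsto N F f" and G: "sq_tendsto N G g"
  shows "sq_tendsto N (\<lambda>m x. F m x + G m x) (\<lambda>x. f x + g x)"
  unfolding sq_tendsto_def
proof (intro conjI allI)
  show "(\<lambda>m. \<integral>\<^sup>+x. ennreal ((norm (F m x + G m x - (f x + g x)))\<^sup>2) \<partial>N) \<longlonglongrightarrow> 0"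
  proof (rule tendsto_sandwich[OF _ _ tendsto_const])
    let ?h = "\<lambda>m. 2 * (\<integral>\<^sup>+x. ennreal ((norm (F m x - f x))\<^sup>2) \<partial>N) + 2 * (\<integral>\<^sup>+x. ennreal ((norm (G m x - g x))\<^sup>2) \<partial>N)"
    have "?h \<longlonglongrightarrow> 2 * 0 + 2 * 0"
      using F G by (intro tendsto_add ennreal_tendsto_cmult) (auto simp: sq_tendsto_def)
    then show "?h \<longlonglongrightarrow> 0" by simp
    show "\<forall>\<^sub>F m in sequentially. (\<integral>\<^sup>+x. ennreal ((norm (F m x + G m x - (f x + g x)))\<^sup>2) \<partial>N) \<le> ?h m"
    proof (rule always_eventually, rule allI)
      fix m
      have eq: "F m x + G m x - (f x + g x) = (F m x - f x) + (G m x - g x)" for x by simp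
      show "(\<integral>\<^sup>+x. ennreal ((norm (F m x + G m x - (f x + g x)))\<^sup>2) \<partial>N) \<le> ?h m"
        unfolding eq using F G unfolding sq_tendsto_def
        by (intro nn_integral_norm_add_sq_le borel_measurable_diff) blast+
    qed
  qed simp
  show "(\<lambda>x. F m x + G m x) \<in> borel_measurable N" for m
    using F G unfolding sq_tendsto_def by (intro borel_measurable_add) blast+
  show "(\<lambda>x. f x + g x) \<in> borel_measurable N"
    using F G unfolding sq_tendsto_def by (intro borel_measurable_add) blast+
qed

lemma sq_tendsto_const: "f \<in> borel_measurable N \<Longrightarrow> sq_tendsto N (\<lambda>m. f) f"
  by (simp add: sq_tendsto_def)

lemma sq_tendsto_sum:
  assumes "finite S" "\<And>i. i \<in> S \<Longrightarrow> sq_tendsto N (F i) (f i)"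
  shows "sq_tendsto N (\<lambda>m x. \<Sum>i\<in>S. F i m x) (\<lambda>x. \<Sum>i\<in>S. f i x)"
  using assms
proof (induction S)
  case empty
  then show ?case by (simp add: sq_tendsto_const)
next
  case (insert i S)
  then show ?case using sq_tendsto_add[of N "F i" "f i"] by simp
qed

lemma sq_tendsto_inner:
  assumes "sq_tendsto N F f" "sq_tendsto N G g" "sq_int N f" "sq_int N g"
  shows "(\<lambda>m. \<integral>x. F m x \<bullet> G m x \<partial>N) \<longlonglongrightarrow> (\<integral>x. f x \<bullet> g x \<partial>N)"
  using assms by (intro tendsto_integral_inner_sq_int) (auto simp: sq_tendsto_def)

lemma sq_tendsto_sq_int:
  assumes "sq_tendsto N F f" "\<And>m. sq_int N (F m)"
  shows "sq_int N f"
  using assms by (intro sq_int_limit[of N F f]) (auto simp: sq_tendsto_def)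

text \<open>Identifies a stochastic integral at time 0, where all approximating simple integrals
  vanish.\<close>

lemma sq_tendsto_0_unique:
  fixes f :: "'a \<Rightarrow> 'b::euclidean_space"
  assumes "sq_tendsto N F f" "\<And>m x. x \<in> space N \<Longrightarrow> F m x = 0"
  shows "AE x in N. f x = 0"
proof -
  have f: "f \<in> borel_measurable N" using assms(1) by (simp add: sq_tendsto_def)
  have "(\<integral>\<^sup>+x. ennreal ((norm (F m x - f x))\<^sup>2) \<partial>N) = (\<integral>\<^sup>+x. ennreal ((norm (f x))\<^sup>2) \<partial>N)" for m
    by (rule nn_integral_cong) (simp add: assms(2))
  then have "(\<lambda>m::nat. \<integral>\<^sup>+x. ennreal ((norm (f x))\<^sup>2) \<partial>N) \<longlonglongrightarrow> 0"
    using assms(1) by (simp add: sq_tendsto_def)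
  then have "(\<integral>\<^sup>+x. ennreal ((norm (f x))\<^sup>2) \<partial>N) = 0"
    by (simp add: LIMSEQ_const_iff)
  then have "AE x in N. ennreal ((norm (f x))\<^sup>2) = 0"
    by (subst (asm) nn_integral_0_iff_AE) (use f in measurable)
  then show ?thesis by eventually_elim simp
qed

text \<open>Serves to pass from bounded to square integrable test variables; truncation by the norm
  keeps measurability with respect to any smaller sigma-algebra.\<close>

lemma sq_tendsto_truncate:
  fixes f :: "'a \<Rightarrow> 'b::euclidean_space"
  assumes f: "sq_int N f"
  shows "sq_tendsto N (\<lambda>m x. if norm (f x) \<le> real m then f x else 0) f"
  unfolding sq_tendsto_def
proof (intro conjI allI)
  note [measurable] = sq_intD(1)[OF f]
  show m1: "(\<lambda>x. if norm (f x) \<le> real m then f x else 0) \<in> borel_measurable N" for m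
    by measurable
  show "f \<in> borel_measurable N" by measurable
  let ?h = "\<lambda>m x. ennreal ((norm ((if norm (f x) \<le> real m then f x else 0) - f x))\<^sup>2)"
  have "(\<lambda>m. \<integral>\<^sup>+x. ?h m x \<partial>N) \<longlonglongrightarrow> (\<integral>\<^sup>+x. 0 \<partial>N)"
  proof (rule nn_integral_dominated_convergence[where w = "\<lambda>x. ennreal ((norm (f x))\<^sup>2)"])
    show "(\<integral>\<^sup>+x. ennreal ((norm (f x))\<^sup>2) \<partial>N) < \<infinity>"
      using f sq_int_iff_nn_integral[of f N] by simp
    show "AE x in N. ?h m x \<le> ennreal ((norm (f x))\<^sup>2)" for m
      by (rule AE_I2) auto
    show "AE x in N. (\<lambda>m. ?h m x) \<longlonglongrightarrow> 0"
    proof (rule AE_I2)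
      fix x
      have "\<forall>\<^sub>F m in sequentially. norm (f x) \<le> real m"
        by (rule eventually_sequentiallyI[of "nat \<lceil>norm (f x)\<rceil>"]) linarith
      then show "(\<lambda>m. ?h m x) \<longlonglongrightarrow> 0"
        by (intro tendsto_eventually) (rule eventually_mono, assumption, simp)
    qed
  qed measurable
  then show "(\<lambda>m. \<integral>\<^sup>+x. ?h m x \<partial>N) \<longlonglongrightarrow> 0" by simp
qed

context regime_switching
begin

section \<open>Stochastic integrals as limits of simple ones: martingale property, isometry,
  orthogonality\<close>

lemma integral_prod_indicator:
  fixes g :: "'w \<Rightarrow> real"
  assumes S: "S \<in> sets borel" "S \<subseteq> {0..T}" and g: "integrable M g"
  shows "integrable prod_measure (\<lambda>(r, \<omega>). indicator S r * g \<omega>)"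
    and "(\<integral>p. (case p of (r, \<omega>) \<Rightarrow> indicator S r * g \<omega>) \<partial>prod_measure) = (\<integral>\<omega>. g \<omega> \<partial>M) * measure lborel S"
proof -
  have St: "S \<in> sets time_measure"
    unfolding time_measure_def using S by (auto simp: sets_restrict_space)
  have S_meas: "measure time_measure S = measure lborel S"
    unfolding time_measure_def using S by (simp add: measure_restrict_space)
  have St': "integrable time_measure (indicator S :: real \<Rightarrow> real)"
    by (intro integrable_real_indicator St) (simp add: time.emeasure_eq_measure)
  have meas: "(\<lambda>(r, \<omega>). indicator S r * g \<omega>) \<in> borel_measurable (time_measure \<Otimes>\<^sub>M M)"
    using St g by measurable
  have "integrable (time_measure \<Otimes>\<^sub>M M) (\<lambda>(r, \<omega>). indicator S r * g \<omega>)"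
  proof (rule prod.Fubini_integrable[OF meas])
    have "(\<lambda>r. \<integral>\<omega>. norm (case (r, \<omega>) of (r, \<omega>) \<Rightarrow> indicator S r * g \<omega>) \<partial>M) = (\<lambda>r. indicator S r * (\<integral>\<omega>. \<bar>g \<omega>\<bar> \<partial>M))"
      by (auto simp: abs_mult)
    then show "integrable time_measure (\<lambda>r. \<integral>\<omega>. norm (case (r, \<omega>) of (r, \<omega>) \<Rightarrow> indicator S r * g \<omega>) \<partial>M)"
      using St' by simp
  qed (use g in auto)
  then show int: "integrable prod_measure (\<lambda>(r, \<omega>). indicator S r * g \<omega>)"
    by (simp add: prod_measure_def)
  have "(\<integral>p. (case p of (r, \<omega>) \<Rightarrow> indicator S r * g \<omega>) \<partial>prod_measure)
      = (\<integral>r. (\<integral>\<omega>. indicator S r * g \<omega> \<partial>M) \<partial>time_measure)"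
    using prod.integral_fst'[OF int[unfolded prod_measure_def]] by (simp add: prod_measure_def)
  also have "\<dots> = (\<integral>\<omega>. g \<omega> \<partial>M) * measure lborel S"
    using St' St S(2) S_meas by (simp add: mult.commute inf.absorb1)
  finally show "(\<integral>p. (case p of (r, \<omega>) \<Rightarrow> indicator S r * g \<omega>) \<partial>prod_measure) = (\<integral>\<omega>. g \<omega> \<partial>M) * measure lborel S" .
qed

lemma simple_value_measurable:
  fixes \<xi> :: "nat \<Rightarrow> 'w \<Rightarrow> 'v::euclidean_space"
  assumes "simple_integrand n \<tau> \<xi>"
  shows "(\<lambda>(t, \<omega>). simple_value n \<tau> \<xi> t \<omega>) \<in> borel_measurable prod_measure"
proof -
  have "(\<lambda>p. \<Sum>l<n. indicator {\<tau> l<..\<tau> (Suc l)} (fst p) *\<^sub>R \<xi> l (snd p)) \<in> borel_measurable (time_measure \<Otimes>\<^sub>M M)"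
  proof (intro borel_measurable_sum borel_measurable_scaleR)
    fix l assume "l \<in> {..<n}"
    then have [measurable]: "\<xi> l \<in> borel_measurable M" using simple_integrandD(5)[OF assms] by simp
    show "(\<lambda>p. \<xi> l (snd p)) \<in> borel_measurable (time_measure \<Otimes>\<^sub>M M)" by measurable
    have [measurable]: "(indicator {\<tau> l<..\<tau> (Suc l)} :: real \<Rightarrow> real) \<in> borel_measurable time_measure"
      unfolding time_measure_def by (rule measurable_restrict_space1) simp
    show "(\<lambda>p. indicator {\<tau> l<..\<tau> (Suc l)} (fst p) :: real) \<in> borel_measurable (time_measure \<Otimes>\<^sub>M M)"
      by measurable
  qed
  then show ?thesis by (simp add: prod_measure_def simple_value_def case_prod_beta)
qed

text \<open>The product of two cell indicators and of the cut-off at t is the indicator of the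
  overlap occurring in \<open>simple_integral_isometry\<close>. One cut-off, placed on the second
  factor, is enough.\<close>

lemma integral_simple_values:
  fixes \<xi> \<xi>' :: "nat \<Rightarrow> 'w \<Rightarrow> 'v::euclidean_space"
  assumes A: "simple_integrand n \<tau> \<xi>" and B: "simple_integrand n' \<tau>' \<xi>'" and t: "0 \<le> t" "t \<le> T"
  shows "(\<integral>\<omega>. simple_integral W n \<tau> \<xi> t \<omega> \<bullet> simple_integral W n' \<tau>' \<xi>' t \<omega> \<partial>M) =
    (\<integral>p. (case p of (r, \<omega>) \<Rightarrow> simple_value n \<tau> \<xi> r \<omega>) \<bullet> (case p of (r, \<omega>) \<Rightarrow> indicator {..t} r
        *\<^sub>R simple_value n' \<tau>' \<xi>' r \<omega>) \<partial>prod_measure)"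
proof -
  let ?S = "\<lambda>l k. {\<tau> l<..\<tau> (Suc l)} \<inter> {\<tau>' k<..\<tau>' (Suc k)} \<inter> {..t}"
  have g: "integrable M (\<lambda>\<omega>. \<xi> l \<omega> \<bullet> \<xi>' k \<omega>)" if lk: "l < n" "k < n'" for l k
  proof -
    obtain b where "\<And>\<omega>. \<omega> \<in> space M \<Longrightarrow> \<bar>\<xi> l \<omega> \<bullet> \<xi>' k \<omega>\<bar> \<le> b"
      using simple_integrands_inner(2)[OF A B lk] by blast
    then show ?thesis
      using simple_integrandD(5)[OF A lk(1)] simple_integrandD(5)[OF B lk(2)]
      by (intro integrable_const_bound[of _ b]) auto
  qed
  have S: "?S l k \<in> sets borel" "?S l k \<subseteq> {0..T}" if "l < n" "k < n'" for l k
    using simple_integrandD(1-3)[OF A that(1)] by auto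
  have "(\<integral>p. (case p of (r, \<omega>) \<Rightarrow> simple_value n \<tau> \<xi> r \<omega>) \<bullet> (case p of (r, \<omega>) \<Rightarrow> indicator {..t} r
      *\<^sub>R simple_value n' \<tau>' \<xi>' r \<omega>) \<partial>prod_measure) =
      (\<integral>p. (\<Sum>l<n. \<Sum>k<n'. (case p of (r, \<omega>) \<Rightarrow> indicator (?S l k) r * (\<xi> l \<omega> \<bullet> \<xi>' k \<omega>))) \<partial>prod_measure)"
  proof (rule Bochner_Integration.integral_cong[OF refl])
    fix p :: "real \<times> 'w"
    obtain r \<omega> where p: "p = (r, \<omega>)" by (cases p)
    have "simple_value n \<tau> \<xi> r \<omega> \<bullet> (indicator {..t} r *\<^sub>R simple_value n' \<tau>' \<xi>' r \<omega>) =
        (\<Sum>l<n. (indicator {\<tau> l<..\<tau> (Suc l)} r *\<^sub>R \<xi> l \<omega>) \<bullet> (\<Sum>k<n'. indicator {..t} r *\<^sub>R indicator {\<tau>' k<..\<tau>' (Suc k)} r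
            *\<^sub>R \<xi>' k \<omega>))"
      by (simp only: simple_value_def inner_sum_left scaleR_sum_right)
    also have "\<dots> = (\<Sum>l<n. \<Sum>k<n'. indicator (?S l k) r * (\<xi> l \<omega> \<bullet> \<xi>' k \<omega>))"
      unfolding inner_sum_right by (intro sum.cong refl) (auto simp: indicator_def)
    finally show "(case p of (r, \<omega>) \<Rightarrow> simple_value n \<tau> \<xi> r \<omega>) \<bullet> (case p of (r, \<omega>) \<Rightarrow> indicator {..t} r
        *\<^sub>R simple_value n' \<tau>' \<xi>' r \<omega>) =
        (\<Sum>l<n. \<Sum>k<n'. (case p of (r, \<omega>) \<Rightarrow> indicator (?S l k) r * (\<xi> l \<omega> \<bullet> \<xi>' k \<omega>)))"
      by (simp add: p)
  qed
  also have "\<dots> = (\<Sum>l<n. \<Sum>k<n'. \<integral>p. (case p of (r, \<omega>) \<Rightarrow> indicator (?S l k) r * (\<xi> l \<omega> \<bullet> \<xi>' k \<omega>)) \<partial>prod_measure)"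
    using integral_prod_indicator(1)[OF S g]
    by (subst Bochner_Integration.integral_sum)
      (auto intro!: Bochner_Integration.integrable_sum sum.cong simp: Bochner_Integration.integral_sum)
  also have "\<dots> = (\<Sum>l<n. \<Sum>k<n'. (\<integral>\<omega>. \<xi> l \<omega> \<bullet> \<xi>' k \<omega> \<partial>M) * measure lborel (?S l k))"
    using integral_prod_indicator(2)[OF S g] by (intro sum.cong) auto
  finally show ?thesis
    using simple_integral_isometry[OF A B t] by simp
qed

lemma simple_integral_0:
  assumes "simple_integrand n \<tau> \<xi>"
  shows "simple_integral N n \<tau> \<xi> 0 \<omega> = 0"
  unfolding simple_integral_def
proof (intro sum.neutral ballI)
  fix l assume "l \<in> {..<n}"
  then have "min (\<tau> (Suc l)) 0 = 0" "min (\<tau> l) 0 = 0" using simple_integrandD(1,2)[OF assms, of l] by auto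
  then show "(N (min (\<tau> (Suc l)) 0) \<omega> - N (min (\<tau> l) 0) \<omega>) *\<^sub>R \<xi> l \<omega> = 0" by simp
qed

lemma L2_integral_sq_tendsto:
  assumes "centred_increments N" "L2_integral N q \<phi> I"
  shows "\<exists>n \<tau> \<xi>. (\<forall>m. simple_integrand (n m) (\<tau> m) (\<xi> m)) \<and>
    (\<lambda>m. \<integral>\<^sup>+\<omega>. (\<integral>\<^sup>+t. ennreal ((norm (simple_value (n m) (\<tau> m) (\<xi> m) t \<omega> - \<phi> t \<omega>))\<^sup>2) \<partial>q \<omega>) \<partial>M) \<longlonglongrightarrow> 0 \<and>
    (\<forall>t\<in>{0..T}. sq_tendsto M (\<lambda>m. simple_integral N (n m) (\<tau> m) (\<xi> m) t) (I t))"
proof -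
  obtain n \<tau> \<xi> where *: "\<forall>m. simple_integrand (n m) (\<tau> m) (\<xi> m)"
    "(\<lambda>m. \<integral>\<^sup>+\<omega>. (\<integral>\<^sup>+t. ennreal ((norm (simple_value (n m) (\<tau> m) (\<xi> m) t \<omega> - \<phi> t \<omega>))\<^sup>2) \<partial>q \<omega>) \<partial>M) \<longlonglongrightarrow> 0"
    "\<forall>t\<in>{0..T}. (\<lambda>m. \<integral>\<^sup>+\<omega>. ennreal ((norm (simple_integral N (n m) (\<tau> m) (\<xi> m) t \<omega> - I t \<omega>))\<^sup>2) \<partial>M) \<longlonglongrightarrow> 0"
    using assms(2) unfolding L2_integral_def by blast
  have I: "I t \<in> borel_measurable M" if "t \<in> {0..T}" for t
  proof -
    have "I t \<in> borel_measurable (filt t)"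
      using assms(2) that unfolding L2_integral_def adapted_def by blast
    then show ?thesis using that by (intro measurable_from_subalg[OF subalgebra_filt]) auto
  qed
  have "sq_tendsto M (\<lambda>m. simple_integral N (n m) (\<tau> m) (\<xi> m) t) (I t)" if "t \<in> {0..T}" for t
    unfolding sq_tendsto_def
    using that *(3) I[OF that] simple_integral_measurable[OF assms(1) *(1)[rule_format]] by auto
  with *(1,2) show ?thesis by blast
qed

text \<open>A weak form of E[I t | F s] = I s, tested against square integrable variables known at
  s. It avoids conditional expectations of vectors given \<open>filt s\<close> and is the form in
  which \<open>drift_product\<close> uses it.\<close>

definition sq_martingale :: "(real \<Rightarrow> 'w \<Rightarrow> 'v::euclidean_space) \<Rightarrow> bool" where
  "sq_martingale I \<longleftrightarrow> (\<forall>t\<in>{0..T}. sq_int M (I t)) \<and> (AE \<omega> in M. I 0 \<omega> = 0) \<and>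
    (\<forall>s t \<eta>. 0 \<le> s \<longrightarrow> s \<le> t \<longrightarrow> t \<le> T \<longrightarrow> \<eta> \<in> borel_measurable (filt s) \<longrightarrow> sq_int M \<eta> \<longrightarrow>
      (\<integral>\<omega>. I t \<omega> \<bullet> \<eta> \<omega> \<partial>M) = (\<integral>\<omega>. I s \<omega> \<bullet> \<eta> \<omega> \<partial>M))"

text \<open>Two limits are taken in this order: first along the approximation with a bounded test
  variable, for which simple integrals against integrable increments make sense, then in the
  truncation level of the test variable.\<close>

lemma sq_martingale_limit:
  fixes I :: "real \<Rightarrow> 'w \<Rightarrow> 'v::euclidean_space"
  assumes lim: "\<And>t. t \<in> {0..T} \<Longrightarrow> sq_tendsto M (\<lambda>m. F m t) (I t)"
    and sq: "\<And>t. t \<in> {0..T} \<Longrightarrow> sq_int M (I t)"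
    and F0: "\<And>m \<omega>. F m 0 \<omega> = 0"
    and mart: "\<And>m s t \<eta> b. 0 \<le> s \<Longrightarrow> s \<le> t \<Longrightarrow> t \<le> T \<Longrightarrow> \<eta> \<in> borel_measurable (filt s) \<Longrightarrow>
      (\<And>\<omega>. \<omega> \<in> space M \<Longrightarrow> norm (\<eta> \<omega>) \<le> b) \<Longrightarrow> (\<integral>\<omega>. F m t \<omega> \<bullet> \<eta> \<omega> \<partial>M) = (\<integral>\<omega>. F m s \<omega> \<bullet> \<eta> \<omega> \<partial>M)"
  shows "sq_martingale I"
  unfolding sq_martingale_def
proof (intro conjI allI impI ballI)
  show "sq_int M (I t)" if "t \<in> {0..T}" for t by (rule sq[OF that])
  show "AE \<omega> in M. I 0 \<omega> = 0"
    using T_pos by (intro sq_tendsto_0_unique[OF lim]) (auto simp: F0)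
  fix s t :: real and \<eta> :: "'w \<Rightarrow> 'v"
  assume st: "0 \<le> s" "s \<le> t" "t \<le> T" and \<eta>: "\<eta> \<in> borel_measurable (filt s)" "sq_int M \<eta>"
  have sT: "s \<in> {0..T}" and tT: "t \<in> {0..T}" using st by auto
  have bounded: "(\<integral>\<omega>. I t \<omega> \<bullet> \<zeta> \<omega> \<partial>M) = (\<integral>\<omega>. I s \<omega> \<bullet> \<zeta> \<omega> \<partial>M)"
    if \<zeta>: "\<zeta> \<in> borel_measurable (filt s)" "\<And>\<omega>. \<omega> \<in> space M \<Longrightarrow> norm (\<zeta> \<omega>) \<le> b" for \<zeta> b
  proof -
    have \<zeta>M: "\<zeta> \<in> borel_measurable M"
      using st by (intro measurable_from_subalg[OF subalgebra_filt \<zeta>(1)]) auto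
    have sq\<zeta>: "sq_int M \<zeta>"
      unfolding sq_int_def using \<zeta>M \<zeta>(2)
      by (auto intro!: integrable_const_bound[of _ "b\<^sup>2"] power_mono AE_I2)
    have "(\<lambda>m. \<integral>\<omega>. F m t \<omega> \<bullet> \<zeta> \<omega> \<partial>M) \<longlonglongrightarrow> (\<integral>\<omega>. I t \<omega> \<bullet> \<zeta> \<omega> \<partial>M)"
      by (rule sq_tendsto_inner[OF lim[OF tT] sq_tendsto_const[OF \<zeta>M] sq[OF tT] sq\<zeta>])
    moreover have "(\<lambda>m. \<integral>\<omega>. F m s \<omega> \<bullet> \<zeta> \<omega> \<partial>M) \<longlonglongrightarrow> (\<integral>\<omega>. I s \<omega> \<bullet> \<zeta> \<omega> \<partial>M)"
      by (rule sq_tendsto_inner[OF lim[OF sT] sq_tendsto_const[OF \<zeta>M] sq[OF sT] sq\<zeta>])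
    moreover have "(\<integral>\<omega>. F m t \<omega> \<bullet> \<zeta> \<omega> \<partial>M) = (\<integral>\<omega>. F m s \<omega> \<bullet> \<zeta> \<omega> \<partial>M)" for m
      by (rule mart[OF st \<zeta>])
    ultimately show ?thesis by (simp add: LIMSEQ_unique)
  qed
  let ?\<eta> = "\<lambda>m \<omega>. if norm (\<eta> \<omega>) \<le> real m then \<eta> \<omega> else 0"
  note [measurable] = \<eta>(1)
  have "(\<lambda>m. \<integral>\<omega>. I t \<omega> \<bullet> ?\<eta> m \<omega> \<partial>M) \<longlonglongrightarrow> (\<integral>\<omega>. I t \<omega> \<bullet> \<eta> \<omega> \<partial>M)"
    by (rule sq_tendsto_inner[OF sq_tendsto_const[OF sq_intD(1)[OF sq[OF tT]]] sq_tendsto_truncate[OF \<eta>(2)] sq[OF tT]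
        \<eta>(2)])
  moreover have "(\<lambda>m. \<integral>\<omega>. I s \<omega> \<bullet> ?\<eta> m \<omega> \<partial>M) \<longlonglongrightarrow> (\<integral>\<omega>. I s \<omega> \<bullet> \<eta> \<omega> \<partial>M)"
    by (rule sq_tendsto_inner[OF sq_tendsto_const[OF sq_intD(1)[OF sq[OF sT]]] sq_tendsto_truncate[OF \<eta>(2)] sq[OF sT]
        \<eta>(2)])
  moreover have "(\<integral>\<omega>. I t \<omega> \<bullet> ?\<eta> m \<omega> \<partial>M) = (\<integral>\<omega>. I s \<omega> \<bullet> ?\<eta> m \<omega> \<partial>M)" for m
  proof (rule bounded[of _ "real m"])
    show "?\<eta> m \<in> borel_measurable (filt s)" by measurable
  qed simp
  ultimately show "(\<integral>\<omega>. I t \<omega> \<bullet> \<eta> \<omega> \<partial>M) = (\<integral>\<omega>. I s \<omega> \<bullet> \<eta> \<omega> \<partial>M)"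
    by (simp add: LIMSEQ_unique)
qed

lemma W_integral_approx:
  fixes \<phi> I :: "real \<Rightarrow> 'w \<Rightarrow> 'v::euclidean_space"
  assumes "W_integral \<phi> I"
  shows "\<exists>n \<tau> \<xi>. (\<forall>m. simple_integrand (n m) (\<tau> m) (\<xi> m)) \<and>
    sq_tendsto prod_measure (\<lambda>m (t, \<omega>). simple_value (n m) (\<tau> m) (\<xi> m) t \<omega>) (\<lambda>(t, \<omega>). \<phi> t \<omega>) \<and>
    (\<forall>t\<in>{0..T}. sq_tendsto M (\<lambda>m. simple_integral W (n m) (\<tau> m) (\<xi> m) t) (I t))"
proof -
  have L: "L2_integral W qv_W \<phi> I" and \<phi>: "L2F \<phi>" using assms by (auto simp: W_integral_def)
  obtain n \<tau> \<xi> where B0: "\<forall>m. simple_integrand (n m) (\<tau> m) (\<xi> m)"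
    "(\<lambda>m. \<integral>\<^sup>+\<omega>. (\<integral>\<^sup>+t. ennreal ((norm (simple_value (n m) (\<tau> m) (\<xi> m) t \<omega> - \<phi> t \<omega>))\<^sup>2) \<partial>qv_W \<omega>) \<partial>M) \<longlonglongrightarrow> 0"
    "\<forall>t\<in>{0..T}. sq_tendsto M (\<lambda>m. simple_integral W (n m) (\<tau> m) (\<xi> m) t) (I t)"
    using L2_integral_sq_tendsto[OF centred_increments_W L] by blast
  note approx = B0(1)[rule_format] B0(2) B0(3)[rule_format]
  have \<phi>m: "(\<lambda>(t, \<omega>). \<phi> t \<omega>) \<in> borel_measurable prod_measure"
    using \<phi> by (auto simp: L2F_iff sq_process_def dest: sq_intD)
  have "sq_tendsto prod_measure (\<lambda>m (t, \<omega>). simple_value (n m) (\<tau> m) (\<xi> m) t \<omega>) (\<lambda>(t, \<omega>). \<phi> t \<omega>)"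
    unfolding sq_tendsto_def
  proof (intro conjI allI simple_value_measurable approx(1) \<phi>m)
    have eq: "(\<integral>\<^sup>+\<omega>. (\<integral>\<^sup>+t. ennreal ((norm (simple_value (n m) (\<tau> m) (\<xi> m) t \<omega> - \<phi> t \<omega>))\<^sup>2) \<partial>qv_W \<omega>) \<partial>M) =
        (\<integral>\<^sup>+p. ennreal ((norm ((case p of (t, \<omega>) \<Rightarrow> simple_value (n m) (\<tau> m) (\<xi> m) t \<omega>) - (case p of (t, \<omega>) \<Rightarrow> \<phi> t \<omega>)))\<^sup>2)
            \<partial>prod_measure)" for m
    proof -
      have "(\<lambda>p. ennreal ((norm ((\<lambda>(t, \<omega>). simple_value (n m) (\<tau> m) (\<xi> m) t \<omega>) p - (\<lambda>(t, \<omega>). \<phi> t \<omega>) p))\<^sup>2))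
          \<in> borel_measurable prod_measure"
        using simple_value_measurable[OF approx(1), of m] \<phi>m by measurable
      then have "(\<lambda>(t, \<omega>). ennreal ((norm (simple_value (n m) (\<tau> m) (\<xi> m) t \<omega> - \<phi> t \<omega>))\<^sup>2))
          \<in> borel_measurable prod_measure"
        by (simp add: case_prod_beta)
      from nn_integral_prod_measure[OF this] show ?thesis
        by (simp add: qv_W_def time_measure_def case_prod_beta)
    qed
    show "(\<lambda>m. \<integral>\<^sup>+p. ennreal ((norm ((case p of (t, \<omega>) \<Rightarrow> simple_value (n m) (\<tau> m) (\<xi> m) t \<omega>)
        - (case p of (t, \<omega>) \<Rightarrow> \<phi> t \<omega>)))\<^sup>2) \<partial>prod_measure) \<longlonglongrightarrow> 0"
      using approx(2) unfolding eq .
  qed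
  with approx(1,3) show ?thesis by blast
qed

lemma sq_martingale_W_integral:
  fixes \<phi> I :: "real \<Rightarrow> 'w \<Rightarrow> 'v::euclidean_space"
  assumes "W_integral \<phi> I"
  shows "sq_martingale I"
proof -
  obtain n \<tau> \<xi> where B0: "\<forall>m. simple_integrand (n m) (\<tau> m) (\<xi> m)"
    "sq_tendsto prod_measure (\<lambda>m (t, \<omega>). simple_value (n m) (\<tau> m) (\<xi> m) t \<omega>) (\<lambda>(t, \<omega>). \<phi> t \<omega>)"
    "\<forall>t\<in>{0..T}. sq_tendsto M (\<lambda>m. simple_integral W (n m) (\<tau> m) (\<xi> m) t) (I t)"
    using W_integral_approx[OF assms] by blast
  note approx = B0(1)[rule_format] B0(2) B0(3)[rule_format]
  show ?thesis
  proof (rule sq_martingale_limit)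
    show "sq_tendsto M (\<lambda>m. simple_integral W (n m) (\<tau> m) (\<xi> m) t) (I t)" if "t \<in> {0..T}" for t
      by (rule approx(3)[OF that])
    show "sq_int M (I t)" if "t \<in> {0..T}" for t
      using that by (intro sq_tendsto_sq_int[OF approx(3)[OF that]] sq_int_simple_integral_W approx(1)) auto
    show "simple_integral W (n m) (\<tau> m) (\<xi> m) 0 \<omega> = 0" for m \<omega>
      by (rule simple_integral_0[OF approx(1)])
    fix m s t b and \<eta> :: "'w \<Rightarrow> 'v"
    assume st: "0 \<le> s" "s \<le> t" "t \<le> T" and \<eta>: "\<eta> \<in> borel_measurable (filt s)" "\<And>\<omega>. \<omega> \<in> space M \<Longrightarrow> norm (\<eta> \<omega>) \<le> b"
    show "(\<integral>\<omega>. simple_integral W (n m) (\<tau> m) (\<xi> m) t \<omega> \<bullet> \<eta> \<omega> \<partial>M) =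
        (\<integral>\<omega>. simple_integral W (n m) (\<tau> m) (\<xi> m) s \<omega> \<bullet> \<eta> \<omega> \<partial>M)"
      by (rule simple_integral_martingale[OF centred_increments_W approx(1) st \<eta>])
  qed
qed

lemma sq_process_indicator:
  fixes \<phi> :: "real \<Rightarrow> 'w \<Rightarrow> 'v::euclidean_space"
  assumes "f \<in> borel_measurable prod_measure"
  shows "(\<lambda>p. indicator {..t} (fst p) *\<^sub>R f p :: 'v) \<in> borel_measurable prod_measure"
proof -
  have [measurable]: "(indicator {..t} :: real \<Rightarrow> real) \<in> borel_measurable time_measure"
    unfolding time_measure_def by (rule measurable_restrict_space1) simp
  have "(\<lambda>p. indicator {..t} (fst p) :: real) \<in> borel_measurable prod_measure"
    unfolding prod_measure_def by measurable
  then show ?thesis using assms by measurable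
qed

text \<open>Each integrand keeps its own approximating sequence, and the polarised identity for
  simple integrands passes to the limit on both sides. The bilinear form is needed because
  diffusions of two different processes are multiplied.\<close>

lemma Ito_isometry:
  fixes \<phi> \<psi> I J :: "real \<Rightarrow> 'w \<Rightarrow> 'v::euclidean_space"
  assumes I: "W_integral \<phi> I" and J: "W_integral \<psi> J" and t: "t \<in> {0..T}"
  shows "(\<integral>\<omega>. I t \<omega> \<bullet> J t \<omega> \<partial>M) = (\<integral>p. indicator {..t} (fst p) * (\<phi> (fst p) (snd p) \<bullet> \<psi> (fst p) (snd p))
      \<partial>prod_measure)"
proof -
  obtain n \<tau> \<xi> where A0: "\<forall>m. simple_integrand (n m) (\<tau> m) (\<xi> m)"
    "sq_tendsto prod_measure (\<lambda>m (t, \<omega>). simple_value (n m) (\<tau> m) (\<xi> m) t \<omega>) (\<lambda>(t, \<omega>). \<phi> t \<omega>)"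
    "\<forall>t\<in>{0..T}. sq_tendsto M (\<lambda>m. simple_integral W (n m) (\<tau> m) (\<xi> m) t) (I t)"
    using W_integral_approx[OF I] by blast
  note A = A0(1)[rule_format] A0(2) A0(3)[rule_format]
  obtain n' \<tau>' \<xi>' where B0: "\<forall>m. simple_integrand (n' m) (\<tau>' m) (\<xi>' m)"
    "sq_tendsto prod_measure (\<lambda>m (t, \<omega>). simple_value (n' m) (\<tau>' m) (\<xi>' m) t \<omega>) (\<lambda>(t, \<omega>). \<psi> t \<omega>)"
    "\<forall>t\<in>{0..T}. sq_tendsto M (\<lambda>m. simple_integral W (n' m) (\<tau>' m) (\<xi>' m) t) (J t)"
    using W_integral_approx[OF J] by blast
  note B = B0(1)[rule_format] B0(2) B0(3)[rule_format]
  have sq: "sq_int prod_measure (\<lambda>(t, \<omega>). \<phi> t \<omega>)" "sq_int prod_measure (\<lambda>(t, \<omega>). \<psi> t \<omega>)"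
    using I J by (auto simp: W_integral_def L2F_iff sq_process_def)
  have sqm: "sq_int M (I t)" "sq_int M (J t)"
    using sq_martingale_W_integral[OF I] sq_martingale_W_integral[OF J] t by (auto simp: sq_martingale_def)
  have C: "sq_tendsto prod_measure (\<lambda>m p. indicator {..t} (fst p)
      *\<^sub>R (case p of (r, \<omega>) \<Rightarrow> simple_value (n' m) (\<tau>' m) (\<xi>' m) r \<omega>))
      (\<lambda>p. indicator {..t} (fst p) *\<^sub>R (case p of (r, \<omega>) \<Rightarrow> \<psi> r \<omega>))"
    unfolding sq_tendsto_def
  proof (intro conjI allI sq_process_indicator simple_value_measurable B(1) sq_intD(1)[OF sq(2)])
    show "(\<lambda>m. \<integral>\<^sup>+p. ennreal ((norm (indicator {..t} (fst p)
        *\<^sub>R (case p of (r, \<omega>) \<Rightarrow> simple_value (n' m) (\<tau>' m) (\<xi>' m) r \<omega>) -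
        indicator {..t} (fst p) *\<^sub>R (case p of (r, \<omega>) \<Rightarrow> \<psi> r \<omega>)))\<^sup>2) \<partial>prod_measure) \<longlonglongrightarrow> 0"
    \<comment> \<open>The cut-off at t can only decrease the mean square distance.\<close>
    proof (rule tendsto_sandwich[OF _ _ tendsto_const])
      show "(\<lambda>m. \<integral>\<^sup>+p. ennreal ((norm ((case p of (r, \<omega>) \<Rightarrow> simple_value (n' m) (\<tau>' m) (\<xi>' m) r \<omega>)
          - (case p of (r, \<omega>) \<Rightarrow> \<psi> r \<omega>)))\<^sup>2) \<partial>prod_measure) \<longlonglongrightarrow> 0"
        using B(2) by (simp add: sq_tendsto_def)
    qed (auto intro!: always_eventually nn_integral_mono simp: indicator_def)
  qed
  have lim1: "(\<lambda>m. \<integral>\<omega>. simple_integral W (n m) (\<tau> m) (\<xi> m) t \<omega> \<bullet> simple_integral W (n' m) (\<tau>' m) (\<xi>' m) t \<omega> \<partial>M)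
      \<longlonglongrightarrow> (\<integral>\<omega>. I t \<omega> \<bullet> J t \<omega> \<partial>M)"
    by (rule sq_tendsto_inner[OF A(3)[OF t] B(3)[OF t] sqm])
  have sqC: "sq_int prod_measure (\<lambda>p. indicator {..t} (fst p) *\<^sub>R (case p of (r, \<omega>) \<Rightarrow> \<psi> r \<omega>))"
    by (rule sq_int_mult_bounded[OF sq(2) sq_process_indicator[OF sq_intD(1)[OF sq(2)]], of _ 1])
      (auto intro!: AE_I2 simp: indicator_def)
  have lim2: "(\<lambda>m. \<integral>p. (case p of (r, \<omega>) \<Rightarrow> simple_value (n m) (\<tau> m) (\<xi> m) r \<omega>) \<bullet>
      (indicator {..t} (fst p) *\<^sub>R (case p of (r, \<omega>) \<Rightarrow> simple_value (n' m) (\<tau>' m) (\<xi>' m) r \<omega>)) \<partial>prod_measure)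
      \<longlonglongrightarrow> (\<integral>p. (case p of (r, \<omega>) \<Rightarrow> \<phi> r \<omega>) \<bullet> (indicator {..t} (fst p) *\<^sub>R (case p of (r, \<omega>) \<Rightarrow> \<psi> r \<omega>)) \<partial>prod_measure)"
    by (rule sq_tendsto_inner[OF A(2) C sq(1) sqC])
  have eq: "(\<integral>\<omega>. simple_integral W (n m) (\<tau> m) (\<xi> m) t \<omega> \<bullet> simple_integral W (n' m) (\<tau>' m) (\<xi>' m) t \<omega> \<partial>M) =
      (\<integral>p. (case p of (r, \<omega>) \<Rightarrow> simple_value (n m) (\<tau> m) (\<xi> m) r \<omega>) \<bullet>
      (indicator {..t} (fst p) *\<^sub>R (case p of (r, \<omega>) \<Rightarrow> simple_value (n' m) (\<tau>' m) (\<xi>' m) r \<omega>)) \<partial>prod_measure)" for m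
    using integral_simple_values[OF A(1)[of m] B(1)[of m], of t] t by (simp add: case_prod_beta)
  have "(\<integral>\<omega>. I t \<omega> \<bullet> J t \<omega> \<partial>M) = (\<integral>p. (case p of (r, \<omega>) \<Rightarrow> \<phi> r \<omega>) \<bullet> (indicator {..t} (fst p)
      *\<^sub>R (case p of (r, \<omega>) \<Rightarrow> \<psi> r \<omega>)) \<partial>prod_measure)"
    by (rule LIMSEQ_unique[OF lim1 lim2[folded eq]])
  then show ?thesis by (simp add: case_prod_beta)
qed

text \<open>Only integrability of \<open>M\<^sub>i\<^sub>j\<close> is established above, hence the assumption on \<open>J\<close>.\<close>

lemma jump_integral_martingale:
  fixes k :: "'s \<Rightarrow> 's \<Rightarrow> real \<Rightarrow> 'w \<Rightarrow> 'v::euclidean_space"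
  assumes J: "jump_integral k J" and sq: "\<And>t. t \<in> {0..T} \<Longrightarrow> sq_int M (J t)"
  shows "sq_martingale J"
    and "\<And>\<phi> I t. W_integral \<phi> I \<Longrightarrow> t \<in> {0..T} \<Longrightarrow> (\<integral>\<omega>. I t \<omega> \<bullet> J t \<omega> \<partial>M) = 0"
proof -
  obtain L where L: "\<And>i j. L2_integral (jump_mart i j) (qv_jump i j) (k i j) (L i j)"
    "J = (\<lambda>t \<omega>. \<Sum>i\<in>UNIV. \<Sum>j\<in>UNIV. L i j t \<omega>)"
    using J unfolding jump_integral_def by blast
  define P where "P i j F \<longleftrightarrow> (\<forall>m. \<exists>n \<tau> \<xi>. simple_integrand n \<tau> \<xi> \<and> F m = simple_integral (jump_mart i j) n \<tau> \<xi>) \<and>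
      (\<forall>t\<in>{0..T}. sq_tendsto M (\<lambda>m. F m t) (L i j t))" for i j and F :: "nat \<Rightarrow> real \<Rightarrow> 'w \<Rightarrow> 'v"
  have "\<exists>F. P i j F" for i j
  proof -
    obtain n \<tau> \<xi> where B0: "\<forall>m. simple_integrand (n m) (\<tau> m) (\<xi> m)"
      "(\<lambda>m. \<integral>\<^sup>+\<omega>. (\<integral>\<^sup>+t. ennreal ((norm (simple_value (n m) (\<tau> m) (\<xi> m) t \<omega> - k i j t \<omega>))\<^sup>2) \<partial>qv_jump i j \<omega>) \<partial>M) \<longlonglongrightarrow> 0"
      "\<forall>t\<in>{0..T}. sq_tendsto M (\<lambda>m. simple_integral (jump_mart i j) (n m) (\<tau> m) (\<xi> m) t) (L i j t)"
      using L2_integral_sq_tendsto[OF centred_increments_jump L(1)[of i j]] by blast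
    from B0 have "P i j (\<lambda>m. simple_integral (jump_mart i j) (n m) (\<tau> m) (\<xi> m))"
      unfolding P_def by blast
    then show ?thesis by blast
  qed
  \<comment> \<open>The approximating sequences of all pairs of states are chosen simultaneously, so
    that their sums approximate the full jump integral.\<close>
  then have "\<forall>p. \<exists>F. P (fst p) (snd p) F" by blast
  from choice[OF this] obtain F0 where F0: "\<And>p. P (fst p) (snd p) (F0 p)" by blast
  define F where "F i j = F0 (i, j)" for i j
  have F: "P i j (F i j)" for i j using F0[of "(i, j)"] by (simp add: F_def)
  define S where "S m t \<omega> = (\<Sum>i\<in>UNIV. \<Sum>j\<in>UNIV. F i j m t \<omega>)" for m t \<omega>
  have lim: "sq_tendsto M (\<lambda>m. S m t) (J t)" if "t \<in> {0..T}" for t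
    unfolding S_def[abs_def] L(2) using F that unfolding P_def by (intro sq_tendsto_sum) auto
  have simple: "\<exists>n \<tau> \<xi>. simple_integrand n \<tau> \<xi> \<and> F i j m = simple_integral (jump_mart i j) n \<tau> \<xi>" for i j m
    using F[of i j] unfolding P_def by blast
  have mart: "integrable M (\<lambda>\<omega>. F i j m t \<omega> \<bullet> \<eta> \<omega>) \<and> (\<integral>\<omega>. F i j m t \<omega> \<bullet> \<eta> \<omega> \<partial>M) = (\<integral>\<omega>. F i j m s \<omega> \<bullet> \<eta> \<omega> \<partial>M)"
    if st: "0 \<le> s" "s \<le> t" "t \<le> T" and \<eta>: "\<eta> \<in> borel_measurable (filt s)" "\<And>\<omega>. \<omega> \<in> space M \<Longrightarrow> norm (\<eta> \<omega>) \<le> b"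
    for i j m s t \<eta> b
  proof -
    obtain n \<tau> \<xi> where "simple_integrand n \<tau> \<xi>" "F i j m = simple_integral (jump_mart i j) n \<tau> \<xi>"
      using simple by blast
    then show ?thesis
      using simple_integral_inner[OF centred_increments_jump _ st \<eta>] by simp
  qed
  show "sq_martingale J"
  proof (rule sq_martingale_limit)
    show "sq_tendsto M (\<lambda>m. S m t) (J t)" "sq_int M (J t)" if "t \<in> {0..T}" for t
      by (rule lim[OF that], rule sq[OF that])
    show "S m 0 \<omega> = 0" for m \<omega>
    proof -
      have "F i j m 0 \<omega> = 0" for i j
      proof -
        obtain n \<tau> \<xi> where "simple_integrand n \<tau> \<xi>" "F i j m = simple_integral (jump_mart i j) n \<tau> \<xi>"
          using simple by blast
        then show ?thesis using simple_integral_0 by simp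
      qed
      then show ?thesis by (simp add: S_def)
    qed
    fix m s t b and \<eta> :: "'w \<Rightarrow> 'v"
    assume st: "0 \<le> s" "s \<le> t" "t \<le> T" and \<eta>: "\<eta> \<in> borel_measurable (filt s)" "\<And>\<omega>. \<omega> \<in> space M \<Longrightarrow> norm (\<eta> \<omega>) \<le> b"
    have ss: "0 \<le> s" "s \<le> s" "s \<le> T" using st by auto
    have expand: "(\<integral>\<omega>. S m r \<omega> \<bullet> \<eta> \<omega> \<partial>M) = (\<Sum>i\<in>UNIV. \<Sum>j\<in>UNIV. \<integral>\<omega>. F i j m r \<omega> \<bullet> \<eta> \<omega> \<partial>M)"
      if "\<And>i j. integrable M (\<lambda>\<omega>. F i j m r \<omega> \<bullet> \<eta> \<omega>)" for r
      unfolding S_def inner_sum_left using that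
      by (subst Bochner_Integration.integral_sum)
        (auto intro!: Bochner_Integration.integrable_sum sum.cong simp: Bochner_Integration.integral_sum)
    show "(\<integral>\<omega>. S m t \<omega> \<bullet> \<eta> \<omega> \<partial>M) = (\<integral>\<omega>. S m s \<omega> \<bullet> \<eta> \<omega> \<partial>M)"
      using mart[OF st \<eta>] mart[OF ss \<eta>] by (simp add: expand)
  qed
  fix \<phi> I :: "real \<Rightarrow> 'w \<Rightarrow> 'v" and t assume I: "W_integral \<phi> I" and t: "t \<in> {0..T}"
  obtain n \<tau> \<xi> where A0: "\<forall>m. simple_integrand (n m) (\<tau> m) (\<xi> m)"
    "sq_tendsto prod_measure (\<lambda>m (t, \<omega>). simple_value (n m) (\<tau> m) (\<xi> m) t \<omega>) (\<lambda>(t, \<omega>). \<phi> t \<omega>)"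
    "\<forall>t\<in>{0..T}. sq_tendsto M (\<lambda>m. simple_integral W (n m) (\<tau> m) (\<xi> m) t) (I t)"
    using W_integral_approx[OF I] by blast
  note A = A0(1)[rule_format] A0(2) A0(3)[rule_format]
  have "sq_int M (I t)" using sq_martingale_W_integral[OF I] t by (auto simp: sq_martingale_def)
  then have "(\<lambda>m. \<integral>\<omega>. simple_integral W (n m) (\<tau> m) (\<xi> m) t \<omega> \<bullet> S m t \<omega> \<partial>M) \<longlonglongrightarrow> (\<integral>\<omega>. I t \<omega> \<bullet> J t \<omega> \<partial>M)"
    by (intro sq_tendsto_inner[OF A(3)[OF t] lim[OF t] _ sq[OF t]])
  moreover have "(\<integral>\<omega>. simple_integral W (n m) (\<tau> m) (\<xi> m) t \<omega> \<bullet> S m t \<omega> \<partial>M) = 0" for m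
  proof -
    have orth: "integrable M (\<lambda>\<omega>. simple_integral W (n m) (\<tau> m) (\<xi> m) t \<omega> \<bullet> F i j m t \<omega>) \<and>
        (\<integral>\<omega>. simple_integral W (n m) (\<tau> m) (\<xi> m) t \<omega> \<bullet> F i j m t \<omega> \<partial>M) = 0" for i j
    proof -
      obtain n' \<tau>' \<xi>' where "simple_integrand n' \<tau>' \<xi>'" "F i j m = simple_integral (jump_mart i j) n' \<tau>' \<xi>'"
        using simple by blast
      then show ?thesis
        using simple_integrals_orthogonal[OF A(1)[of m], of n' \<tau>' \<xi>' t i j] t by simp
    qed
    have "(\<integral>\<omega>. simple_integral W (n m) (\<tau> m) (\<xi> m) t \<omega> \<bullet> S m t \<omega> \<partial>M) =
        (\<Sum>i\<in>UNIV. \<Sum>j\<in>UNIV. \<integral>\<omega>. simple_integral W (n m) (\<tau> m) (\<xi> m) t \<omega> \<bullet> F i j m t \<omega> \<partial>M)"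
      unfolding S_def inner_sum_right using orth
      by (subst Bochner_Integration.integral_sum)
        (auto intro!: Bochner_Integration.integrable_sum sum.cong simp: Bochner_Integration.integral_sum)
    then show ?thesis using orth by simp
  qed
  ultimately show "(\<integral>\<omega>. I t \<omega> \<bullet> J t \<omega> \<partial>M) = 0"
    by (simp add: LIMSEQ_const_iff)
qed

subsection \<open>Time integrals\<close>

text \<open>Taken over the finite measure on the whole horizon with a cut-off instead of a variable
  domain, so that Fubini on the product space applies; \<open>time_integral_eq\<close> connects it
  with the integrals in the equations.\<close>

definition time_integral :: "(real \<Rightarrow> 'w \<Rightarrow> 'v::euclidean_space) \<Rightarrow> real \<Rightarrow> 'w \<Rightarrow> 'v" where
  "time_integral b t \<omega> = (\<integral>s. indicator {..t} s *\<^sub>R b s \<omega> \<partial>time_measure)"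

lemma time_integral_eq:
  assumes "t \<in> {0..T}"
  shows "time_integral b t \<omega> = (LBINT s:{0..t}. b s \<omega>)"
proof -
  have "time_integral b t \<omega> = (\<integral>s. indicator {0..T} s *\<^sub>R (indicator {..t} s *\<^sub>R b s \<omega>) \<partial>lborel)"
    unfolding time_integral_def time_measure_def by (rule integral_restrict_space) simp
  also have "\<dots> = (\<integral>s. indicator {0..t} s *\<^sub>R b s \<omega> \<partial>lborel)"
    using assms by (intro Bochner_Integration.integral_cong) (auto simp: indicator_def)
  finally show ?thesis by (simp add: set_lebesgue_integral_def)
qed

lemma time_integral_T: "time_integral b T \<omega> = (\<integral>s. b s \<omega> \<partial>time_measure)"
  unfolding time_integral_def by (rule Bochner_Integration.integral_cong) auto

lemma sq_process_iff: "sq_process x \<longleftrightarrow> sq_int prod_measure (\<lambda>p. x (fst p) (snd p))"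
  by (simp add: sq_process_def case_prod_beta')

lemma indicator_atMost_measurable: "(indicator {..t} :: real \<Rightarrow> real) \<in> borel_measurable time_measure"
  unfolding time_measure_def by (rule measurable_restrict_space1) simp

lemma sq_process_section:
  assumes "sq_process x" "t \<in> {0..T}"
  shows "x t \<in> borel_measurable M"
  using assms by (intro measurable_process_section) (auto simp: measurable_process_iff sq_process_def dest: sq_intD)

lemma sq_process_AE_time:
  assumes "sq_process x"
  shows "AE t in time_measure. sq_int M (x t)"
proof -
  have "AE t in time_measure. integrable M (\<lambda>\<omega>. (norm (x t \<omega>))\<^sup>2)"
    using prod.AE_integrable_fst'[of "\<lambda>p. (norm (x (fst p) (snd p)))\<^sup>2"] sq_intD(2)[OF assms[unfolded sq_process_iff]]
    by (simp add: prod_measure_def)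
  then show ?thesis
  proof (rule AE_mp, intro AE_I2 impI)
    fix t assume "t \<in> space time_measure" "integrable M (\<lambda>\<omega>. (norm (x t \<omega>))\<^sup>2)"
    then show "sq_int M (x t)"
      using sq_process_section[OF assms, of t] by (simp add: sq_int_def)
  qed
qed

lemma sq_process_AE_path:
  assumes "sq_process x"
  shows "AE \<omega> in M. sq_int time_measure (\<lambda>t. x t \<omega>)"
proof -
  have "integrable (time_measure \<Otimes>\<^sub>M M) (\<lambda>(t, \<omega>). (norm (x t \<omega>))\<^sup>2)"
    using sq_intD(2)[OF assms[unfolded sq_process_iff]] by (simp add: prod_measure_def case_prod_beta')
  from prod.AE_integrable_snd[OF this] show ?thesis
  proof (rule AE_mp, intro AE_I2 impI)
    fix \<omega> assume "\<omega> \<in> space M" and int: "integrable time_measure (\<lambda>t. (norm (x t \<omega>))\<^sup>2)"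
    moreover have "(\<lambda>(t, \<omega>). x t \<omega>) \<in> borel_measurable (time_measure \<Otimes>\<^sub>M M)"
      using assms by (auto simp: sq_process_def prod_measure_def dest: sq_intD)
    ultimately show "sq_int time_measure (\<lambda>t. x t \<omega>)"
      using measurable_Pair1[of "\<lambda>(t, \<omega>). x t \<omega>" time_measure M borel \<omega>] by (simp add: sq_int_def)
  qed
qed

text \<open>Cauchy-Schwarz against the constant 1, whose squared norm is the total mass T.\<close>

lemma norm_time_integral_sq_le:
  assumes "sq_int time_measure f"
  shows "(norm (\<integral>s. f s \<partial>time_measure))\<^sup>2 \<le> T * (\<integral>s. (norm (f s))\<^sup>2 \<partial>time_measure)"
proof -
  have "norm (\<integral>s. f s \<partial>time_measure) \<le> (\<integral>s. norm (f s) \<partial>time_measure)"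
    by (rule integral_norm_bound)
  also have "\<dots> = \<bar>\<integral>s. norm (f s) \<bullet> 1 \<partial>time_measure\<bar>"
    by simp
  also have "\<dots> \<le> sqrt (\<integral>s. (norm (norm (f s)))\<^sup>2 \<partial>time_measure) * sqrt (\<integral>s. (norm (1::real))\<^sup>2 \<partial>time_measure)"
    using sq_intD[OF assms] by (intro Cauchy_Schwarz_integral time.sq_int_const) (simp add:
        sq_int_def borel_measurable_norm)
  also have "(\<integral>s. (norm (1::real))\<^sup>2 \<partial>time_measure) = T"
    using T_pos by (simp add: time_measure_def measure_restrict_space)
  finally have "(norm (\<integral>s. f s \<partial>time_measure))\<^sup>2 \<le> (sqrt (\<integral>s. (norm (f s))\<^sup>2 \<partial>time_measure) * sqrt T)\<^sup>2"
    by (intro power_mono) simp_all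
  also have "\<dots> = T * (\<integral>s. (norm (f s))\<^sup>2 \<partial>time_measure)"
    using T_pos by (simp add: power_mult_distrib)
  finally show ?thesis .
qed

lemma sq_int_time_indicator:
  assumes "sq_int time_measure f"
  shows "sq_int time_measure (\<lambda>s. indicator {..t} s *\<^sub>R f s)"
proof (rule sq_int_mult_bounded[OF assms, of _ 1])
  show "(\<lambda>s. indicator {..t} s *\<^sub>R f s) \<in> borel_measurable time_measure"
    by (rule borel_measurable_scaleR[OF indicator_atMost_measurable sq_intD(1)[OF assms]])
qed (auto simp: indicator_def)

lemma sq_process_time_indicator:
  assumes "sq_process b"
  shows "sq_process (\<lambda>s \<omega>. indicator {..t} s *\<^sub>R b s \<omega>)"
  using assms unfolding sq_process_iff
  by (intro sq_int_mult_bounded[OF assms[unfolded sq_process_iff], of _ 1]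
      sq_process_indicator[where f = "\<lambda>p. b (fst p) (snd p)"] AE_I2)
    (auto simp: sq_int_def indicator_def)

text \<open>A partial integral of a function jointly measurable in time, path and integration
  variable; the cut-off is read as the measurable condition that the integration variable does not
  exceed the time.\<close>

lemma time_integral_measurable:
  fixes b :: "real \<Rightarrow> 'w \<Rightarrow> 'v::euclidean_space"
  assumes "sq_process b"
  shows "(\<lambda>p. time_integral b (fst p) (snd p)) \<in> borel_measurable prod_measure"
proof -
  have [measurable]: "(\<lambda>(t, \<omega>). b t \<omega>) \<in> borel_measurable (time_measure \<Otimes>\<^sub>M M)"
    using assms by (auto simp: sq_process_def prod_measure_def dest: sq_intD)
  have [measurable]: "(\<lambda>s::real. s) \<in> borel_measurable time_measure"
    unfolding time_measure_def by (rule measurable_restrict_space1) simp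
  have "(\<lambda>(p, s). indicator {..fst p} s *\<^sub>R b s (snd p)) \<in> borel_measurable ((time_measure \<Otimes>\<^sub>M M) \<Otimes>\<^sub>M time_measure)"
  proof -
    have b: "(\<lambda>q. b (snd q) (snd (fst q))) \<in> borel_measurable ((time_measure \<Otimes>\<^sub>M M) \<Otimes>\<^sub>M time_measure)"
      using measurable_compose[of "\<lambda>q. (snd q, snd (fst q))" "(time_measure \<Otimes>\<^sub>M M) \<Otimes>\<^sub>M time_measure" "time_measure \<Otimes>\<^sub>M M"
          "\<lambda>(t, \<omega>). b t \<omega>"]
      by simp
    have i: "(\<lambda>q. if snd q \<le> fst (fst q) then 1 else 0 :: real) \<in> borel_measurable
        ((time_measure \<Otimes>\<^sub>M M) \<Otimes>\<^sub>M time_measure)"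
      by measurable
    have "(\<lambda>(p, s). indicator {..fst p} s *\<^sub>R b s (snd p)) = (\<lambda>q. (if snd q \<le> fst (fst q) then 1 else 0 :: real)
        *\<^sub>R b (snd q) (snd (fst q)))"
      by (auto simp: indicator_def)
    then show ?thesis using borel_measurable_scaleR[OF i b] by (simp only:)
  qed
  from time.borel_measurable_lebesgue_integral[OF this] show ?thesis
    by (simp add: time_integral_def prod_measure_def)
qed

lemma time_integral_section_measurable:
  fixes b :: "real \<Rightarrow> 'w \<Rightarrow> 'v::euclidean_space"
  assumes "sq_process b" "t \<in> {0..T}"
  shows "time_integral b t \<in> borel_measurable M"
proof -
  have "(\<lambda>(t, \<omega>). time_integral b t \<omega>) \<in> borel_measurable (time_measure \<Otimes>\<^sub>M M)"
    using time_integral_measurable[OF assms(1)] by (simp add: prod_measure_def case_prod_beta')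
  from measurable_Pair2[OF this, of t] show ?thesis using assms(2) by simp
qed

text \<open>One null set serves all t, namely that of the paths that are not square integrable in
  time.\<close>

lemma AE_norm_time_integral_sq_le:
  fixes b :: "real \<Rightarrow> 'w \<Rightarrow> 'v::euclidean_space"
  assumes b: "sq_process b"
  shows "AE \<omega> in M. \<forall>t. (norm (time_integral b t \<omega>))\<^sup>2 \<le> T * (\<integral>s. indicator {..t} s * (norm (b s \<omega>))\<^sup>2 \<partial>time_measure)
      \<and> (norm (time_integral b t \<omega>))\<^sup>2 \<le> T * (\<integral>s. (norm (b s \<omega>))\<^sup>2 \<partial>time_measure)"
  using sq_process_AE_path[OF b]
proof eventually_elim
  case (elim \<omega>)
  show ?case
  proof
    fix t
    have eq: "(\<lambda>s. (norm (indicator {..t} s *\<^sub>R b s \<omega>))\<^sup>2) = (\<lambda>s. indicator {..t} s * (norm (b s \<omega>))\<^sup>2)"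
      by (auto simp: indicator_def)
    note sq = sq_int_time_indicator[OF elim, of t]
    have "(norm (time_integral b t \<omega>))\<^sup>2 \<le> T * (\<integral>s. indicator {..t} s * (norm (b s \<omega>))\<^sup>2 \<partial>time_measure)"
      using norm_time_integral_sq_le[OF sq] unfolding time_integral_def eq .
    moreover have "(\<integral>s. indicator {..t} s * (norm (b s \<omega>))\<^sup>2 \<partial>time_measure) \<le> (\<integral>s. (norm (b s \<omega>))\<^sup>2 \<partial>time_measure)"
      using sq_intD(2)[OF sq] sq_intD(2)[OF elim] unfolding eq by (intro integral_mono) (auto simp: indicator_def)
    ultimately show "(norm (time_integral b t \<omega>))\<^sup>2 \<le> T * (\<integral>s. indicator {..t} s * (norm (b s \<omega>))\<^sup>2 \<partial>time_measure)
      \<and> (norm (time_integral b t \<omega>))\<^sup>2 \<le> T * (\<integral>s. (norm (b s \<omega>))\<^sup>2 \<partial>time_measure)"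
      using mult_left_mono[of _ _ T] T_pos by (meson less_imp_le order_trans)
  qed
qed

lemma integrable_path_square:
  assumes b: "sq_process b"
  shows "integrable M (\<lambda>\<omega>. \<integral>s. indicator {..t} s * (norm (b s \<omega>))\<^sup>2 \<partial>time_measure)"
    and "(\<integral>\<omega>. (\<integral>s. indicator {..t} s * (norm (b s \<omega>))\<^sup>2 \<partial>time_measure) \<partial>M) =
      (\<integral>p. indicator {..t} (fst p) * (norm (b (fst p) (snd p)))\<^sup>2 \<partial>prod_measure)"
proof -
  have eq: "(norm (indicator {..t} s *\<^sub>R b s \<omega>))\<^sup>2 = indicator {..t} s * (norm (b s \<omega>))\<^sup>2" for s \<omega>
    by (auto simp: indicator_def)
  have "integrable prod_measure (\<lambda>p. indicator {..t} (fst p) * (norm (b (fst p) (snd p)))\<^sup>2)"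
    using sq_intD(2)[OF sq_process_time_indicator[OF b, of t, unfolded sq_process_iff]] unfolding eq .
  then have int: "integrable (time_measure \<Otimes>\<^sub>M M) (\<lambda>(s, \<omega>). indicator {..t} s * (norm (b s \<omega>))\<^sup>2)"
    by (simp add: prod_measure_def case_prod_beta')
  from prod.integrable_snd[OF this]
  show "integrable M (\<lambda>\<omega>. \<integral>s. indicator {..t} s * (norm (b s \<omega>))\<^sup>2 \<partial>time_measure)" .
  from prod.integral_snd[OF int]
  show "(\<integral>\<omega>. (\<integral>s. indicator {..t} s * (norm (b s \<omega>))\<^sup>2 \<partial>time_measure) \<partial>M) =
      (\<integral>p. indicator {..t} (fst p) * (norm (b (fst p) (snd p)))\<^sup>2 \<partial>prod_measure)"
    by (simp add: prod_measure_def case_prod_beta')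
qed

lemma sq_int_time_integral:
  fixes b :: "real \<Rightarrow> 'w \<Rightarrow> 'v::euclidean_space"
  assumes b: "sq_process b" and t: "t \<in> {0..T}"
  shows "sq_int M (time_integral b t)"
    and "(\<integral>\<omega>. (norm (time_integral b t \<omega>))\<^sup>2 \<partial>M) \<le> T * (\<integral>p. indicator {..t} (fst p) * (norm (b (fst p) (snd p)))\<^sup>2
        \<partial>prod_measure)"
proof -
  have bound: "AE \<omega> in M. (norm (time_integral b t \<omega>))\<^sup>2 \<le> T * (\<integral>s. indicator {..t} s * (norm (b s \<omega>))\<^sup>2 \<partial>time_measure)"
    using AE_norm_time_integral_sq_le[OF b] by eventually_elim blast
  have int: "integrable M (\<lambda>\<omega>. T * (\<integral>s. indicator {..t} s * (norm (b s \<omega>))\<^sup>2 \<partial>time_measure))"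
    using integrable_path_square(1)[OF b] by simp
  show sq: "sq_int M (time_integral b t)"
    by (rule sq_int_bound[OF time_integral_section_measurable[OF b t] int bound])
  have "(\<integral>\<omega>. (norm (time_integral b t \<omega>))\<^sup>2 \<partial>M) \<le> (\<integral>\<omega>. T * (\<integral>s. indicator {..t} s * (norm (b s \<omega>))\<^sup>2 \<partial>time_measure) \<partial>M)"
    by (rule integral_mono_AE[OF sq_intD(2)[OF sq] int bound])
  then show "(\<integral>\<omega>. (norm (time_integral b t \<omega>))\<^sup>2 \<partial>M) \<le> T * (\<integral>p. indicator {..t} (fst p) * (norm (b (fst p) (snd p)))\<^sup>2
      \<partial>prod_measure)"
    using integrable_path_square(2)[OF b, of t] by simp
qed

lemma integrable_prod_snd:
  fixes f :: "'w \<Rightarrow> real"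
  assumes "integrable M f"
  shows "integrable prod_measure (\<lambda>p. f (snd p))"
proof -
  have "integrable prod_measure (\<lambda>(r, \<omega>). indicator {0..T} r * f \<omega>)"
    by (rule integral_prod_indicator(1)[OF _ _ assms]) auto
  then show ?thesis
    by (rule Bochner_Integration.integrable_cong[THEN iffD1, rotated -1]) (auto simp: space_prod_measure)
qed

lemma sq_process_const:
  assumes "sq_int M V"
  shows "sq_process (\<lambda>t. V)"
  unfolding sq_process_iff sq_int_def
proof
  have "V \<in> borel_measurable M" using assms by (rule sq_intD)
  then show "(\<lambda>p. V (snd p)) \<in> borel_measurable prod_measure"
    unfolding prod_measure_def by measurable
  show "integrable prod_measure (\<lambda>p. (norm (V (snd p)))\<^sup>2)"
    by (rule integrable_prod_snd[OF sq_intD(2)[OF assms]])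
qed

lemma sq_process_time_integral:
  fixes b :: "real \<Rightarrow> 'w \<Rightarrow> 'v::euclidean_space"
  assumes b: "sq_process b"
  shows "sq_process (time_integral b)"
  unfolding sq_process_iff
proof (rule sq_int_bound[OF time_integral_measurable[OF b]])
  have meas: "(\<lambda>\<omega>. \<integral>s. (norm (b s \<omega>))\<^sup>2 \<partial>time_measure) \<in> borel_measurable M" (is "?f \<in> _")
    and int: "integrable M (\<lambda>\<omega>. \<integral>s. (norm (b s \<omega>))\<^sup>2 \<partial>time_measure)"
  proof -
    have "integrable (time_measure \<Otimes>\<^sub>M M) (\<lambda>(s, \<omega>). (norm (b s \<omega>))\<^sup>2)"
      using sq_intD(2)[OF b[unfolded sq_process_iff]] by (simp add: prod_measure_def case_prod_beta')
    from prod.integrable_snd[OF this] show "integrable M ?f" .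
    then show "?f \<in> borel_measurable M" by simp
  qed
  show "integrable prod_measure (\<lambda>p. T * ?f (snd p))"
    using integrable_prod_snd[OF int] by simp
  have [measurable]: "(\<lambda>p. time_integral b (fst p) (snd p)) \<in> borel_measurable (time_measure \<Otimes>\<^sub>M M)"
    using time_integral_measurable[OF b] by (simp add: prod_measure_def)
  note [measurable] = meas
  have "AE p in time_measure \<Otimes>\<^sub>M M. (norm (time_integral b (fst p) (snd p)))\<^sup>2 \<le> T * ?f (snd p)"
  proof (rule prod.AE_pair_measure)
    show "{p \<in> space (time_measure \<Otimes>\<^sub>M M). (norm (time_integral b (fst p) (snd p)))\<^sup>2 \<le> T * ?f (snd p)}
        \<in> sets (time_measure \<Otimes>\<^sub>M M)"
      by measurable
    show "AE t in time_measure. AE \<omega> in M. (norm (time_integral b (fst (t, \<omega>)) (snd (t, \<omega>))))\<^sup>2 \<le> T * ?f (snd (t, \<omega>))"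
    proof (rule AE_I2)
      fix t
      show "AE \<omega> in M. (norm (time_integral b (fst (t, \<omega>)) (snd (t, \<omega>))))\<^sup>2 \<le> T * ?f (snd (t, \<omega>))"
        using AE_norm_time_integral_sq_le[OF b] by eventually_elim simp
    qed
  qed
  then show "AE p in prod_measure. (norm (time_integral b (fst p) (snd p)))\<^sup>2 \<le> T * ?f (snd p)"
    unfolding prod_measure_def .
qed

lemma integral_prod_fst:
  assumes "integrable prod_measure (\<lambda>p. f (fst p) (snd p) :: real)"
  shows "(\<integral>p. f (fst p) (snd p) \<partial>prod_measure) = (\<integral>t. (\<integral>\<omega>. f t \<omega> \<partial>M) \<partial>time_measure)"
  using prod.integral_fst'[of "\<lambda>p. f (fst p) (snd p)"] assms by (simp add: prod_measure_def)

lemma integral_prod_snd: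
  assumes "integrable prod_measure (\<lambda>p. f (fst p) (snd p) :: real)"
  shows "(\<integral>p. f (fst p) (snd p) \<partial>prod_measure) = (\<integral>\<omega>. (\<integral>t. f t \<omega> \<partial>time_measure) \<partial>M)"
    and "integrable M (\<lambda>\<omega>. \<integral>t. f t \<omega> \<partial>time_measure)"
  using prod.integral_snd[of f] prod.integrable_snd[of f] assms by (simp_all add: prod_measure_def case_prod_beta')

lemma sq_process_inner:
  assumes "sq_process x" "sq_process y"
  shows "integrable prod_measure (\<lambda>p. x (fst p) (snd p) \<bullet> y (fst p) (snd p))"
  using integrable_inner_sq_int[OF assms[unfolded sq_process_iff]] .

lemma integral_time_integral_inner:
  fixes b :: "real \<Rightarrow> 'w \<Rightarrow> 'v::euclidean_space"
  assumes b: "sq_process b" and V: "sq_int M V"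
  shows "(\<integral>p. b (fst p) (snd p) \<bullet> V (snd p) \<partial>prod_measure) = (\<integral>\<omega>. time_integral b T \<omega> \<bullet> V \<omega> \<partial>M)"
proof -
  have "(\<integral>p. b (fst p) (snd p) \<bullet> V (snd p) \<partial>prod_measure) = (\<integral>\<omega>. (\<integral>t. b t \<omega> \<bullet> V \<omega> \<partial>time_measure) \<partial>M)"
    by (rule integral_prod_snd(1)[OF sq_process_inner[OF b sq_process_const[OF V]]])
  also have "\<dots> = (\<integral>\<omega>. time_integral b T \<omega> \<bullet> V \<omega> \<partial>M)"
  proof (rule integral_cong_AE)
    show "AE \<omega> in M. (\<integral>t. b t \<omega> \<bullet> V \<omega> \<partial>time_measure) = time_integral b T \<omega> \<bullet> V \<omega>"
      using sq_process_AE_path[OF b]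
      by eventually_elim (simp add: time_integral_T time.sq_int_integrable(1))
    show "(\<lambda>\<omega>. \<integral>t. b t \<omega> \<bullet> V \<omega> \<partial>time_measure) \<in> borel_measurable M"
      using integral_prod_snd(2)[OF sq_process_inner[OF b sq_process_const[OF V]]] by simp
    show "(\<lambda>\<omega>. time_integral b T \<omega> \<bullet> V \<omega>) \<in> borel_measurable M"
      using sq_intD(1)[OF V] time_integral_section_measurable[OF b, of T] T_pos by simp
  qed
  finally show ?thesis .
qed

text \<open>Integration by parts for absolutely continuous functions, seen as Fubini on a square:
  the two terms integrate the same kernel over the triangles below and above the diagonal.\<close>

lemma time_Fubini:
  fixes f g :: "real \<Rightarrow> 'v::euclidean_space"
  assumes f: "integrable time_measure f" and g: "integrable time_measure g"
  shows "(\<integral>t. f t \<bullet> (\<integral>s. indicator {..t} s *\<^sub>R g s \<partial>time_measure) \<partial>time_measure) +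
      (\<integral>s. (\<integral>t. indicator {..s} t *\<^sub>R f t \<partial>time_measure) \<bullet> g s \<partial>time_measure) =
      (\<integral>t. f t \<partial>time_measure) \<bullet> (\<integral>s. g s \<partial>time_measure)"
proof -
  interpret tt: pair_sigma_finite time_measure time_measure ..
  let ?Q = "time_measure \<Otimes>\<^sub>M time_measure"
  note [measurable] = borel_measurable_integrable[OF f] borel_measurable_integrable[OF g]
  have idm [measurable]: "(\<lambda>s::real. s) \<in> borel_measurable time_measure"
    unfolding time_measure_def by (rule measurable_restrict_space1) simp
  have Km: "(\<lambda>p. f (fst p) \<bullet> g (snd p)) \<in> borel_measurable ?Q" by measurable
  have K: "integrable ?Q (\<lambda>p. f (fst p) \<bullet> g (snd p))"
  proof (rule tt.Fubini_integrable[OF Km])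
    show "AE t in time_measure. integrable time_measure (\<lambda>s. f (fst (t, s)) \<bullet> g (snd (t, s)))"
      using g by simp
    show "integrable time_measure (\<lambda>t. \<integral>s. norm (f (fst (t, s)) \<bullet> g (snd (t, s))) \<partial>time_measure)"
    proof (rule Bochner_Integration.integrable_bound)
      show "integrable time_measure (\<lambda>t. norm (f t) * (\<integral>s. norm (g s) \<partial>time_measure))"
        using f by simp
      show "AE t in time_measure. norm (\<integral>s. norm (f (fst (t, s)) \<bullet> g (snd (t, s))) \<partial>time_measure)
          \<le> norm (norm (f t) * (\<integral>s. norm (g s) \<partial>time_measure))"
      proof (rule AE_I2)
        fix t
        have "(\<integral>s. norm (f t \<bullet> g s) \<partial>time_measure) \<le> (\<integral>s. norm (f t) * norm (g s) \<partial>time_measure)"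
          using g by (intro integral_mono) (auto intro: Cauchy_Schwarz_ineq2)
        moreover have "(\<integral>s. norm (f t \<bullet> g s) \<partial>time_measure) \<ge> 0" "(\<integral>s. norm (g s) \<partial>time_measure) \<ge> 0"
          by (auto intro!: Bochner_Integration.integral_nonneg)
        ultimately show "norm (\<integral>s. norm (f (fst (t, s)) \<bullet> g (snd (t, s))) \<partial>time_measure)
            \<le> norm (norm (f t) * (\<integral>s. norm (g s) \<partial>time_measure))"
          by simp
      qed
    qed measurable
  qed
  let ?K1 = "\<lambda>p. (if snd p \<le> fst p then 1 else 0) * (f (fst p) \<bullet> g (snd p))"
  let ?K2 = "\<lambda>p. (if fst p < snd p then 1 else 0) * (f (fst p) \<bullet> g (snd p))"
  have K1: "integrable ?Q ?K1" and K2: "integrable ?Q ?K2"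
    by (rule Bochner_Integration.integrable_bound[OF K]; (measurable | simp))+
  have ind: "integrable time_measure (\<lambda>s. indicator {..t} s *\<^sub>R h s)" if "integrable time_measure h" for h ::
      "real \<Rightarrow> 'v" and t
    by (rule Bochner_Integration.integrable_bound[OF that])
      (use that indicator_atMost_measurable[of t] in \<open>auto simp: indicator_def intro!:
          borel_measurable_scaleR[of "indicator {..t}", unfolded indicator_def]\<close>)
  have "(\<integral>p. f (fst p) \<bullet> g (snd p) \<partial>?Q) = (\<integral>t. (\<integral>s. f t \<bullet> g s \<partial>time_measure) \<partial>time_measure)"
    using tt.integral_fst'[OF K] by simp
  also have "\<dots> = (\<integral>t. f t \<partial>time_measure) \<bullet> (\<integral>s. g s \<partial>time_measure)"
    using f g by simp
  finally have "(\<integral>t. f t \<partial>time_measure) \<bullet> (\<integral>s. g s \<partial>time_measure) = (\<integral>p. f (fst p) \<bullet> g (snd p) \<partial>?Q)" ..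
  also have "\<dots> = (\<integral>p. ?K1 p + ?K2 p \<partial>?Q)"
    by (rule Bochner_Integration.integral_cong) auto
  also have "\<dots> = (\<integral>p. ?K1 p \<partial>?Q) + (\<integral>p. ?K2 p \<partial>?Q)"
    by (rule Bochner_Integration.integral_add[OF K1 K2])
  also have "(\<integral>p. ?K1 p \<partial>?Q) = (\<integral>t. (\<integral>s. ?K1 (t, s) \<partial>time_measure) \<partial>time_measure)"
    using tt.integral_fst'[OF K1] by simp
  also have "\<dots> = (\<integral>t. f t \<bullet> (\<integral>s. indicator {..t} s *\<^sub>R g s \<partial>time_measure) \<partial>time_measure)"
  proof (rule Bochner_Integration.integral_cong[OF refl])
    fix t
    have "(\<integral>s. ?K1 (t, s) \<partial>time_measure) = (\<integral>s. f t \<bullet> (indicator {..t} s *\<^sub>R g s) \<partial>time_measure)"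
      by (rule Bochner_Integration.integral_cong) (auto simp: indicator_def)
    also have "\<dots> = f t \<bullet> (\<integral>s. indicator {..t} s *\<^sub>R g s \<partial>time_measure)"
      by (rule integral_inner_right) (rule ind[OF g])
    finally show "(\<integral>s. ?K1 (t, s) \<partial>time_measure) = f t \<bullet> (\<integral>s. indicator {..t} s *\<^sub>R g s \<partial>time_measure)" .
  qed
  also have "(\<integral>p. ?K2 p \<partial>?Q) = (\<integral>s. (\<integral>t. ?K2 (t, s) \<partial>time_measure) \<partial>time_measure)"
    using tt.integral_snd[of "\<lambda>t s. ?K2 (t, s)"] K2 by (simp add: case_prod_beta')
  also have "\<dots> = (\<integral>s. (\<integral>t. indicator {..s} t *\<^sub>R f t \<partial>time_measure) \<bullet> g s \<partial>time_measure)"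
  proof (rule Bochner_Integration.integral_cong[OF refl])
    fix s
    \<comment> \<open>The second triangle has a strict inequality while the cut-off has a weak one;
      the diagonal is a null set for each fixed s.\<close>
    have ne: "AE t in time_measure. t \<noteq> s"
      unfolding time_measure_def using AE_lborel_singleton[of s]
      by (subst AE_restrict_space_iff) (auto elim: eventually_mono)
    have "(\<integral>t. ?K2 (t, s) \<partial>time_measure) = (\<integral>t. (indicator {..s} t *\<^sub>R f t) \<bullet> g s \<partial>time_measure)"
    proof (rule integral_cong_AE)
      show "AE t in time_measure. ?K2 (t, s) = (indicator {..s} t *\<^sub>R f t) \<bullet> g s"
        using ne by eventually_elim (auto simp: indicator_def)
      show "(\<lambda>t. (indicator {..s} t *\<^sub>R f t) \<bullet> g s) \<in> borel_measurable time_measure"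
        using borel_measurable_integrable[OF ind[OF f, of s]] by simp
      show "(\<lambda>t. ?K2 (t, s)) \<in> borel_measurable time_measure"
        unfolding fst_conv snd_conv by measurable
    qed
    also have "\<dots> = (\<integral>t. indicator {..s} t *\<^sub>R f t \<partial>time_measure) \<bullet> g s"
      by (rule integral_inner_left) (rule ind[OF f])
    finally show "(\<integral>t. ?K2 (t, s) \<partial>time_measure) = (\<integral>t. indicator {..s} t *\<^sub>R f t \<partial>time_measure) \<bullet> g s" .
  qed
  finally show ?thesis by simp
qed

text \<open>Pathwise integration by parts, averaged: it disposes of the product of the two drift
  parts in the product formula.\<close>

lemma integral_time_integrals:
  fixes b g :: "real \<Rightarrow> 'w \<Rightarrow> 'v::euclidean_space"
  assumes b: "sq_process b" and g: "sq_process g"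
  shows "(\<integral>p. b (fst p) (snd p) \<bullet> time_integral g (fst p) (snd p) \<partial>prod_measure) +
      (\<integral>p. time_integral b (fst p) (snd p) \<bullet> g (fst p) (snd p) \<partial>prod_measure) =
      (\<integral>\<omega>. time_integral b T \<omega> \<bullet> time_integral g T \<omega> \<partial>M)"
proof -
  note bG = sq_process_inner[OF b sq_process_time_integral[OF g]]
  note Bg = sq_process_inner[OF sq_process_time_integral[OF b] g]
  have "(\<integral>p. b (fst p) (snd p) \<bullet> time_integral g (fst p) (snd p) \<partial>prod_measure) +
      (\<integral>p. time_integral b (fst p) (snd p) \<bullet> g (fst p) (snd p) \<partial>prod_measure) =
      (\<integral>\<omega>. (\<integral>t. b t \<omega> \<bullet> time_integral g t \<omega> \<partial>time_measure) + (\<integral>t. time_integral b t \<omega> \<bullet> g t \<omega> \<partial>time_measure) \<partial>M)"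
    using integral_prod_snd[OF bG] integral_prod_snd[OF Bg] by simp
  also have "\<dots> = (\<integral>\<omega>. time_integral b T \<omega> \<bullet> time_integral g T \<omega> \<partial>M)"
  proof (rule integral_cong_AE)
    show "AE \<omega> in M. (\<integral>t. b t \<omega> \<bullet> time_integral g t \<omega> \<partial>time_measure) +
        (\<integral>t. time_integral b t \<omega> \<bullet> g t \<omega> \<partial>time_measure) =
        time_integral b T \<omega> \<bullet> time_integral g T \<omega>"
      using sq_process_AE_path[OF b] sq_process_AE_path[OF g]
    proof eventually_elim
      case (elim \<omega>)
      from time_Fubini[OF elim[THEN time.sq_int_integrable(1)]] show ?case
        unfolding time_integral_T unfolding time_integral_def .
    qed
    show "(\<lambda>\<omega>. (\<integral>t. b t \<omega> \<bullet> time_integral g t \<omega> \<partial>time_measure) + (\<integral>t. time_integral b t \<omega> \<bullet> g t \<omega> \<partial>time_measure))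
        \<in> borel_measurable M"
      using integral_prod_snd(2)[OF bG] integral_prod_snd(2)[OF Bg] by simp
    show "(\<lambda>\<omega>. time_integral b T \<omega> \<bullet> time_integral g T \<omega>) \<in> borel_measurable M"
      using time_integral_section_measurable[OF b, of T] time_integral_section_measurable[OF g, of T] T_pos by simp
  qed
  finally show ?thesis .
qed

end

lemma borel_measurable_vec_lambda:
  fixes f :: "'k::finite \<Rightarrow> 'a \<Rightarrow> real"
  assumes "\<And>a. f a \<in> borel_measurable N"
  shows "(\<lambda>x. \<chi> a. f a x) \<in> borel_measurable N"
  by (subst borel_measurable_euclidean_space) (use assms in \<open>auto simp: Basis_vec_def inner_axis\<close>)

lemma borel_measurable_vec_nth:
  fixes f :: "'a \<Rightarrow> real^'k"
  assumes "f \<in> borel_measurable N"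
  shows "(\<lambda>x. f x $ a) \<in> borel_measurable N"
proof -
  have "(\<lambda>x. f x \<bullet> axis a 1) \<in> borel_measurable N" using assms by simp
  then show ?thesis by (simp add: inner_axis)
qed

text \<open>Division by a norm that may vanish, as needed to see that conditional expectation is a
  contraction.\<close>

lemma le_of_le_sqrt_mult:
  fixes p q :: real
  assumes "0 \<le> p" "0 \<le> q" "q \<le> sqrt p * sqrt q"
  shows "q \<le> p"
proof (cases "q = 0")
  case False
  then have "sqrt q > 0" using assms(2) by simp
  moreover have "sqrt q * sqrt q \<le> sqrt p * sqrt q" using assms by simp
  ultimately have "sqrt q \<le> sqrt p" by (rule mult_right_le_imp_le[rotated])
  then show ?thesis by simp
qed (use assms(1) in simp)

context regime_switching
begin

subsection \<open>The product formula\<close>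

lemma sq_martingaleD:
  assumes "sq_martingale N"
  shows "t \<in> {0..T} \<Longrightarrow> sq_int M (N t)" "AE \<omega> in M. N 0 \<omega> = 0"
    "0 \<le> s \<Longrightarrow> s \<le> t \<Longrightarrow> t \<le> T \<Longrightarrow> \<eta> \<in> borel_measurable (filt s) \<Longrightarrow> sq_int M \<eta> \<Longrightarrow>
      (\<integral>\<omega>. N t \<omega> \<bullet> \<eta> \<omega> \<partial>M) = (\<integral>\<omega>. N s \<omega> \<bullet> \<eta> \<omega> \<partial>M)"
  using assms unfolding sq_martingale_def by blast+

lemma sq_martingale_orthogonal_0:
  assumes N: "sq_martingale N" and \<eta>: "\<eta> \<in> borel_measurable (filt 0)" "sq_int M \<eta>" and t: "t \<in> {0..T}"
  shows "(\<integral>\<omega>. N t \<omega> \<bullet> \<eta> \<omega> \<partial>M) = 0"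
proof -
  have "(\<integral>\<omega>. N t \<omega> \<bullet> \<eta> \<omega> \<partial>M) = (\<integral>\<omega>. N 0 \<omega> \<bullet> \<eta> \<omega> \<partial>M)"
    by (rule sq_martingaleD(3)[OF N _ _ _ \<eta>]) (use t in auto)
  also have "\<dots> = (\<integral>\<omega>. 0 \<partial>M)"
  proof (rule integral_cong_AE)
    show "AE \<omega> in M. N 0 \<omega> \<bullet> \<eta> \<omega> = 0"
      using sq_martingaleD(2)[OF N] by eventually_elim simp
    show "(\<lambda>\<omega>. N 0 \<omega> \<bullet> \<eta> \<omega>) \<in> borel_measurable M"
      using sq_intD(1)[OF sq_martingaleD(1)[OF N, of 0]] sq_intD(1)[OF \<eta>(2)] T_pos by simp
  qed simp
  finally show ?thesis by simp
qed

lemma sq_martingale_add: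
  fixes N K :: "real \<Rightarrow> 'w \<Rightarrow> 'v::euclidean_space"
  assumes N: "sq_martingale N" and K: "sq_martingale K"
  shows "sq_martingale (\<lambda>t \<omega>. N t \<omega> + K t \<omega>)"
  unfolding sq_martingale_def
proof (intro conjI ballI allI impI)
  show "sq_int M (\<lambda>\<omega>. N t \<omega> + K t \<omega>)" if "t \<in> {0..T}" for t
    by (rule sq_int_add[OF sq_martingaleD(1)[OF N that] sq_martingaleD(1)[OF K that]])
  show "AE \<omega> in M. N 0 \<omega> + K 0 \<omega> = 0"
    using sq_martingaleD(2)[OF N] sq_martingaleD(2)[OF K] by eventually_elim simp
  fix s t :: real and \<eta> :: "'w \<Rightarrow> 'v"
  assume st: "0 \<le> s" "s \<le> t" "t \<le> T" and \<eta>: "\<eta> \<in> borel_measurable (filt s)" "sq_int M \<eta>"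
  have e: "(\<integral>\<omega>. (N r \<omega> + K r \<omega>) \<bullet> \<eta> \<omega> \<partial>M) = (\<integral>\<omega>. N r \<omega> \<bullet> \<eta> \<omega> \<partial>M) + (\<integral>\<omega>. K r \<omega> \<bullet> \<eta> \<omega> \<partial>M)" if "r \<in> {0..T}" for r
    using integrable_inner_sq_int[OF sq_martingaleD(1)[OF N that] \<eta>(2)]
        integrable_inner_sq_int[OF sq_martingaleD(1)[OF K that] \<eta>(2)]
    by (simp add: inner_add_left)
  show "(\<integral>\<omega>. (N t \<omega> + K t \<omega>) \<bullet> \<eta> \<omega> \<partial>M) = (\<integral>\<omega>. (N s \<omega> + K s \<omega>) \<bullet> \<eta> \<omega> \<partial>M)"
    using e[of t] e[of s] st sq_martingaleD(3)[OF N st \<eta>] sq_martingaleD(3)[OF K st \<eta>] by simp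
qed

text \<open>At a fixed time t the variable \<open>b t\<close> is known, so the martingale part of y
  may be moved forward from t to T. The sum of \<open>y 0\<close> and \<open>N T\<close> then no
  longer depends on time and leaves the time integral.\<close>

lemma drift_product:
  fixes y b g N :: "real \<Rightarrow> 'w \<Rightarrow> 'v::euclidean_space"
  assumes N: "sq_martingale N" and y: "sq_process y" and b: "sq_process b" "adapted b" and g: "sq_process g"
    and y0: "sq_int M (y 0)"
    and eq: "AE \<omega> in M. \<forall>t\<in>{0..T}. y t \<omega> = y 0 \<omega> + time_integral g t \<omega> + N t \<omega>"
  shows "(\<integral>p. b (fst p) (snd p) \<bullet> y (fst p) (snd p) \<partial>prod_measure) =
    (\<integral>\<omega>. time_integral b T \<omega> \<bullet> (y 0 \<omega> + N T \<omega>) \<partial>M) + (\<integral>p. b (fst p) (snd p) \<bullet> time_integral g (fst p) (snd p)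
        \<partial>prod_measure)"
proof -
  have TT: "T \<in> {0..T}" using T_pos by simp
  define V where "V \<omega> = y 0 \<omega> + N T \<omega>" for \<omega>
  have V: "sq_int M V"
    unfolding V_def[abs_def] by (rule sq_int_add[OF y0 sq_martingaleD(1)[OF N TT]])
  have bV: "integrable prod_measure (\<lambda>p. b (fst p) (snd p) \<bullet> V (snd p))"
    by (rule sq_process_inner[OF b(1) sq_process_const[OF V]])
  have bG: "integrable prod_measure (\<lambda>p. b (fst p) (snd p) \<bullet> time_integral g (fst p) (snd p))"
    by (rule sq_process_inner[OF b(1) sq_process_time_integral[OF g]])
  have by_int: "integrable prod_measure (\<lambda>p. b (fst p) (snd p) \<bullet> y (fst p) (snd p))"
    by (rule sq_process_inner[OF b(1) y])
  have int: "integrable prod_measure (\<lambda>p. b (fst p) (snd p) \<bullet> V (snd p) +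
      b (fst p) (snd p) \<bullet> time_integral g (fst p) (snd p))"
    using bV bG by simp
  have "(\<integral>p. b (fst p) (snd p) \<bullet> y (fst p) (snd p) \<partial>prod_measure) = (\<integral>t. (\<integral>\<omega>. b t \<omega> \<bullet> y t \<omega> \<partial>M) \<partial>time_measure)"
    by (rule integral_prod_fst[OF by_int])
  also have "\<dots> = (\<integral>t. (\<integral>\<omega>. b t \<omega> \<bullet> V \<omega> + b t \<omega> \<bullet> time_integral g t \<omega> \<partial>M) \<partial>time_measure)"
  proof (rule integral_cong_AE)
    show "(\<lambda>t. \<integral>\<omega>. b t \<omega> \<bullet> y t \<omega> \<partial>M) \<in> borel_measurable time_measure"
      using prod.integrable_fst[of "\<lambda>t \<omega>. b t \<omega> \<bullet> y t \<omega>"] by_int by (simp add: prod_measure_def case_prod_beta')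
    show "(\<lambda>t. \<integral>\<omega>. b t \<omega> \<bullet> V \<omega> + b t \<omega> \<bullet> time_integral g t \<omega> \<partial>M) \<in> borel_measurable time_measure"
      using prod.integrable_fst[of "\<lambda>t \<omega>. b t \<omega> \<bullet> V \<omega> + b t \<omega> \<bullet> time_integral g t \<omega>"] int
          by (simp add: prod_measure_def case_prod_beta')
    show "AE t in time_measure. (\<integral>\<omega>. b t \<omega> \<bullet> y t \<omega> \<partial>M) = (\<integral>\<omega>. b t \<omega> \<bullet> V \<omega> + b t \<omega> \<bullet> time_integral g t \<omega> \<partial>M)"
      using sq_process_AE_time[OF b(1)]
    proof (rule AE_mp, intro AE_I2 impI)
      fix t assume "t \<in> space time_measure" and bt: "sq_int M (b t)"
      then have t: "t \<in> {0..T}" by simp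
      have bt_meas: "b t \<in> borel_measurable (filt t)" using b(2) t by (simp add: adapted_def)
      have i1: "integrable M (\<lambda>\<omega>. b t \<omega> \<bullet> y 0 \<omega>)" "integrable M (\<lambda>\<omega>. b t \<omega> \<bullet> time_integral g t \<omega>)"
        "integrable M (\<lambda>\<omega>. b t \<omega> \<bullet> N t \<omega>)" "integrable M (\<lambda>\<omega>. b t \<omega> \<bullet> N T \<omega>)"
        using integrable_inner_sq_int[OF bt] y0 sq_int_time_integral(1)[OF g t] sq_martingaleD(1)[OF N] t TT by auto
      have "(\<integral>\<omega>. b t \<omega> \<bullet> y t \<omega> \<partial>M) = (\<integral>\<omega>. b t \<omega> \<bullet> y 0 \<omega> + b t \<omega> \<bullet> time_integral g t \<omega> + b t \<omega> \<bullet> N t \<omega> \<partial>M)"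
      proof (rule integral_cong_AE)
        show "AE \<omega> in M. b t \<omega> \<bullet> y t \<omega> = b t \<omega> \<bullet> y 0 \<omega> + b t \<omega> \<bullet> time_integral g t \<omega> + b t \<omega> \<bullet> N t \<omega>"
          using eq
        proof eventually_elim
          case (elim \<omega>)
          then have "y t \<omega> = y 0 \<omega> + time_integral g t \<omega> + N t \<omega>" using t by blast
          then show ?case by (simp only: inner_add_right)
        qed
        show "(\<lambda>\<omega>. b t \<omega> \<bullet> y t \<omega>) \<in> borel_measurable M"
          using sq_intD(1)[OF bt] sq_process_section[OF y t] by simp
      qed (use i1 in auto)
      also have "\<dots> = (\<integral>\<omega>. b t \<omega> \<bullet> y 0 \<omega> \<partial>M) + (\<integral>\<omega>. b t \<omega> \<bullet> time_integral g t \<omega> \<partial>M) + (\<integral>\<omega>. b t \<omega> \<bullet> N t \<omega> \<partial>M)"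
        using i1 by simp
      \<comment> \<open>The martingale property with the test variable \<open>b t\<close>; here the
        adaptedness of b is used.\<close>
      also have "(\<integral>\<omega>. b t \<omega> \<bullet> N t \<omega> \<partial>M) = (\<integral>\<omega>. b t \<omega> \<bullet> N T \<omega> \<partial>M)"
        using sq_martingaleD(3)[OF N _ _ _ bt_meas bt, of T] t by (simp add: inner_commute)
      finally show "(\<integral>\<omega>. b t \<omega> \<bullet> y t \<omega> \<partial>M) = (\<integral>\<omega>. b t \<omega> \<bullet> V \<omega> + b t \<omega> \<bullet> time_integral g t \<omega> \<partial>M)"
        using i1 by (simp add: V_def inner_add_right)
    qed
  qed
  also have "\<dots> = (\<integral>p. b (fst p) (snd p) \<bullet> V (snd p) + b (fst p) (snd p) \<bullet> time_integral g (fst p) (snd p)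
      \<partial>prod_measure)"
    by (rule integral_prod_fst[OF int, symmetric])
  also have "\<dots> = (\<integral>p. b (fst p) (snd p) \<bullet> V (snd p) \<partial>prod_measure) +
      (\<integral>p. b (fst p) (snd p) \<bullet> time_integral g (fst p) (snd p) \<partial>prod_measure)"
    using bV bG by simp
  also have "(\<integral>p. b (fst p) (snd p) \<bullet> V (snd p) \<partial>prod_measure) = (\<integral>\<omega>. time_integral b T \<omega> \<bullet> V \<omega> \<partial>M)"
    by (rule integral_time_integral_inner[OF b(1) V])
  finally show ?thesis by (simp add: V_def)
qed

text \<open>Integration by parts in expectation. Both terminal values are written as initial value
  plus drift plus martingale and multiplied out. \<open>drift_product\<close> accounts for a drift
  against the initial value and the martingale of the other process,
  \<open>integral_time_integrals\<close> for drift against drift, and the isometry together with the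
  orthogonality of W and jumps for martingale against martingale.\<close>

theorem product_formula:
  fixes x y b g \<sigma> z I I' J :: "real \<Rightarrow> 'w \<Rightarrow> 'v::euclidean_space"
  assumes I: "W_integral \<sigma> I" and I': "W_integral z I'"
    and J: "sq_martingale J" "(\<integral>\<omega>. I T \<omega> \<bullet> J T \<omega> \<partial>M) = 0"
    and x: "sq_process x" "adapted x" "sq_int M (x 0)" and y: "sq_process y" "adapted y" "sq_int M (y 0)"
    and b: "sq_process b" "adapted b" and g: "sq_process g" "adapted g"
    and x_eq: "AE \<omega> in M. \<forall>t\<in>{0..T}. x t \<omega> = x 0 \<omega> + (LBINT s:{0..t}. b s \<omega>) + I t \<omega>"
    and y_eq: "AE \<omega> in M. \<forall>t\<in>{0..T}. y t \<omega> = y 0 \<omega> + (LBINT s:{0..t}. g s \<omega>) + I' t \<omega> + J t \<omega>"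
  shows "(\<integral>\<omega>. x T \<omega> \<bullet> y T \<omega> \<partial>M) - (\<integral>\<omega>. x 0 \<omega> \<bullet> y 0 \<omega> \<partial>M) =
    (\<integral>p. b (fst p) (snd p) \<bullet> y (fst p) (snd p) \<partial>prod_measure) +
    (\<integral>p. x (fst p) (snd p) \<bullet> g (fst p) (snd p) \<partial>prod_measure) +
    (\<integral>p. \<sigma> (fst p) (snd p) \<bullet> z (fst p) (snd p) \<partial>prod_measure)"
proof -
  have TT: "T \<in> {0..T}" and z0: "0 \<in> {0..T}" using T_pos by auto
  define N where "N t \<omega> = I' t \<omega> + J t \<omega>" for t \<omega>
  have I_mart: "sq_martingale I" and I'_mart: "sq_martingale I'"
    using sq_martingale_W_integral I I' by auto
  have N: "sq_martingale N"
    unfolding N_def[abs_def] by (rule sq_martingale_add[OF I'_mart J(1)])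
  have x_eq': "AE \<omega> in M. \<forall>t\<in>{0..T}. x t \<omega> = x 0 \<omega> + time_integral b t \<omega> + I t \<omega>"
    using x_eq
  proof eventually_elim
    case (elim \<omega>)
    show ?case
    proof
      fix t assume t: "t \<in> {0..T}"
      have "x t \<omega> = x 0 \<omega> + (LBINT s:{0..t}. b s \<omega>) + I t \<omega>"
        using elim t by blast
      then show "x t \<omega> = x 0 \<omega> + time_integral b t \<omega> + I t \<omega>"
        by (simp only: time_integral_eq[OF t])
    qed
  qed
  have y_eq': "AE \<omega> in M. \<forall>t\<in>{0..T}. y t \<omega> = y 0 \<omega> + time_integral g t \<omega> + N t \<omega>"
    using y_eq
  proof eventually_elim
    case (elim \<omega>)
    show ?case
    proof
      fix t assume t: "t \<in> {0..T}"
      have "y t \<omega> = y 0 \<omega> + (LBINT s:{0..t}. g s \<omega>) + I' t \<omega> + J t \<omega>"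
        using elim t by blast
      then show "y t \<omega> = y 0 \<omega> + time_integral g t \<omega> + N t \<omega>"
        by (simp only: time_integral_eq[OF t] N_def add.assoc)
    qed
  qed
  let ?B = "time_integral b T" and ?G = "time_integral g T"
  have sq: "sq_int M ?B" "sq_int M ?G" "sq_int M (I T)" "sq_int M (N T)" "sq_int M (I' T)" "sq_int M (J T)"
    using sq_int_time_integral(1)[OF b(1) TT] sq_int_time_integral(1)[OF g(1) TT] sq_martingaleD(1)[OF I_mart TT]
      sq_martingaleD(1)[OF N TT] sq_martingaleD(1)[OF I'_mart TT] sq_martingaleD(1)[OF J(1) TT] by auto
  note int = integrable_inner_sq_int
  have x0: "x 0 \<in> borel_measurable (filt 0)" and y0: "y 0 \<in> borel_measurable (filt 0)"
    using x(2) y(2) z0 by (auto simp: adapted_def)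
  have d1: "(\<integral>p. b (fst p) (snd p) \<bullet> y (fst p) (snd p) \<partial>prod_measure) =
      (\<integral>\<omega>. ?B \<omega> \<bullet> y 0 \<omega> \<partial>M) + (\<integral>\<omega>. ?B \<omega> \<bullet> N T \<omega> \<partial>M) + (\<integral>p. b (fst p) (snd p) \<bullet> time_integral g (fst p) (snd p)
          \<partial>prod_measure)"
    using drift_product[OF N y(1) b g(1) y(3) y_eq'] int[OF sq(1) y(3)] int[OF sq(1,4)]
    by (simp add: inner_add_right)
  have d2: "(\<integral>p. x (fst p) (snd p) \<bullet> g (fst p) (snd p) \<partial>prod_measure) =
      (\<integral>\<omega>. x 0 \<omega> \<bullet> ?G \<omega> \<partial>M) + (\<integral>\<omega>. I T \<omega> \<bullet> ?G \<omega> \<partial>M) + (\<integral>p. time_integral b (fst p) (snd p) \<bullet> g (fst p) (snd p)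
          \<partial>prod_measure)"
    using drift_product[OF I_mart x(1) g b(1) x(3) x_eq'] int[OF sq(2) x(3)] int[OF sq(2,3)]
    by (simp add: inner_add_right inner_commute)
  have d3: "(\<integral>p. \<sigma> (fst p) (snd p) \<bullet> z (fst p) (snd p) \<partial>prod_measure) = (\<integral>\<omega>. I T \<omega> \<bullet> N T \<omega> \<partial>M)"
  proof -
    have "(\<integral>\<omega>. I T \<omega> \<bullet> N T \<omega> \<partial>M) = (\<integral>\<omega>. I T \<omega> \<bullet> I' T \<omega> \<partial>M)"
      unfolding N_def using J(2) int[OF sq(3,5)] int[OF sq(3,6)] by (simp add: inner_add_right)
    also have "\<dots> = (\<integral>p. indicator {..T} (fst p) * (\<sigma> (fst p) (snd p) \<bullet> z (fst p) (snd p)) \<partial>prod_measure)"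
      by (rule Ito_isometry[OF I I' TT])
    also have "\<dots> = (\<integral>p. \<sigma> (fst p) (snd p) \<bullet> z (fst p) (snd p) \<partial>prod_measure)"
      by (rule Bochner_Integration.integral_cong) (auto simp: space_prod_measure)
    finally show ?thesis by simp
  qed
  have o1: "(\<integral>\<omega>. I T \<omega> \<bullet> y 0 \<omega> \<partial>M) = 0"
    by (rule sq_martingale_orthogonal_0[OF I_mart y0 y(3) TT])
  have o2: "(\<integral>\<omega>. x 0 \<omega> \<bullet> N T \<omega> \<partial>M) = 0"
    using sq_martingale_orthogonal_0[OF N x0 x(3) TT] by (simp add: inner_commute)
  \<comment> \<open>Of the nine products, an initial value against the martingale part of the other
    process has mean 0 by \<open>o1\<close> and \<open>o2\<close>; the others are matched with
    \<open>d1\<close>, \<open>d2\<close> and \<open>d3\<close>.\<close>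
  have "(\<integral>\<omega>. x T \<omega> \<bullet> y T \<omega> \<partial>M) = (\<integral>\<omega>. x 0 \<omega> \<bullet> y 0 \<omega> + x 0 \<omega> \<bullet> ?G \<omega> + x 0 \<omega> \<bullet> N T \<omega> + ?B \<omega> \<bullet> y 0 \<omega> + ?B \<omega> \<bullet> ?G \<omega> +
      ?B \<omega> \<bullet> N T \<omega> +
      I T \<omega> \<bullet> y 0 \<omega> + I T \<omega> \<bullet> ?G \<omega> + I T \<omega> \<bullet> N T \<omega> \<partial>M)"
  proof (rule integral_cong_AE)
    show "AE \<omega> in M. x T \<omega> \<bullet> y T \<omega> = x 0 \<omega> \<bullet> y 0 \<omega> + x 0 \<omega> \<bullet> ?G \<omega> + x 0 \<omega> \<bullet> N T \<omega> + ?B \<omega> \<bullet> y 0 \<omega> + ?B \<omega> \<bullet> ?G \<omega> +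
        ?B \<omega> \<bullet> N T \<omega> +
      I T \<omega> \<bullet> y 0 \<omega> + I T \<omega> \<bullet> ?G \<omega> + I T \<omega> \<bullet> N T \<omega>"
      using x_eq' y_eq'
    proof eventually_elim
      case (elim \<omega>)
      then have "x T \<omega> = x 0 \<omega> + ?B \<omega> + I T \<omega>" "y T \<omega> = y 0 \<omega> + ?G \<omega> + N T \<omega>"
        using TT by blast+
      then show ?case by (simp add: inner_add_left inner_add_right)
    qed
    show "(\<lambda>\<omega>. x T \<omega> \<bullet> y T \<omega>) \<in> borel_measurable M"
      using sq_process_section[OF x(1) TT] sq_process_section[OF y(1) TT] by simp
  qed (use int[OF x(3) y(3)] int[OF x(3) sq(2)] int[OF x(3) sq(4)] int[OF sq(1) y(3)] int[OF sq(1,2)] int[OF sq(1,4)]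
      int[OF sq(3) y(3)] int[OF sq(3,2)] int[OF sq(3,4)] in auto)
  also have "\<dots> = (\<integral>\<omega>. x 0 \<omega> \<bullet> y 0 \<omega> \<partial>M) + (\<integral>\<omega>. x 0 \<omega> \<bullet> ?G \<omega> \<partial>M) + (\<integral>\<omega>. x 0 \<omega> \<bullet> N T \<omega> \<partial>M) + (\<integral>\<omega>. ?B \<omega> \<bullet> y 0 \<omega> \<partial>M) +
      (\<integral>\<omega>. ?B \<omega> \<bullet> ?G \<omega> \<partial>M) + (\<integral>\<omega>. ?B \<omega> \<bullet> N T \<omega> \<partial>M) + (\<integral>\<omega>. I T \<omega> \<bullet> y 0 \<omega> \<partial>M) + (\<integral>\<omega>. I T \<omega> \<bullet> ?G \<omega> \<partial>M) +
          (\<integral>\<omega>. I T \<omega> \<bullet> N T \<omega> \<partial>M)"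
    using int[OF x(3) y(3)] int[OF x(3) sq(2)] int[OF x(3) sq(4)] int[OF sq(1) y(3)] int[OF sq(1,2)] int[OF sq(1,4)]
      int[OF sq(3) y(3)] int[OF sq(3,2)] int[OF sq(3,4)] by simp
  finally show ?thesis
    using d1 d2 d3 o1 o2 integral_time_integrals[OF b(1) g(1)] by linarith
qed

subsection \<open>Conditional expectations given the chain\<close>

text \<open>Works because \<open>filt\<close> contains the null sets: the two preimages of a Borel
  set differ inside the null set where f and g disagree.\<close>

lemma filt_measurable_AE_cong:
  fixes f g :: "'w \<Rightarrow> 'v::euclidean_space"
  assumes t: "t \<le> T" and f: "f \<in> borel_measurable (filt t)" and g: "g \<in> borel_measurable M" and eq:
      "AE \<omega> in M. f \<omega> = g \<omega>"
  shows "g \<in> borel_measurable (filt t)"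
proof (rule measurableI)
  have fM: "f \<in> borel_measurable M"
    by (rule measurable_from_subalg[OF subalgebra_filt[OF t] f])
  define N where "N = {\<omega> \<in> space M. f \<omega> \<noteq> g \<omega>}"
  have "{\<omega> \<in> space M. f \<omega> = g \<omega>} \<in> sets M"
    using fM g by measurable
  then have "space M - {\<omega> \<in> space M. f \<omega> = g \<omega>} \<in> sets M" by auto
  also have "space M - {\<omega> \<in> space M. f \<omega> = g \<omega>} = N" by (auto simp: N_def)
  finally have NM: "N \<in> sets M" .
  then have null: "N \<in> null_sets M"
    using eq by (subst (asm) AE_iff_null[where P = "\<lambda>\<omega>. f \<omega> = g \<omega>"]) (auto simp: N_def)
  have null_filt: "C \<in> sets (filt t)" if "C \<in> null_sets M" for C
    using that t by (auto simp: sets_filt intro: sigma_sets.Basic)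
  fix B :: "'v set" assume B: "B \<in> sets borel"
  have "f -` B \<inter> space (filt t) - N \<in> sets (filt t)"
    using measurable_sets[OF f B] null_filt[OF null] by blast
  \<comment> \<open>Completeness of M is not assumed, so the part inside the null set is measurable
    because g is.\<close>
  moreover have "g -` B \<inter> space M \<inter> N \<in> sets (filt t)"
    using null measurable_sets[OF g B] by (intro null_filt null_set_Int1) auto
  moreover have "g -` B \<inter> space (filt t) = (f -` B \<inter> space (filt t) - N) \<union> (g -` B \<inter> space M \<inter> N)"
    by (auto simp: N_def)
  ultimately show "g -` B \<inter> space (filt t) \<in> sets (filt t)"
    by (simp only: sets.Un)
qed simp

text \<open>The filtration of the chain is not augmented, so a version \<open>xh\<close> that agrees
  only almost everywhere need not be measurable for it. The variable \<open>\<xi>\<close> is, and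
  replaces \<open>xh\<close> wherever a test variable for conditioning is needed.\<close>

lemma cond_version_adapted_version:
  fixes x xh :: "real \<Rightarrow> 'w \<Rightarrow> real^'k"
  assumes "cond_version x xh" "t \<in> {0..T}"
  obtains \<xi> where "\<xi> \<in> borel_measurable (filt_alpha t)" "AE \<omega> in M. xh t \<omega> = \<xi> \<omega>"
    "\<And>a. (\<lambda>\<omega>. \<xi> \<omega> $ a) = real_cond_exp M (filt_alpha t) (\<lambda>\<omega>. x t \<omega> $ a)"
proof
  let ?\<xi> = "\<lambda>\<omega>. \<chi> a. real_cond_exp M (filt_alpha t) (\<lambda>\<omega>. x t \<omega> $ a) \<omega>"
  show "?\<xi> \<in> borel_measurable (filt_alpha t)"
    by (rule borel_measurable_vec_lambda) (rule borel_measurable_cond_exp)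
  have "AE \<omega> in M. \<forall>a\<in>UNIV. xh t \<omega> $ a = real_cond_exp M (filt_alpha t) (\<lambda>\<omega>. x t \<omega> $ a) \<omega>"
    using assms by (intro AE_finite_allI) (auto simp: cond_version_def)
  then show "AE \<omega> in M. xh t \<omega> = ?\<xi> \<omega>"
    by eventually_elim (simp add: vec_eq_iff)
qed simp

lemma cond_version_measurable:
  assumes "cond_version x xh" "t \<in> {0..T}"
  shows "xh t \<in> borel_measurable M"
  using assms by (intro measurable_process_section) (auto simp: cond_version_def)

lemma cond_version_adapted:
  assumes "cond_version x xh"
  shows "adapted xh"
  unfolding adapted_def
proof
  fix t assume t: "t \<in> {0..T}"
  obtain \<xi> where \<xi>: "\<xi> \<in> borel_measurable (filt_alpha t)" "AE \<omega> in M. xh t \<omega> = \<xi> \<omega>"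
    using cond_version_adapted_version[OF assms t] by blast
  have "\<xi> \<in> borel_measurable (filt t)"
    using t by (intro measurable_from_subalg[OF filt_alpha_le_filt \<xi>(1)]) auto
  then show "xh t \<in> borel_measurable (filt t)"
  proof (rule filt_measurable_AE_cong[rotated])
    show "AE \<omega> in M. \<xi> \<omega> = xh t \<omega>" using \<xi>(2) by eventually_elim simp
    show "xh t \<in> borel_measurable M" by (rule cond_version_measurable[OF assms t])
  qed (use t in auto)
qed

text \<open>Coordinatewise Jensen gives square integrability, coordinatewise pulling out gives the
  projection identity. Testing with \<open>xh\<close> itself, in its measurable version, and
  Cauchy-Schwarz give the contraction.\<close>

lemma cond_version_inner:
  fixes x xh :: "real \<Rightarrow> 'w \<Rightarrow> real^'k"
  assumes xh: "cond_version x xh" and t: "t \<in> {0..T}" and x: "sq_int M (x t)"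
  shows sq_int_cond_version: "sq_int M (xh t)"
    and integral_cond_version_inner: "\<eta> \<in> borel_measurable (filt_alpha t) \<Longrightarrow> sq_int M \<eta> \<Longrightarrow>
      (\<integral>\<omega>. x t \<omega> \<bullet> \<eta> \<omega> \<partial>M) = (\<integral>\<omega>. xh t \<omega> \<bullet> \<eta> \<omega> \<partial>M)"
    and norm_cond_version_le: "(\<integral>\<omega>. (norm (xh t \<omega>))\<^sup>2 \<partial>M) \<le> (\<integral>\<omega>. (norm (x t \<omega>))\<^sup>2 \<partial>M)"
proof -
  interpret sigma_finite_subalgebra M "filt_alpha t"
    using t by (intro sigma_finite_filt_alpha) auto
  obtain \<xi> where \<xi>: "\<xi> \<in> borel_measurable (filt_alpha t)" "AE \<omega> in M. xh t \<omega> = \<xi> \<omega>"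
    and \<xi>_eq: "\<And>a. (\<lambda>\<omega>. \<xi> \<omega> $ a) = real_cond_exp M (filt_alpha t) (\<lambda>\<omega>. x t \<omega> $ a)"
    by (rule cond_version_adapted_version[OF xh t]) blast
  have \<xi>M: "\<xi> \<in> borel_measurable M"
    by (rule measurable_from_subalg[OF subalg \<xi>(1)])
  have xa: "sq_int M (\<lambda>\<omega>. x t \<omega> $ a)" for a
    by (rule sq_int_bounded_linear[OF x bounded_linear_vec_nth])
  have "integrable M (\<lambda>\<omega>. (\<xi> \<omega> $ a)\<^sup>2)" for a
  proof -
    have "integrable M (\<lambda>\<omega>. (real_cond_exp M (filt_alpha t) (\<lambda>\<omega>. x t \<omega> $ a) \<omega>)\<^sup>2)"
      by (rule integrable_convex_cond_exp[where I = UNIV])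
        (use sq_int_integrable(1)[OF xa] sq_intD(2)[OF xa] in \<open>auto intro: convex_power2\<close>)
    then show ?thesis by (simp add: \<xi>_eq[symmetric])
  qed
  then have "integrable M (\<lambda>\<omega>. \<Sum>a\<in>UNIV. (\<xi> \<omega> $ a)\<^sup>2)" by simp
  then have \<xi>sq: "sq_int M \<xi>"
    unfolding sq_int_def using \<xi>M by (simp add: norm_vec_def L2_set_def sum_nonneg)
  have xhM: "xh t \<in> borel_measurable M" by (rule cond_version_measurable[OF xh t])
  show xhsq: "sq_int M (xh t)"
    by (rule sq_int_cong_AE[OF \<xi>sq xhM]) (use \<xi>(2) in eventually_elim, simp)
  have inner: "(\<integral>\<omega>. x t \<omega> \<bullet> \<eta> \<omega> \<partial>M) = (\<integral>\<omega>. xh t \<omega> \<bullet> \<eta> \<omega> \<partial>M)"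
    if \<eta>: "\<eta> \<in> borel_measurable (filt_alpha t)" "sq_int M \<eta>" for \<eta>
  proof -
    have \<eta>a: "sq_int M (\<lambda>\<omega>. \<eta> \<omega> $ a)" for a
      by (rule sq_int_bounded_linear[OF \<eta>(2) bounded_linear_vec_nth])
    have \<xi>a: "sq_int M (\<lambda>\<omega>. \<xi> \<omega> $ a)" for a
      by (rule sq_int_bounded_linear[OF \<xi>sq bounded_linear_vec_nth])
    have "(\<integral>\<omega>. x t \<omega> \<bullet> \<eta> \<omega> \<partial>M) = (\<Sum>a\<in>UNIV. \<integral>\<omega>. \<eta> \<omega> $ a * (x t \<omega> $ a) \<partial>M)"
      unfolding inner_vec_def using integrable_inner_sq_int[OF \<eta>a xa]
      by (simp add: mult.commute)
    also have "\<dots> = (\<Sum>a\<in>UNIV. \<integral>\<omega>. \<eta> \<omega> $ a * (\<xi> \<omega> $ a) \<partial>M)"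
    proof (rule sum.cong[OF refl])
      fix a
      have i: "integrable M (\<lambda>\<omega>. \<eta> \<omega> $ a * (x t \<omega> $ a))"
        using integrable_inner_sq_int[OF \<eta>a xa] by simp
      have m: "(\<lambda>\<omega>. \<eta> \<omega> $ a) \<in> borel_measurable (filt_alpha t)"
        by (rule borel_measurable_vec_nth[OF \<eta>(1)])
      show "(\<integral>\<omega>. \<eta> \<omega> $ a * (x t \<omega> $ a) \<partial>M) = (\<integral>\<omega>. \<eta> \<omega> $ a * (\<xi> \<omega> $ a) \<partial>M)"
        using real_cond_exp_intg(2)[OF i m sq_intD(1)[OF xa]] by (simp add: \<xi>_eq[THEN fun_cong])
    qed
    also have "\<dots> = (\<integral>\<omega>. \<xi> \<omega> \<bullet> \<eta> \<omega> \<partial>M)"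
      unfolding inner_vec_def using integrable_inner_sq_int[OF \<eta>a \<xi>a]
      by (simp add: mult.commute)
    also have "\<dots> = (\<integral>\<omega>. xh t \<omega> \<bullet> \<eta> \<omega> \<partial>M)"
      using sq_intD(1)[OF \<eta>(2)] \<xi>M xhM \<xi>(2) by (intro integral_cong_AE) auto
    finally show ?thesis .
  qed
  show "(\<integral>\<omega>. x t \<omega> \<bullet> \<eta> \<omega> \<partial>M) = (\<integral>\<omega>. xh t \<omega> \<bullet> \<eta> \<omega> \<partial>M)"
    if "\<eta> \<in> borel_measurable (filt_alpha t)" "sq_int M \<eta>" by (rule inner[OF that])
  let ?p = "\<integral>\<omega>. (norm (x t \<omega>))\<^sup>2 \<partial>M" and ?q = "\<integral>\<omega>. (norm (xh t \<omega>))\<^sup>2 \<partial>M"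
  have "?q = (\<integral>\<omega>. xh t \<omega> \<bullet> \<xi> \<omega> \<partial>M)"
    using \<xi>M xhM \<xi>(2) by (intro integral_cong_AE) (auto simp: power2_norm_eq_inner)
  also have "\<dots> = (\<integral>\<omega>. x t \<omega> \<bullet> \<xi> \<omega> \<partial>M)"
    by (rule inner[OF \<xi>(1) \<xi>sq, symmetric])
  also have "\<dots> = (\<integral>\<omega>. x t \<omega> \<bullet> xh t \<omega> \<partial>M)"
    using \<xi>M xhM \<xi>(2) sq_intD(1)[OF x] by (intro integral_cong_AE) auto
  also have "\<dots> \<le> sqrt ?p * sqrt ?q"
    using Cauchy_Schwarz_integral[OF x xhsq] by linarith
  finally have "?q \<le> sqrt ?p * sqrt ?q" .
  then show "?q \<le> ?p"
    by (rule le_of_le_sqrt_mult[rotated 2]) simp_all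
qed

text \<open>A hat is defined time by time, so Tonelli is applied with time outermost and the
  contraction is used at almost every time.\<close>

lemma sq_process_cond_version:
  fixes x xh :: "real \<Rightarrow> 'w \<Rightarrow> real^'k"
  assumes xh: "cond_version x xh" and x: "sq_process x"
  shows "sq_process xh"
proof -
  have m: "(\<lambda>p. xh (fst p) (snd p)) \<in> borel_measurable prod_measure"
    using xh by (simp add: cond_version_def measurable_process_iff case_prod_beta')
  have mx: "(\<lambda>p. x (fst p) (snd p)) \<in> borel_measurable prod_measure"
    using sq_intD(1)[OF x[unfolded sq_process_iff]] .
  have "(\<integral>\<^sup>+p. ennreal ((norm (xh (fst p) (snd p)))\<^sup>2) \<partial>prod_measure)
      = (\<integral>\<^sup>+t. \<integral>\<^sup>+\<omega>. ennreal ((norm (xh t \<omega>))\<^sup>2) \<partial>M \<partial>time_measure)"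
    using nn_integral_fst[of "\<lambda>p. ennreal ((norm (xh (fst p) (snd p)))\<^sup>2)" time_measure] m
        by (simp add: prod_measure_def)
  also have "\<dots> \<le> (\<integral>\<^sup>+t. \<integral>\<^sup>+\<omega>. ennreal ((norm (x t \<omega>))\<^sup>2) \<partial>M \<partial>time_measure)"
  proof (rule nn_integral_mono_AE)
    show "AE t in time_measure. (\<integral>\<^sup>+\<omega>. ennreal ((norm (xh t \<omega>))\<^sup>2) \<partial>M) \<le> (\<integral>\<^sup>+\<omega>. ennreal ((norm (x t \<omega>))\<^sup>2) \<partial>M)"
      using sq_process_AE_time[OF x]
    proof (rule AE_mp, intro AE_I2 impI)
      fix t assume "t \<in> space time_measure" and sq: "sq_int M (x t)"
      then have t: "t \<in> {0..T}" by simp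
      have "(\<integral>\<^sup>+\<omega>. ennreal ((norm (xh t \<omega>))\<^sup>2) \<partial>M) = ennreal (\<integral>\<omega>. (norm (xh t \<omega>))\<^sup>2 \<partial>M)"
        by (rule nn_integral_eq_integral[OF sq_intD(2)[OF sq_int_cond_version[OF xh t sq]]]) simp
      also have "\<dots> \<le> ennreal (\<integral>\<omega>. (norm (x t \<omega>))\<^sup>2 \<partial>M)"
        by (rule ennreal_leI[OF norm_cond_version_le[OF xh t sq]])
      also have "\<dots> = (\<integral>\<^sup>+\<omega>. ennreal ((norm (x t \<omega>))\<^sup>2) \<partial>M)"
        by (rule nn_integral_eq_integral[OF sq_intD(2)[OF sq], symmetric]) simp
      finally show "(\<integral>\<^sup>+\<omega>. ennreal ((norm (xh t \<omega>))\<^sup>2) \<partial>M) \<le> (\<integral>\<^sup>+\<omega>. ennreal ((norm (x t \<omega>))\<^sup>2) \<partial>M)" .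
    qed
  qed
  also have "\<dots> = (\<integral>\<^sup>+p. ennreal ((norm (x (fst p) (snd p)))\<^sup>2) \<partial>prod_measure)"
    using nn_integral_fst[of "\<lambda>p. ennreal ((norm (x (fst p) (snd p)))\<^sup>2)" time_measure] mx
        by (simp add: prod_measure_def)
  also have "\<dots> < \<infinity>"
    using x sq_int_iff_nn_integral[OF mx] by (simp add: sq_process_iff)
  finally show ?thesis
    unfolding sq_process_iff sq_int_iff_nn_integral[OF m] .
qed

end

subsection \<open>Continuity of matrix operations\<close>

lemma bounded_bilinear_matrix_vector_mult: "bounded_bilinear ((*v) :: real^'n^'m \<Rightarrow> real^'n \<Rightarrow> real^'m)"
  unfolding bilinear_conv_bounded_bilinear[symmetric] bilinear_def
  by (auto intro!: linearI simp: matrix_vector_right_distrib matrix_vector_mult_add_rdistrib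
      scaleR_matrix_vector_assoc matrix_vector_mult_scaleR)

lemma bounded_bilinear_matrix_matrix_mult: "bounded_bilinear ((**) :: real^'n^'m \<Rightarrow> real^'k^'n \<Rightarrow> real^'k^'m)"
  unfolding bilinear_conv_bounded_bilinear[symmetric] bilinear_def
  by (auto intro!: linearI simp: matrix_add_ldistrib matrix_scalar_ac scalar_matrix_assoc
      vec_eq_iff matrix_matrix_mult_def sum.distrib sum_distrib_left algebra_simps)

lemmas continuous_on_matrix_matrix_mult [continuous_intros] =
  bounded_bilinear.continuous_on[OF bounded_bilinear_matrix_matrix_mult]

lemma continuous_on_transpose [continuous_intros]:
  fixes A :: "'a::topological_space \<Rightarrow> real^'n^'m"
  assumes "continuous_on S A"
  shows "continuous_on S (\<lambda>x. transpose (A x))"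
  unfolding transpose_def by (intro continuous_intros assms)

lemma continuous_on_vstack [continuous_intros]:
  fixes u :: "'a::topological_space \<Rightarrow> 'b::topological_space^'n::finite" and v :: "'a \<Rightarrow> 'b^'m::finite"
  assumes u: "continuous_on S u" and v: "continuous_on S v"
  shows "continuous_on S (\<lambda>x. vstack (u x) (v x))"
  unfolding vstack_def
proof (rule continuous_on_vec_lambda)
  fix r :: "'n + 'm"
  show "continuous_on S (\<lambda>x. case r of Inl a \<Rightarrow> u x $ a | Inr b \<Rightarrow> v x $ b)"
    by (cases r) (auto intro!: continuous_intros u v)
qed

lemma continuous_on_hstack [continuous_intros]:
  fixes A :: "'a::topological_space \<Rightarrow> real^'n^'k" and B :: "'a \<Rightarrow> real^'m^'k"
  assumes "continuous_on S A" "continuous_on S B"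
  shows "continuous_on S (\<lambda>x. hstack (A x) (B x))"
  unfolding hstack_def by (intro continuous_intros assms)

lemma continuous_on_block [continuous_intros]:
  fixes A :: "'a::topological_space \<Rightarrow> real^'n^'k" and B :: "'a \<Rightarrow> real^'m^'k"
    and C :: "'a \<Rightarrow> real^'n^'l" and D :: "'a \<Rightarrow> real^'m^'l"
  assumes "continuous_on S A" "continuous_on S B" "continuous_on S C" "continuous_on S D"
  shows "continuous_on S (\<lambda>x. block (A x) (B x) (C x) (D x))"
  unfolding block_def by (intro continuous_intros assms)

lemma continuous_on_det:
  fixes A :: "'a::topological_space \<Rightarrow> real^'n^'n"
  assumes "\<And>i j. continuous_on S (\<lambda>x. A x $ i $ j)"
  shows "continuous_on S (\<lambda>x. det (A x))"
  unfolding det_def by (intro continuous_intros assms)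

lemma matrix_inv_mult:
  fixes A :: "real^'n^'n"
  assumes "invertible A"
  shows "A ** matrix_inv A = mat 1" "matrix_inv A ** A = mat 1"
  using someI_ex[OF assms[unfolded invertible_def]] unfolding matrix_inv_def by blast+

text \<open>Cramer's rule for the equation with right-hand side \<open>axis j 1\<close>. The entries
  of the inverse become quotients of polynomials in those of A, so continuity follows from that of
  determinants.\<close>

lemma matrix_inv_component:
  fixes A :: "real^'n^'n"
  assumes "invertible A"
  shows "matrix_inv A $ k $ j = det (\<chi> i l. if l = k then axis j 1 $ i else A $ i $ l) / det A"
proof -
  have "det A \<noteq> 0" using assms by (simp add: invertible_det_nz)
  moreover have "A *v (matrix_inv A *v axis j 1) = axis j 1"
    by (simp add: matrix_vector_mul_assoc matrix_inv_mult[OF assms])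
  ultimately have "matrix_inv A *v axis j 1 = (\<chi> k. det (\<chi> i l. if l = k then axis j 1 $ i else A $ i $ l) / det A)"
    by (simp add: cramer)
  moreover have "matrix_inv A $ k $ j = (matrix_inv A *v axis j 1) $ k"
    by (simp add: matrix_vector_mul_component inner_axis)
  ultimately show ?thesis by simp
qed

lemma continuous_on_matrix_inv:
  fixes A :: "'a::topological_space \<Rightarrow> real^'n^'n"
  assumes A: "continuous_on S A" and inv: "\<And>x. x \<in> S \<Longrightarrow> invertible (A x)"
  shows "continuous_on S (\<lambda>x. matrix_inv (A x))"
proof -
  have comp: "continuous_on S (\<lambda>x. A x $ i $ j)" for i j
    by (intro continuous_intros A)
  have ent: "continuous_on S (\<lambda>x. matrix_inv (A x) $ k $ j)" for k j
  proof -
    have "continuous_on S (\<lambda>x. det (\<chi> i l. if l = k then axis j 1 $ i else A x $ i $ l) / det (A x))"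
    proof (intro continuous_on_divide continuous_on_det ballI)
      show "continuous_on S (\<lambda>x. (\<chi> i l. if l = k then axis j 1 $ i else A x $ i $ l) $ i $ l)" for i l
        by (cases "l = k") (use comp in auto)
      show "det (A x) \<noteq> 0" if "x \<in> S" for x
        using inv[OF that] by (simp add: invertible_det_nz)
    qed (rule comp)
    then show ?thesis
      by (rule continuous_on_eq) (simp add: matrix_inv_component inv)
  qed
  have "continuous_on S (\<lambda>x. \<chi> k j. matrix_inv (A x) $ k $ j)"
    by (intro continuous_on_vec_lambda ent)
  then show ?thesis by simp
qed

context regime_switching
begin

subsection \<open>Coefficients depending on the chain\<close>

text \<open>By right continuity the state at t is the limit of the states at the right ends of the
  grid cells containing t. The cells are open on the right, so those points come after t; the last
  time T is added by hand.\<close>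

lemma ind_state_process: "(\<lambda>p. ind_state (fst p) i (snd p)) \<in> borel_measurable prod_measure"
proof -
  let ?g = "grid 0 T" and ?I = "\<lambda>n k. {grid 0 T n k..<grid 0 T n (Suc k)}"
  define g where "g n p = (\<Sum>k<n. indicator (?I n k) (fst p) * ind_state (?g n (Suc k)) i (snd p)) +
      indicator {T} (fst p) * ind_state T i (snd p)" for n and p :: "real \<times> 'w"
  have T0: "0 \<le> T" using T_pos by simp
  have cell: "g n (t, \<omega>) = ind_state (?g n (Suc k)) i \<omega>" if kn: "k < n" and t: "t \<in> ?I n k" for n k t \<omega>
  proof -
    have "t \<notin> ?I n l" if "l < n" "l \<noteq> k" for l
    proof (cases "l < k")
      case True
      then have "?g n (Suc l) \<le> ?g n k" using T0 by (intro grid_mono) auto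
      then show ?thesis using t by auto
    next
      case False
      then have "?g n (Suc k) \<le> ?g n l" using T0 that by (intro grid_mono) auto
      then show ?thesis using t by auto
    qed
    then have "(\<Sum>l<n. indicator (?I n l) t * ind_state (?g n (Suc l)) i \<omega>) =
        (\<Sum>l<n. if l = k then ind_state (?g n (Suc k)) i \<omega> else 0)"
      using t by (intro sum.cong) auto
    moreover have "t \<noteq> T"
      using t kn grid_bounds(2)[of 0 T "Suc k" n] T0 by auto
    ultimately show ?thesis using kn by (simp add: g_def)
  qed
  have ex_cell: "\<exists>k<n. t \<in> ?I n k" if n: "n > 0" and t: "0 \<le> t" "t < T" for n t
  proof -
    have "\<exists>k<m. t \<in> ?I n k" if "t < ?g n m" for m
      using that
    proof (induction m)
      case 0
      then show ?case using t by simp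
    next
      case (Suc m)
      then show ?case by (cases "t < ?g n m") (auto simp: less_Suc_eq)
    qed
    from this[of n] show ?thesis using n t by (simp add: grid_n)
  qed
  show ?thesis
  proof (rule borel_measurable_LIMSEQ_real)
    fix p assume "p \<in> space prod_measure"
    then obtain t \<omega> where p: "p = (t, \<omega>)" and t: "t \<in> {0..T}" and \<omega>: "\<omega> \<in> space M"
      by (auto simp: space_prod_measure)
    show "(\<lambda>n. g n p) \<longlonglongrightarrow> ind_state (fst p) i (snd p)"
    proof (cases "t = T")
      case True
      have "T \<notin> ?I n k" if "k < n" for n k
        using grid_bounds(2)[of 0 T "Suc k" n] T0 that by auto
      then have "g n p = ind_state (fst p) i (snd p)" for n
        by (simp add: g_def p True)
      then show ?thesis by simp
    next
      case False
      then have tT: "0 \<le> t" "t < T" using t by auto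
      obtain e where e: "e > 0" "\<forall>x. t \<le> x \<and> x < t + e \<and> x \<le> T \<longrightarrow> \<alpha> x \<omega> = \<alpha> t \<omega>"
        using path_local[OF \<omega> t] by blast
      have "(\<lambda>n. (T - 0) / real n) \<longlonglongrightarrow> 0"
        by (rule lim_const_over_n)
      then have "\<forall>\<^sub>F n in sequentially. (T - 0) / real n < e"
        using e(1) by (rule order_tendstoD)
      with eventually_gt_at_top[of 0] have "\<forall>\<^sub>F n in sequentially. g n p = ind_state (fst p) i (snd p)"
      proof eventually_elim
        case (elim n)
        obtain k where k: "k < n" "t \<in> ?I n k" using ex_cell[OF elim(1) tT] by auto
        have "\<alpha> (?g n (Suc k)) \<omega> = \<alpha> t \<omega>"
        proof (rule e(2)[rule_format], intro conjI)
          show "t \<le> ?g n (Suc k)" "?g n (Suc k) < t + e"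
            using k(2) elim(2) by (auto simp: grid_Suc)
          show "?g n (Suc k) \<le> T"
            using grid_bounds(2)[of 0 T "Suc k" n] T0 k(1) by auto
        qed
        then show ?case using cell[OF k] by (simp add: p)
      qed
      then show ?thesis by (rule tendsto_eventually)
    qed
  next
    fix n
    have i1: "(\<lambda>p. indicator A (fst p) * ind_state s i (snd p)) \<in> borel_measurable prod_measure"
      if "A \<in> sets borel" "s \<in> {0..T}" for A s
    proof -
      have [measurable]: "(indicator A :: real \<Rightarrow> real) \<in> borel_measurable time_measure"
        unfolding time_measure_def using that by (intro measurable_restrict_space1) simp
      have [measurable]: "ind_state s i \<in> borel_measurable M"
        using measurable_from_subalg[OF subalgebra_filt_alpha ind_state_measurable, of T s i] that by simp
      show ?thesis unfolding prod_measure_def by measurable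
    qed
    have gT: "?g n (Suc k) \<in> {0..T}" if "k < n" for k
      using grid_bounds[of 0 T "Suc k" n] T0 that by auto
    show "g n \<in> borel_measurable prod_measure"
      unfolding g_def[abs_def] using T0 gT by (intro borel_measurable_add borel_measurable_sum i1) auto
  qed
qed

text \<open>Splitting over the finitely many regimes reduces a random coefficient to deterministic
  matrices multiplied by indicators of the chain.\<close>

lemma coeff_sum: "D t (\<alpha> t \<omega>) *v v = (\<Sum>i\<in>UNIV. ind_state t i \<omega> *\<^sub>R (D t i *v v))"
  for D :: "real \<Rightarrow> 's \<Rightarrow> real^'n^'m"
  by (simp add: if_distrib[of "\<lambda>x. x *\<^sub>R _"] cong: if_cong)

text \<open>Continuous coefficients are bounded on the compact horizon, and so multiplication by
  them preserves square integrability. For this the continuity of the Riccati solutions will be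
  needed.\<close>

lemma sq_process_coeff:
  fixes D :: "real \<Rightarrow> 's \<Rightarrow> real^'n^'m" and x :: "real \<Rightarrow> 'w \<Rightarrow> real^'n"
  assumes D: "\<And>i. continuous_on {0..T} (\<lambda>t. D t i)" and x: "sq_process x"
  shows "sq_process (\<lambda>t \<omega>. D t (\<alpha> t \<omega>) *v x t \<omega>)"
proof -
  obtain K where K: "K > 0" "\<And>A (v :: real^'n). norm ((A :: real^'n^'m) *v v) \<le> norm A * norm v * K"
    using bounded_bilinear.pos_bounded[OF bounded_bilinear_matrix_vector_mult] by blast
  have one: "sq_process (\<lambda>t \<omega>. ind_state t i \<omega> *\<^sub>R (D t i *v x t \<omega>))" for i
  proof -
    have "compact ((\<lambda>t. D t i) ` {0..T})"
      by (rule compact_continuous_image[OF D compact_Icc])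
    then have "bounded ((\<lambda>t. D t i) ` {0..T})" by (rule compact_imp_bounded)
    then obtain B where "\<forall>A\<in>(\<lambda>t. D t i) ` {0..T}. norm A \<le> B" unfolding bounded_iff by blast
    then have B: "norm (D t i) \<le> B" if "t \<in> {0..T}" for t using that by blast
    have xm: "(\<lambda>p. x (fst p) (snd p)) \<in> borel_measurable prod_measure"
      using sq_intD(1)[OF x[unfolded sq_process_iff]] .
    have Dm: "(\<lambda>p. D (fst p) i) \<in> borel_measurable prod_measure"
    proof -
      have [measurable]: "(\<lambda>t. D t i) \<in> borel_measurable time_measure"
        unfolding measurable_cong_sets[OF sets_time_measure refl]
        by (rule borel_measurable_continuous_on_restrict[OF D])
      show ?thesis unfolding prod_measure_def by measurable
    qed
    have Dx: "(\<lambda>p. D (fst p) i *v x (fst p) (snd p)) \<in> borel_measurable prod_measure"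
      by (rule borel_measurable_continuous_Pair[OF Dm xm])
        (intro bounded_bilinear.continuous_on[OF bounded_bilinear_matrix_vector_mult] continuous_intros)
    show ?thesis unfolding sq_process_iff
    proof (rule sq_int_mult_bounded[OF x[unfolded sq_process_iff]])
      show "(\<lambda>p. ind_state (fst p) i (snd p) *\<^sub>R (D (fst p) i *v x (fst p) (snd p))) \<in> borel_measurable prod_measure"
        by (rule borel_measurable_scaleR[OF ind_state_process Dx])
      show "AE p in prod_measure. norm (ind_state (fst p) i (snd p) *\<^sub>R (D (fst p) i *v x (fst p) (snd p))) \<le> (B * K) *
          norm (x (fst p) (snd p))"
      proof (rule AE_I2)
        fix p assume "p \<in> space prod_measure"
        then have t: "fst p \<in> {0..T}" by (auto simp: space_prod_measure)
        have "norm (ind_state (fst p) i (snd p) *\<^sub>R (D (fst p) i *v x (fst p) (snd p)))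
            \<le> norm (D (fst p) i *v x (fst p) (snd p))"
          by simp
        also have "\<dots> \<le> norm (D (fst p) i) * norm (x (fst p) (snd p)) * K" by (rule K(2))
        also have "\<dots> \<le> B * norm (x (fst p) (snd p)) * K"
          using B[OF t] K(1) by (intro mult_right_mono) auto
        finally show "norm (ind_state (fst p) i (snd p) *\<^sub>R (D (fst p) i *v x (fst p) (snd p))) \<le> (B * K) *
            norm (x (fst p) (snd p))"
          by (simp add: mult_ac)
      qed
    qed
  qed
  have "sq_int prod_measure (\<lambda>p. \<Sum>i\<in>UNIV. ind_state (fst p) i (snd p) *\<^sub>R (D (fst p) i *v x (fst p) (snd p)))"
    by (rule sq_int_sum) (rule one[unfolded sq_process_iff])
  then show ?thesis unfolding sq_process_iff coeff_sum .
qed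

lemma coeff_measurable:
  fixes D :: "real \<Rightarrow> 's \<Rightarrow> real^'n^'m" and v :: "'w \<Rightarrow> real^'n"
  assumes a: "\<And>i. ind_state t i \<in> borel_measurable N" and v: "v \<in> borel_measurable N"
  shows "(\<lambda>\<omega>. D t (\<alpha> t \<omega>) *v v \<omega>) \<in> borel_measurable N"
  unfolding coeff_sum
proof (intro borel_measurable_sum borel_measurable_scaleR a)
  fix i
  have "(\<lambda>x. D t i *v x) \<in> borel_measurable borel"
    by (intro borel_measurable_continuous_onI linear_continuous_on) simp
  from measurable_compose[OF v this] show "(\<lambda>\<omega>. D t i *v v \<omega>) \<in> borel_measurable N" .
qed

lemma ind_state_filt:
  assumes "t \<in> {0..T}"
  shows "ind_state t i \<in> borel_measurable (filt t)" "ind_state t i \<in> borel_measurable M"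
proof -
  have "ind_state t i \<in> borel_measurable (filt_alpha t)"
    using assms by (intro ind_state_measurable) auto
  moreover have "subalgebra (filt t) (filt_alpha t)" "subalgebra M (filt_alpha t)"
    using filt_alpha_le_filt subalgebra_filt_alpha assms by auto
  ultimately show "ind_state t i \<in> borel_measurable (filt t)" "ind_state t i \<in> borel_measurable M"
    using measurable_from_subalg by blast+
qed

lemma adapted_coeff:
  fixes D :: "real \<Rightarrow> 's \<Rightarrow> real^'n^'m"
  assumes "adapted x"
  shows "adapted (\<lambda>t \<omega>. D t (\<alpha> t \<omega>) *v x t \<omega>)"
  unfolding adapted_def
proof
  fix t assume t: "t \<in> {0..T}"
  then have "x t \<in> borel_measurable (filt t)" using assms by (auto simp: adapted_def)
  then show "(\<lambda>\<omega>. D t (\<alpha> t \<omega>) *v x t \<omega>) \<in> borel_measurable (filt t)"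
    by (rule coeff_measurable[OF ind_state_filt(1)[OF t]])
qed

lemma coeff_bound:
  fixes D :: "real \<Rightarrow> 's \<Rightarrow> real^'n^'m"
  obtains B where "B \<ge> 0" "\<And>i v. norm (D t i *v v) \<le> B * norm v"
proof -
  obtain K where K: "K > 0" "\<And>A (v :: real^'n). norm ((A :: real^'n^'m) *v v) \<le> norm A * norm v * K"
    using bounded_bilinear.pos_bounded[OF bounded_bilinear_matrix_vector_mult] by blast
  let ?B = "\<Sum>i\<in>UNIV. norm (D t i)"
  have "norm (D t i *v v) \<le> (?B * K) * norm v" for i v
  proof -
    have "norm (D t i) \<le> ?B" by (rule member_le_sum) auto
    then have "norm (D t i) * norm v * K \<le> ?B * norm v * K"
      using K(1) by (intro mult_right_mono) auto
    then show ?thesis using K(2)[of "D t i" v] by (simp add: mult_ac)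
  qed
  moreover have "?B * K \<ge> 0" using K(1) by (simp add: sum_nonneg)
  ultimately show ?thesis using that by blast
qed

lemma sq_int_coeff:
  fixes D :: "real \<Rightarrow> 's \<Rightarrow> real^'n^'m"
  assumes t: "t \<in> {0..T}" and v: "sq_int M v"
  shows "sq_int M (\<lambda>\<omega>. D t (\<alpha> t \<omega>) *v v \<omega>)"
proof -
  obtain B where "\<And>i v. norm (D t i *v v) \<le> B * norm v" by (rule coeff_bound[of D t]) blast
  then show ?thesis
    by (intro sq_int_mult_bounded[OF v] coeff_measurable ind_state_filt(2)[OF t] sq_intD(1)[OF v]) auto
qed

lemma sq_process_add: "sq_process x \<Longrightarrow> sq_process y \<Longrightarrow> sq_process (\<lambda>t \<omega>. x t \<omega> + y t \<omega>)"
  unfolding sq_process_iff by (rule sq_int_add)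

lemma sq_process_diff: "sq_process x \<Longrightarrow> sq_process y \<Longrightarrow> sq_process (\<lambda>t \<omega>. x t \<omega> - y t \<omega>)"
  unfolding sq_process_iff by (rule sq_int_diff)

lemma sq_process_minus: "sq_process x \<Longrightarrow> sq_process (\<lambda>t \<omega>. - x t \<omega>)"
  unfolding sq_process_iff by (rule sq_int_minus)

lemma sq_process_bounded_linear: "sq_process x \<Longrightarrow> bounded_linear h \<Longrightarrow> sq_process (\<lambda>t \<omega>. h (x t \<omega>))"
  unfolding sq_process_iff by (rule sq_int_bounded_linear)

lemma adapted_add: "adapted x \<Longrightarrow> adapted y \<Longrightarrow> adapted (\<lambda>t \<omega>. x t \<omega> + y t \<omega>)"
  unfolding adapted_def by (intro ballI borel_measurable_add) blast+

lemma adapted_minus: "adapted x \<Longrightarrow> adapted (\<lambda>t \<omega>. - x t \<omega>)"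
  unfolding adapted_def by (intro ballI borel_measurable_uminus) blast

lemma adapted_bounded_linear:
  assumes "adapted x" "bounded_linear h"
  shows "adapted (\<lambda>t \<omega>. h (x t \<omega>))"
proof -
  have "h \<in> borel_measurable borel"
    using assms(2) borel_measurable_continuous_onI linear_continuous_on by blast
  then show ?thesis using assms(1) unfolding adapted_def by (auto intro: measurable_compose)
qed

subsection \<open>Uniqueness for linear equations\<close>

text \<open>Since f is merely integrable, the inequality is iterated instead of differentiated: n
  iterations bound the integral by K (C t)^n / n!, which tends to 0.\<close>

lemma Gronwall:
  fixes f :: "real \<Rightarrow> real"
  assumes f: "integrable time_measure f" and nonneg: "\<And>t. t \<in> {0..T} \<Longrightarrow> 0 \<le> f t" and C: "0 \<le> C"
    and le: "\<And>t. t \<in> {0..T} \<Longrightarrow> f t \<le> C * (\<integral>r. indicator {..t} r * f r \<partial>time_measure)"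
    and t: "t \<in> {0..T}"
  shows "f t = 0"
proof -
  define K where "K = (\<integral>r. f r \<partial>time_measure)"
  have K: "0 \<le> K"
    unfolding K_def by (intro Bochner_Integration.integral_nonneg) (simp add: nonneg)
  have int: "integrable time_measure (\<lambda>r. indicator {..t} r * f r)" for t
  proof (rule Bochner_Integration.integrable_bound[OF f])
    show "(\<lambda>r. indicator {..t} r * f r) \<in> borel_measurable time_measure"
      by (intro borel_measurable_times indicator_atMost_measurable borel_measurable_integrable[OF f])
  qed (auto simp: indicator_def)
  have pow: "(\<integral>r. indicator {..t} r * r ^ n \<partial>time_measure) = t ^ Suc n / real (Suc n) \<and>
      integrable time_measure (\<lambda>r. indicator {..t} r * r ^ n)" if t: "t \<in> {0..T}" for t n
  proof -
    have eq: "(\<lambda>r. indicator {0..T} r *\<^sub>R (indicator {..t} r * r ^ n)) = (\<lambda>r. r ^ n * indicator {0..t} r :: real)"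
      using t by (auto simp: indicator_def)
    have "(\<integral>r. indicator {..t} r * r ^ n \<partial>time_measure) = (\<integral>r. r ^ n * indicator {0..t} r \<partial>lborel)"
      unfolding time_measure_def by (subst integral_restrict_space) (simp_all only: eq, simp)
    also have "\<dots> = t ^ Suc n / real (Suc n)"
      using integral_power[of 0 t n] t by simp
    finally have "(\<integral>r. indicator {..t} r * r ^ n \<partial>time_measure) = t ^ Suc n / real (Suc n)" .
    moreover have "set_integrable lborel {0..t} (\<lambda>r. r ^ n)"
      by (rule borel_integrable_atLeastAtMost') (intro continuous_intros)
    then have "integrable lborel (\<lambda>r. indicator {0..T} r *\<^sub>R (indicator {..t} r * r ^ n))"
      unfolding eq by (simp add: set_integrable_def mult.commute)
    then have "integrable time_measure (\<lambda>r. indicator {..t} r * r ^ n)"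
      unfolding time_measure_def by (subst integrable_restrict_space) simp_all
    ultimately show ?thesis by blast
  qed
  have bound: "(\<integral>r. indicator {..t} r * f r \<partial>time_measure) \<le> K * (C * t) ^ n / fact n" if t: "t \<in> {0..T}" for t n
    using t
  proof (induction n arbitrary: t)
    case 0
    have "(\<integral>r. indicator {..t} r * f r \<partial>time_measure) \<le> (\<integral>r. f r \<partial>time_measure)"
      by (rule integral_mono_AE[OF int f]) (auto simp: indicator_def nonneg)
    then show ?case by (simp add: K_def)
  next
    case (Suc n)
    have "(\<integral>r. indicator {..t} r * f r \<partial>time_measure) \<le> (\<integral>r. (C * K * C ^ n / fact n) * (indicator {..t} r * r ^ n)
        \<partial>time_measure)"
    proof (rule integral_mono_AE[OF int])
      show "integrable time_measure (\<lambda>r. (C * K * C ^ n / fact n) * (indicator {..t} r * r ^ n))"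
        using pow[OF Suc.prems] by simp
      show "AE r in time_measure. indicator {..t} r * f r \<le> (C * K * C ^ n / fact n) * (indicator {..t} r * r ^ n)"
      proof (rule AE_I2)
        fix r assume "r \<in> space time_measure"
        then have r: "r \<in> {0..T}" by simp
        have "f r \<le> C * (K * (C * r) ^ n / fact n)"
          using le[OF r] Suc.IH[OF r] C by (meson mult_left_mono order_trans)
        then show "indicator {..t} r * f r \<le> (C * K * C ^ n / fact n) * (indicator {..t} r * r ^ n)"
          by (simp add: indicator_def power_mult_distrib mult_ac)
      qed
    qed
    also have "\<dots> = (C * K * C ^ n / fact n) * (\<integral>r. indicator {..t} r * r ^ n \<partial>time_measure)"
      by (rule integral_mult_right_zero)
    \<comment> \<open>Integrating the n-th power produces the factor 1 / (n + 1) that completes the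
      next factorial.\<close>
    also have "\<dots> = (C * K * C ^ n / fact n) * (t ^ Suc n / real (Suc n))"
      by (simp only: pow[OF Suc.prems, THEN conjunct1])
    also have "\<dots> = K * (C * t) ^ Suc n / fact (Suc n)"
      by (simp only: fact_Suc power_Suc power_mult_distrib times_divide_times_eq of_nat_fact mult_ac)
    finally show ?case .
  qed
  have "(\<lambda>n. inverse (fact n) * (C * t) ^ n) \<longlonglongrightarrow> 0"
    by (rule summable_LIMSEQ_zero[OF summable_exp])
  then have "(\<lambda>n. K * (inverse (fact n) * (C * t) ^ n)) \<longlonglongrightarrow> K * 0"
    by (rule tendsto_mult_left)
  then have "(\<lambda>n. K * (C * t) ^ n / fact n) \<longlonglongrightarrow> 0"
    by (simp add: field_simps)
  then have "(\<integral>r. indicator {..t} r * f r \<partial>time_measure) \<le> 0"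
    by (rule LIMSEQ_le_const) (use bound[OF t] in auto)
  then have "f t \<le> 0"
    using le[OF t] C by (meson mult_nonneg_nonpos order_trans)
  then show ?thesis using nonneg[OF t] by simp
qed

text \<open>Expanding the square and using the polarised isometry three times avoids showing first
  that I - J is the stochastic integral of the difference.\<close>

lemma W_integral_difference:
  fixes I J \<phi> \<psi> :: "real \<Rightarrow> 'w \<Rightarrow> 'v::euclidean_space"
  assumes I: "W_integral \<phi> I" and J: "W_integral \<psi> J" and t: "t \<in> {0..T}"
  shows "(\<integral>\<omega>. (norm (I t \<omega> - J t \<omega>))\<^sup>2 \<partial>M) =
    (\<integral>p. indicator {..t} (fst p) * (norm (\<phi> (fst p) (snd p) - \<psi> (fst p) (snd p)))\<^sup>2 \<partial>prod_measure)"
proof -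
  have sq: "sq_int M (I t)" "sq_int M (J t)"
    using sq_martingaleD(1)[OF sq_martingale_W_integral] I J t by blast+
  have p: "sq_process \<phi>" "sq_process \<psi>" using I J by (auto simp: W_integral_def L2F_iff)
  have i: "integrable prod_measure (\<lambda>p. indicator {..t} (fst p) * (x (fst p) (snd p) \<bullet> y (fst p) (snd p)))"
    if "sq_process x" "sq_process y" for x y :: "real \<Rightarrow> 'w \<Rightarrow> 'v"
    using sq_process_inner[OF sq_process_time_indicator[OF that(1), of t] that(2)] by simp
  have e: "(norm (u - v))\<^sup>2 = u \<bullet> u - 2 * (u \<bullet> v) + v \<bullet> v" for u v :: 'v
    by (simp add: power2_norm_eq_inner inner_diff_left inner_diff_right inner_commute)
  have "(\<integral>\<omega>. (norm (I t \<omega> - J t \<omega>))\<^sup>2 \<partial>M) = (\<integral>\<omega>. I t \<omega> \<bullet> I t \<omega> \<partial>M) - 2 * (\<integral>\<omega>. I t \<omega> \<bullet> J t \<omega> \<partial>M) +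
      (\<integral>\<omega>. J t \<omega> \<bullet> J t \<omega> \<partial>M)"
    unfolding e using integrable_inner_sq_int[OF sq(1,1)] integrable_inner_sq_int[OF sq(1,2)]
        integrable_inner_sq_int[OF sq(2,2)] by simp
  also have "\<dots> = (\<integral>p. indicator {..t} (fst p) * (\<phi> (fst p) (snd p) \<bullet> \<phi> (fst p) (snd p)) -
      2 * (indicator {..t} (fst p) * (\<phi> (fst p) (snd p) \<bullet> \<psi> (fst p) (snd p))) +
      indicator {..t} (fst p) * (\<psi> (fst p) (snd p) \<bullet> \<psi> (fst p) (snd p)) \<partial>prod_measure)"
    unfolding Ito_isometry[OF I I t] Ito_isometry[OF I J t] Ito_isometry[OF J J t]
    using i[OF p(1,1)] i[OF p(1,2)] i[OF p(2,2)] by simp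
  also have "\<dots> = (\<integral>p. indicator {..t} (fst p) * (norm (\<phi> (fst p) (snd p) - \<psi> (fst p) (snd p)))\<^sup>2 \<partial>prod_measure)"
    by (rule Bochner_Integration.integral_cong) (simp_all add: e algebra_simps)
  finally show ?thesis .
qed

lemma cond_version_diff:
  fixes x xh x' xh' :: "real \<Rightarrow> 'w \<Rightarrow> real^'k"
  assumes x: "cond_version x xh" and x': "cond_version x' xh'"
    and sq: "\<And>t. t \<in> {0..T} \<Longrightarrow> sq_int M (x t)" "\<And>t. t \<in> {0..T} \<Longrightarrow> sq_int M (x' t)"
  shows "cond_version (\<lambda>t \<omega>. x t \<omega> - x' t \<omega>) (\<lambda>t \<omega>. xh t \<omega> - xh' t \<omega>)"
  unfolding cond_version_def
proof (intro conjI ballI allI)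
  show "measurable_process (\<lambda>t \<omega>. xh t \<omega> - xh' t \<omega>)"
    using x x' by (auto simp: cond_version_def measurable_process_iff case_prod_beta')
  fix t a assume t: "t \<in> {0..T}"
  interpret sigma_finite_subalgebra M "filt_alpha t"
    using t by (intro sigma_finite_filt_alpha) auto
  have "AE \<omega> in M. real_cond_exp M (filt_alpha t) (\<lambda>\<omega>. x t \<omega> $ a - x' t \<omega> $ a) \<omega> =
      real_cond_exp M (filt_alpha t) (\<lambda>\<omega>. x t \<omega> $ a) \<omega> - real_cond_exp M (filt_alpha t) (\<lambda>\<omega>. x' t \<omega> $ a) \<omega>"
    using sq_int_integrable(1)[OF sq_int_bounded_linear[OF sq(1)[OF t] bounded_linear_vec_nth]]
      sq_int_integrable(1)[OF sq_int_bounded_linear[OF sq(2)[OF t] bounded_linear_vec_nth]]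
    by (intro real_cond_exp_diff)
  moreover have "AE \<omega> in M. xh t \<omega> $ a = real_cond_exp M (filt_alpha t) (\<lambda>\<omega>. x t \<omega> $ a) \<omega>"
    "AE \<omega> in M. xh' t \<omega> $ a = real_cond_exp M (filt_alpha t) (\<lambda>\<omega>. x' t \<omega> $ a) \<omega>"
    using x x' t by (auto simp: cond_version_def)
  ultimately show "AE \<omega> in M. (xh t \<omega> - xh' t \<omega>) $ a = real_cond_exp M (filt_alpha t) (\<lambda>\<omega>. (x t \<omega> - x' t \<omega>) $ a) \<omega>"
    by eventually_elim simp
qed

text \<open>Membership in \<open>L2F\<close> controls x at almost every time only. The equation
  gives a finite second moment at every time, in particular at T, where the costs look.\<close>

lemma differential_W_sq_int:
  fixes x b \<sigma> :: "real \<Rightarrow> 'w \<Rightarrow> 'v::euclidean_space"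
  assumes d: "differential_W x b \<sigma>" and x: "sq_process x" "sq_int M (x 0)" and b: "sq_process b" and t: "t \<in> {0..T}"
  shows "sq_int M (x t)"
proof -
  obtain I where I: "W_integral \<sigma> I"
    "AE \<omega> in M. \<forall>t\<in>{0..T}. x t \<omega> = x 0 \<omega> + (LBINT s:{0..t}. b s \<omega>) + I t \<omega>"
    using d by (auto simp: differential_W_def)
  have "sq_int M (\<lambda>\<omega>. x 0 \<omega> + time_integral b t \<omega> + I t \<omega>)"
    using x(2) sq_int_time_integral(1)[OF b t] sq_martingaleD(1)[OF sq_martingale_W_integral[OF I(1)] t]
    by (intro sq_int_add)
  then show ?thesis
  proof (rule sq_int_cong_AE[OF _ sq_process_section[OF x(1) t]])
    show "AE \<omega> in M. x 0 \<omega> + time_integral b t \<omega> + I t \<omega> = x t \<omega>"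
      using I(2)
    proof eventually_elim
      case (elim \<omega>)
      then have "x t \<omega> = x 0 \<omega> + (LBINT s:{0..t}. b s \<omega>) + I t \<omega>" using t by blast
      then show ?case by (simp only: time_integral_eq[OF t])
    qed
  qed
qed

text \<open>The contraction property absorbs the hatted term, so the bound involves the second
  moment of x alone. The constant combines the operator bounds of both coefficients, maximised over
  the regimes, with the factor 2 of \<open>norm_add_sq_le\<close>.\<close>

lemma linear_drift_estimate:
  fixes x xh :: "real \<Rightarrow> 'w \<Rightarrow> real^'k" and A Ah :: "'s \<Rightarrow> real^'k^'m"
  assumes xh: "cond_version x xh" and x: "sq_process x" "\<And>t. t \<in> {0..T} \<Longrightarrow> sq_int M (x t)"
  obtains C where "0 \<le> C" "\<And>t. t \<in> {0..T} \<Longrightarrow>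
    (\<integral>p. indicator {..t} (fst p) * (norm (A (\<alpha> (fst p) (snd p)) *v x (fst p) (snd p) +
        Ah (\<alpha> (fst p) (snd p)) *v xh (fst p) (snd p)))\<^sup>2 \<partial>prod_measure)
      \<le> C * (\<integral>r. indicator {..t} r * (\<integral>\<omega>. (norm (x r \<omega>))\<^sup>2 \<partial>M) \<partial>time_measure)"
proof -
  obtain a where a: "a \<ge> 0" "\<And>i v. norm (A i *v v) \<le> a * norm v"
    by (rule coeff_bound[of "\<lambda>t. A" 0]) blast
  obtain ah where ah: "ah \<ge> 0" "\<And>i v. norm (Ah i *v v) \<le> ah * norm v"
    by (rule coeff_bound[of "\<lambda>t. Ah" 0]) blast
  define C where "C = 2 * a\<^sup>2 + 2 * ah\<^sup>2"
  define y where "y t \<omega> = A (\<alpha> t \<omega>) *v x t \<omega> + Ah (\<alpha> t \<omega>) *v xh t \<omega>" for t \<omega>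
  have y: "sq_process y"
    unfolding y_def[abs_def]
    by (intro sq_process_add sq_process_coeff[of "\<lambda>t. A"] sq_process_coeff[of "\<lambda>t. Ah"]
        x(1) sq_process_cond_version[OF xh x(1)])
      auto
  have y_le: "(\<integral>\<omega>. (norm (y t \<omega>))\<^sup>2 \<partial>M) \<le> C * (\<integral>\<omega>. (norm (x t \<omega>))\<^sup>2 \<partial>M)" if t: "t \<in> {0..T}" for t
  proof -
    note sx = x(2)[OF t] and sxh = sq_int_cond_version[OF xh t x(2)[OF t]]
    have sy: "sq_int M (y t)"
      unfolding y_def[abs_def] using sq_int_coeff[OF t sx, of "\<lambda>t. A"] sq_int_coeff[OF t sxh, of "\<lambda>t. Ah"]
          by (rule sq_int_add)
    have "(\<integral>\<omega>. (norm (y t \<omega>))\<^sup>2 \<partial>M) \<le> (\<integral>\<omega>. 2 * a\<^sup>2 * (norm (x t \<omega>))\<^sup>2 + 2 * ah\<^sup>2 * (norm (xh t \<omega>))\<^sup>2 \<partial>M)"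
    proof (rule integral_mono_AE[OF sq_intD(2)[OF sy]])
      show "integrable M (\<lambda>\<omega>. 2 * a\<^sup>2 * (norm (x t \<omega>))\<^sup>2 + 2 * ah\<^sup>2 * (norm (xh t \<omega>))\<^sup>2)"
        using sq_intD(2)[OF sx] sq_intD(2)[OF sxh] by simp
      show "AE \<omega> in M. (norm (y t \<omega>))\<^sup>2 \<le> 2 * a\<^sup>2 * (norm (x t \<omega>))\<^sup>2 + 2 * ah\<^sup>2 * (norm (xh t \<omega>))\<^sup>2"
      proof (rule AE_I2)
        fix \<omega>
        have "(norm (y t \<omega>))\<^sup>2 \<le> 2 * (norm (A (\<alpha> t \<omega>) *v x t \<omega>))\<^sup>2 + 2 * (norm (Ah (\<alpha> t \<omega>) *v xh t \<omega>))\<^sup>2"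
          unfolding y_def by (rule norm_add_sq_le)
        also have "\<dots> \<le> 2 * (a * norm (x t \<omega>))\<^sup>2 + 2 * (ah * norm (xh t \<omega>))\<^sup>2"
          using a(2) ah(2) by (intro add_mono mult_left_mono power_mono) auto
        finally show "(norm (y t \<omega>))\<^sup>2 \<le> 2 * a\<^sup>2 * (norm (x t \<omega>))\<^sup>2 + 2 * ah\<^sup>2 * (norm (xh t \<omega>))\<^sup>2"
          by (simp add: power_mult_distrib)
      qed
    qed
    also have "\<dots> = 2 * a\<^sup>2 * (\<integral>\<omega>. (norm (x t \<omega>))\<^sup>2 \<partial>M) + 2 * ah\<^sup>2 * (\<integral>\<omega>. (norm (xh t \<omega>))\<^sup>2 \<partial>M)"
      using sq_intD(2)[OF sx] sq_intD(2)[OF sxh] by simp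
    also have "\<dots> \<le> 2 * a\<^sup>2 * (\<integral>\<omega>. (norm (x t \<omega>))\<^sup>2 \<partial>M) + 2 * ah\<^sup>2 * (\<integral>\<omega>. (norm (x t \<omega>))\<^sup>2 \<partial>M)"
      using norm_cond_version_le[OF xh t sx] by (intro add_left_mono mult_left_mono) auto
    finally show ?thesis by (simp add: C_def algebra_simps)
  qed
  show ?thesis
  proof (rule that)
    show "0 \<le> C" by (simp add: C_def)
    fix t assume t: "t \<in> {0..T}"
    have int: "integrable prod_measure (\<lambda>p. indicator {..t} (fst p) * (norm (z (fst p) (snd p)))\<^sup>2)" if "sq_process z"
        for z :: "real \<Rightarrow> 'w \<Rightarrow> real^'l"
      using sq_process_inner[OF sq_process_time_indicator[OF that, of t] that] by (simp add: power2_norm_eq_inner)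
    have int_x: "integrable time_measure (\<lambda>r. \<integral>\<omega>. indicator {..t} r * (norm (x r \<omega>))\<^sup>2 \<partial>M)"
      using prod.integrable_fst'[of "\<lambda>p. indicator {..t} (fst p) * (norm (x (fst p) (snd p)))\<^sup>2"] int[OF x(1)]
          by (simp add: prod_measure_def)
    have int_y: "integrable time_measure (\<lambda>r. \<integral>\<omega>. indicator {..t} r * (norm (y r \<omega>))\<^sup>2 \<partial>M)"
      using prod.integrable_fst'[of "\<lambda>p. indicator {..t} (fst p) * (norm (y (fst p) (snd p)))\<^sup>2"] int[OF y]
          by (simp add: prod_measure_def)
    have "(\<integral>p. indicator {..t} (fst p) * (norm (y (fst p) (snd p)))\<^sup>2 \<partial>prod_measure) =
        (\<integral>r. (\<integral>\<omega>. indicator {..t} r * (norm (y r \<omega>))\<^sup>2 \<partial>M) \<partial>time_measure)"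
      by (rule integral_prod_fst[OF int[OF y]])
    also have "\<dots> \<le> (\<integral>r. C * (\<integral>\<omega>. indicator {..t} r * (norm (x r \<omega>))\<^sup>2 \<partial>M) \<partial>time_measure)"
    proof (rule integral_mono_AE[OF int_y])
      show "integrable time_measure (\<lambda>r. C * (\<integral>\<omega>. indicator {..t} r * (norm (x r \<omega>))\<^sup>2 \<partial>M))"
        using int_x by (rule integrable_mult_right)
      show "AE r in time_measure. (\<integral>\<omega>. indicator {..t} r * (norm (y r \<omega>))\<^sup>2 \<partial>M) \<le> C *
          (\<integral>\<omega>. indicator {..t} r * (norm (x r \<omega>))\<^sup>2 \<partial>M)"
        using y_le by (intro AE_I2) (auto simp: indicator_def)
    qed
    also have "\<dots> = C * (\<integral>r. indicator {..t} r * (\<integral>\<omega>. (norm (x r \<omega>))\<^sup>2 \<partial>M) \<partial>time_measure)"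
      by simp
    finally show "(\<integral>p. indicator {..t} (fst p) *
        (norm (A (\<alpha> (fst p) (snd p)) *v x (fst p) (snd p) + Ah (\<alpha> (fst p) (snd p)) *v xh (fst p) (snd p)))\<^sup>2
        \<partial>prod_measure)
      \<le> C * (\<integral>r. indicator {..t} r * (\<integral>\<omega>. (norm (x r \<omega>))\<^sup>2 \<partial>M) \<partial>time_measure)"
      unfolding y_def .
  qed
qed

text \<open>Only the differences of drifts and diffusions are prescribed, so control terms common to
  both equations have already cancelled. The second moment of x - x' then satisfies a Gronwall
  inequality.\<close>

lemma linear_SDE_unique:
  fixes x xh x' xh' b b' \<sigma> \<sigma>' :: "real \<Rightarrow> 'w \<Rightarrow> real^'k" and A Ah C Ch :: "'s \<Rightarrow> real^'k^'k"
  assumes dx: "differential_W x b \<sigma>" and dx': "differential_W x' b' \<sigma>'"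
    and xh: "cond_version x xh" and xh': "cond_version x' xh'"
    and x: "sq_process x" "sq_int M (x 0)" and x': "sq_process x'" "sq_int M (x' 0)"
    and b: "sq_process b" and b': "sq_process b'"
    and init: "AE \<omega> in M. x 0 \<omega> = x' 0 \<omega>"
    and b_eq: "\<And>t \<omega>. t \<in> {0..T} \<Longrightarrow> b t \<omega> - b' t \<omega> = A (\<alpha> t \<omega>) *v (x t \<omega> - x' t \<omega>) + Ah (\<alpha> t \<omega>) *v (xh t \<omega> - xh' t \<omega>)"
    and \<sigma>_eq: "\<And>t \<omega>. t \<in> {0..T} \<Longrightarrow> \<sigma> t \<omega> - \<sigma>' t \<omega> = C (\<alpha> t \<omega>) *v (x t \<omega> - x' t \<omega>) + Ch (\<alpha> t \<omega>) *v (xh t \<omega> - xh' t \<omega>)"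
    and t: "t \<in> {0..T}"
  shows "AE \<omega> in M. x t \<omega> = x' t \<omega>"
proof -
  define d where "d t \<omega> = x t \<omega> - x' t \<omega>" for t \<omega>
  have sqx: "sq_int M (x t)" "sq_int M (x' t)" if "t \<in> {0..T}" for t
    using differential_W_sq_int[OF dx x b that] differential_W_sq_int[OF dx' x' b' that] by auto
  have sqd: "sq_int M (d t)" if "t \<in> {0..T}" for t
    unfolding d_def[abs_def] using sqx[OF that] by (intro sq_int_diff)
  have d: "sq_process d"
    unfolding d_def[abs_def] by (rule sq_process_diff[OF x(1) x'(1)])
  have dh: "cond_version d (\<lambda>t \<omega>. xh t \<omega> - xh' t \<omega>)"
    unfolding d_def[abs_def] by (rule cond_version_diff[OF xh xh' sqx])
  obtain I where I: "W_integral \<sigma> I"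
    "AE \<omega> in M. \<forall>t\<in>{0..T}. x t \<omega> = x 0 \<omega> + (LBINT s:{0..t}. b s \<omega>) + I t \<omega>"
    using dx by (auto simp: differential_W_def)
  obtain I' where I': "W_integral \<sigma>' I'"
    "AE \<omega> in M. \<forall>t\<in>{0..T}. x' t \<omega> = x' 0 \<omega> + (LBINT s:{0..t}. b' s \<omega>) + I' t \<omega>"
    using dx' by (auto simp: differential_W_def)
  define f where "f t = (\<integral>\<omega>. (norm (d t \<omega>))\<^sup>2 \<partial>M)" for t
  obtain K where K: "0 \<le> K" "\<And>t. t \<in> {0..T} \<Longrightarrow>
    (\<integral>p. indicator {..t} (fst p) * (norm (A (\<alpha> (fst p) (snd p)) *v d (fst p) (snd p) +
        Ah (\<alpha> (fst p) (snd p)) *v (xh (fst p) (snd p) - xh' (fst p) (snd p))))\<^sup>2 \<partial>prod_measure)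
      \<le> K * (\<integral>r. indicator {..t} r * f r \<partial>time_measure)"
    unfolding f_def by (rule linear_drift_estimate[OF dh d sqd, of A Ah]) auto
  obtain L where L: "0 \<le> L" "\<And>t. t \<in> {0..T} \<Longrightarrow>
    (\<integral>p. indicator {..t} (fst p) * (norm (C (\<alpha> (fst p) (snd p)) *v d (fst p) (snd p) +
        Ch (\<alpha> (fst p) (snd p)) *v (xh (fst p) (snd p) - xh' (fst p) (snd p))))\<^sup>2 \<partial>prod_measure)
      \<le> L * (\<integral>r. indicator {..t} r * f r \<partial>time_measure)"
    unfolding f_def by (rule linear_drift_estimate[OF dh d sqd, of C Ch]) auto
  define bb where "bb t \<omega> = b t \<omega> - b' t \<omega>" for t \<omega>
  have bb: "sq_process bb"
    unfolding bb_def[abs_def] by (rule sq_process_diff[OF b b'])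
  \<comment> \<open>The factors 2 separate drift from stochastic integral, T comes from
    Cauchy-Schwarz in time, and K and L are the constants for drift and diffusion.\<close>
  have est: "f t \<le> (2 * T * K + 2 * L) * (\<integral>r. indicator {..t} r * f r \<partial>time_measure)" if t: "t \<in> {0..T}" for t
  proof -
    let ?F = "\<integral>r. indicator {..t} r * f r \<partial>time_measure"
    note sI = sq_martingaleD(1)[OF sq_martingale_W_integral[OF I(1)] t]
      and sI' = sq_martingaleD(1)[OF sq_martingale_W_integral[OF I'(1)] t]
      and sb = sq_int_time_integral(1)[OF b t] and sb' = sq_int_time_integral(1)[OF b' t]
    have path: "AE \<omega> in M. d t \<omega> = time_integral bb t \<omega> + (I t \<omega> - I' t \<omega>)"
      using I(2) I'(2) init sq_process_AE_path[OF b] sq_process_AE_path[OF b']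
    proof eventually_elim
      case (elim \<omega>)
      have "x t \<omega> = x 0 \<omega> + time_integral b t \<omega> + I t \<omega>" "x' t \<omega> = x' 0 \<omega> + time_integral b' t \<omega> + I' t \<omega>"
        using elim(1,2) t unfolding time_integral_eq[OF t] by blast+
      moreover have "time_integral bb t \<omega> = time_integral b t \<omega> - time_integral b' t \<omega>"
        unfolding time_integral_def bb_def scaleR_diff_right
        using sq_int_time_indicator[OF elim(4), of t] sq_int_time_indicator[OF elim(5), of t]
        by (intro Bochner_Integration.integral_diff time.sq_int_integrable)
      ultimately show ?case using elim(3) by (simp only: d_def) simp
    qed
    have sII: "sq_int M (\<lambda>\<omega>. I t \<omega> - I' t \<omega>)" by (rule sq_int_diff[OF sI sI'])
    note sbb = sq_int_time_integral[OF bb t]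
    have "f t \<le> (\<integral>\<omega>. 2 * (norm (time_integral bb t \<omega>))\<^sup>2 + 2 * (norm (I t \<omega> - I' t \<omega>))\<^sup>2 \<partial>M)"
      unfolding f_def
    proof (rule integral_mono_AE[OF sq_intD(2)[OF sqd[OF t]]])
      show "integrable M (\<lambda>\<omega>. 2 * (norm (time_integral bb t \<omega>))\<^sup>2 + 2 * (norm (I t \<omega> - I' t \<omega>))\<^sup>2)"
        using sq_intD(2)[OF sbb(1)] sq_intD(2)[OF sII] by simp
      show "AE \<omega> in M. (norm (d t \<omega>))\<^sup>2 \<le> 2 * (norm (time_integral bb t \<omega>))\<^sup>2 + 2 * (norm (I t \<omega> - I' t \<omega>))\<^sup>2"
        using path by eventually_elim (simp only: norm_add_sq_le)
    qed
    also have "\<dots> = 2 * (\<integral>\<omega>. (norm (time_integral bb t \<omega>))\<^sup>2 \<partial>M) + 2 * (\<integral>\<omega>. (norm (I t \<omega> - I' t \<omega>))\<^sup>2 \<partial>M)"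
      using sq_intD(2)[OF sbb(1)] sq_intD(2)[OF sII] by simp
    also have "(\<integral>\<omega>. (norm (time_integral bb t \<omega>))\<^sup>2 \<partial>M) \<le> T * (K * ?F)"
    proof -
      have "(\<integral>p. indicator {..t} (fst p) * (norm (bb (fst p) (snd p)))\<^sup>2 \<partial>prod_measure) =
          (\<integral>p. indicator {..t} (fst p) * (norm (A (\<alpha> (fst p) (snd p)) *v d (fst p) (snd p) +
              Ah (\<alpha> (fst p) (snd p)) *v (xh (fst p) (snd p) - xh' (fst p) (snd p))))\<^sup>2 \<partial>prod_measure)"
        by (rule Bochner_Integration.integral_cong[OF refl]) (auto simp: space_prod_measure bb_def d_def b_eq)
      also have "\<dots> \<le> K * ?F" by (rule K(2)[OF t])
      finally show ?thesis
        using sbb(2) T_pos by (meson less_imp_le mult_left_mono order_trans)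
    qed
    also have "(\<integral>\<omega>. (norm (I t \<omega> - I' t \<omega>))\<^sup>2 \<partial>M) \<le> L * ?F"
    proof -
      have "(\<integral>\<omega>. (norm (I t \<omega> - I' t \<omega>))\<^sup>2 \<partial>M) =
          (\<integral>p. indicator {..t} (fst p) * (norm (C (\<alpha> (fst p) (snd p)) *v d (fst p) (snd p) +
              Ch (\<alpha> (fst p) (snd p)) *v (xh (fst p) (snd p) - xh' (fst p) (snd p))))\<^sup>2 \<partial>prod_measure)"
        unfolding W_integral_difference[OF I(1) I'(1) t]
        by (rule Bochner_Integration.integral_cong[OF refl]) (auto simp: space_prod_measure d_def \<sigma>_eq)
      also have "\<dots> \<le> L * ?F" by (rule L(2)[OF t])
      finally show ?thesis .
    qed
    finally show ?thesis by (simp add: algebra_simps)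
  qed
  have f_int: "integrable time_measure f"
    unfolding f_def
    using prod.integrable_fst'[of "\<lambda>p. (norm (d (fst p) (snd p)))\<^sup>2"] sq_intD(2)[OF d[unfolded sq_process_iff]]
    by (simp add: prod_measure_def)
  have "f t = 0"
    by (rule Gronwall[OF f_int _ _ est t]) (use K(1) L(1) T_pos in \<open>auto simp: f_def\<close>)
  then have "AE \<omega> in M. (norm (d t \<omega>))\<^sup>2 = 0"
    unfolding f_def by (subst (asm) integral_nonneg_eq_0_iff_AE) (use sq_intD(2)[OF sqd[OF t]] in auto)
  then show ?thesis
    by eventually_elim (simp add: d_def)
qed

end

subsection \<open>Block algebra\<close>

lemma upper_vstack [simp]: "upper (vstack u v) = u"
  by (simp add: upper_def vstack_def vec_eq_iff)

lemma lower_vstack [simp]: "lower (vstack u v) = v"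
  by (simp add: lower_def vstack_def vec_eq_iff)

lemma sum_UNIV_Plus: "(\<Sum>r\<in>(UNIV :: ('n::finite + 'm::finite) set). f r) = (\<Sum>a\<in>UNIV. f (Inl a)) + (\<Sum>b\<in>UNIV. f (Inr b))"
  unfolding UNIV_Plus_UNIV[symmetric] by (simp add: sum.Plus comp_def del: UNIV_Plus_UNIV)

lemma inner_upper_lower: "u \<bullet> v = upper u \<bullet> upper v + lower u \<bullet> lower v"
  for u v :: "real^('n::finite + 'm::finite)"
  by (simp add: inner_vec_def sum_UNIV_Plus upper_def lower_def)

lemma bounded_linear_upper: "bounded_linear (upper :: real^('n::finite + 'm::finite) \<Rightarrow> real^'n)"
  unfolding linear_conv_bounded_linear[symmetric] by (auto intro!: linearI simp: upper_def vec_eq_iff)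

lemma bounded_linear_lower: "bounded_linear (lower :: real^('n::finite + 'm::finite) \<Rightarrow> real^'m)"
  unfolding linear_conv_bounded_linear[symmetric] by (auto intro!: linearI simp: lower_def vec_eq_iff)

lemmas upper_linear = linear_add[OF bounded_linear.linear[OF bounded_linear_upper]]
  linear_neg[OF bounded_linear.linear[OF bounded_linear_upper]]
      linear_diff[OF bounded_linear.linear[OF bounded_linear_upper]]

lemmas lower_linear = linear_add[OF bounded_linear.linear[OF bounded_linear_lower]]
  linear_neg[OF bounded_linear.linear[OF bounded_linear_lower]]
      linear_diff[OF bounded_linear.linear[OF bounded_linear_lower]]

lemma hstack_mult: "hstack A B *v v = A *v upper v + B *v lower v"
  for A :: "real^'n^'k" and B :: "real^'m^'k"
  by (simp add: vec_eq_iff matrix_vector_mult_def hstack_def vstack_def sum_UNIV_Plus upper_def lower_def)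

lemma vstack_mult: "vstack A B *v v = vstack (A *v v) (B *v v)"
  for A :: "real^'k^'n" and B :: "real^'k^'m"
  by (auto simp: vec_eq_iff matrix_vector_mult_def vstack_def split: sum.split)

lemma block_mult: "block A B C D *v v = vstack (A *v upper v + B *v lower v) (C *v upper v + D *v lower v)"
  for A :: "real^'n^'k" and B :: "real^'m^'k" and C :: "real^'n^'l" and D :: "real^'m^'l"
  by (simp add: block_def vstack_mult hstack_mult)

lemma transpose_block: "transpose (block A B C D) = block (transpose A) (transpose C) (transpose B) (transpose D)"
  for A :: "real^'n^'k" and B :: "real^'m^'k" and C :: "real^'n^'l" and D :: "real^'m^'l"
  by (auto simp: vec_eq_iff transpose_def block_def vstack_def hstack_def split: sum.split)

lemma transpose_hstack: "transpose (hstack A B) = vstack (transpose A) (transpose B)"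
  for A :: "real^'n^'k" and B :: "real^'m^'k"
  by (auto simp: vec_eq_iff transpose_def vstack_def hstack_def split: sum.split)

lemma transpose_vstack: "transpose (vstack A B) = hstack (transpose A) (transpose B)"
  for A :: "real^'k^'n" and B :: "real^'k^'m"
  by (auto simp: vec_eq_iff transpose_def vstack_def hstack_def split: sum.split)

lemma upper_block11_mult: "upper (P *v vstack u 0) = block11 P *v u"
  for P :: "real^('n::finite + 'm::finite)^('k::finite + 'l::finite)"
  by (simp add: vec_eq_iff upper_def block11_def matrix_vector_mult_def sum_UNIV_Plus vstack_def)

lemma inner_matrix_transpose: "(A *v x) \<bullet> y = x \<bullet> (transpose A *v y)"
  for A :: "real^'n^'m"
  by (metis dot_lmul_matrix inner_commute transpose_matrix_vector)

lemma transpose_add: "transpose (A + B) = transpose A + transpose B"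
  by (simp add: transpose_def vec_eq_iff)

lemma transpose_minus: "transpose (- A) = - transpose A"
  by (simp add: transpose_def vec_eq_iff)

lemma sym_mat_matrix_inv:
  fixes A :: "real^'n^'n"
  assumes "sym_mat A" "invertible A"
  shows "transpose (matrix_inv A) = matrix_inv A"
proof -
  have "transpose (matrix_inv A) ** A = mat 1"
    using arg_cong[OF matrix_inv_mult(1)[OF assms(2)], of transpose] assms(1)
    by (simp add: matrix_transpose_mul sym_mat_def)
  then have "transpose (matrix_inv A) ** (A ** matrix_inv A) = matrix_inv A"
    by (simp add: matrix_mul_assoc)
  then show ?thesis by (simp add: matrix_inv_mult(1)[OF assms(2)])
qed

text \<open>\<open>flip X \<bullet> Y\<close> is \<open>\<langle>x, y\<rangle> - \<langle>\<psi>, \<phi>\<rangle>\<close>.\<close>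

definition flip :: "real^('n::finite + 'm::finite) \<Rightarrow> real^('n + 'm)" where
  "flip v = vstack (upper v) (- lower v)"

lemma bounded_linear_flip: "bounded_linear (flip :: real^('n::finite + 'm::finite) \<Rightarrow> real^('n + 'm))"
  unfolding linear_conv_bounded_linear[symmetric]
  by (auto intro!: linearI simp: flip_def upper_def lower_def vstack_def vec_eq_iff split: sum.split)

context regime_switching
begin

subsection \<open>Linear images\<close>

lemma L2F_bounded_linear: "L2F x \<Longrightarrow> bounded_linear h \<Longrightarrow> L2F (\<lambda>t \<omega>. h (x t \<omega>))"
  unfolding L2F_iff by (auto intro: sq_process_bounded_linear adapted_bounded_linear)

text \<open>Neither the integrands nor the inner integrals are assumed measurable, as the definition
  of \<open>L2_integral\<close> permits. The squared operator bound is therefore pulled out as an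
  inequality, obtained from the definition of the nonnegative integral.\<close>

lemma nn_integral_bounded_linear_tendsto_0:
  fixes f :: "nat \<Rightarrow> 'a \<Rightarrow> 'b \<Rightarrow> 'v::euclidean_space" and h :: "'v \<Rightarrow> 'u::euclidean_space"
  assumes h: "bounded_linear h"
    and lim: "(\<lambda>m. \<integral>\<^sup>+x. (\<integral>\<^sup>+y. ennreal ((norm (f m x y))\<^sup>2) \<partial>q x) \<partial>N) \<longlonglongrightarrow> 0"
  shows "(\<lambda>m. \<integral>\<^sup>+x. (\<integral>\<^sup>+y. ennreal ((norm (h (f m x y)))\<^sup>2) \<partial>q x) \<partial>N) \<longlonglongrightarrow> 0"
proof -
  obtain B where B: "B > 0" "\<And>x. norm (h x) \<le> norm x * B"
    using bounded_linear.pos_bounded[OF h] by blast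
  have le: "ennreal ((norm (h v))\<^sup>2) \<le> ennreal (B\<^sup>2) * ennreal ((norm v)\<^sup>2)" for v
  proof -
    have "(norm (h v))\<^sup>2 \<le> (norm v * B)\<^sup>2" using B(2) by (intro power_mono) auto
    then show ?thesis by (simp add: ennreal_mult[symmetric] power_mult_distrib mult.commute ennreal_leI)
  qed
  have nz: "ennreal (B\<^sup>2) < \<infinity>" by simp
  show ?thesis
  proof (rule tendsto_sandwich[OF _ _ tendsto_const])
    have "(\<lambda>m. ennreal (B\<^sup>2) * (\<integral>\<^sup>+x. (\<integral>\<^sup>+y. ennreal ((norm (f m x y))\<^sup>2) \<partial>q x) \<partial>N)) \<longlonglongrightarrow> ennreal (B\<^sup>2) * 0"
      by (intro ennreal_tendsto_cmult lim) simp
    then show "(\<lambda>m. ennreal (B\<^sup>2) * (\<integral>\<^sup>+x. (\<integral>\<^sup>+y. ennreal ((norm (f m x y))\<^sup>2) \<partial>q x) \<partial>N)) \<longlonglongrightarrow> 0" by simp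
    show "\<forall>\<^sub>F m in sequentially. (\<integral>\<^sup>+x. (\<integral>\<^sup>+y. ennreal ((norm (h (f m x y)))\<^sup>2) \<partial>q x) \<partial>N)
        \<le> ennreal (B\<^sup>2) * (\<integral>\<^sup>+x. (\<integral>\<^sup>+y. ennreal ((norm (f m x y))\<^sup>2) \<partial>q x) \<partial>N)"
    proof (rule always_eventually, rule allI)
      fix m
      \<comment> \<open>A simple function u below c g yields the simple function u / c below g; this
        needs c to be finite and nonzero, but no measurability of g.\<close>
      have cm: "(\<integral>\<^sup>+x. c * g x \<partial>K) \<le> c * (\<integral>\<^sup>+x. g x \<partial>K)" if "c < \<infinity>" "c \<noteq> 0" for c g and K :: "'c measure"
      proof -
        have "(\<integral>\<^sup>+x. c * g x \<partial>K) = (SUP u \<in> {u. simple_function K u \<and> u \<le> (\<lambda>x. c * g x)}. integral\<^sup>S K u)"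
          by (simp add: nn_integral_def)
        also have "\<dots> \<le> c * (\<integral>\<^sup>+x. g x \<partial>K)"
        proof (rule SUP_least)
          fix u assume "u \<in> {u. simple_function K u \<and> u \<le> (\<lambda>x. c * g x)}"
          then have u: "simple_function K u" "\<And>x. u x \<le> c * g x" by (auto simp: le_fun_def)
          have "integral\<^sup>S K u = (\<integral>\<^sup>+x. u x \<partial>K)" by (rule nn_integral_eq_simple_integral[OF u(1), symmetric])
          also have "\<dots> = (\<integral>\<^sup>+x. c * (u x / c) \<partial>K)"
            using that by (intro nn_integral_cong) (simp add:
                ennreal_times_divide mult_divide_eq_ennreal mult.commute[of c])
          also have "\<dots> = c * (\<integral>\<^sup>+x. u x / c \<partial>K)"
            using u(1) by (intro nn_integral_cmult) (auto intro: borel_measurable_simple_function)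
          also have "\<dots> \<le> c * (\<integral>\<^sup>+x. g x \<partial>K)"
          proof (intro mult_left_mono nn_integral_mono)
            fix x
            have "u x / c \<le> (c * g x) / c" by (rule divide_right_mono_ennreal[OF u(2)])
            also have "\<dots> = g x" using that by (simp add: mult_divide_eq_ennreal mult.commute[of c])
            finally show "u x / c \<le> g x" .
          qed simp
          finally show "integral\<^sup>S K u \<le> c * (\<integral>\<^sup>+x. g x \<partial>K)" .
        qed
        finally show ?thesis .
      qed
      have B0: "ennreal (B\<^sup>2) \<noteq> 0" using B(1) by simp
      have "(\<integral>\<^sup>+x. (\<integral>\<^sup>+y. ennreal ((norm (h (f m x y)))\<^sup>2) \<partial>q x) \<partial>N) \<le>
          (\<integral>\<^sup>+x. (\<integral>\<^sup>+y. ennreal (B\<^sup>2) * ennreal ((norm (f m x y))\<^sup>2) \<partial>q x) \<partial>N)"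
        by (intro nn_integral_mono le)
      also have "\<dots> \<le> (\<integral>\<^sup>+x. ennreal (B\<^sup>2) * (\<integral>\<^sup>+y. ennreal ((norm (f m x y))\<^sup>2) \<partial>q x) \<partial>N)"
        by (intro nn_integral_mono cm[OF nz B0])
      also have "\<dots> \<le> ennreal (B\<^sup>2) * (\<integral>\<^sup>+x. (\<integral>\<^sup>+y. ennreal ((norm (f m x y))\<^sup>2) \<partial>q x) \<partial>N)"
        by (rule cm[OF nz B0])
      finally show "(\<integral>\<^sup>+x. (\<integral>\<^sup>+y. ennreal ((norm (h (f m x y)))\<^sup>2) \<partial>q x) \<partial>N)
          \<le> ennreal (B\<^sup>2) * (\<integral>\<^sup>+x. (\<integral>\<^sup>+y. ennreal ((norm (f m x y))\<^sup>2) \<partial>q x) \<partial>N)" .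
    qed
  qed simp
qed

lemma simple_integrand_bounded_linear:
  fixes \<xi> :: "nat \<Rightarrow> 'w \<Rightarrow> 'v::euclidean_space" and h :: "'v \<Rightarrow> 'u::euclidean_space"
  assumes \<xi>: "simple_integrand n \<tau> \<xi>" and h: "bounded_linear h"
  shows "simple_integrand n \<tau> (\<lambda>l \<omega>. h (\<xi> l \<omega>))"
  unfolding simple_integrand_def
proof (intro conjI allI impI)
  show "mono_on {..n} \<tau>" "\<tau> ` {..n} \<subseteq> {0..T}" using \<xi> by (auto simp: simple_integrand_def)
  fix l assume l: "l < n"
  have "h \<in> borel_measurable borel"
    using h borel_measurable_continuous_onI linear_continuous_on by blast
  from measurable_compose[OF simple_integrandD(4)[OF \<xi> l] this]
  show "(\<lambda>\<omega>. h (\<xi> l \<omega>)) \<in> borel_measurable (filt (\<tau> l))" .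
  obtain b where b: "\<forall>\<omega>\<in>space M. norm (\<xi> l \<omega>) \<le> b" using simple_integrandD(6)[OF \<xi> l] by blast
  obtain B where B: "B > 0" "\<And>x. norm (h x) \<le> norm x * B"
    using bounded_linear.pos_bounded[OF h] by blast
  show "\<exists>b. \<forall>\<omega>\<in>space M. norm (h (\<xi> l \<omega>)) \<le> b"
  proof (intro exI ballI)
    fix \<omega> assume "\<omega> \<in> space M"
    then have "norm (\<xi> l \<omega>) * B \<le> b * B" using b B(1) by (intro mult_right_mono) auto
    then show "norm (h (\<xi> l \<omega>)) \<le> b * B" using B(2)[of "\<xi> l \<omega>"] by linarith
  qed
qed

lemma L2_integral_bounded_linear:
  fixes \<phi> I :: "real \<Rightarrow> 'w \<Rightarrow> 'v::euclidean_space" and h :: "'v \<Rightarrow> 'u::euclidean_space"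
  assumes I: "L2_integral N q \<phi> I" and h: "bounded_linear h"
  shows "L2_integral N q (\<lambda>t \<omega>. h (\<phi> t \<omega>)) (\<lambda>t \<omega>. h (I t \<omega>))"
proof -
  interpret bounded_linear h by (rule h)
  obtain n \<tau> \<xi> where *: "\<forall>m. simple_integrand (n m) (\<tau> m) (\<xi> m)"
    "(\<lambda>m. \<integral>\<^sup>+\<omega>. (\<integral>\<^sup>+t. ennreal ((norm (simple_value (n m) (\<tau> m) (\<xi> m) t \<omega> - \<phi> t \<omega>))\<^sup>2) \<partial>q \<omega>) \<partial>M) \<longlonglongrightarrow> 0"
    "\<forall>t\<in>{0..T}. (\<lambda>m. \<integral>\<^sup>+\<omega>. ennreal ((norm (simple_integral N (n m) (\<tau> m) (\<xi> m) t \<omega> - I t \<omega>))\<^sup>2) \<partial>M) \<longlonglongrightarrow> 0"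
    using I unfolding L2_integral_def by blast
  have ad: "adapted (\<lambda>t \<omega>. h (I t \<omega>))"
    using I h unfolding L2_integral_def by (blast intro: adapted_bounded_linear)
  let ?\<xi> = "\<lambda>m l \<omega>. h (\<xi> m l \<omega>)"
  have sv: "simple_value (n m) (\<tau> m) (?\<xi> m) t \<omega> - h (\<phi> t \<omega>) = h (simple_value (n m) (\<tau> m) (\<xi> m) t \<omega> - \<phi> t \<omega>)"
      for m t \<omega>
    by (simp add: simple_value_def diff sum scaleR)
  have si: "simple_integral N (n m) (\<tau> m) (?\<xi> m) t \<omega> - h (I t \<omega>) =
      h (simple_integral N (n m) (\<tau> m) (\<xi> m) t \<omega> - I t \<omega>)" for m t \<omega>
    by (simp add: simple_integral_def diff sum scaleR)
  have l1: "(\<lambda>m. \<integral>\<^sup>+\<omega>. (\<integral>\<^sup>+t. ennreal ((norm (simple_value (n m) (\<tau> m) (?\<xi> m) t \<omega> - h (\<phi> t \<omega>)))\<^sup>2) \<partial>q \<omega>) \<partial>M) \<longlonglongrightarrow> 0"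
    unfolding sv by (rule nn_integral_bounded_linear_tendsto_0[OF h *(2)])
  have l2: "(\<lambda>m. \<integral>\<^sup>+\<omega>. ennreal ((norm (simple_integral N (n m) (\<tau> m) (?\<xi> m) t \<omega> - h (I t \<omega>)))\<^sup>2) \<partial>M) \<longlonglongrightarrow> 0" if t:
      "t \<in> {0..T}" for t
  proof -
    \<comment> \<open>The convergence lemma speaks of iterated integrals; a one-point outer measure
      reduces a single integral to that case.\<close>
    have one: "(\<integral>\<^sup>+x. (\<integral>\<^sup>+\<omega>. F \<omega> \<partial>M) \<partial>count_space {()}) = (\<integral>\<^sup>+\<omega>. F \<omega> \<partial>M)" for F
      by (simp add: nn_integral_count_space_finite)
    show ?thesis
      unfolding si
      using nn_integral_bounded_linear_tendsto_0[OF h,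
          where f = "\<lambda>m _ \<omega>. simple_integral N (n m) (\<tau> m) (\<xi> m) t \<omega> - I t \<omega>" and q = "\<lambda>_. M"
          and N = "count_space {()}"]
        *(3)[rule_format, OF t] unfolding one by blast
  qed
  show ?thesis
    unfolding L2_integral_def
    using ad l1 l2 *(1) simple_integrand_bounded_linear[OF _ h]
    by (intro conjI exI[of _ n] exI[of _ \<tau>] exI[of _ ?\<xi>]) auto
qed

lemma W_integral_bounded_linear:
  fixes \<phi> I :: "real \<Rightarrow> 'w \<Rightarrow> 'v::euclidean_space" and h :: "'v \<Rightarrow> 'u::euclidean_space"
  assumes I: "W_integral \<phi> I" and h: "bounded_linear h"
  shows "W_integral (\<lambda>t \<omega>. h (\<phi> t \<omega>)) (\<lambda>t \<omega>. h (I t \<omega>))"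
  unfolding W_integral_def
proof (intro conjI)
  show "L2F (\<lambda>t \<omega>. h (\<phi> t \<omega>))" "L2_integral W qv_W (\<lambda>t \<omega>. h (\<phi> t \<omega>)) (\<lambda>t \<omega>. h (I t \<omega>))"
    using I unfolding W_integral_def by (auto intro: L2F_bounded_linear[OF _ h] L2_integral_bounded_linear[OF _ h])
  have "AE \<omega> in M. continuous_on {0..T} (\<lambda>t. I t \<omega>)" using I by (simp add: W_integral_def)
  then show "AE \<omega> in M. continuous_on {0..T} (\<lambda>t. h (I t \<omega>))"
    by eventually_elim (rule bounded_linear.continuous_on[OF h])
qed

lemma W_integral_cong:
  fixes \<phi> \<psi> I :: "real \<Rightarrow> 'w \<Rightarrow> 'v::euclidean_space"
  assumes I: "W_integral \<phi> I" and eq: "\<And>t \<omega>. t \<in> {0..T} \<Longrightarrow> \<phi> t \<omega> = \<psi> t \<omega>"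
  shows "W_integral \<psi> I"
proof -
  have L: "L2F \<phi>" "L2_integral W qv_W \<phi> I" "AE \<omega> in M. continuous_on {0..T} (\<lambda>t. I t \<omega>)"
    using I by (auto simp: W_integral_def)
  have "L2F \<psi>"
  proof -
    have "adapted \<psi> \<longleftrightarrow> adapted \<phi>"
      unfolding adapted_def using eq by (intro ball_cong refl measurable_cong) auto
    moreover have "(\<lambda>p. \<psi> (fst p) (snd p)) \<in> borel_measurable prod_measure \<longleftrightarrow> (\<lambda>p. \<phi> (fst p) (snd p))
        \<in> borel_measurable prod_measure"
      by (rule measurable_cong) (auto simp: space_prod_measure eq)
    moreover have "integrable prod_measure (\<lambda>p. (norm (\<psi> (fst p) (snd p)))\<^sup>2) \<longleftrightarrow> integrable prod_measure (\<lambda>p.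
        (norm (\<phi> (fst p) (snd p)))\<^sup>2)"
      by (rule Bochner_Integration.integrable_cong) (auto simp: space_prod_measure eq)
    ultimately show ?thesis using L(1) by (simp add: L2F_iff sq_process_iff sq_int_def)
  qed
  moreover have "(\<integral>\<^sup>+\<omega>. (\<integral>\<^sup>+t. ennreal ((norm (simple_value n \<tau> \<xi> t \<omega> - \<psi> t \<omega>))\<^sup>2) \<partial>qv_W \<omega>) \<partial>M) =
      (\<integral>\<^sup>+\<omega>. (\<integral>\<^sup>+t. ennreal ((norm (simple_value n \<tau> \<xi> t \<omega> - \<phi> t \<omega>))\<^sup>2) \<partial>qv_W \<omega>) \<partial>M)" for n \<tau> \<xi>
    by (intro nn_integral_cong) (auto simp: qv_W_def eq)
  then have "L2_integral W qv_W \<psi> I"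
    using L(2) unfolding L2_integral_def by simp
  ultimately show ?thesis using L(3) by (simp add: W_integral_def)
qed

lemma path_bounded_linear:
  fixes x b I :: "real \<Rightarrow> 'w \<Rightarrow> 'v::euclidean_space" and h :: "'v \<Rightarrow> 'u::euclidean_space"
  assumes h: "bounded_linear h" and b: "sq_process b"
    and x: "AE \<omega> in M. \<forall>t\<in>{0..T}. x t \<omega> = x 0 \<omega> + (LBINT s:{0..t}. b s \<omega>) + I t \<omega>"
    and b': "\<And>t \<omega>. t \<in> {0..T} \<Longrightarrow> h (b t \<omega>) = b' t \<omega>"
  shows "AE \<omega> in M. \<forall>t\<in>{0..T}. h (x t \<omega>) = h (x 0 \<omega>) + (LBINT s:{0..t}. b' s \<omega>) + h (I t \<omega>)"
  using x sq_process_AE_path[OF b]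
proof eventually_elim
  case (elim \<omega>)
  show ?case
  proof
    fix t assume t: "t \<in> {0..T}"
    have "x t \<omega> = x 0 \<omega> + time_integral b t \<omega> + I t \<omega>"
      using elim(1) t unfolding time_integral_eq[OF t] by blast
    then have "h (x t \<omega>) = h (x 0 \<omega>) + h (time_integral b t \<omega>) + h (I t \<omega>)"
      by (simp only: linear_add[OF bounded_linear.linear[OF h]])
    also have "h (time_integral b t \<omega>) = (\<integral>s. h (indicator {..t} s *\<^sub>R b s \<omega>) \<partial>time_measure)"
      unfolding time_integral_def
      by (rule integral_bounded_linear[OF h, symmetric])
        (rule time.sq_int_integrable(1)[OF sq_int_time_indicator[OF elim(2)]])
    also have "\<dots> = time_integral b' t \<omega>"
      unfolding time_integral_def
      by (rule Bochner_Integration.integral_cong[OF refl]) (simp add: linear_scale[OF bounded_linear.linear[OF h]] b')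
    finally show "h (x t \<omega>) = h (x 0 \<omega>) + (LBINT s:{0..t}. b' s \<omega>) + h (I t \<omega>)"
      by (simp only: time_integral_eq[OF t])
  qed
qed

lemma cond_version_upper:
  assumes "cond_version X Xh"
  shows "cond_version (\<lambda>t \<omega>. upper (X t \<omega>)) (\<lambda>t \<omega>. upper (Xh t \<omega>))"
  unfolding cond_version_def
proof (intro conjI ballI allI)
  have "upper \<in> borel_measurable (borel :: (real^('a + 'b)) measure)"
    using bounded_linear_upper borel_measurable_continuous_onI linear_continuous_on by blast
  then show "measurable_process (\<lambda>t \<omega>. upper (Xh t \<omega>))"
    using assms measurable_compose[of "\<lambda>p. Xh (fst p) (snd p)" prod_measure borel upper borel]
    by (simp add: cond_version_def measurable_process_iff case_prod_beta')
  show "AE \<omega> in M. upper (Xh t \<omega>) $ a = real_cond_exp M (filt_alpha t) (\<lambda>\<omega>. upper (X t \<omega>) $ a) \<omega>" if "t \<in> {0..T}"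
      for t a
    using assms that by (simp add: cond_version_def upper_def)
qed

lemma coeff_measurable_alpha:
  fixes D :: "real \<Rightarrow> 's \<Rightarrow> real^'n^'m"
  assumes "t \<in> {0..T}" "v \<in> borel_measurable (filt_alpha t)"
  shows "(\<lambda>\<omega>. D t (\<alpha> t \<omega>) *v v \<omega>) \<in> borel_measurable (filt_alpha t)"
  using assms by (intro coeff_measurable ind_state_measurable) auto

text \<open>A regime-dependent matrix applied to a hat is known to the chain, up to the measurable
  version of that hat, so x may be replaced by its projection.\<close>

lemma cond_version_pull_out:
  fixes x xh :: "real \<Rightarrow> 'w \<Rightarrow> real^'k" and y yh :: "real \<Rightarrow> 'w \<Rightarrow> real^'l" and H :: "'s \<Rightarrow> real^'l^'k"
  assumes x: "cond_version x xh" "sq_int M (x t)" and y: "cond_version y yh" "sq_int M (y t)" and t: "t \<in> {0..T}"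
  shows "(\<integral>\<omega>. x t \<omega> \<bullet> (H (\<alpha> t \<omega>) *v yh t \<omega>) \<partial>M) = (\<integral>\<omega>. xh t \<omega> \<bullet> (H (\<alpha> t \<omega>) *v yh t \<omega>) \<partial>M)"
proof -
  obtain \<xi> where \<xi>: "\<xi> \<in> borel_measurable (filt_alpha t)" "AE \<omega> in M. yh t \<omega> = \<xi> \<omega>"
    using cond_version_adapted_version[OF y(1) t] by blast
  have \<xi>M: "\<xi> \<in> borel_measurable M"
    using t by (intro measurable_from_subalg[OF subalgebra_filt_alpha \<xi>(1)]) auto
  note yh = sq_int_cond_version[OF y(1) t y(2)] and xh = sq_int_cond_version[OF x(1) t x(2)]
  have \<xi>sq: "sq_int M \<xi>" by (rule sq_int_cong_AE[OF yh \<xi>M \<xi>(2)])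
  let ?\<eta> = "\<lambda>\<omega>. H (\<alpha> t \<omega>) *v \<xi> \<omega>"
  have \<eta>: "?\<eta> \<in> borel_measurable (filt_alpha t)" "sq_int M ?\<eta>"
    using coeff_measurable_alpha[OF t \<xi>(1), of "\<lambda>_. H"] sq_int_coeff[OF t \<xi>sq, of "\<lambda>_. H"] by auto
  have repl: "(\<integral>\<omega>. v \<omega> \<bullet> (H (\<alpha> t \<omega>) *v yh t \<omega>) \<partial>M) = (\<integral>\<omega>. v \<omega> \<bullet> ?\<eta> \<omega> \<partial>M)" if "sq_int M v" for v
    using \<xi>(2) sq_intD(1)[OF that] sq_intD(1)[OF \<eta>(2)] sq_intD(1)[OF sq_int_coeff[OF t yh, of "\<lambda>_. H"]]
    by (intro integral_cong_AE) auto
  show ?thesis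
    unfolding repl[OF x(2)] repl[OF xh] by (rule integral_cond_version_inner[OF x(1) t x(2) \<eta>])
qed

text \<open>Conditioning on the chain is an orthogonal projection that commutes with
  regime-dependent matrices: both sides equal the expression with two hats. This is what cancels the
  hatted coefficients between the two equations.\<close>

lemma cond_version_swap:
  fixes x xh :: "real \<Rightarrow> 'w \<Rightarrow> real^'k" and y yh :: "real \<Rightarrow> 'w \<Rightarrow> real^'l" and H :: "'s \<Rightarrow> real^'l^'k"
  assumes x: "cond_version x xh" "sq_int M (x t)" and y: "cond_version y yh" "sq_int M (y t)" and t: "t \<in> {0..T}"
  shows "(\<integral>\<omega>. x t \<omega> \<bullet> (H (\<alpha> t \<omega>) *v yh t \<omega>) \<partial>M) = (\<integral>\<omega>. xh t \<omega> \<bullet> (H (\<alpha> t \<omega>) *v y t \<omega>) \<partial>M)"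
proof -
  have tr: "u \<bullet> (H i *v v) = v \<bullet> (transpose (H i) *v u)" for u v i
    using inner_matrix_transpose[of "H i" v u] by (simp only: inner_commute)
  have "(\<integral>\<omega>. xh t \<omega> \<bullet> (H (\<alpha> t \<omega>) *v y t \<omega>) \<partial>M) = (\<integral>\<omega>. y t \<omega> \<bullet> (transpose (H (\<alpha> t \<omega>)) *v xh t \<omega>) \<partial>M)"
    unfolding tr ..
  also have "\<dots> = (\<integral>\<omega>. yh t \<omega> \<bullet> (transpose (H (\<alpha> t \<omega>)) *v xh t \<omega>) \<partial>M)"
    by (rule cond_version_pull_out[OF y x t, of "\<lambda>i. transpose (H i)"])
  also have "\<dots> = (\<integral>\<omega>. xh t \<omega> \<bullet> (H (\<alpha> t \<omega>) *v yh t \<omega>) \<partial>M)"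
    unfolding tr ..
  finally show ?thesis
    unfolding cond_version_pull_out[OF x y t] ..
qed

end

context lq_game
begin

subsection \<open>The cost as an integral over the product space\<close>

definition running_cost :: "(real \<Rightarrow> 'w \<Rightarrow> real^'m2) \<Rightarrow> (real \<Rightarrow> 'w \<Rightarrow> real^'n) \<Rightarrow> (real \<Rightarrow> 'w \<Rightarrow> real^'n) \<Rightarrow> real \<Rightarrow> 'w \<Rightarrow> real"
    where
  "running_cost u2 x xh t \<omega> = (cQ2 c (\<alpha> t \<omega>) *v x t \<omega>) \<bullet> x t \<omega> + (cQh2 c (\<alpha> t \<omega>) *v xh t \<omega>) \<bullet> xh t \<omega> +
    (cN2 c (\<alpha> t \<omega>) *v u2 t \<omega>) \<bullet> u2 t \<omega>"

definition terminal_cost :: "(real \<Rightarrow> 'w \<Rightarrow> real^'n) \<Rightarrow> (real \<Rightarrow> 'w \<Rightarrow> real^'n) \<Rightarrow> 'w \<Rightarrow> real" where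
  "terminal_cost x xh \<omega> = (cG2 c (\<alpha> T \<omega>) *v x T \<omega>) \<bullet> x T \<omega> + (cGh2 c (\<alpha> T \<omega>) *v xh T \<omega>) \<bullet> xh T \<omega>"

lemma sq_process_const_coeff:
  fixes x :: "real \<Rightarrow> 'w \<Rightarrow> real^'k" and D :: "'s \<Rightarrow> real^'k^'l"
  shows "sq_process x \<Longrightarrow> sq_process (\<lambda>t \<omega>. D (\<alpha> t \<omega>) *v x t \<omega>)"
  by (rule sq_process_coeff[of "\<lambda>t. D"]) (rule continuous_on_const)

lemma integrable_running_cost:
  assumes "sq_process x" "sq_process xh" "sq_process u2"
  shows "integrable prod_measure (\<lambda>p. running_cost u2 x xh (fst p) (snd p))"
  unfolding running_cost_def
  by (intro Bochner_Integration.integrable_add sq_process_inner[OF sq_process_const_coeff[where D = "cQ2 c"]]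
      sq_process_inner[OF sq_process_const_coeff[where D = "cQh2 c"]]
          sq_process_inner[OF sq_process_const_coeff[where D = "cN2 c"]] assms)

lemma integrable_terminal_cost:
  assumes "sq_int M (x T)" "sq_int M (xh T)"
  shows "integrable M (terminal_cost x xh)"
  unfolding terminal_cost_def[abs_def]
  by (intro Bochner_Integration.integrable_add integrable_inner_sq_int sq_int_coeff[where D = "\<lambda>_. cG2 c"]
      sq_int_coeff[where D = "\<lambda>_. cGh2 c"] assms) (use T_pos in auto)

lemma leader_cost_eq:
  assumes x: "sq_process x" "sq_process xh" "sq_process u2" and T: "sq_int M (x T)" "sq_int M (xh T)"
  shows "leader_cost u2 x xh = 1/2 * ((\<integral>p. running_cost u2 x xh (fst p) (snd p) \<partial>prod_measure) +
      (\<integral>\<omega>. terminal_cost x xh \<omega> \<partial>M))"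
proof -
  note rc = integrable_running_cost[OF x] and tc = integrable_terminal_cost[where x=x and xh=xh, OF T]
  have path: "(LBINT t:{0..T}. running_cost u2 x xh t \<omega>) = (\<integral>t. running_cost u2 x xh t \<omega> \<partial>time_measure)" for \<omega>
    using time_integral_eq[of T "running_cost u2 x xh" \<omega>] time_integral_T[of "running_cost u2 x xh" \<omega>] T_pos by simp
  have "leader_cost u2 x xh = 1/2 * (\<integral>\<omega>. (LBINT t:{0..T}. running_cost u2 x xh t \<omega>) + terminal_cost x xh \<omega> \<partial>M)"
    unfolding leader_cost_def running_cost_def terminal_cost_def by (simp only: add.assoc)
  also have "\<dots> = 1/2 * (\<integral>\<omega>. (\<integral>t. running_cost u2 x xh t \<omega> \<partial>time_measure) + terminal_cost x xh \<omega> \<partial>M)"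
    unfolding path ..
  also have "\<dots> = 1/2 * ((\<integral>\<omega>. (\<integral>t. running_cost u2 x xh t \<omega> \<partial>time_measure) \<partial>M) + (\<integral>\<omega>. terminal_cost x xh \<omega> \<partial>M))"
    using integral_prod_snd(2)[OF rc] tc by simp
  also have "(\<integral>\<omega>. (\<integral>t. running_cost u2 x xh t \<omega> \<partial>time_measure) \<partial>M)
      = (\<integral>p. running_cost u2 x xh (fst p) (snd p) \<partial>prod_measure)"
    by (rule integral_prod_snd(1)[OF rc, symmetric])
  finally show ?thesis .
qed

text \<open>The state is unique time by time up to null sets depending on the time; with expectation
  as the inner integral this is sufficient for the running cost.\<close>

lemma leader_cost_cong:
  assumes x: "sq_process x" "sq_process xh" and x': "sq_process x'" "sq_process xh'" and u: "sq_process u2"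
    and T: "sq_int M (x T)" "sq_int M (xh T)" and T': "sq_int M (x' T)" "sq_int M (xh' T)"
    and eq: "\<And>t. t \<in> {0..T} \<Longrightarrow> AE \<omega> in M. x t \<omega> = x' t \<omega>" "\<And>t. t \<in> {0..T} \<Longrightarrow> AE \<omega> in M. xh t \<omega> = xh' t \<omega>"
  shows "leader_cost u2 x xh = leader_cost u2 x' xh'"
proof -
  note rc = integrable_running_cost[OF x u] and rc' = integrable_running_cost[OF x' u]
  have meas: "running_cost u2 y yh t \<in> borel_measurable M" if "sq_process y" "sq_process yh" "t \<in> {0..T}" for y yh t
  proof -
    have [measurable]: "y t \<in> borel_measurable M" "yh t \<in> borel_measurable M" "u2 t \<in> borel_measurable M"
      using sq_process_section that u by blast+
    have "(\<lambda>\<omega>. cQ2 c (\<alpha> t \<omega>) *v y t \<omega>) \<in> borel_measurable M" "(\<lambda>\<omega>. cQh2 c (\<alpha> t \<omega>) *v yh t \<omega>) \<in> borel_measurable M"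
      "(\<lambda>\<omega>. cN2 c (\<alpha> t \<omega>) *v u2 t \<omega>) \<in> borel_measurable M"
      by (intro coeff_measurable[where D = "\<lambda>_. cQ2 c"] coeff_measurable[where D = "\<lambda>_. cQh2 c"]
          coeff_measurable[where D = "\<lambda>_. cN2 c"] ind_state_filt(2)[OF that(3)]; measurable)+
    then show ?thesis unfolding running_cost_def[abs_def] by measurable
  qed
  have "(\<integral>p. running_cost u2 x xh (fst p) (snd p) \<partial>prod_measure) =
      (\<integral>t. (\<integral>\<omega>. running_cost u2 x xh t \<omega> \<partial>M) \<partial>time_measure)"
    by (rule integral_prod_fst[OF rc])
  also have "\<dots> = (\<integral>t. (\<integral>\<omega>. running_cost u2 x' xh' t \<omega> \<partial>M) \<partial>time_measure)"
  proof (rule Bochner_Integration.integral_cong[OF refl])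
    fix t assume "t \<in> space time_measure"
    then have t: "t \<in> {0..T}" by simp
    show "(\<integral>\<omega>. running_cost u2 x xh t \<omega> \<partial>M) = (\<integral>\<omega>. running_cost u2 x' xh' t \<omega> \<partial>M)"
    proof (rule integral_cong_AE[OF meas[OF x t] meas[OF x' t]])
      show "AE \<omega> in M. running_cost u2 x xh t \<omega> = running_cost u2 x' xh' t \<omega>"
        using eq(1)[OF t] eq(2)[OF t] by eventually_elim (simp only: running_cost_def)
    qed
  qed
  also have "\<dots> = (\<integral>p. running_cost u2 x' xh' (fst p) (snd p) \<partial>prod_measure)"
    by (rule integral_prod_fst[OF rc', symmetric])
  finally have "(\<integral>p. running_cost u2 x xh (fst p) (snd p) \<partial>prod_measure)
      = (\<integral>p. running_cost u2 x' xh' (fst p) (snd p) \<partial>prod_measure)" .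
  moreover have "(\<integral>\<omega>. terminal_cost x xh \<omega> \<partial>M) = (\<integral>\<omega>. terminal_cost x' xh' \<omega> \<partial>M)"
  proof (rule integral_cong_AE)
    have TT: "T \<in> {0..T}" using T_pos by simp
    show "AE \<omega> in M. terminal_cost x xh \<omega> = terminal_cost x' xh' \<omega>"
      using eq(1)[OF TT] eq(2)[OF TT] by eventually_elim (simp only: terminal_cost_def)
  qed (use integrable_terminal_cost[where x=x and xh=xh, OF T] integrable_terminal_cost[where x=x' and xh=xh', OF T']
      in auto)
  ultimately show ?thesis
    unfolding leader_cost_eq[where x=x and xh=xh, OF x u T] leader_cost_eq[where x=x' and xh=xh', OF x' u T'] by simp
qed

subsection \<open>Matrix identities\<close>

lemma matrix_vector_mult_minus_left: "(- A) *v x = - (A *v x)" for A :: "real^'k^'l"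
  by (simp add: vec_eq_iff matrix_vector_mult_def sum_negf)

lemma matrix_vector_mult_minus_right: "A *v (- x) = - (A *v x)" for A :: "real^'k^'l"
  by (rule linear_neg[OF matrix_vector_mul_linear])

text \<open>Once y and z are inserted, the coefficients of x, xh and u on the left are
  \<open>bS2\<close>, \<open>bSh2\<close> and \<open>N2t\<close>, which is where these abbreviations
  come from. The control u is the solution of the resulting linear equation.\<close>

lemma stationarity:
  assumes "invertible (N2t t i)"
    and u: "u = - (matrix_inv (N2t t i) *v (bS2 t i *v x + bSh2 t i *v xh))"
    and y: "y = P2 t i *v x + Ph2 t i *v xh"
    and z: "z = (matrix_inv (I_P2_D1 t i) ** P2 t i) *v (bJ2 t i *v x + bJh2 t i *v xh + bD2 t i *v u)"
  shows "transpose (bB2 t i) *v y + transpose (bD2 t i) *v z + bF2 t i *v x + bFh2 t i *v xh + cN2 c i *v u = 0"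
proof -
  have "transpose (bB2 t i) *v y + transpose (bD2 t i) *v z + bF2 t i *v x + bFh2 t i *v xh + cN2 c i *v u =
      (bS2 t i *v x + bSh2 t i *v xh) + N2t t i *v u"
    unfolding y z bS2_def bSh2_def N2t_def
    by (simp del: transpose_matrix_vector add: matrix_vector_right_distrib matrix_vector_mult_add_rdistrib
        matrix_vector_mul_assoc matrix_mul_assoc)
  also have "N2t t i *v u = - (bS2 t i *v x + bSh2 t i *v xh)"
  proof -
    have "N2t t i *v u = - ((N2t t i ** matrix_inv (N2t t i)) *v (bS2 t i *v x + bSh2 t i *v xh))"
      unfolding u by (simp only: matrix_vector_mul_assoc[symmetric] linear_neg[OF matrix_vector_mul_linear])
    then show ?thesis by (simp add: matrix_inv_mult(1)[OF assms(1)])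
  qed
  finally show ?thesis by simp
qed

text \<open>The integrand of the product formula for \<open>flip X\<close> and \<open>Y\<close> at a
  fixed time and path. The B1 terms of drift and diffusion cancel each other, while F1 and D1 cancel
  by symmetry because \<open>flip\<close> gives their two occurrences opposite signs. The hatted
  terms stay as differences that vanish in expectation only; the sign in their lower block is again
  that of \<open>flip\<close>.\<close>

lemma inner_duality:
  assumes F1: "transpose (dF1 t i) = dF1 t i" and D1: "transpose (dD1 t i) = dD1 t i"
  shows "flip (bA t i *v x + bAh t i *v xh + bF1 t i *v y + bB1 t i *v z + bB2 t i *v u) \<bullet> y +
      flip x \<bullet> - (transpose (bA t i) *v y + transpose (bAh t i) *v yh + transpose (bC t i) *v z +
          transpose (bCh t i) *v zh +
        bQ2 i *v x + bQh2 i *v xh + transpose (bF2 t i) *v u + transpose (bFh2 t i) *v uh) +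
      flip (bC t i *v x + bCh t i *v xh + transpose (bB1 t i) *v y + bD1 t i *v z + bD2 t i *v u) \<bullet> z =
    u \<bullet> (transpose (bB2 t i) *v y + transpose (bD2 t i) *v z + bF2 t i *v x) - (cQ2 c i *v upper x) \<bullet> upper x
      + (xh \<bullet> (block (transpose (dAh t i)) 0 0 (- transpose (dAh t i)) *v y)
          - x \<bullet> (block (transpose (dAh t i)) 0 0 (- transpose (dAh t i)) *v yh))
      + (xh \<bullet> (block (transpose (dCh t i)) 0 0 (- transpose (dCh t i)) *v z)
          - x \<bullet> (block (transpose (dCh t i)) 0 0 (- transpose (dCh t i)) *v zh))
      - upper x \<bullet> (cQh2 c i *v upper xh) + uh \<bullet> (bFh2 t i *v x)"
proof -
  have tr: "v \<bullet> (transpose A *v w) = (A *v v) \<bullet> w" for A :: "real^'j^'k" and v w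
    by (rule inner_matrix_transpose[symmetric])
  have tr': "(transpose A *v w) \<bullet> v = (A *v v) \<bullet> w" for A :: "real^'j^'k" and v w
    by (simp only: inner_commute[of _ v] tr)
  have F1': "upper y \<bullet> (dF1 t i *v lower y) = lower y \<bullet> (dF1 t i *v upper y)"
    using tr[of "lower y" "dF1 t i" "upper y"] unfolding F1 by (simp add: inner_commute)
  have D1': "upper z \<bullet> (dD1 t i *v lower z) = lower z \<bullet> (dD1 t i *v upper z)"
    using tr[of "lower z" "dD1 t i" "upper z"] unfolding D1 by (simp add: inner_commute)
  show ?thesis
    by (simp del: transpose_matrix_vector
        add: bA_def bAh_def bC_def bCh_def bB1_def bD1_def bF1_def bB2_def bD2_def bF2_def bFh2_def bQ2_def bQh2_def
        transpose_block transpose_hstack transpose_vstack block_mult hstack_mult vstack_mult flip_def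
            inner_upper_lower[where 'n = 'n and 'm = 'n]
        upper_linear lower_linear inner_add_left inner_add_right inner_diff_left inner_diff_right inner_minus_left
            inner_minus_right
        tr tr' matrix_vector_mult_minus_left matrix_vector_mult_minus_right)
      (simp add: F1' D1' inner_commute)
qed

end

text \<open>Fixes the data once so that the notation of \<open>lq_game\<close> can be used without
  parameters. Symmetry of \<open>cN1\<close> makes \<open>N1t\<close> symmetric, and with it F1 and
  D1.\<close>

locale stackelberg_solution = lq_game M T W \<alpha> \<Lambda> i0 c P1 Ph1 P2 Pt2
  for M :: "'w measure" and T :: real and W :: "real \<Rightarrow> 'w \<Rightarrow> real"
    and \<alpha> :: "real \<Rightarrow> 'w \<Rightarrow> 's::finite" and \<Lambda> :: "'s \<Rightarrow> 's \<Rightarrow> real" and i0 :: 's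
    and c :: "('s, 'n::finite, 'm1::finite, 'm2::finite) lq_coeffs"
    and P1 Ph1 :: "real \<Rightarrow> 's \<Rightarrow> real^'n^'n"
    and P2 Pt2 :: "real \<Rightarrow> 's \<Rightarrow> real^('n + 'n)^('n + 'n)" +
  fixes x0 :: "real^'n"
    and X Xh Y Z :: "real \<Rightarrow> 'w \<Rightarrow> real^('n + 'n)"
    and K :: "'s \<Rightarrow> 's \<Rightarrow> real \<Rightarrow> 'w \<Rightarrow> real^('n + 'n)"
    and u1 :: "real \<Rightarrow> 'w \<Rightarrow> real^'m1" and u2 :: "real \<Rightarrow> 'w \<Rightarrow> real^'m2"
  assumes cN1_sym: "\<And>i. sym_mat (cN1 c i)"
    and P1: riccati_P1 and Ph1: riccati_Ph1 and P2: riccati_P2 and Pt2: riccati_Pt2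
    and N2t_invertible: "\<And>t i. t \<in> {0..T} \<Longrightarrow> invertible (N2t t i)"
    and I_P2_D1_invertible: "\<And>t i. t \<in> {0..T} \<Longrightarrow> invertible (I_P2_D1 t i)"
    and H: "hamiltonian_system x0 u2 X Xh Y Z K"
    and YZ: "decoupled u2 X Xh Y Z"
    and u2: "u2 = leader_control X Xh"
    and u1: "u1 = follower_control u2 (\<lambda>t \<omega>. upper (X t \<omega>)) (\<lambda>t \<omega>. upper (Xh t \<omega>))
                    (\<lambda>t \<omega>. lower (Y t \<omega>)) (\<lambda>t \<omega>. lower (Z t \<omega>))"
begin

subsection \<open>Regularity of the coefficients\<close>

lemma N1t_invertible: "t \<in> {0..T} \<Longrightarrow> invertible (N1t t i)"
  using P1 by (simp add: riccati_P1_def)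

text \<open>The source of the symmetries behind \<open>inner_duality\<close>, and of the formula for
  the transpose of B1 needed to recover the diffusion of the state.\<close>

lemma transpose_N1t_inv:
  assumes t: "t \<in> {0..T}"
  shows "transpose (matrix_inv (N1t t i)) = matrix_inv (N1t t i)"
proof (rule sym_mat_matrix_inv[OF _ N1t_invertible[OF t]])
  have "transpose (P1 t i) = P1 t i" "transpose (cN1 c i) = cN1 c i"
    using P1 t cN1_sym by (auto simp: riccati_P1_def sym_mat_def)
  then show "sym_mat (N1t t i)"
    by (simp add: sym_mat_def N1t_def transpose_add matrix_transpose_mul matrix_mul_assoc)
qed

lemma transpose_dF1: "t \<in> {0..T} \<Longrightarrow> transpose (dF1 t i) = dF1 t i"
  by (simp add: dF1_def transpose_minus matrix_transpose_mul transpose_N1t_inv matrix_mul_assoc)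

lemma transpose_dD1: "t \<in> {0..T} \<Longrightarrow> transpose (dD1 t i) = dD1 t i"
  by (simp add: dD1_def transpose_minus matrix_transpose_mul transpose_N1t_inv matrix_mul_assoc)

lemma transpose_dB1: "t \<in> {0..T} \<Longrightarrow> transpose (dB1 t i) = - (cD1 c i ** matrix_inv (N1t t i) ** transpose (cB1 c i))"
  by (simp add: dB1_def transpose_minus matrix_transpose_mul transpose_N1t_inv matrix_mul_assoc)

text \<open>Differentiability of the Riccati solutions is turned into continuity, hence boundedness,
  of all coefficients derived from them.\<close>

lemma continuous_P:
  "continuous_on {0..T} (\<lambda>t. P1 t i)" "continuous_on {0..T} (\<lambda>t. Ph1 t i)"
  "continuous_on {0..T} (\<lambda>t. P2 t i)" "continuous_on {0..T} (\<lambda>t. Pt2 t i)"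
proof -
  have *: "continuous_on {0..T} f" if "\<forall>t\<in>{0..T}. \<exists>D. (f has_vector_derivative D) (at t within {0..T})"
    for f :: "real \<Rightarrow> real^'k^'l"
    using that has_vector_derivative_continuous continuous_on_eq_continuous_within by blast
  show "continuous_on {0..T} (\<lambda>t. P1 t i)"
    by (rule *) (use P1 in \<open>unfold riccati_P1_def, blast\<close>)
  show "continuous_on {0..T} (\<lambda>t. Ph1 t i)"
    by (rule *) (use Ph1 in \<open>unfold riccati_Ph1_def, blast\<close>)
  show "continuous_on {0..T} (\<lambda>t. P2 t i)"
    by (rule *) (use P2 in \<open>unfold riccati_P2_def, blast\<close>)
  show "continuous_on {0..T} (\<lambda>t. Pt2 t i)"
    by (rule *) (use Pt2 in \<open>unfold riccati_Pt2_def, blast\<close>)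
qed

lemma continuous_N1t_inv: "continuous_on {0..T} (\<lambda>t. matrix_inv (N1t t i))"
proof (rule continuous_on_matrix_inv[OF _ N1t_invertible])
  show "continuous_on {0..T} (\<lambda>t. N1t t i)"
    unfolding N1t_def by (intro continuous_intros continuous_P)
qed

lemma continuous_follower_coeffs:
  "continuous_on {0..T} (\<lambda>t. S1 t i)" "continuous_on {0..T} (\<lambda>t. Sh1 t i)"
  "continuous_on {0..T} (\<lambda>t. S2 t i)" "continuous_on {0..T} (\<lambda>t. Sh2 t i)"
  unfolding S1_def Sh1_def S2_def Sh2_def by (intro continuous_intros continuous_P)+

lemma continuous_closed_loop_coeffs:
  "continuous_on {0..T} (\<lambda>t. bA t i)" "continuous_on {0..T} (\<lambda>t. bAh t i)"
  "continuous_on {0..T} (\<lambda>t. bC t i)" "continuous_on {0..T} (\<lambda>t. bCh t i)"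
  "continuous_on {0..T} (\<lambda>t. bB1 t i)" "continuous_on {0..T} (\<lambda>t. bD1 t i)" "continuous_on {0..T} (\<lambda>t. bF1 t i)"
  "continuous_on {0..T} (\<lambda>t. bB2 t i)" "continuous_on {0..T} (\<lambda>t. bD2 t i)"
  "continuous_on {0..T} (\<lambda>t. bF2 t i)" "continuous_on {0..T} (\<lambda>t. bFh2 t i)"
  unfolding bA_def bAh_def bC_def bCh_def bB1_def bD1_def bF1_def bB2_def bD2_def bF2_def bFh2_def
    dA_def dAh_def dC_def dCh_def dB1_def dD1_def dF1_def dB2_def dD2_def dF2_def dFh2_def
  by (intro continuous_intros continuous_P continuous_N1t_inv continuous_follower_coeffs)+

lemma continuous_Ph2: "continuous_on {0..T} (\<lambda>t. Ph2 t i)"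
  unfolding Ph2_def by (intro continuous_intros continuous_P)

lemma continuous_I_P2_D1_inv: "continuous_on {0..T} (\<lambda>t. matrix_inv (I_P2_D1 t i))"
proof (rule continuous_on_matrix_inv[OF _ I_P2_D1_invertible])
  show "continuous_on {0..T} (\<lambda>t. I_P2_D1 t i)"
    unfolding I_P2_D1_def by (intro continuous_intros continuous_P continuous_closed_loop_coeffs)
qed

lemma continuous_N2t_inv: "continuous_on {0..T} (\<lambda>t. matrix_inv (N2t t i))"
proof (rule continuous_on_matrix_inv[OF _ N2t_invertible])
  show "continuous_on {0..T} (\<lambda>t. N2t t i)"
    unfolding N2t_def by (intro continuous_intros continuous_P continuous_closed_loop_coeffs continuous_I_P2_D1_inv)
qed

lemma continuous_leader_coeffs:
  "continuous_on {0..T} (\<lambda>t. bS2 t i)" "continuous_on {0..T} (\<lambda>t. bSh2 t i)"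
  unfolding bS2_def bSh2_def bJ2_def bJh2_def
  by (intro continuous_intros continuous_P continuous_Ph2 continuous_closed_loop_coeffs continuous_I_P2_D1_inv)+

subsection \<open>The processes of the Hamiltonian system\<close>

lemma hamiltonian_processes:
  shows X: "sq_process X" "adapted X" and Y: "sq_process Y" "adapted Y" and Z: "sq_process Z" "adapted Z"
    and Xh: "cond_version X Xh" "sq_process Xh" "adapted Xh"
    and X_0: "AE \<omega> in M. X 0 \<omega> = vstack x0 0"
    and Y_T: "AE \<omega> in M. Y T \<omega> = bG2 (\<alpha> T \<omega>) *v X T \<omega> + bGh2 (\<alpha> T \<omega>) *v Xh T \<omega>"
proof -
  have *: "L2F X" "S2F Y" "L2F Z" "cond_version X Xh" and
    "AE \<omega> in M. X 0 \<omega> = vstack x0 0" "AE \<omega> in M. Y T \<omega> = bG2 (\<alpha> T \<omega>) *v X T \<omega> + bGh2 (\<alpha> T \<omega>) *v Xh T \<omega>"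
    using H unfolding hamiltonian_system_def by blast+
  then show "sq_process X" "adapted X" "sq_process Y" "adapted Y" "sq_process Z" "adapted Z" "cond_version X Xh"
    "AE \<omega> in M. X 0 \<omega> = vstack x0 0" "AE \<omega> in M. Y T \<omega> = bG2 (\<alpha> T \<omega>) *v X T \<omega> + bGh2 (\<alpha> T \<omega>) *v Xh T \<omega>"
    by (simp_all add: L2F_iff S2F_def)
  then show "sq_process Xh" "adapted Xh"
    using sq_process_cond_version[of X Xh] cond_version_adapted[of X Xh] by blast+
qed

lemma u2_eq: "u2 t \<omega> = - (matrix_inv (N2t t (\<alpha> t \<omega>)) *v (bS2 t (\<alpha> t \<omega>) *v X t \<omega> + bSh2 t (\<alpha> t \<omega>) *v Xh t \<omega>))"
  by (simp add: u2 leader_control_def Let_def)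

lemma u2_process: "sq_process u2" "adapted u2"
proof -
  have "sq_process (\<lambda>t \<omega>. u2 t \<omega>)" "adapted (\<lambda>t \<omega>. u2 t \<omega>)"
    unfolding u2_eq
    by (intro sq_process_minus sq_process_add sq_process_coeff continuous_N2t_inv continuous_leader_coeffs X Xh
        adapted_minus adapted_add adapted_coeff)+
  then show "sq_process u2" "adapted u2" by simp_all
qed

definition drift_X where
  "drift_X t \<omega> = bA t (\<alpha> t \<omega>) *v X t \<omega> + bAh t (\<alpha> t \<omega>) *v Xh t \<omega> + bF1 t (\<alpha> t \<omega>) *v Y t \<omega> +
     bB1 t (\<alpha> t \<omega>) *v Z t \<omega> + bB2 t (\<alpha> t \<omega>) *v u2 t \<omega>"

definition diffusion_X where
  "diffusion_X t \<omega> = bC t (\<alpha> t \<omega>) *v X t \<omega> + bCh t (\<alpha> t \<omega>) *v Xh t \<omega> + transpose (bB1 t (\<alpha> t \<omega>)) *v Y t \<omega> +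
     bD1 t (\<alpha> t \<omega>) *v Z t \<omega> + bD2 t (\<alpha> t \<omega>) *v u2 t \<omega>"

lemma X_process:
  "sq_process drift_X" "adapted drift_X" "sq_process diffusion_X" "adapted diffusion_X"
  "differential_W X drift_X diffusion_X"
proof -
  have "sq_process (\<lambda>t \<omega>. drift_X t \<omega>)" "adapted (\<lambda>t \<omega>. drift_X t \<omega>)"
    "sq_process (\<lambda>t \<omega>. diffusion_X t \<omega>)" "adapted (\<lambda>t \<omega>. diffusion_X t \<omega>)"
    unfolding drift_X_def diffusion_X_def
    by (intro sq_process_add sq_process_coeff[where D = "bA"] sq_process_coeff[where D = "bAh"]
        sq_process_coeff[where D = "bF1"]
        sq_process_coeff[where D = "bB1"] sq_process_coeff[where D = "bB2"] sq_process_coeff[where D = "bC"]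
        sq_process_coeff[where D = "bCh"] sq_process_coeff[where D = "\<lambda>t i. transpose (bB1 t i)"]
        sq_process_coeff[where D = "bD1"] sq_process_coeff[where D = "bD2"]
        continuous_closed_loop_coeffs continuous_on_transpose X Xh Y Z u2_process
        adapted_add adapted_coeff[where D = "bA"] adapted_coeff[where D = "bAh"] adapted_coeff[where D = "bF1"]
        adapted_coeff[where D = "bB1"] adapted_coeff[where D = "bB2"] adapted_coeff[where D = "bC"]
        adapted_coeff[where D = "bCh"] adapted_coeff[where D = "\<lambda>t i. transpose (bB1 t i)"]
        adapted_coeff[where D = "bD1"] adapted_coeff[where D = "bD2"])+
  then show "sq_process drift_X" "adapted drift_X" "sq_process diffusion_X" "adapted diffusion_X" by simp_all
  show "differential_W X drift_X diffusion_X"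
    using H unfolding hamiltonian_system_def drift_X_def[abs_def] diffusion_X_def[abs_def] by blast
qed

lemma sq_int_X_0: "sq_int M (X 0)"
proof (rule sq_int_cong_AE)
  show "sq_int M (\<lambda>_. vstack x0 0 :: real^('n + 'n))" by (simp add: sq_int_def)
  show "X 0 \<in> borel_measurable M" using T_pos by (intro sq_process_section X) auto
  show "AE \<omega> in M. vstack x0 0 = X 0 \<omega>" using X_0 by eventually_elim simp
qed

text \<open>Needed at every time, including 0 and T. For X the equation provides it; for Y and Z it
  is inherited through the decoupling relations, which hold at each time.\<close>

lemma sq_int_sections:
  assumes t: "t \<in> {0..T}"
  shows "sq_int M (X t)" "sq_int M (Xh t)" "sq_int M (u2 t)" "sq_int M (Y t)" "sq_int M (Z t)"
proof -
  show X: "sq_int M (X t)"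
    by (rule differential_W_sq_int[OF X_process(5) X(1) sq_int_X_0 X_process(1) t])
  show Xh: "sq_int M (Xh t)" by (rule sq_int_cond_version[OF Xh(1) t X])
  have "sq_int M (\<lambda>\<omega>. u2 t \<omega>)"
    unfolding u2_eq by (intro sq_int_minus sq_int_add sq_int_coeff t X Xh)
  then show u2: "sq_int M (u2 t)" by simp
  have YZt: "AE \<omega> in M. Y t \<omega> = P2 t (\<alpha> t \<omega>) *v X t \<omega> + Ph2 t (\<alpha> t \<omega>) *v Xh t \<omega> \<and>
      Z t \<omega> = (matrix_inv (I_P2_D1 t (\<alpha> t \<omega>)) ** P2 t (\<alpha> t \<omega>)) *v
                (bJ2 t (\<alpha> t \<omega>) *v X t \<omega> + bJh2 t (\<alpha> t \<omega>) *v Xh t \<omega> + bD2 t (\<alpha> t \<omega>) *v u2 t \<omega>)"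
    using YZ t unfolding decoupled_def by blast
  show "sq_int M (Y t)"
  proof (rule sq_int_cong_AE)
    show "sq_int M (\<lambda>\<omega>. P2 t (\<alpha> t \<omega>) *v X t \<omega> + Ph2 t (\<alpha> t \<omega>) *v Xh t \<omega>)"
      by (intro sq_int_add sq_int_coeff t X Xh)
    show "Y t \<in> borel_measurable M" by (rule sq_process_section[OF Y(1) t])
    show "AE \<omega> in M. P2 t (\<alpha> t \<omega>) *v X t \<omega> + Ph2 t (\<alpha> t \<omega>) *v Xh t \<omega> = Y t \<omega>"
      using YZt by eventually_elim simp
  qed
  show "sq_int M (Z t)"
  proof (rule sq_int_cong_AE)
    show "sq_int M (\<lambda>\<omega>. (matrix_inv (I_P2_D1 t (\<alpha> t \<omega>)) ** P2 t (\<alpha> t \<omega>)) *v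
                (bJ2 t (\<alpha> t \<omega>) *v X t \<omega> + bJh2 t (\<alpha> t \<omega>) *v Xh t \<omega> + bD2 t (\<alpha> t \<omega>) *v u2 t \<omega>))"
      by (intro sq_int_add sq_int_coeff[where D = "\<lambda>t i. matrix_inv (I_P2_D1 t i) ** P2 t i"]
          sq_int_coeff[where D = bJ2] sq_int_coeff[where D = bJh2] sq_int_coeff[where D = bD2] t X Xh u2)
    show "Z t \<in> borel_measurable M" by (rule sq_process_section[OF Z(1) t])
    show "AE \<omega> in M. (matrix_inv (I_P2_D1 t (\<alpha> t \<omega>)) ** P2 t (\<alpha> t \<omega>)) *v
                (bJ2 t (\<alpha> t \<omega>) *v X t \<omega> + bJh2 t (\<alpha> t \<omega>) *v Xh t \<omega> + bD2 t (\<alpha> t \<omega>) *v u2 t \<omega>) = Z t \<omega>"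
      using YZt by eventually_elim simp
  qed
qed

subsection \<open>Feedback form of the follower's control\<close>

lemma follower_feedback:
  assumes t: "t \<in> {0..T}"
  shows "AE \<omega> in M. u1 t \<omega> =
    - ((matrix_inv (N1t t (\<alpha> t \<omega>)) ** follower_gain t (\<alpha> t \<omega>)) *v X t \<omega>)
    - ((matrix_inv (N1t t (\<alpha> t \<omega>)) ** follower_gain_h t (\<alpha> t \<omega>)) *v Xh t \<omega>)"
proof -
  have YZt: "AE \<omega> in M. Y t \<omega> = P2 t (\<alpha> t \<omega>) *v X t \<omega> + Ph2 t (\<alpha> t \<omega>) *v Xh t \<omega> \<and>
      Z t \<omega> = (matrix_inv (I_P2_D1 t (\<alpha> t \<omega>)) ** P2 t (\<alpha> t \<omega>)) *v
                (bJ2 t (\<alpha> t \<omega>) *v X t \<omega> + bJh2 t (\<alpha> t \<omega>) *v Xh t \<omega> + bD2 t (\<alpha> t \<omega>) *v u2 t \<omega>)"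
    using YZ t unfolding decoupled_def by blast
  then show ?thesis
  proof eventually_elim
    case (elim \<omega>)
    define i where "i = \<alpha> t \<omega>"
    \<comment> \<open>Padding with a zero block lets every matrix act on the full vectors, which is
      the shape of the two gains.\<close>
    have up: "A *v upper v = hstack A 0 *v v" and lo: "B *v lower v = hstack 0 B *v v"
      for A B :: "real^'n^'m1" and v :: "real^('n + 'n)"
      by (simp_all add: hstack_mult)
    have u2': "u2 t \<omega> = - (matrix_inv (N2t t i) *v (bS2 t i *v X t \<omega> + bSh2 t i *v Xh t \<omega>))"
      by (simp add: u2_eq i_def)
    have YZ': "Y t \<omega> = P2 t i *v X t \<omega> + Ph2 t i *v Xh t \<omega>"
      "Z t \<omega> = (matrix_inv (I_P2_D1 t i) ** P2 t i) *v (bJ2 t i *v X t \<omega> + bJh2 t i *v Xh t \<omega> + bD2 t i *v u2 t \<omega>)"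
      using elim by (simp_all add: i_def)
    have "S1 t i *v upper (X t \<omega>) + Sh1 t i *v upper (Xh t \<omega>) +
          (transpose (cB1 c i) *v lower (Y t \<omega>) + transpose (cD1 c i) *v lower (Z t \<omega>) +
           (transpose (cD1 c i) ** P1 t i ** cD2 c i) *v u2 t \<omega>) =
        follower_gain t i *v X t \<omega> + follower_gain_h t i *v Xh t \<omega>"
      unfolding up lo YZ' u2' follower_gain_def follower_gain_h_def
      by (simp del: transpose_matrix_vector add: matrix_vector_right_distrib matrix_vector_mult_add_rdistrib
          matrix_vector_mult_diff_rdistrib matrix_vector_mult_diff_distrib matrix_vector_mult_minus_right
              matrix_vector_mul_assoc matrix_mul_assoc)
    then show ?case
      unfolding u1 follower_control_def Let_def i_def[symmetric]
      by (simp only: matrix_vector_right_distrib matrix_vector_mul_assoc[symmetric]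
          minus_add_distrib diff_conv_add_uminus)
  qed
qed

subsection \<open>The value of the game\<close>

text \<open>Stationarity eliminates Y and Z from the control terms of \<open>inner_duality\<close>,
  leaving minus the cost of control and a hatted remainder. The hats of Y, Z and the control are
  parameters because the Hamiltonian system only asserts that suitable versions exist.\<close>

lemma expected_duality:
  assumes t: "t \<in> {0..T}"
    and Yh: "cond_version Y Yh" and Zh: "cond_version Z Zh" and uh: "cond_version u2 u2h"
    and g: "g t = (\<lambda>\<omega>. - (transpose (bA t (\<alpha> t \<omega>)) *v Y t \<omega> + transpose (bAh t (\<alpha> t \<omega>)) *v Yh t \<omega> +
        transpose (bC t (\<alpha> t \<omega>)) *v Z t \<omega> + transpose (bCh t (\<alpha> t \<omega>)) *v Zh t \<omega> +
        bQ2 (\<alpha> t \<omega>) *v X t \<omega> + bQh2 (\<alpha> t \<omega>) *v Xh t \<omega> +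
        transpose (bF2 t (\<alpha> t \<omega>)) *v u2 t \<omega> + transpose (bFh2 t (\<alpha> t \<omega>)) *v u2h t \<omega>))"
    and g_meas: "g t \<in> borel_measurable M"
  shows "(\<integral>\<omega>. flip (drift_X t \<omega>) \<bullet> Y t \<omega> + flip (X t \<omega>) \<bullet> g t \<omega> + flip (diffusion_X t \<omega>) \<bullet> Z t \<omega> \<partial>M) =
    (\<integral>\<omega>. - running_cost u2 (\<lambda>t \<omega>. upper (X t \<omega>)) (\<lambda>t \<omega>. upper (Xh t \<omega>)) t \<omega> \<partial>M)"
proof -
  note sq = sq_int_sections[OF t]
  have Yh': "sq_int M (Yh t)" by (rule sq_int_cond_version[OF Yh t sq(4)])
  have Zh': "sq_int M (Zh t)" by (rule sq_int_cond_version[OF Zh t sq(5)])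
  have uh': "sq_int M (u2h t)" by (rule sq_int_cond_version[OF uh t sq(3)])
  have up: "sq_int M (\<lambda>\<omega>. upper (X t \<omega>))" "sq_int M (\<lambda>\<omega>. upper (Xh t \<omega>))"
    by (intro sq_int_bounded_linear[OF sq(1) bounded_linear_upper]
        sq_int_bounded_linear[OF sq(2) bounded_linear_upper])+
  define HA where "HA i = block (transpose (dAh t i)) 0 0 (- transpose (dAh t i))" for i
  define HC where "HC i = block (transpose (dCh t i)) 0 0 (- transpose (dCh t i))" for i
  let ?N = "\<lambda>\<omega>. (cN2 c (\<alpha> t \<omega>) *v u2 t \<omega>) \<bullet> u2 t \<omega>"
  let ?Q = "\<lambda>\<omega>. (cQ2 c (\<alpha> t \<omega>) *v upper (X t \<omega>)) \<bullet> upper (X t \<omega>)"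
  let ?Qh = "\<lambda>\<omega>. upper (X t \<omega>) \<bullet> (cQh2 c (\<alpha> t \<omega>) *v upper (Xh t \<omega>))"
  let ?Qhh = "\<lambda>\<omega>. upper (Xh t \<omega>) \<bullet> (cQh2 c (\<alpha> t \<omega>) *v upper (Xh t \<omega>))"
  let ?F = "\<lambda>\<omega>. u2 t \<omega> \<bullet> (bFh2 t (\<alpha> t \<omega>) *v Xh t \<omega>)"
  let ?F' = "\<lambda>\<omega>. u2h t \<omega> \<bullet> (bFh2 t (\<alpha> t \<omega>) *v X t \<omega>)"
  let ?A = "\<lambda>\<omega>. X t \<omega> \<bullet> (HA (\<alpha> t \<omega>) *v Yh t \<omega>)"
  let ?A' = "\<lambda>\<omega>. Xh t \<omega> \<bullet> (HA (\<alpha> t \<omega>) *v Y t \<omega>)"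
  let ?C = "\<lambda>\<omega>. X t \<omega> \<bullet> (HC (\<alpha> t \<omega>) *v Zh t \<omega>)"
  let ?C' = "\<lambda>\<omega>. Xh t \<omega> \<bullet> (HC (\<alpha> t \<omega>) *v Z t \<omega>)"
  let ?R = "\<lambda>\<omega>. - ?N \<omega> - ?F \<omega> - ?Q \<omega> + (?A' \<omega> - ?A \<omega>) + (?C' \<omega> - ?C \<omega>) - ?Qh \<omega> + ?F' \<omega>"
  have int: "integrable M ?N" "integrable M ?Q" "integrable M ?Qh" "integrable M ?Qhh" "integrable M ?F"
      "integrable M ?F'"
    "integrable M ?A" "integrable M ?A'" "integrable M ?C" "integrable M ?C'"
    by (intro integrable_inner_sq_int sq_int_coeff[where D = "\<lambda>_. cN2 c"] sq_int_coeff[where D = "\<lambda>_. cQ2 c"]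
        sq_int_coeff[where D = "\<lambda>_. cQh2 c"] sq_int_coeff[where D = bFh2] sq_int_coeff[where D = "\<lambda>_. HA"]
        sq_int_coeff[where D = "\<lambda>_. HC"] t sq Yh' Zh' uh' up)+
  \<comment> \<open>The A and C terms pair drift or diffusion of X with the drift of Y. The F terms
    pair the remainder of stationarity with the hatted control in the drift of Y. The last identity
    produces the doubly hatted form in which the cost is written.\<close>
  have eqs: "(\<integral>\<omega>. ?F \<omega> \<partial>M) = (\<integral>\<omega>. ?F' \<omega> \<partial>M)" "(\<integral>\<omega>. ?A \<omega> \<partial>M) = (\<integral>\<omega>. ?A' \<omega> \<partial>M)" "(\<integral>\<omega>. ?C \<omega> \<partial>M) = (\<integral>\<omega>. ?C' \<omega> \<partial>M)"
    "(\<integral>\<omega>. ?Qh \<omega> \<partial>M) = (\<integral>\<omega>. ?Qhh \<omega> \<partial>M)"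
  proof -
    show "(\<integral>\<omega>. ?F \<omega> \<partial>M) = (\<integral>\<omega>. ?F' \<omega> \<partial>M)"
      by (rule cond_version_swap[OF uh sq(3) Xh(1) sq(1) t, of "bFh2 t"])
    show "(\<integral>\<omega>. ?A \<omega> \<partial>M) = (\<integral>\<omega>. ?A' \<omega> \<partial>M)"
      by (rule cond_version_swap[OF Xh(1) sq(1) Yh sq(4) t, of HA])
    show "(\<integral>\<omega>. ?C \<omega> \<partial>M) = (\<integral>\<omega>. ?C' \<omega> \<partial>M)"
      by (rule cond_version_swap[OF Xh(1) sq(1) Zh sq(5) t, of HC])
    show "(\<integral>\<omega>. ?Qh \<omega> \<partial>M) = (\<integral>\<omega>. ?Qhh \<omega> \<partial>M)"
      by (rule cond_version_pull_out[OF cond_version_upper[OF Xh(1)] up(1) cond_version_upper[OF Xh(1)] up(1) t, of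
          "cQh2 c"])
  qed
  have meas: "drift_X t \<in> borel_measurable M" "diffusion_X t \<in> borel_measurable M"
    by (rule sq_process_section[OF X_process(1) t], rule sq_process_section[OF X_process(3) t])
  have flip_meas: "(\<lambda>\<omega>. flip (v \<omega>)) \<in> borel_measurable M" if "v \<in> borel_measurable M" for v :: "'w \<Rightarrow> real^('n + 'n)"
    using borel_measurable_continuous_onI[OF linear_continuous_on[OF bounded_linear_flip]] that
    by (rule measurable_compose[rotated])
  have YZt: "AE \<omega> in M. Y t \<omega> = P2 t (\<alpha> t \<omega>) *v X t \<omega> + Ph2 t (\<alpha> t \<omega>) *v Xh t \<omega> \<and>
      Z t \<omega> = (matrix_inv (I_P2_D1 t (\<alpha> t \<omega>)) ** P2 t (\<alpha> t \<omega>)) *v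
                (bJ2 t (\<alpha> t \<omega>) *v X t \<omega> + bJh2 t (\<alpha> t \<omega>) *v Xh t \<omega> + bD2 t (\<alpha> t \<omega>) *v u2 t \<omega>)"
    using YZ t unfolding decoupled_def by blast
  have "(\<integral>\<omega>. flip (drift_X t \<omega>) \<bullet> Y t \<omega> + flip (X t \<omega>) \<bullet> g t \<omega> + flip (diffusion_X t \<omega>) \<bullet> Z t \<omega> \<partial>M) = (\<integral>\<omega>. ?R \<omega> \<partial>M)"
  proof (rule integral_cong_AE)
    show "(\<lambda>\<omega>. flip (drift_X t \<omega>) \<bullet> Y t \<omega> + flip (X t \<omega>) \<bullet> g t \<omega> + flip (diffusion_X t \<omega>) \<bullet> Z t \<omega>)
        \<in> borel_measurable M"
      by (intro borel_measurable_add borel_measurable_inner flip_meas meas g_meas sq_intD(1)[OF sq(1)]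
          sq_intD(1)[OF sq(4)] sq_intD(1)[OF sq(5)])
    show "?R \<in> borel_measurable M"
      by (intro borel_measurable_add borel_measurable_diff borel_measurable_uminus
          int[THEN borel_measurable_integrable])
    show "AE \<omega> in M. flip (drift_X t \<omega>) \<bullet> Y t \<omega> + flip (X t \<omega>) \<bullet> g t \<omega> + flip (diffusion_X t \<omega>) \<bullet> Z t \<omega> = ?R \<omega>"
      using YZt
    proof eventually_elim
      case (elim \<omega>)
      define i where "i = \<alpha> t \<omega>"
      have "transpose (bB2 t i) *v Y t \<omega> + transpose (bD2 t i) *v Z t \<omega> + bF2 t i *v X t \<omega> + bFh2 t i *v Xh t \<omega> +
          cN2 c i *v u2 t \<omega> = 0"
        by (rule stationarity[OF N2t_invertible[OF t]]) (use elim u2_eq in \<open>simp_all add: i_def\<close>)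
      then have "transpose (bB2 t i) *v Y t \<omega> + transpose (bD2 t i) *v Z t \<omega> +
          bF2 t i *v X t \<omega> = - (bFh2 t i *v Xh t \<omega>) - cN2 c i *v u2 t \<omega>"
        by (simp only: add_eq_0_iff diff_conv_add_uminus minus_add_distrib) (simp add: algebra_simps)
      then have "u2 t \<omega> \<bullet> (transpose (bB2 t i) *v Y t \<omega> + transpose (bD2 t i) *v Z t \<omega> + bF2 t i *v X t \<omega>) =
          - (u2 t \<omega> \<bullet> (bFh2 t i *v Xh t \<omega>)) - (cN2 c i *v u2 t \<omega>) \<bullet> u2 t \<omega>"
        by (simp only: inner_diff_right inner_minus_right inner_commute[of "u2 t \<omega>" "cN2 c i *v u2 t \<omega>"])
      then show ?case
        unfolding g drift_X_def diffusion_X_def HA_def HC_def i_def[symmetric]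
          inner_duality[OF transpose_dF1[OF t] transpose_dD1[OF t]]
        by linarith
    qed
  qed
  also have "\<dots> = - (\<integral>\<omega>. ?N \<omega> \<partial>M) - (\<integral>\<omega>. ?Q \<omega> \<partial>M) - (\<integral>\<omega>. ?Qhh \<omega> \<partial>M)"
    using int eqs by simp
  also have "\<dots> = (\<integral>\<omega>. - ?N \<omega> - ?Q \<omega> - ?Qhh \<omega> \<partial>M)"
    using int by simp
  also have "\<dots> = (\<integral>\<omega>. - running_cost u2 (\<lambda>t \<omega>. upper (X t \<omega>)) (\<lambda>t \<omega>. upper (Xh t \<omega>)) t \<omega> \<partial>M)"
    by (rule Bochner_Integration.integral_cong[OF refl]) (simp add: running_cost_def inner_commute)
  finally show ?thesis .
qed

abbreviation x_opt where "x_opt \<equiv> \<lambda>t \<omega>. upper (X t \<omega>)"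
abbreviation xh_opt where "xh_opt \<equiv> \<lambda>t \<omega>. upper (Xh t \<omega>)"

lemma x_opt: "sq_process x_opt" "sq_process xh_opt" "t \<in> {0..T} \<Longrightarrow> sq_int M (x_opt t)"
    "t \<in> {0..T} \<Longrightarrow> sq_int M (xh_opt t)"
  using sq_process_bounded_linear[OF X(1) bounded_linear_upper]
      sq_process_bounded_linear[OF Xh(2) bounded_linear_upper]
    sq_int_bounded_linear[OF sq_int_sections(1) bounded_linear_upper]
        sq_int_bounded_linear[OF sq_int_sections(2) bounded_linear_upper]
  by auto

text \<open>The product formula applied to \<open>flip X\<close> and \<open>Y\<close>; by Fubini its
  right-hand side can be evaluated at fixed times, where \<open>expected_duality\<close> identifies
  it with minus the running cost.\<close>

lemma flipped_duality:
  "(\<integral>\<omega>. flip (X T \<omega>) \<bullet> Y T \<omega> \<partial>M) - (\<integral>\<omega>. flip (X 0 \<omega>) \<bullet> Y 0 \<omega> \<partial>M) =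
    - (\<integral>p. running_cost u2 x_opt xh_opt (fst p) (snd p) \<partial>prod_measure)"
proof -
  have TT: "T \<in> {0..T}" and z0: "0 \<in> {0..T}" using T_pos by auto
  obtain I where I: "W_integral diffusion_X I"
    "AE \<omega> in M. \<forall>t\<in>{0..T}. X t \<omega> = X 0 \<omega> + (LBINT s:{0..t}. drift_X s \<omega>) + I t \<omega>"
    using X_process(5) unfolding differential_W_def by blast
  define g where "g Yh Zh u2h t \<omega> = - (transpose (bA t (\<alpha> t \<omega>)) *v Y t \<omega> + transpose (bAh t (\<alpha> t \<omega>)) *v Yh t \<omega> +
        transpose (bC t (\<alpha> t \<omega>)) *v Z t \<omega> + transpose (bCh t (\<alpha> t \<omega>)) *v Zh t \<omega> +
        bQ2 (\<alpha> t \<omega>) *v X t \<omega> + bQh2 (\<alpha> t \<omega>) *v Xh t \<omega> +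
        transpose (bF2 t (\<alpha> t \<omega>)) *v u2 t \<omega> + transpose (bFh2 t (\<alpha> t \<omega>)) *v u2h t \<omega>)" for Yh Zh u2h t \<omega>
  have "\<exists>Yh Zh u2h. cond_version Y Yh \<and> cond_version Z Zh \<and> cond_version u2 u2h
      \<and> differential_W_jump Y (g Yh Zh u2h) Z K"
    using H unfolding hamiltonian_system_def g_def[abs_def] by blast
  then obtain Yh Zh u2h where h: "cond_version Y Yh" "cond_version Z Zh" "cond_version u2 u2h"
    and "differential_W_jump Y (g Yh Zh u2h) Z K"
    by blast
  then obtain I' J where I': "W_integral Z I'" and J: "jump_integral K J" and
    Y_eq: "AE \<omega> in M. \<forall>t\<in>{0..T}. Y t \<omega> = Y 0 \<omega> + (LBINT s:{0..t}. g Yh Zh u2h s \<omega>) + I' t \<omega> + J t \<omega>"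
    unfolding differential_W_jump_def by blast
  define G where "G = g Yh Zh u2h"
  have G: "sq_process G" "adapted G"
  proof -
    have "sq_process (\<lambda>t \<omega>. g Yh Zh u2h t \<omega>)" "adapted (\<lambda>t \<omega>. g Yh Zh u2h t \<omega>)"
      unfolding g_def
      by (intro sq_process_minus sq_process_add sq_process_coeff[where D = "\<lambda>t i. transpose (bA t i)"]
          sq_process_coeff[where D = "\<lambda>t i. transpose (bAh t i)"]
              sq_process_coeff[where D = "\<lambda>t i. transpose (bC t i)"]
          sq_process_coeff[where D = "\<lambda>t i. transpose (bCh t i)"]
              sq_process_coeff[where D = "\<lambda>t i. transpose (bF2 t i)"]
          sq_process_coeff[where D = "\<lambda>t i. transpose (bFh2 t i)"] sq_process_const_coeff[where D = bQ2]
          sq_process_const_coeff[where D = bQh2] continuous_on_transpose continuous_closed_loop_coeffs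
          X Xh Y Z u2_process sq_process_cond_version[OF h(1) Y(1)] sq_process_cond_version[OF h(2) Z(1)]
          sq_process_cond_version[OF h(3) u2_process(1)]
          adapted_minus adapted_add adapted_coeff[where D = "\<lambda>t i. transpose (bA t i)"]
          adapted_coeff[where D = "\<lambda>t i. transpose (bAh t i)"] adapted_coeff[where D = "\<lambda>t i. transpose (bC t i)"]
          adapted_coeff[where D = "\<lambda>t i. transpose (bCh t i)"] adapted_coeff[where D = "\<lambda>t i. transpose (bF2 t i)"]
          adapted_coeff[where D = "\<lambda>t i. transpose (bFh2 t i)"] adapted_coeff[where D = "\<lambda>t. bQ2"]
          adapted_coeff[where D = "\<lambda>t. bQh2"] cond_version_adapted[OF h(1)] cond_version_adapted[OF h(2)]
          cond_version_adapted[OF h(3)])+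
    then show "sq_process G" "adapted G" by (simp_all add: G_def)
  qed
  have Y_eq': "AE \<omega> in M. \<forall>t\<in>{0..T}. Y t \<omega> = Y 0 \<omega> + (LBINT s:{0..t}. G s \<omega>) + I' t \<omega> + J t \<omega>"
    unfolding G_def by (rule Y_eq)
  have I'_mart: "sq_martingale I'" by (rule sq_martingale_W_integral[OF I'])
  \<comment> \<open>The equation expresses \<open>J t\<close> through square integrable terms. As
    this holds only almost everywhere, measurability of \<open>J t\<close> is taken separately from
    the adaptedness of its summands.\<close>
  have J_sq: "sq_int M (J t)" if t: "t \<in> {0..T}" for t
  proof -
    have "sq_int M (\<lambda>\<omega>. Y t \<omega> - Y 0 \<omega> - time_integral G t \<omega> - I' t \<omega>)"
      by (intro sq_int_diff sq_int_sections t z0 sq_int_time_integral G sq_martingaleD(1)[OF I'_mart])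
    then show ?thesis
    proof (rule sq_int_cong_AE)
      obtain J' where J': "\<forall>i j. L2_integral (jump_mart i j) (qv_jump i j) (K i j) (J' i j)"
        "J = (\<lambda>t \<omega>. \<Sum>i\<in>UNIV. \<Sum>j\<in>UNIV. J' i j t \<omega>)"
        using J unfolding jump_integral_def by blast
      have "J' i j t \<in> borel_measurable M" for i j
      proof -
        have "J' i j t \<in> borel_measurable (filt t)"
          using J'(1) t unfolding L2_integral_def adapted_def by blast
        then show ?thesis
          using t by (intro measurable_from_subalg[OF subalgebra_filt]) auto
      qed
      then show "J t \<in> borel_measurable M"
        unfolding J'(2) by (intro borel_measurable_sum)
      show "AE \<omega> in M. Y t \<omega> - Y 0 \<omega> - time_integral G t \<omega> - I' t \<omega> = J t \<omega>"
        using Y_eq'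
      proof eventually_elim
        case (elim \<omega>)
        then have "Y t \<omega> = Y 0 \<omega> + time_integral G t \<omega> + I' t \<omega> + J t \<omega>"
          unfolding time_integral_eq[OF t] using t by blast
        then show ?case by (simp add: algebra_simps)
      qed
    qed
  qed
  note flip = bounded_linear_flip[where ?'n = 'n and ?'m = 'n]
  have fI: "W_integral (\<lambda>t \<omega>. flip (diffusion_X t \<omega>)) (\<lambda>t \<omega>. flip (I t \<omega>))"
    by (rule W_integral_bounded_linear[OF I(1) flip])
  note J_mart = jump_integral_martingale(1)[OF J J_sq] jump_integral_martingale(2)[OF J J_sq fI TT]
  have fX: "sq_process (\<lambda>t \<omega>. flip (X t \<omega>))" and fb: "sq_process (\<lambda>t \<omega>. flip (drift_X t \<omega>))"
    and fs: "sq_process (\<lambda>t \<omega>. flip (diffusion_X t \<omega>))"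
    by (rule sq_process_bounded_linear[OF X(1) flip] sq_process_bounded_linear[OF X_process(1) flip]
        sq_process_bounded_linear[OF X_process(3) flip])+
  have "(\<integral>\<omega>. flip (X T \<omega>) \<bullet> Y T \<omega> \<partial>M) - (\<integral>\<omega>. flip (X 0 \<omega>) \<bullet> Y 0 \<omega> \<partial>M) =
      (\<integral>p. flip (drift_X (fst p) (snd p)) \<bullet> Y (fst p) (snd p) \<partial>prod_measure) +
      (\<integral>p. flip (X (fst p) (snd p)) \<bullet> G (fst p) (snd p) \<partial>prod_measure) +
      (\<integral>p. flip (diffusion_X (fst p) (snd p)) \<bullet> Z (fst p) (snd p) \<partial>prod_measure)"
    by (rule product_formula[OF fI I' J_mart fX _ _ Y(1,2) sq_int_sections(4)[OF z0] fb _ G _ Y_eq'])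
      (assumption | rule adapted_bounded_linear[OF X(2) flip] adapted_bounded_linear[OF X_process(2) flip]
        sq_int_bounded_linear[OF sq_int_sections(1)[OF z0] flip] path_bounded_linear[OF flip X_process(1) I(2) refl])+
  also have "\<dots> = (\<integral>p. flip (drift_X (fst p) (snd p)) \<bullet> Y (fst p) (snd p) +
      flip (X (fst p) (snd p)) \<bullet> G (fst p) (snd p) + flip (diffusion_X (fst p) (snd p)) \<bullet> Z (fst p) (snd p)
          \<partial>prod_measure)"
    using sq_process_inner[OF fb Y(1)] sq_process_inner[OF fX G(1)] sq_process_inner[OF fs Z(1)] by simp
  also have "\<dots> = (\<integral>t. (\<integral>\<omega>. flip (drift_X t \<omega>) \<bullet> Y t \<omega> + flip (X t \<omega>) \<bullet> G t \<omega> + flip (diffusion_X t \<omega>) \<bullet> Z t \<omega> \<partial>M)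
      \<partial>time_measure)"
    by (rule integral_prod_fst) (intro Bochner_Integration.integrable_add sq_process_inner[OF fb Y(1)]
      sq_process_inner[OF fX G(1)] sq_process_inner[OF fs Z(1)])
  also have "\<dots> = (\<integral>t. (\<integral>\<omega>. - running_cost u2 x_opt xh_opt t \<omega> \<partial>M) \<partial>time_measure)"
  proof (rule Bochner_Integration.integral_cong[OF refl])
    fix t assume "t \<in> space time_measure"
    then have t: "t \<in> {0..T}" by simp
    show "(\<integral>\<omega>. flip (drift_X t \<omega>) \<bullet> Y t \<omega> + flip (X t \<omega>) \<bullet> G t \<omega> + flip (diffusion_X t \<omega>) \<bullet> Z t \<omega> \<partial>M) =
        (\<integral>\<omega>. - running_cost u2 x_opt xh_opt t \<omega> \<partial>M)"
      by (rule expected_duality[where g = G, OF t h _ sq_process_section[OF G(1) t]]) (unfold G_def, rule ext,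
          rule g_def)
  qed
  also have "\<dots> = (\<integral>p. - running_cost u2 x_opt xh_opt (fst p) (snd p) \<partial>prod_measure)"
    by (rule integral_prod_fst[symmetric])
      (intro Bochner_Integration.integrable_minus integrable_running_cost x_opt u2_process)
  finally show ?thesis by simp
qed

text \<open>The terminal matrices have only an upper left block, so the lower half of
  \<open>Y T\<close> is zero and psi drops out. The hatted part is completed to two hats by
  \<open>cond_version_pull_out\<close>.\<close>

lemma expected_terminal: "(\<integral>\<omega>. flip (X T \<omega>) \<bullet> Y T \<omega> \<partial>M) = (\<integral>\<omega>. terminal_cost x_opt xh_opt \<omega> \<partial>M)"
proof -
  have TT: "T \<in> {0..T}" using T_pos by simp
  note x = x_opt(3)[OF TT] and xh = x_opt(4)[OF TT]
  have "(\<integral>\<omega>. flip (X T \<omega>) \<bullet> Y T \<omega> \<partial>M) =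
      (\<integral>\<omega>. (cG2 c (\<alpha> T \<omega>) *v x_opt T \<omega>) \<bullet> x_opt T \<omega> + x_opt T \<omega> \<bullet> (cGh2 c (\<alpha> T \<omega>) *v xh_opt T \<omega>) \<partial>M)"
  proof (rule integral_cong_AE)
    show "AE \<omega> in M. flip (X T \<omega>) \<bullet> Y T \<omega> =
        (cG2 c (\<alpha> T \<omega>) *v x_opt T \<omega>) \<bullet> x_opt T \<omega> + x_opt T \<omega> \<bullet> (cGh2 c (\<alpha> T \<omega>) *v xh_opt T \<omega>)"
      using Y_T
      by eventually_elim (simp add: flip_def bG2_def bGh2_def block_mult inner_upper_lower upper_linear lower_linear
          inner_add_right inner_commute)
    show "(\<lambda>\<omega>. flip (X T \<omega>) \<bullet> Y T \<omega>) \<in> borel_measurable M"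
      by (intro borel_measurable_integrable integrable_inner_sq_int sq_int_sections(4)
          sq_int_bounded_linear[OF sq_int_sections(1) bounded_linear_flip] TT)
    show "(\<lambda>\<omega>. (cG2 c (\<alpha> T \<omega>) *v x_opt T \<omega>) \<bullet> x_opt T \<omega> + x_opt T \<omega> \<bullet> (cGh2 c (\<alpha> T \<omega>) *v xh_opt T \<omega>))
        \<in> borel_measurable M"
      by (intro borel_measurable_integrable Bochner_Integration.integrable_add integrable_inner_sq_int
          sq_int_coeff[where D = "\<lambda>_. cG2 c"] sq_int_coeff[where D = "\<lambda>_. cGh2 c"] TT x xh)
  qed
  also have "\<dots> = (\<integral>\<omega>. (cG2 c (\<alpha> T \<omega>) *v x_opt T \<omega>) \<bullet> x_opt T \<omega> \<partial>M) +
      (\<integral>\<omega>. x_opt T \<omega> \<bullet> (cGh2 c (\<alpha> T \<omega>) *v xh_opt T \<omega>) \<partial>M)"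
    by (intro Bochner_Integration.integral_add integrable_inner_sq_int sq_int_coeff[where D = "\<lambda>_. cG2 c"]
        sq_int_coeff[where D = "\<lambda>_. cGh2 c"] TT x xh)
  also have "(\<integral>\<omega>. x_opt T \<omega> \<bullet> (cGh2 c (\<alpha> T \<omega>) *v xh_opt T \<omega>) \<partial>M) =
      (\<integral>\<omega>. xh_opt T \<omega> \<bullet> (cGh2 c (\<alpha> T \<omega>) *v xh_opt T \<omega>) \<partial>M)"
    by (rule cond_version_pull_out[OF cond_version_upper[OF Xh(1)] x cond_version_upper[OF Xh(1)] x TT, of "cGh2 c"])
  also have "(\<integral>\<omega>. (cG2 c (\<alpha> T \<omega>) *v x_opt T \<omega>) \<bullet> x_opt T \<omega> \<partial>M) + (\<integral>\<omega>. xh_opt T \<omega> \<bullet> (cGh2 c (\<alpha> T \<omega>) *v xh_opt T \<omega>) \<partial>M)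
      =
      (\<integral>\<omega>. (cG2 c (\<alpha> T \<omega>) *v x_opt T \<omega>) \<bullet> x_opt T \<omega> + xh_opt T \<omega> \<bullet> (cGh2 c (\<alpha> T \<omega>) *v xh_opt T \<omega>) \<partial>M)"
    by (intro Bochner_Integration.integral_add[symmetric] integrable_inner_sq_int sq_int_coeff[where D = "\<lambda>_. cG2 c"]
        sq_int_coeff[where D = "\<lambda>_. cGh2 c"] TT x xh)
  also have "\<dots> = (\<integral>\<omega>. terminal_cost x_opt xh_opt \<omega> \<partial>M)"
    by (rule Bochner_Integration.integral_cong[OF refl]) (simp add: terminal_cost_def inner_commute)
  finally show ?thesis .
qed

text \<open>The initial value is almost surely constant and hence equal to its conditional
  expectation; both coefficients in the decoupling at time 0 therefore act on the same
  vector.\<close>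

lemma Xh_0: "AE \<omega> in M. Xh 0 \<omega> = vstack x0 0"
proof -
  have z0: "0 \<in> {0..T}" using T_pos by simp
  interpret sigma_finite_subalgebra M "filt_alpha 0"
    by (rule sigma_finite_filt_alpha) (use T_pos in auto)
  have "AE \<omega> in M. Xh 0 \<omega> $ a = (vstack x0 0 :: real^('n + 'n)) $ a" for a
  proof -
    have "AE \<omega> in M. real_cond_exp M (filt_alpha 0) (\<lambda>\<omega>. X 0 \<omega> $ a) \<omega>
        = real_cond_exp M (filt_alpha 0) (\<lambda>_. (vstack x0 0 :: real^('n + 'n)) $ a) \<omega>"
    proof (rule real_cond_exp_cong)
      show "AE \<omega> in M. X 0 \<omega> $ a = (vstack x0 0 :: real^('n + 'n)) $ a"
        using X_0 by eventually_elim simp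
      show "(\<lambda>\<omega>. X 0 \<omega> $ a) \<in> borel_measurable M"
        using sq_intD(1)[OF sq_int_bounded_linear[OF sq_int_X_0 bounded_linear_vec_nth]] .
    qed simp
    moreover have "AE \<omega> in M. real_cond_exp M (filt_alpha 0) (\<lambda>_. (vstack x0 0 :: real^('n + 'n)) $ a) \<omega>
        = (vstack x0 0 :: real^('n + 'n)) $ a"
      by (rule real_cond_exp_F_meas) simp_all
    moreover have "AE \<omega> in M. Xh 0 \<omega> $ a = real_cond_exp M (filt_alpha 0) (\<lambda>\<omega>. X 0 \<omega> $ a) \<omega>"
      using Xh(1) z0 unfolding cond_version_def by blast
    ultimately show ?thesis by eventually_elim simp
  qed
  then have "AE \<omega> in M. \<forall>a. Xh 0 \<omega> $ a = (vstack x0 0 :: real^('n + 'n)) $ a"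
    by (simp add: AE_all_countable)
  then show ?thesis by eventually_elim (subst vec_eq_iff)
qed

text \<open>As psi starts at 0, \<open>flip\<close> leaves the initial vector unchanged and only the
  upper left block of the matrix is seen.\<close>

lemma expected_initial: "(\<integral>\<omega>. flip (X 0 \<omega>) \<bullet> Y 0 \<omega> \<partial>M) = (block11 (Pt2 0 i0) *v x0) \<bullet> x0"
proof -
  have z0: "0 \<in> {0..T}" using T_pos by simp
  have YZt: "AE \<omega> in M. Y 0 \<omega> = P2 0 (\<alpha> 0 \<omega>) *v X 0 \<omega> + Ph2 0 (\<alpha> 0 \<omega>) *v Xh 0 \<omega> \<and>
      Z 0 \<omega> = (matrix_inv (I_P2_D1 0 (\<alpha> 0 \<omega>)) ** P2 0 (\<alpha> 0 \<omega>)) *v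
                (bJ2 0 (\<alpha> 0 \<omega>) *v X 0 \<omega> + bJh2 0 (\<alpha> 0 \<omega>) *v Xh 0 \<omega> + bD2 0 (\<alpha> 0 \<omega>) *v u2 0 \<omega>)"
    using YZ z0 unfolding decoupled_def by blast
  have "(\<integral>\<omega>. flip (X 0 \<omega>) \<bullet> Y 0 \<omega> \<partial>M) = (\<integral>\<omega>. (block11 (Pt2 0 i0) *v x0) \<bullet> x0 \<partial>M)"
  proof (rule integral_cong_AE)
    show "(\<lambda>\<omega>. flip (X 0 \<omega>) \<bullet> Y 0 \<omega>) \<in> borel_measurable M"
      by (intro borel_measurable_integrable integrable_inner_sq_int sq_int_sections(4)
          sq_int_bounded_linear[OF sq_int_sections(1) bounded_linear_flip] z0)
    show "AE \<omega> in M. flip (X 0 \<omega>) \<bullet> Y 0 \<omega> = (block11 (Pt2 0 i0) *v x0) \<bullet> x0"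
      using YZt X_0 Xh_0 initial
    proof eventually_elim
      case (elim \<omega>)
      then have "Y 0 \<omega> = Pt2 0 i0 *v vstack x0 0"
        by (simp add: Ph2_def matrix_vector_mult_diff_rdistrib)
      then show ?case
        using elim by (simp add: flip_def inner_upper_lower upper_block11_mult inner_commute)
    qed
  qed simp
  then show ?thesis by (simp add: prob_space)
qed

text \<open>Terminal minus initial pairing equals minus the running cost, so running plus terminal
  cost is the initial pairing; the factor 1/2 is the one in front of the cost.\<close>

lemma leader_cost_opt: "leader_cost u2 x_opt xh_opt = 1/2 * ((block11 (Pt2 0 i0) *v x0) \<bullet> x0)"
proof -
  have TT: "T \<in> {0..T}" using T_pos by simp
  have "leader_cost u2 x_opt xh_opt = 1/2 * ((\<integral>p. running_cost u2 x_opt xh_opt (fst p) (snd p) \<partial>prod_measure) +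
      (\<integral>\<omega>. terminal_cost x_opt xh_opt \<omega> \<partial>M))"
    by (rule leader_cost_eq[where x = x_opt and xh = xh_opt, OF x_opt(1,2) u2_process(1) x_opt(3,4)[OF TT]])
  then show ?thesis
    using flipped_duality expected_terminal expected_initial by simp
qed

subsection \<open>The state equation\<close>

lemma u1_eq: "u1 t \<omega> = - (matrix_inv (N1t t (\<alpha> t \<omega>)) *v
   (S1 t (\<alpha> t \<omega>) *v x_opt t \<omega> + Sh1 t (\<alpha> t \<omega>) *v xh_opt t \<omega> +
    (transpose (cB1 c (\<alpha> t \<omega>)) *v lower (Y t \<omega>) + transpose (cD1 c (\<alpha> t \<omega>)) *v lower (Z t \<omega>) +
     (transpose (cD1 c (\<alpha> t \<omega>)) ** P1 t (\<alpha> t \<omega>) ** cD2 c (\<alpha> t \<omega>)) *v u2 t \<omega>)))"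
  by (simp add: u1 follower_control_def Let_def)

lemma sq_process_u1: "sq_process u1"
proof -
  have "sq_process (\<lambda>t \<omega>. u1 t \<omega>)"
    unfolding u1_eq
    by (intro sq_process_minus sq_process_add sq_process_coeff[where D = "\<lambda>t i. matrix_inv (N1t t i)"]
        sq_process_coeff[where D = S1] sq_process_coeff[where D = Sh1]
            sq_process_const_coeff[where D = "\<lambda>i. transpose (cB1 c i)"]
        sq_process_const_coeff[where D = "\<lambda>i. transpose (cD1 c i)"]
        sq_process_coeff[where D = "\<lambda>t i. transpose (cD1 c i) ** P1 t i ** cD2 c i"]
            continuous_N1t_inv continuous_follower_coeffs
        continuous_on_matrix_matrix_mult continuous_on_const continuous_P x_opt u2_process
        sq_process_bounded_linear[OF Y(1) bounded_linear_lower]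
            sq_process_bounded_linear[OF Z(1) bounded_linear_lower])
  then show ?thesis by simp
qed

text \<open>The closed-loop coefficients arose by inserting (F) into the state equation; here that
  substitution is undone for the upper row.\<close>

lemma upper_drift_X: "upper (drift_X t \<omega>) = cA c (\<alpha> t \<omega>) *v x_opt t \<omega> + cAh c (\<alpha> t \<omega>) *v xh_opt t \<omega> +
    cB1 c (\<alpha> t \<omega>) *v u1 t \<omega> + cB2 c (\<alpha> t \<omega>) *v u2 t \<omega>"
  unfolding drift_X_def u1_eq
  by (simp del: transpose_matrix_vector add:
      upper_linear bA_def bAh_def bF1_def bB1_def bB2_def block_mult vstack_mult
      dA_def dAh_def dF1_def dB1_def dB2_def matrix_vector_right_distrib matrix_vector_mult_add_rdistrib
      matrix_vector_mult_diff_rdistrib matrix_vector_mult_minus_left matrix_vector_mult_diff_distrib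
      matrix_vector_mult_minus_right matrix_vector_mul_assoc matrix_mul_assoc)

lemma transpose_zero: "transpose (0 :: real^'k^'l) = 0"
  by (simp add: transpose_def vec_eq_iff)

text \<open>Unlike in the drift, the coefficient of phi is a transpose of B1. It agrees with the
  term produced by the control because the inverse of \<open>N1t\<close> is symmetric on the
  horizon, hence the restriction on t.\<close>

lemma upper_diffusion_X:
  assumes "t \<in> {0..T}"
  shows "upper (diffusion_X t \<omega>) = cC c (\<alpha> t \<omega>) *v x_opt t \<omega> + cCh c (\<alpha> t \<omega>) *v xh_opt t \<omega> +
    cD1 c (\<alpha> t \<omega>) *v u1 t \<omega> + cD2 c (\<alpha> t \<omega>) *v u2 t \<omega>"
  unfolding diffusion_X_def u1_eq
  by (simp del: transpose_matrix_vector add: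
      upper_linear bC_def bCh_def bB1_def bD1_def bD2_def transpose_block transpose_zero
      transpose_dB1[OF assms] block_mult vstack_mult
      dC_def dCh_def dD1_def dD2_def matrix_vector_right_distrib matrix_vector_mult_add_rdistrib
      matrix_vector_mult_diff_rdistrib matrix_vector_mult_minus_left matrix_vector_mult_diff_distrib
      matrix_vector_mult_minus_right matrix_vector_mul_assoc matrix_mul_assoc)

text \<open>Provides the solution without which the choice in \<open>J2\<close> would be
  meaningless, and the one whose cost is known.\<close>

lemma state_solution_opt: "state_solution x0 u1 u2 x_opt xh_opt"
  unfolding state_solution_def
proof (intro conjI)
  show "L2F x_opt" using L2F_bounded_linear[OF _ bounded_linear_upper, of X] X by (simp add: L2F_iff)
  show "cond_version x_opt xh_opt" by (rule cond_version_upper[OF Xh(1)])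
  show "AE \<omega> in M. x_opt 0 \<omega> = x0" using X_0 by eventually_elim simp
  obtain I where I: "W_integral diffusion_X I"
    "AE \<omega> in M. \<forall>t\<in>{0..T}. X t \<omega> = X 0 \<omega> + (LBINT s:{0..t}. drift_X s \<omega>) + I t \<omega>"
    using X_process(5) unfolding differential_W_def by blast
  show "differential_W x_opt
      (\<lambda>t \<omega>. cA c (\<alpha> t \<omega>) *v x_opt t \<omega> + cAh c (\<alpha> t \<omega>) *v xh_opt t \<omega> + cB1 c (\<alpha> t \<omega>) *v u1 t \<omega> +
          cB2 c (\<alpha> t \<omega>) *v u2 t \<omega>)
      (\<lambda>t \<omega>. cC c (\<alpha> t \<omega>) *v x_opt t \<omega> + cCh c (\<alpha> t \<omega>) *v xh_opt t \<omega> + cD1 c (\<alpha> t \<omega>) *v u1 t \<omega> +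
          cD2 c (\<alpha> t \<omega>) *v u2 t \<omega>)"
    unfolding differential_W_def
    by (rule exI[of _ "\<lambda>t \<omega>. upper (I t \<omega>)"], rule conjI,
        rule W_integral_cong[OF W_integral_bounded_linear[OF I(1) bounded_linear_upper]], erule upper_diffusion_X,
        rule path_bounded_linear[OF bounded_linear_upper X_process(1) I(2)], rule upper_drift_X)
qed

text \<open>The choice in \<open>J2\<close> may return any solution and any version of its hat. The
  controls are fixed, so two solutions differ by a homogeneous linear equation; equality of the
  states up to modification then carries over to the hats.\<close>

lemma leader_cost_unique:
  assumes "state_solution x0 u1 u2 x xh"
  shows "leader_cost u2 x xh = leader_cost u2 x_opt xh_opt"
proof -
  have TT: "T \<in> {0..T}" and z0: "0 \<in> {0..T}" using T_pos by auto
  let ?b = "\<lambda>x xh t \<omega>. cA c (\<alpha> t \<omega>) *v x t \<omega> + cAh c (\<alpha> t \<omega>) *v xh t \<omega> + cB1 c (\<alpha> t \<omega>) *v u1 t \<omega> +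
      cB2 c (\<alpha> t \<omega>) *v u2 t \<omega>"
  let ?s = "\<lambda>x xh t \<omega>. cC c (\<alpha> t \<omega>) *v x t \<omega> + cCh c (\<alpha> t \<omega>) *v xh t \<omega> + cD1 c (\<alpha> t \<omega>) *v u1 t \<omega> +
      cD2 c (\<alpha> t \<omega>) *v u2 t \<omega>"
  have sol: "sq_process y" "cond_version y yh" "sq_process yh" "AE \<omega> in M. y 0 \<omega> = x0"
      "differential_W y (?b y yh) (?s y yh)"
    "sq_process (?b y yh)" "sq_int M (y 0)" "\<And>t. t \<in> {0..T} \<Longrightarrow> sq_int M (y t)" "\<And>t. t \<in> {0..T} \<Longrightarrow> sq_int M (yh t)"
    if "state_solution x0 u1 u2 y yh" for y yh
  proof -
    show y: "sq_process y" and yh: "cond_version y yh" and y0: "AE \<omega> in M. y 0 \<omega> = x0"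
      and dy: "differential_W y (?b y yh) (?s y yh)"
      using that unfolding state_solution_def L2F_iff by blast+
    show yh': "sq_process yh" by (rule sq_process_cond_version[OF yh y])
    show by_: "sq_process (?b y yh)"
      by (intro sq_process_add sq_process_const_coeff[where D = "cA c"] sq_process_const_coeff[where D = "cAh c"]
          sq_process_const_coeff[where D = "cB1 c"] sq_process_const_coeff[where D = "cB2 c"]
              y yh' sq_process_u1 u2_process)
    show y0': "sq_int M (y 0)"
    proof (rule sq_int_cong_AE)
      show "sq_int M (\<lambda>_. x0)" by (simp add: sq_int_def)
      show "y 0 \<in> borel_measurable M" by (rule sq_process_section[OF y z0])
      show "AE \<omega> in M. x0 = y 0 \<omega>" using y0 by eventually_elim simp
    qed
    show yt: "sq_int M (y t)" if "t \<in> {0..T}" for t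
      by (rule differential_W_sq_int[OF dy y y0' by_ that])
    show "sq_int M (yh t)" if "t \<in> {0..T}" for t
      by (rule sq_int_cond_version[OF yh that yt[OF that]])
  qed
  note s = sol[OF assms] and s' = sol[OF state_solution_opt]
  have eq: "AE \<omega> in M. x t \<omega> = x_opt t \<omega>" if t: "t \<in> {0..T}" for t
  proof (rule linear_SDE_unique[where A = "cA c" and Ah = "cAh c" and C = "cC c" and Ch = "cCh c",
        OF s(5) s'(5) s(2) s'(2) s(1,7) s'(1,7) s(6) s'(6) _ _ _ t])
    show "AE \<omega> in M. x 0 \<omega> = x_opt 0 \<omega>" using s(4) s'(4) by eventually_elim simp
  qed (simp_all add: matrix_vector_mult_diff_distrib)
  have eqh: "AE \<omega> in M. xh t \<omega> = xh_opt t \<omega>" if t: "t \<in> {0..T}" for t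
  proof -
    interpret sigma_finite_subalgebra M "filt_alpha t"
      by (rule sigma_finite_filt_alpha) (use t in auto)
    have "AE \<omega> in M. xh t \<omega> $ a = xh_opt t \<omega> $ a" for a
    proof -
      have "AE \<omega> in M. real_cond_exp M (filt_alpha t) (\<lambda>\<omega>. x t \<omega> $ a) \<omega>
          = real_cond_exp M (filt_alpha t) (\<lambda>\<omega>. x_opt t \<omega> $ a) \<omega>"
      proof (rule real_cond_exp_cong)
        show "AE \<omega> in M. x t \<omega> $ a = x_opt t \<omega> $ a"
          using eq[OF t] by eventually_elim simp
        show "(\<lambda>\<omega>. x t \<omega> $ a) \<in> borel_measurable M" "(\<lambda>\<omega>. x_opt t \<omega> $ a) \<in> borel_measurable M"
          using sq_intD(1)[OF sq_int_bounded_linear[OF s(8)[OF t] bounded_linear_vec_nth]]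
            sq_intD(1)[OF sq_int_bounded_linear[OF s'(8)[OF t] bounded_linear_vec_nth]] .
      qed
      moreover have "AE \<omega> in M. xh t \<omega> $ a = real_cond_exp M (filt_alpha t) (\<lambda>\<omega>. x t \<omega> $ a) \<omega>"
        using s(2) t unfolding cond_version_def by blast
      moreover have "AE \<omega> in M. xh_opt t \<omega> $ a = real_cond_exp M (filt_alpha t) (\<lambda>\<omega>. x_opt t \<omega> $ a) \<omega>"
        using s'(2) t unfolding cond_version_def by blast
      ultimately show ?thesis by eventually_elim simp
    qed
    then have "AE \<omega> in M. \<forall>a. xh t \<omega> $ a = xh_opt t \<omega> $ a"
      by (simp add: AE_all_countable)
    then show ?thesis by eventually_elim (subst vec_eq_iff)
  qed
  show ?thesis
    by (rule leader_cost_cong[where x = x and xh = xh and x' = x_opt and xh' = xh_opt,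
        OF s(1,3) s'(1,3) u2_process(1) s(8)[OF TT] s(9)[OF TT] s'(8)[OF TT] s'(9)[OF TT] eq eqh])
qed

text \<open>Whatever solution is chosen, its cost is that of the upper component of X. The factor
  1/2 stays because the cost is normalised with it; an identity without it would hold only where the
  quadratic form vanishes.\<close>

theorem J2_eq: "J2 x0 u1 u2 = 1/2 * ((block11 (Pt2 0 i0) *v x0) \<bullet> x0)"
proof -
  have "\<exists>p. (\<lambda>(x, xh). state_solution x0 u1 u2 x xh) p"
    by (rule exI[of _ "(x_opt, xh_opt)"]) (simp only: prod.case state_solution_opt)
  from someI_ex[OF this]
  obtain x xh where x: "(SOME (x, xh). state_solution x0 u1 u2 x xh) = (x, xh)" "state_solution x0 u1 u2 x xh"
    by (cases "SOME (x, xh). state_solution x0 u1 u2 x xh") auto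
  have "J2 x0 u1 u2 = leader_cost u2 x xh"
    unfolding J2_def Let_def x(1) prod.case ..
  then show ?thesis
    using leader_cost_unique[OF x(2)] leader_cost_opt by simp
qed

end

theorem theorem4p3:
  fixes M :: "'w measure" and T :: real
    and W :: "real \<Rightarrow> 'w \<Rightarrow> real" and \<alpha> :: "real \<Rightarrow> 'w \<Rightarrow> 's::finite"
    and \<Lambda> :: "'s \<Rightarrow> 's \<Rightarrow> real" and i0 :: 's
    and c :: "('s, 'n::finite, 'm1::finite, 'm2::finite) lq_coeffs"
    and P1 Ph1 :: "real \<Rightarrow> 's \<Rightarrow> real^'n^'n"
    and P2 Pt2 :: "real \<Rightarrow> 's \<Rightarrow> real^('n + 'n)^('n + 'n)"
    and x0 :: "real^'n"
    and X Xh Y Z :: "real \<Rightarrow> 'w \<Rightarrow> real^('n + 'n)"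
    and K :: "'s \<Rightarrow> 's \<Rightarrow> real \<Rightarrow> 'w \<Rightarrow> real^('n + 'n)"
    and u1 :: "real \<Rightarrow> 'w \<Rightarrow> real^'m1" and u2 :: "real \<Rightarrow> 'w \<Rightarrow> real^'m2"
  assumes setting: "lq_game M T W \<alpha> \<Lambda> i0"
    and A1: "\<forall>i. pos_semidef (cQ1 c i) \<and> pos_semidef (cQh1 c i) \<and> pos_def (cN1 c i) \<and>
                 pos_semidef (cG1 c i) \<and> pos_semidef (cGh1 c i)"
    and A2: "\<forall>i. pos_semidef (cQ2 c i) \<and> pos_semidef (cQh2 c i) \<and> pos_def (cN2 c i) \<and>
                 pos_semidef (cG2 c i) \<and> pos_semidef (cGh2 c i)"
    and P1: "lq_game.riccati_P1 T \<Lambda> c P1"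
    and Ph1: "lq_game.riccati_Ph1 T \<Lambda> c P1 Ph1"
    and P2: "lq_game.riccati_P2 T \<Lambda> c P1 P2"
    and Pt2: "lq_game.riccati_Pt2 T \<Lambda> c P1 Ph1 P2 Pt2"
    and inv: "\<forall>t\<in>{0..T}. \<forall>i. invertible (lq_game.N2t c P1 P2 t i) \<and>
                               invertible (mat 1 - P2 t i ** lq_game.bD1 c P1 t i)"
    and H: "lq_game.hamiltonian_system M T W \<alpha> \<Lambda> c P1 Ph1 x0 u2 X Xh Y Z K"
    and YZ: "lq_game.decoupled M T \<alpha> c P1 Ph1 P2 Pt2 u2 X Xh Y Z"
    and u2: "u2 = lq_game.leader_control \<alpha> c P1 Ph1 P2 Pt2 X Xh"
    and u1: "u1 = lq_game.follower_control \<alpha> c P1 Ph1 u2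
                    (\<lambda>t \<omega>. upper (X t \<omega>)) (\<lambda>t \<omega>. upper (Xh t \<omega>))
                    (\<lambda>t \<omega>. lower (Y t \<omega>)) (\<lambda>t \<omega>. lower (Z t \<omega>))"
  shows "lq_game.J2 M T W \<alpha> c x0 u1 u2 = 1/2 * ((block11 (Pt2 0 i0) *v x0) \<bullet> x0) \<and>
    (\<forall>t\<in>{0..T}. AE \<omega> in M.
       u1 t \<omega> =
         - ((matrix_inv (lq_game.N1t c P1 t (\<alpha> t \<omega>)) ** lq_game.follower_gain c P1 P2 t (\<alpha> t \<omega>)) *v X t \<omega>)
         - ((matrix_inv (lq_game.N1t c P1 t (\<alpha> t \<omega>)) **
               lq_game.follower_gain_h c P1 Ph1 P2 Pt2 t (\<alpha> t \<omega>)) *v Xh t \<omega>))"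
proof -
  interpret lq_game M T W \<alpha> \<Lambda> i0 c P1 Ph1 P2 Pt2 by (rule setting)
  interpret stackelberg_solution M T W \<alpha> \<Lambda> i0 c P1 Ph1 P2 Pt2 x0 X Xh Y Z K u1 u2
    using A1 P1 Ph1 P2 Pt2 inv H YZ u2 u1
    by unfold_locales (simp_all only: pos_def_def I_P2_D1_def)
  show ?thesis
    using J2_eq follower_feedback by blast
qed

end
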